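(* Let $Z\subseteq\mathbb{Z}+\frac12$, let $\Gamma$ be the monoid of all monic polynomials in $\mathbb{C}[z]$ whose zero set is contained in $Z$, and let $\mathcal{O}=\{(z-\lambda)\mid\lambda\in\mathbb{Z}\}$. The canonical homomorphism $[M]\mapsto[M]$ from the split Grothendieck group to the Grothendieck group yields a surjective $\mathbb{C}$-algebra homomorphism $$\mathscr{A}^{\mathrm{split}}(\Gamma,\mathcal{O})\to\mathscr{A}(\Gamma,\mathcal{O})$$ which in terms of the algebra generators is given by $$x_k^+\mapsto x_k^+,\qquad x_k^-\mapsto x_k^-,\qquad y_k^{\pm}\mapsto x_k^++x_k^-\qquad\text{for all }k\in Z.$$ Here $x_k^+,x_k^-,y_k^+,y_k^-$ in $\mathscr{A}^{\mathrm{split}}(\Gamma,\mathcal{O})$ are the generators $[M^{z-k}_{(k,\infty)}]$, $[M^{z-k}_{(-\infty,k)}]$, $[M^{z-k}_{\mathbb{R}_k^+}]$, $[M^{z-k}_{\mathbb{R}_k^-}]$, and $x_k^+,x_k^-$ in $\mathscr{A}(\Gamma,\mathcal{O})$ are the generators $[M^{z-k}_{(k,\infty)}]$, $[M^{z-k}_{(-\infty,k)}]$.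
   Context: Let $R=\mathbb{C}[z]$, $\sigma^{1/2}(z)=z-\frac12$, $\sigma(z)=z-1$. For nonzero $t\in\mathbb{C}[z]$, $A(t)$ is the $\mathbb{C}$-algebra generated by $\mathbb{C}[z]$ and $X^+,X^-$ with relations $X^{\pm}r=\sigma^{\pm1}(r)X^{\pm}$ ($r\in\mathbb{C}[z]$) and $X^{\pm}X^{\mp}=\sigma^{\pm1/2}(t)$. A weight module is an $A(t)$-module $M=\bigoplus_{\mathfrak{m}}M_{\mathfrak{m}}$, $M_{\mathfrak{m}}=\{v\mid\mathfrak{m}v=0\}$, over maximal ideals $\mathfrak{m}$ of $\mathbb{C}[z]$; $v\in M_{(z-\lambda)}$ is said to have weight $\lambda$. $A(t)\text{-wmod}_{\mathcal{O}}$ is the category of weight modules with finite-dimensional weight spaces and all weights in $\mathbb{Z}$. $K_0$ denotes the Grothendieck group (classes $[M]$ modulo $[M'']=[M]+[M']$ for short exact sequences $0\to M\to M''\to M'\to0$) and $K_0^{\mathrm{split}}$ the split Grothendieck group (classes $[M]$ modulo $[M\oplus M']=[M]+[M']$). If $M$ is a weight $A(t)$-module and $M'$ a weight $A(t')$-module, then $M\otimes_{\mathbb{C}[z]}M'$ is an $A(tt')$-module via $r(v\otimes v')=rv\otimes v'$ and $X^{\pm}(v\otimes v')=X^{\pm}v\otimes X^{\pm}v'$. With the product $[M][M']=[M\otimes_{\mathbb{C}[z]}M']$, $$\mathscr{A}(\Gamma,\mathcal{O})=\bigoplus_{t\in\Gamma}\mathbb{C}\otimes_{\mathbb{Z}}K_0(A(t)\text{-wmod}_{\mathcal{O}}),\qquad\mathscr{A}^{\mathrm{split}}(\Gamma,\mathcal{O})=\bigoplus_{t\in\Gamma}\mathbb{C}\otimes_{\mathbb{Z}}K_0^{\mathrm{split}}(A(t)\text{-wmod}_{\mathcal{O}})$$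 are commutative unital $\Gamma$-graded $\mathbb{C}$-algebras. For $k\in\mathbb{Z}+\frac12$, the following objects of $A(z-k)\text{-wmod}_{\mathcal{O}}$ have one-dimensional weight spaces and are determined up to isomorphism by: $M^{z-k}_{(k,\infty)}$ is simple with weights $\{\lambda\in\mathbb{Z}\mid\lambda>k\}$; $M^{z-k}_{(-\infty,k)}$ is simple with weights $\{\lambda\in\mathbb{Z}\mid\lambda<k\}$; $M^{z-k}_{\mathbb{R}_k^+}$ has set of weights $\mathbb{Z}$, with $X^+v\ne0$ for $v\neq 0$ of weight $k-\frac12$ and $X^-v=0$ for $v$ of weight $k+\frac12$; $M^{z-k}_{\mathbb{R}_k^-}$ has set of weights $\mathbb{Z}$, with $X^+v=0$ for $v$ of weight $k-\frac12$ and $X^-v\neq0$ for $v\ne0$ of weight $k+\frac12$. The classes of these four modules ($k\in Z$) generate $\mathscr{A}^{\mathrm{split}}(\Gamma,\mathcal{O})$, and the classes of the first two generate $\mathscr{A}(\Gamma,\mathcal{O})$, as algebras. *)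

theory Defs
  imports
    "HOL-Algebra.Module"
    "HOL-Algebra.QuotRing"
    "HOL-Algebra.Free_Abelian_Groups"
    "HOL-Computational_Algebra.Polynomial"
    Complex_Main
begin

hide_const (open) Polynomial.smult Polynomial.order


section \<open>The generalized Weyl algebra A(t)\<close>

datatype gwa_gen = Gen_z | Gen_Xp | Gen_Xm

text \<open>
  The free algebra on \<open>z\<close>, \<open>X\<^sup>+\<close>, \<open>X\<^sup>-\<close> over the complex numbers: finitely supported
  functions on words, with the convolution product.
\<close>

type_synonym gwa_free = "gwa_gen list \<Rightarrow>\<^sub>0 complex"

definition free_mult :: "gwa_free \<Rightarrow> gwa_free \<Rightarrow> gwa_free" where
  "free_mult f g =
     (\<Sum>u\<in>Poly_Mapping.keys f. \<Sum>v\<in>Poly_Mapping.keys g.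
        Poly_Mapping.single (u @ v) (Poly_Mapping.lookup f u * Poly_Mapping.lookup g v))"

definition free_algebra :: "gwa_free ring" where
  "free_algebra =
     \<lparr>carrier = UNIV, monoid.mult = free_mult, one = Poly_Mapping.single [] 1, ring.zero = 0, add = (+)\<rparr>"

definition free_gen :: "gwa_gen \<Rightarrow> gwa_free" where
  "free_gen x = Poly_Mapping.single [x] 1"

definition free_poly :: "complex poly \<Rightarrow> gwa_free" where
  "free_poly r = (\<Sum>i\<le>degree r. Poly_Mapping.single (replicate i Gen_z) (coeff r i))"

text \<open>\<open>shift a\<close> is the automorphism \<open>z \<mapsto> z - a\<close>, i.e. \<open>\<sigma>\<close> to the power \<open>a\<close>.\<close>

definition shift :: "complex \<Rightarrow> complex poly \<Rightarrow> complex poly" where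
  "shift a r = pcompose r [:- a, 1:]"

definition gwa_rels :: "complex poly \<Rightarrow> gwa_free set" where
  "gwa_rels t =
     {free_mult (free_gen Gen_Xp) (free_poly r) - free_mult (free_poly (shift 1 r)) (free_gen Gen_Xp) | r. True}
   \<union> {free_mult (free_gen Gen_Xm) (free_poly r) - free_mult (free_poly (shift (- 1) r)) (free_gen Gen_Xm) | r. True}
   \<union> {free_mult (free_gen Gen_Xp) (free_gen Gen_Xm) - free_poly (shift (1 / 2) t),
      free_mult (free_gen Gen_Xm) (free_gen Gen_Xp) - free_poly (shift (- 1 / 2) t)}"

definition gwa :: "complex poly \<Rightarrow> gwa_free set ring" where
  "gwa t = free_algebra Quot (Idl\<^bsub>free_algebra\<^esub> (gwa_rels t))"

definition gwa_elt :: "complex poly \<Rightarrow> gwa_free \<Rightarrow> gwa_free set" where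
  "gwa_elt t f = (Idl\<^bsub>free_algebra\<^esub> (gwa_rels t)) +>\<^bsub>free_algebra\<^esub> f"


section \<open>Modules\<close>

text \<open>
  The library locale \<open>module\<close> is restricted to commutative base rings.  As there, the fields
  \<open>mult\<close> and \<open>one\<close> of the record of a module carry no information.
\<close>

locale left_module = R?: ring R + M?: abelian_group M
  for R (structure) and M (structure) +
  assumes smult_closed:
      "\<lbrakk>a \<in> carrier R; x \<in> carrier M\<rbrakk> \<Longrightarrow> a \<odot>\<^bsub>M\<^esub> x \<in> carrier M"
    and smult_l_distr:
      "\<lbrakk>a \<in> carrier R; b \<in> carrier R; x \<in> carrier M\<rbrakk> \<Longrightarrow>
       (a \<oplus> b) \<odot>\<^bsub>M\<^esub> x = a \<odot>\<^bsub>M\<^esub> x \<oplus>\<^bsub>M\<^esub> b \<odot>\<^bsub>M\<^esub> x"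
    and smult_r_distr:
      "\<lbrakk>a \<in> carrier R; x \<in> carrier M; y \<in> carrier M\<rbrakk> \<Longrightarrow>
       a \<odot>\<^bsub>M\<^esub> (x \<oplus>\<^bsub>M\<^esub> y) = a \<odot>\<^bsub>M\<^esub> x \<oplus>\<^bsub>M\<^esub> a \<odot>\<^bsub>M\<^esub> y"
    and smult_assoc1:
      "\<lbrakk>a \<in> carrier R; b \<in> carrier R; x \<in> carrier M\<rbrakk> \<Longrightarrow>
       (a \<otimes> b) \<odot>\<^bsub>M\<^esub> x = a \<odot>\<^bsub>M\<^esub> (b \<odot>\<^bsub>M\<^esub> x)"
    and smult_one:
      "x \<in> carrier M \<Longrightarrow> \<one> \<odot>\<^bsub>M\<^esub> x = x"

type_synonym 'a gwa_module = "(gwa_free set, 'a) module"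

definition act_poly :: "complex poly \<Rightarrow> 'a gwa_module \<Rightarrow> complex poly \<Rightarrow> 'a \<Rightarrow> 'a" where
  "act_poly t M r v = gwa_elt t (free_poly r) \<odot>\<^bsub>M\<^esub> v"

definition act_gen :: "complex poly \<Rightarrow> 'a gwa_module \<Rightarrow> gwa_gen \<Rightarrow> 'a \<Rightarrow> 'a" where
  "act_gen t M x v = gwa_elt t (free_gen x) \<odot>\<^bsub>M\<^esub> v"

definition gwa_hom ::
    "complex poly \<Rightarrow> 'a gwa_module \<Rightarrow> 'b gwa_module \<Rightarrow> ('a \<Rightarrow> 'b) set" where
  "gwa_hom t M N =
     {f. f \<in> carrier M \<rightarrow> carrier N
       \<and> (\<forall>x\<in>carrier M. \<forall>y\<in>carrier M. f (x \<oplus>\<^bsub>M\<^esub> y) = f x \<oplus>\<^bsub>N\<^esub> f y)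
       \<and> (\<forall>a\<in>carrier (gwa t). \<forall>x\<in>carrier M. f (a \<odot>\<^bsub>M\<^esub> x) = a \<odot>\<^bsub>N\<^esub> f x)}"

definition gwa_iso :: "complex poly \<Rightarrow> 'a gwa_module \<Rightarrow> 'b gwa_module \<Rightarrow> bool" where
  "gwa_iso t M N \<longleftrightarrow> (\<exists>f\<in>gwa_hom t M N. bij_betw f (carrier M) (carrier N))"

definition short_exact ::
    "complex poly \<Rightarrow> 'a gwa_module \<Rightarrow> 'b gwa_module \<Rightarrow> 'c gwa_module \<Rightarrow> bool" where
  "short_exact t M M'' M' \<longleftrightarrow>
     (\<exists>f\<in>gwa_hom t M M''. \<exists>g\<in>gwa_hom t M'' M'.
        inj_on f (carrier M) \<and> g ` carrier M'' = carrier M'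
      \<and> f ` carrier M = {x \<in> carrier M''. g x = \<zero>\<^bsub>M'\<^esub>})"

definition direct_sum :: "'a gwa_module \<Rightarrow> 'b gwa_module \<Rightarrow> ('a \<times> 'b) gwa_module" where
  "direct_sum M N =
     \<lparr>carrier = carrier M \<times> carrier N, monoid.mult = undefined, one = undefined,
      ring.zero = (\<zero>\<^bsub>M\<^esub>, \<zero>\<^bsub>N\<^esub>),
      add = (\<lambda>(x, y) (x', y'). (x \<oplus>\<^bsub>M\<^esub> x', y \<oplus>\<^bsub>N\<^esub> y')),
      smult = (\<lambda>a (x, y). (a \<odot>\<^bsub>M\<^esub> x, a \<odot>\<^bsub>N\<^esub> y))\<rparr>"

definition simple_module :: "complex poly \<Rightarrow> 'a gwa_module \<Rightarrow> bool" where
  "simple_module t M \<longleftrightarrow>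
     carrier M \<noteq> {\<zero>\<^bsub>M\<^esub>}
   \<and> (\<forall>H. submodule H (gwa t) M \<longrightarrow> H = {\<zero>\<^bsub>M\<^esub>} \<or> H = carrier M)"


section \<open>Weight modules\<close>

definition poly_ring :: "complex poly ring" where
  "poly_ring = \<lparr>carrier = UNIV, monoid.mult = (*), one = 1, ring.zero = 0, add = (+)\<rparr>"

definition max_ideals :: "complex poly set set" where
  "max_ideals = {I. maximalideal I poly_ring}"

definition ideal_at :: "complex \<Rightarrow> complex poly set" where
  "ideal_at w = PIdl\<^bsub>poly_ring\<^esub> [:- w, 1:]"

definition weight_space ::
    "complex poly \<Rightarrow> 'a gwa_module \<Rightarrow> complex poly set \<Rightarrow> 'a set" where
  "weight_space t M I = {v \<in> carrier M. \<forall>r\<in>I. act_poly t M r v = \<zero>\<^bsub>M\<^esub>}"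

definition weight_module :: "complex poly \<Rightarrow> 'a gwa_module \<Rightarrow> bool" where
  "weight_module t M \<longleftrightarrow>
     left_module (gwa t) M
   \<and> (\<forall>v\<in>carrier M. \<exists>!f.
        (\<forall>I\<in>max_ideals. f I \<in> weight_space t M I)
      \<and> (\<forall>I. I \<notin> max_ideals \<longrightarrow> f I = \<zero>\<^bsub>M\<^esub>)
      \<and> finite {I. f I \<noteq> \<zero>\<^bsub>M\<^esub>}
      \<and> v = (\<Oplus>\<^bsub>M\<^esub>I\<in>{I. f I \<noteq> \<zero>\<^bsub>M\<^esub>}. f I))"

definition finite_dim :: "complex poly \<Rightarrow> 'a gwa_module \<Rightarrow> 'a set \<Rightarrow> bool" where
  "finite_dim t M W \<longleftrightarrow>
     (\<exists>B. finite B \<and> B \<subseteq> W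
        \<and> (\<forall>w\<in>W. \<exists>c::'a \<Rightarrow> complex. w = (\<Oplus>\<^bsub>M\<^esub>b\<in>B. act_poly t M [:c b:] b)))"

definition wmod :: "complex poly set set \<Rightarrow> complex poly \<Rightarrow> 'a gwa_module \<Rightarrow> bool" where
  "wmod Om t M \<longleftrightarrow>
     weight_module t M
   \<and> (\<forall>I\<in>max_ideals. finite_dim t M (weight_space t M I))
   \<and> (\<forall>I\<in>max_ideals. weight_space t M I \<noteq> {\<zero>\<^bsub>M\<^esub>} \<longrightarrow> I \<in> Om)"

definition weights :: "complex poly \<Rightarrow> 'a gwa_module \<Rightarrow> complex set" where
  "weights t M = {w. weight_space t M (ideal_at w) \<noteq> {\<zero>\<^bsub>M\<^esub>}}"

definition integer_orbit :: "complex poly set set" where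
  "integer_orbit = {ideal_at (of_int n) | n::int. True}"

text \<open>
  A module in the category has countable dimension over the complex numbers, hence is isomorphic
  to one whose carrier is a subset of the type below.  The category is thus represented by
  its objects on this type; isomorphism classes are formed inside it, but
  \<open>iso_class\<close> accepts modules on arbitrary types (such as direct sums and tensor products).
\<close>

type_synonym universe = "(int \<times> nat) \<Rightarrow>\<^sub>0 complex"

definition objs :: "complex poly \<Rightarrow> universe gwa_module set" where
  "objs t = {M. wmod integer_orbit t M}"

definition iso_class :: "complex poly \<Rightarrow> 'a gwa_module \<Rightarrow> universe gwa_module set" where
  "iso_class t N = {M \<in> objs t. gwa_iso t M N}"


section \<open>Grothendieck groups\<close>

text \<open>
  Both Grothendieck groups are quotients of the free abelian group on isomorphism classes.  The
  argument \<open>E\<close> below is one of the two families of relations \<open>exact_rels\<close>, \<open>split_rels\<close>.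
\<close>

type_synonym formal_sum = "universe gwa_module set \<Rightarrow>\<^sub>0 int"
type_synonym rel_family = "complex poly \<Rightarrow> formal_sum set"

definition exact_rels :: rel_family where
  "exact_rels t =
     {frag_of (iso_class t M'') - frag_of (iso_class t M) - frag_of (iso_class t M') | M M'' M'.
        M \<in> objs t \<and> M'' \<in> objs t \<and> M' \<in> objs t \<and> short_exact t M M'' M'}"

definition split_rels :: rel_family where
  "split_rels t =
     {frag_of (iso_class t (direct_sum M M')) - frag_of (iso_class t M) - frag_of (iso_class t M') | M M'.
        M \<in> objs t \<and> M' \<in> objs t}"

definition free_classes :: "complex poly \<Rightarrow> formal_sum monoid" where
  "free_classes t = free_Abelian_group (iso_class t ` objs t)"

definition groth :: "rel_family \<Rightarrow> complex poly \<Rightarrow> formal_sum set monoid" where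
  "groth E t = free_classes t Mod generate (free_classes t) (E t)"

definition groth_class :: "rel_family \<Rightarrow> complex poly \<Rightarrow> 'a gwa_module \<Rightarrow> formal_sum set" where
  "groth_class E t N =
     generate (free_classes t) (E t) #>\<^bsub>free_classes t\<^esub> frag_of (iso_class t N)"


section \<open>Tensor products\<close>

text \<open>
  Tensor product over a commutative ring of scalars \<open>'r\<close> of two abelian groups \<open>G\<close>, \<open>H\<close> (written
  multiplicatively, as monoid records) on which \<open>'r\<close> acts through \<open>a\<close> and \<open>b\<close>.
\<close>

definition tensor_rels ::
    "('r \<Rightarrow> 'a \<Rightarrow> 'a) \<Rightarrow> 'a monoid \<Rightarrow> ('r \<Rightarrow> 'b \<Rightarrow> 'b) \<Rightarrow> 'b monoid \<Rightarrow> ('a \<times> 'b \<Rightarrow>\<^sub>0 int) set" where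
  "tensor_rels a G b H =
     {frag_of (x \<otimes>\<^bsub>G\<^esub> x', y) - frag_of (x, y) - frag_of (x', y) | x x' y.
        x \<in> carrier G \<and> x' \<in> carrier G \<and> y \<in> carrier H}
   \<union> {frag_of (x, y \<otimes>\<^bsub>H\<^esub> y') - frag_of (x, y) - frag_of (x, y') | x y y'.
        x \<in> carrier G \<and> y \<in> carrier H \<and> y' \<in> carrier H}
   \<union> {frag_of (a r x, y) - frag_of (x, b r y) | r x y. x \<in> carrier G \<and> y \<in> carrier H}"

definition tensor_null ::
    "('r \<Rightarrow> 'a \<Rightarrow> 'a) \<Rightarrow> 'a monoid \<Rightarrow> ('r \<Rightarrow> 'b \<Rightarrow> 'b) \<Rightarrow> 'b monoid \<Rightarrow> ('a \<times> 'b \<Rightarrow>\<^sub>0 int) set" where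
  "tensor_null a G b H =
     generate (free_Abelian_group (carrier G \<times> carrier H)) (tensor_rels a G b H)"

definition tensor_group ::
    "('r \<Rightarrow> 'a \<Rightarrow> 'a) \<Rightarrow> 'a monoid \<Rightarrow> ('r \<Rightarrow> 'b \<Rightarrow> 'b) \<Rightarrow> 'b monoid \<Rightarrow> ('a \<times> 'b \<Rightarrow>\<^sub>0 int) set monoid" where
  "tensor_group a G b H =
     free_Abelian_group (carrier G \<times> carrier H) Mod tensor_null a G b H"

definition tensor_pure ::
    "('r \<Rightarrow> 'a \<Rightarrow> 'a) \<Rightarrow> 'a monoid \<Rightarrow> ('r \<Rightarrow> 'b \<Rightarrow> 'b) \<Rightarrow> 'b monoid \<Rightarrow> 'a \<Rightarrow> 'b \<Rightarrow> ('a \<times> 'b \<Rightarrow>\<^sub>0 int) set" where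
  "tensor_pure a G b H x y =
     tensor_null a G b H #>\<^bsub>free_Abelian_group (carrier G \<times> carrier H)\<^esub> frag_of (x, y)"

definition add_group :: "('a, 'm) ring_scheme \<Rightarrow> 'a monoid" where
  "add_group M = \<lparr>carrier = carrier M, monoid.mult = add M, one = ring.zero M\<rparr>"

text \<open>
  The tensor product over polynomials in \<open>z\<close> of a module over \<open>A(t)\<close> and one over \<open>A(t')\<close>.
  The action of \<open>A(tt')\<close> is determined on the carrier by the formulas for its generators.
\<close>

definition tensor_module ::
    "complex poly \<Rightarrow> 'a gwa_module \<Rightarrow> complex poly \<Rightarrow> 'b gwa_module \<Rightarrow> ('a \<times> 'b \<Rightarrow>\<^sub>0 int) set gwa_module" where
  "tensor_module t M t' M' =
     (let T = tensor_group (act_poly t M) (add_group M) (act_poly t' M') (add_group M');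
          pure = tensor_pure (act_poly t M) (add_group M) (act_poly t' M') (add_group M');
          V = (\<lambda>s. \<lparr>carrier = carrier T, monoid.mult = undefined, one = undefined,
                    ring.zero = \<one>\<^bsub>T\<^esub>, add = monoid.mult T, smult = s\<rparr>)
      in V (SOME s. left_module (gwa (t * t')) (V s)
              \<and> (\<forall>v\<in>carrier M. \<forall>v'\<in>carrier M'.
                   (\<forall>r. act_poly (t * t') (V s) r (pure v v') = pure (act_poly t M r v) v')
                 \<and> (\<forall>x\<in>{Gen_Xp, Gen_Xm}.
                      act_gen (t * t') (V s) x (pure v v') = pure (act_gen t M x v) (act_gen t' M' x v')))))"


section \<open>The algebras\<close>

definition complex_ring :: "complex ring" where
  "complex_ring = \<lparr>carrier = UNIV, monoid.mult = (*), one = 1, ring.zero = 0, add = (+)\<rparr>"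

type_synonym cgroth_elt = "(complex \<times> formal_sum set \<Rightarrow>\<^sub>0 int) set"

text \<open>The tensor product over the integers of the complex numbers and a Grothendieck group.\<close>

definition cgroth :: "rel_family \<Rightarrow> complex poly \<Rightarrow> cgroth_elt monoid" where
  "cgroth E t =
     tensor_group (\<lambda>(n::int) c. of_int n * c) (add_group complex_ring)
                  (\<lambda>n g. g [^]\<^bsub>groth E t\<^esub> n) (groth E t)"

definition cgroth_null :: "rel_family \<Rightarrow> complex poly \<Rightarrow> (complex \<times> formal_sum set \<Rightarrow>\<^sub>0 int) set" where
  "cgroth_null E t =
     tensor_null (\<lambda>(n::int) c. of_int n * c) (add_group complex_ring)
                 (\<lambda>n g. g [^]\<^bsub>groth E t\<^esub> n) (groth E t)"

definition cgroth_pure ::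
    "rel_family \<Rightarrow> complex poly \<Rightarrow> complex \<Rightarrow> formal_sum set \<Rightarrow> cgroth_elt" where
  "cgroth_pure E t =
     tensor_pure (\<lambda>(n::int) c. of_int n * c) (add_group complex_ring)
                 (\<lambda>n g. g [^]\<^bsub>groth E t\<^esub> n) (groth E t)"

text \<open>
  Scalar multiplication: the endomorphism of the quotient induced by \<open>(d, g) \<mapsto> (c d, g)\<close>.
\<close>

definition cgroth_smult :: "rel_family \<Rightarrow> complex poly \<Rightarrow> complex \<Rightarrow> cgroth_elt \<Rightarrow> cgroth_elt" where
  "cgroth_smult E t c S =
     cgroth_null E t
       <#>\<^bsub>free_Abelian_group (UNIV \<times> carrier (groth E t))\<^esub>
     (frag_extend (\<lambda>(d, g). frag_of (c * d, g)) ` S)"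

type_synonym alg_elt = "complex poly \<Rightarrow> cgroth_elt"

definition alg_group :: "rel_family \<Rightarrow> complex poly set \<Rightarrow> alg_elt monoid" where
  "alg_group E \<Gamma> = sum_group \<Gamma> (cgroth E)"

definition alg_smult ::
    "rel_family \<Rightarrow> complex poly set \<Rightarrow> complex \<Rightarrow> alg_elt \<Rightarrow> alg_elt" where
  "alg_smult E \<Gamma> c x = (\<lambda>t\<in>\<Gamma>. cgroth_smult E t c (x t))"

definition alg_incl ::
    "rel_family \<Rightarrow> complex poly set \<Rightarrow> complex poly \<Rightarrow> cgroth_elt \<Rightarrow> alg_elt" where
  "alg_incl E \<Gamma> t g = (\<lambda>s\<in>\<Gamma>. if s = t then g else \<one>\<^bsub>cgroth E s\<^esub>)"

definition alg_class ::
    "rel_family \<Rightarrow> complex poly set \<Rightarrow> complex poly \<Rightarrow> 'a gwa_module \<Rightarrow> alg_elt" where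
  "alg_class E \<Gamma> t M = alg_incl E \<Gamma> t (cgroth_pure E t 1 (groth_class E t M))"

text \<open>
  The product is the bilinear extension of the tensor product of modules; as the classes of
  objects span, it is determined on the carrier.
\<close>

definition is_alg_product ::
    "rel_family \<Rightarrow> complex poly set \<Rightarrow> (alg_elt \<Rightarrow> alg_elt \<Rightarrow> alg_elt) \<Rightarrow> bool" where
  "is_alg_product E \<Gamma> P \<longleftrightarrow>
     (let B = alg_group E \<Gamma>; sm = alg_smult E \<Gamma> in
        (\<forall>x\<in>carrier B. \<forall>y\<in>carrier B. P x y \<in> carrier B)
      \<and> (\<forall>x\<in>carrier B. \<forall>x'\<in>carrier B. \<forall>y\<in>carrier B.
           P (x \<otimes>\<^bsub>B\<^esub> x') y = P x y \<otimes>\<^bsub>B\<^esub> P x' y)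
      \<and> (\<forall>x\<in>carrier B. \<forall>y\<in>carrier B. \<forall>y'\<in>carrier B.
           P x (y \<otimes>\<^bsub>B\<^esub> y') = P x y \<otimes>\<^bsub>B\<^esub> P x y')
      \<and> (\<forall>c. \<forall>x\<in>carrier B. \<forall>y\<in>carrier B.
           P (sm c x) y = sm c (P x y) \<and> P x (sm c y) = sm c (P x y))
      \<and> (\<forall>t\<in>\<Gamma>. \<forall>t'\<in>\<Gamma>. \<forall>M\<in>objs t. \<forall>M'\<in>objs t'.
           P (alg_class E \<Gamma> t M) (alg_class E \<Gamma> t' M')
             = alg_class E \<Gamma> (t * t') (tensor_module t M t' M')))"

definition alg_mult ::
    "rel_family \<Rightarrow> complex poly set \<Rightarrow> alg_elt \<Rightarrow> alg_elt \<Rightarrow> alg_elt" where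
  "alg_mult E \<Gamma> = (SOME P. is_alg_product E \<Gamma> P)"

definition alg :: "rel_family \<Rightarrow> complex poly set \<Rightarrow> (complex, alg_elt) module" where
  "alg E \<Gamma> =
     \<lparr>carrier = carrier (alg_group E \<Gamma>),
      monoid.mult = alg_mult E \<Gamma>,
      one = (THE e. e \<in> carrier (alg_group E \<Gamma>)
                  \<and> (\<forall>x\<in>carrier (alg_group E \<Gamma>). alg_mult E \<Gamma> e x = x \<and> alg_mult E \<Gamma> x e = x)),
      ring.zero = \<one>\<^bsub>alg_group E \<Gamma>\<^esub>,
      add = monoid.mult (alg_group E \<Gamma>),
      smult = alg_smult E \<Gamma>\<rparr>"

definition alg_exact :: "complex poly set \<Rightarrow> (complex, alg_elt) module" where
  "alg_exact = alg exact_rels"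

definition alg_split :: "complex poly set \<Rightarrow> (complex, alg_elt) module" where
  "alg_split = alg split_rels"

definition algebra_hom :: "(complex, 'a) module \<Rightarrow> (complex, 'b) module \<Rightarrow> ('a \<Rightarrow> 'b) set" where
  "algebra_hom A B =
     {h \<in> ring_hom A B. \<forall>c. \<forall>x\<in>carrier A. h (c \<odot>\<^bsub>A\<^esub> x) = c \<odot>\<^bsub>B\<^esub> h x}"


section \<open>The generators\<close>

definition monic_with_zeros_in :: "real set \<Rightarrow> complex poly set" where
  "monic_with_zeros_in Z = {t. lead_coeff t = 1 \<and> {x. poly t x = 0} \<subseteq> complex_of_real ` Z}"

definition lin :: "real \<Rightarrow> complex poly" where
  "lin k = [:- complex_of_real k, 1:]"

definition one_dim_weight_spaces :: "complex poly \<Rightarrow> 'a gwa_module \<Rightarrow> bool" where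
  "one_dim_weight_spaces t M \<longleftrightarrow>
     (\<forall>w\<in>weights t M. \<exists>v. v \<noteq> \<zero>\<^bsub>M\<^esub>
        \<and> weight_space t M (ideal_at w) = {act_poly t M [:c:] v | c. True} \<and> v \<in> carrier M)"

text \<open>Each of the following modules is determined up to isomorphism.\<close>

definition mod_above :: "real \<Rightarrow> universe gwa_module" where
  "mod_above k = (SOME M. M \<in> objs (lin k) \<and> one_dim_weight_spaces (lin k) M
     \<and> simple_module (lin k) M
     \<and> weights (lin k) M = {of_int n | n::int. real_of_int n > k})"

definition mod_below :: "real \<Rightarrow> universe gwa_module" where
  "mod_below k = (SOME M. M \<in> objs (lin k) \<and> one_dim_weight_spaces (lin k) M
     \<and> simple_module (lin k) M
     \<and> weights (lin k) M = {of_int n | n::int. real_of_int n < k})"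

definition mod_plus :: "real \<Rightarrow> universe gwa_module" where
  "mod_plus k = (SOME M. M \<in> objs (lin k) \<and> one_dim_weight_spaces (lin k) M
     \<and> weights (lin k) M = range of_int
     \<and> (\<forall>v\<in>weight_space (lin k) M (ideal_at (of_real (k - 1 / 2))).
          v \<noteq> \<zero>\<^bsub>M\<^esub> \<longrightarrow> act_gen (lin k) M Gen_Xp v \<noteq> \<zero>\<^bsub>M\<^esub>)
     \<and> (\<forall>v\<in>weight_space (lin k) M (ideal_at (of_real (k + 1 / 2))).
          act_gen (lin k) M Gen_Xm v = \<zero>\<^bsub>M\<^esub>))"

definition mod_minus :: "real \<Rightarrow> universe gwa_module" where
  "mod_minus k = (SOME M. M \<in> objs (lin k) \<and> one_dim_weight_spaces (lin k) M
     \<and> weights (lin k) M = range of_int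
     \<and> (\<forall>v\<in>weight_space (lin k) M (ideal_at (of_real (k - 1 / 2))).
          act_gen (lin k) M Gen_Xp v = \<zero>\<^bsub>M\<^esub>)
     \<and> (\<forall>v\<in>weight_space (lin k) M (ideal_at (of_real (k + 1 / 2))).
          v \<noteq> \<zero>\<^bsub>M\<^esub> \<longrightarrow> act_gen (lin k) M Gen_Xm v \<noteq> \<zero>\<^bsub>M\<^esub>))"

definition x_plus :: "rel_family \<Rightarrow> complex poly set \<Rightarrow> real \<Rightarrow> alg_elt" where
  "x_plus E \<Gamma> k = alg_class E \<Gamma> (lin k) (mod_above k)"

definition x_minus :: "rel_family \<Rightarrow> complex poly set \<Rightarrow> real \<Rightarrow> alg_elt" where
  "x_minus E \<Gamma> k = alg_class E \<Gamma> (lin k) (mod_below k)"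

definition y_plus :: "complex poly set \<Rightarrow> real \<Rightarrow> alg_elt" where
  "y_plus \<Gamma> k = alg_class split_rels \<Gamma> (lin k) (mod_plus k)"

definition y_minus :: "complex poly set \<Rightarrow> real \<Rightarrow> alg_elt" where
  "y_minus \<Gamma> k = alg_class split_rels \<Gamma> (lin k) (mod_minus k)"

end

theory Submission
  imports Defs
begin

text \<open>
  A split extension is exact, so the relations of the split group are among those of the exact
  one; this gives the surjections \<open>\<kappa>\<close> of Grothendieck groups and, after tensoring with the complex
  numbers and summing over \<open>t\<close>, the map \<open>\<phi>\<close>.  For the products to exist, tensoring over \<open>\<complex>[z]\<close> must
  respect both kinds of relations.  It does because a weight module is semisimple over \<open>\<complex>[z]\<close>: every
  short exact sequence of weight modules splits over \<open>\<complex>[z]\<close>, hence stays exact after tensoring.  The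
  unit is the module over \<open>A(1)\<close> with all integer weight spaces one-dimensional.

  For \<open>t = z - k\<close> the only pair of consecutive weights between which \<open>X\<^sup>-X\<^sup>+\<close> vanishes is \<open>k - 1/2\<close>,
  \<open>k + 1/2\<close>.  If \<open>X\<^sup>-\<close> vanishes there, the weights above \<open>k\<close> span a submodule with
  quotient supported below \<open>k\<close>; if \<open>X\<^sup>+\<close> does, the roles are exchanged.  Either way the class is
  the sum of the two simple classes.
\<close>

section \<open>The free algebra and A(t)\<close>

text \<open>The product, the unit, the action on a tensor product and the four modules are all
  introduced by choice or description operators; nothing is known of them until something meeting
  the specification is exhibited, so most of the work is existence. A(t) is a quotient of a free
  algebra, and an action is handled through one operator for each polynomial and one each for X+ and
  X-. The section of an exact sequence over C[z] need not commute with X+ and X-; it only witnesses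
  exactness after tensoring, in the form of equations that the tensor functor preserves. Isomorphism
  classes consist of modules on one fixed type, while direct sums and tensor products live on other
  types and are replaced by isomorphic objects on the fixed one. The four modules are controlled by
  explicit models with one basis vector per weight. In these only the product of the two structure
  constants between neighbouring weights is prescribed, because the same simple modules must occur
  in two extensions that need different normalizations.\<close>

lemma poly_mapping_additive_induct:
  fixes f :: "'a \<Rightarrow>\<^sub>0 'b::comm_monoid_add"
  assumes "\<And>u c. P (Poly_Mapping.single u c)"
    and "\<And>f g. P f \<Longrightarrow> P g \<Longrightarrow> P (f + g)"
  shows "P f"
proof -
  have f: "f = (\<Sum>u\<in>Poly_Mapping.keys f. Poly_Mapping.single u (Poly_Mapping.lookup f u))"
    by (rule poly_mapping_eqI)
      (auto simp: lookup_sum lookup_single when_def in_keys_iff sum.delta)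
  have "P (\<Sum>u\<in>A. Poly_Mapping.single u (Poly_Mapping.lookup f u))" if "finite A" for A
    using that
  proof induction
    case empty
    \<comment> \<open>The zero element is a monomial with coefficient 0, so the rule has no separate
      base case.\<close>
    show ?case using assms(1)[of undefined 0] by simp
  qed (auto intro: assms)
  then show ?thesis by (subst f) simp
qed

text \<open>Cancellation can make the support of a sum smaller than the union of the supports.
  Summing over finite supersets puts all terms over one index set, from which bilinearity can be
  read off.\<close>

lemma free_mult_superset:
  assumes "finite A" "Poly_Mapping.keys f \<subseteq> A" "finite B" "Poly_Mapping.keys g \<subseteq> B"
  shows "free_mult f g =
    (\<Sum>u\<in>A. \<Sum>v\<in>B. Poly_Mapping.single (u @ v) (Poly_Mapping.lookup f u * Poly_Mapping.lookup g v))"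
proof -
  have "free_mult f g = (\<Sum>u\<in>A. \<Sum>v\<in>Poly_Mapping.keys g.
      Poly_Mapping.single (u @ v) (Poly_Mapping.lookup f u * Poly_Mapping.lookup g v))"
    unfolding free_mult_def using assms
    by (intro sum.mono_neutral_left) (auto simp: in_keys_iff)
  also have "\<dots> = (\<Sum>u\<in>A. \<Sum>v\<in>B.
      Poly_Mapping.single (u @ v) (Poly_Mapping.lookup f u * Poly_Mapping.lookup g v))"
    using assms by (intro sum.cong refl sum.mono_neutral_left) (auto simp: in_keys_iff)
  finally show ?thesis .
qed

lemma free_mult_single [simp]:
  "free_mult (Poly_Mapping.single u a) (Poly_Mapping.single v b) = Poly_Mapping.single (u @ v) (a * b)"
  by (subst free_mult_superset[of "{u}" _ "{v}"]) auto

lemma free_mult_add_left: "free_mult (f + f') g = free_mult f g + free_mult f' g"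
proof -
  let ?A = "Poly_Mapping.keys f \<union> Poly_Mapping.keys f'" and ?B = "Poly_Mapping.keys g"
  have "Poly_Mapping.keys (f + f') \<subseteq> ?A" by (rule keys_add)
  then show ?thesis
    by (simp add: free_mult_superset[of ?A _ ?B] lookup_add single_add distrib_right sum.distrib)
qed

lemma free_mult_add_right: "free_mult f (g + g') = free_mult f g + free_mult f g'"
proof -
  let ?B = "Poly_Mapping.keys g \<union> Poly_Mapping.keys g'" and ?A = "Poly_Mapping.keys f"
  have "Poly_Mapping.keys (g + g') \<subseteq> ?B" by (rule keys_add)
  then show ?thesis
    by (simp add: free_mult_superset[of ?A _ ?B] lookup_add single_add distrib_left sum.distrib)
qed

lemma free_mult_zero [simp]: "free_mult 0 g = 0" "free_mult f 0 = 0"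
  by (auto simp: free_mult_def)

lemma free_mult_sum_right: "free_mult f (\<Sum>i\<in>I. g i) = (\<Sum>i\<in>I. free_mult f (g i))"
  by (induction I rule: infinite_finite_induct) (auto simp: free_mult_add_right)

lemma free_mult_assoc: "free_mult (free_mult f g) h = free_mult f (free_mult g h)"
proof (induction f rule: poly_mapping_additive_induct)
  case (1 u a)
  show ?case
  proof (induction g rule: poly_mapping_additive_induct)
    case (1 v b)
    show ?case
      by (induction h rule: poly_mapping_additive_induct)
        (auto simp: free_mult_add_right mult.assoc)
  qed (auto simp: free_mult_add_right free_mult_add_left)
qed (auto simp: free_mult_add_left)

lemma free_mult_one [simp]:
  "free_mult (Poly_Mapping.single [] 1) f = f" "free_mult f (Poly_Mapping.single [] 1) = f"
  by (induction f rule: poly_mapping_additive_induct)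
    (auto simp: free_mult_add_right free_mult_add_left)

lemma free_algebra_simps [simp]:
  "carrier free_algebra = UNIV" "monoid.mult free_algebra = free_mult"
  "one free_algebra = Poly_Mapping.single [] 1" "ring.zero free_algebra = 0"
  "add free_algebra = (+)"
  by (auto simp: free_algebra_def)

lemma ring_free_algebra: "ring free_algebra"
proof (rule ringI)
  show "abelian_group free_algebra"
    by (rule abelian_groupI) (auto simp: add.assoc add.commute intro: exI[of _ "- _"] add.left_inverse)
  show "monoid free_algebra"
    by (rule monoidI) (auto simp: free_mult_assoc)
qed (auto simp: free_mult_add_left free_mult_add_right)

interpretation F: ring free_algebra by (rule ring_free_algebra)

section \<open>Polynomials in z inside the free algebra\<close>

lemma free_poly_bound:
  assumes "degree r \<le> n"
  shows "free_poly r = (\<Sum>i\<le>n. Poly_Mapping.single (replicate i Gen_z) (coeff r i))"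
  unfolding free_poly_def using assms
  by (intro sum.mono_neutral_left) (auto simp: coeff_eq_0)

text \<open>The Horner recursion inside the free algebra. It turns induction on polynomials into a
  proof that \<open>free_poly\<close> is multiplicative, and later into the computation of its
  action.\<close>

lemma free_poly_pCons:
  "free_poly (pCons a r) = Poly_Mapping.single [] a + free_mult (free_gen Gen_z) (free_poly r)"
proof -
  have "free_poly (pCons a r) =
      (\<Sum>i\<le>Suc (degree r). Poly_Mapping.single (replicate i Gen_z) (coeff (pCons a r) i))"
    by (rule free_poly_bound) (simp add: degree_pCons_le)
  also have "\<dots> = Poly_Mapping.single [] a +
      (\<Sum>i\<le>degree r. Poly_Mapping.single (Gen_z # replicate i Gen_z) (coeff r i))"
    by (subst sum.atMost_Suc_shift) simp
  finally show ?thesis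
    by (simp add: free_poly_def free_mult_sum_right free_gen_def)
qed

lemma free_poly_0 [simp]: "free_poly 0 = 0"
  by (simp add: free_poly_def)

lemma free_poly_const: "free_poly [:c:] = Poly_Mapping.single [] c"
  by (simp add: free_poly_pCons)

lemma free_poly_1: "free_poly 1 = Poly_Mapping.single [] 1"
  by (simp add: one_pCons free_poly_const)

lemma free_poly_add: "free_poly (r + s) = free_poly r + free_poly s"
proof -
  let ?n = "max (degree r) (degree s)"
  have "degree (r + s) \<le> ?n" by (rule degree_add_le_max)
  then show ?thesis
    by (simp add: free_poly_bound[of _ ?n] single_add sum.distrib)
qed

lemma free_poly_smult: "free_poly (Polynomial.smult a s) = free_mult (Poly_Mapping.single [] a) (free_poly s)"
  by (simp add: free_poly_bound[of "Polynomial.smult a s" "degree s"] degree_smult_le free_poly_bound[of s "degree s"] 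
      free_mult_sum_right)

lemma free_poly_mult: "free_poly (r * s) = free_mult (free_poly r) (free_poly s)"
  by (induction r)
    (auto simp: free_poly_pCons free_poly_add free_poly_smult free_mult_add_left free_mult_assoc)

section \<open>The quotient A(t) and its elements\<close>

lemma ideal_gwa: "ideal (Idl\<^bsub>free_algebra\<^esub> (gwa_rels t)) free_algebra"
  by (rule F.genideal_ideal) simp

lemma ring_gwa: "ring (gwa t)"
  unfolding gwa_def by (rule ideal.quotient_is_ring[OF ideal_gwa])

lemma gwa_elt_hom: "gwa_elt t \<in> ring_hom free_algebra (gwa t)"
  unfolding gwa_def gwa_elt_def[abs_def] by (rule ideal.rcos_ring_hom[OF ideal_gwa])

lemma gwa_elt_simps:
  "gwa_elt t (f + g) = gwa_elt t f \<oplus>\<^bsub>gwa t\<^esub> gwa_elt t g"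
  "gwa_elt t (free_mult f g) = gwa_elt t f \<otimes>\<^bsub>gwa t\<^esub> gwa_elt t g"
  "gwa_elt t (Poly_Mapping.single [] 1) = \<one>\<^bsub>gwa t\<^esub>"
  "gwa_elt t f \<in> carrier (gwa t)"
  using gwa_elt_hom[of t] by (auto simp: ring_hom_def)

lemma carrier_gwa: "carrier (gwa t) = range (gwa_elt t)"
  by (auto simp: gwa_def FactRing_def A_RCOSETS_def' a_r_coset_def' gwa_elt_def)

lemma gwa_elt_eq_iff: "gwa_elt t f = gwa_elt t g \<longleftrightarrow> f - g \<in> Idl\<^bsub>free_algebra\<^esub> (gwa_rels t)"
proof -
  interpret I: ideal "Idl\<^bsub>free_algebra\<^esub> (gwa_rels t)" free_algebra by (rule ideal_gwa)
  have m: "\<ominus>\<^bsub>free_algebra\<^esub> x = - x" for x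
    by (rule F.minus_equality) auto
  show ?thesis
    using F.quotient_eq_iff_same_a_r_cos[OF ideal_gwa, of f g t]
    by (simp add: gwa_elt_def a_minus_def m)
qed

lemma gwa_elt_rel:
  assumes "f - g \<in> gwa_rels t" shows "gwa_elt t f = gwa_elt t g"
  using assms F.genideal_self[of "gwa_rels t"] by (auto simp: gwa_elt_eq_iff)

text \<open>Scalars are constant polynomials and z is the polynomial \<open>[:0, 1:]\<close>, so
  polynomials together with X+ and X- generate the free algebra. Linearity over A(t) thus has to be
  checked only against these.\<close>

lemma free_algebra_induct:
  assumes "\<And>r. P (free_poly r)" "\<And>x. x \<noteq> Gen_z \<Longrightarrow> P (free_gen x)"
    and "\<And>f g. P f \<Longrightarrow> P g \<Longrightarrow> P (f + g)" "\<And>f g. P f \<Longrightarrow> P g \<Longrightarrow> P (free_mult f g)"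
  shows "P f"
proof (induction f rule: poly_mapping_additive_induct)
  case (1 u c)
  show ?case
  proof (induction u)
    case Nil
    show ?case using assms(1)[of "[:c:]"] by (simp add: free_poly_const)
  next
    case (Cons x u)
    have "P (free_gen x)"
      using assms(1)[of "[:0,1:]"] assms(2)[of x]
      by (cases "x = Gen_z") (simp_all add: free_poly_pCons)
    from assms(4)[OF this Cons] show ?case by (simp add: free_gen_def)
  qed
qed (rule assms)

section \<open>Modules over A(t) through the action of the generators\<close>

text \<open>A module over C[z] whose action is a plain function, independent of t and of the record
  of a module over A(t). Complex scalars have no action of their own: the scalar c acts as
  \<open>p [:c:]\<close>.\<close>

locale poly_act = abelian_group M for M :: "('a, 'm) ring_scheme" (structure) +
  fixes p :: "complex poly \<Rightarrow> 'a \<Rightarrow> 'a"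
  assumes p_closed [simp, intro]: "v \<in> carrier M \<Longrightarrow> p r v \<in> carrier M"
    and p_radd: "v \<in> carrier M \<Longrightarrow> w \<in> carrier M \<Longrightarrow> p r (v \<oplus> w) = p r v \<oplus> p r w"
    and p_add: "v \<in> carrier M \<Longrightarrow> p (r + s) v = p r v \<oplus> p s v"
    and p_mult: "v \<in> carrier M \<Longrightarrow> p (r * s) v = p r (p s v)"
    and p_one: "v \<in> carrier M \<Longrightarrow> p 1 v = v"
begin

lemma p_zero [simp]: "v \<in> carrier M \<Longrightarrow> p 0 v = \<zero>"
  using p_add[of v 0 0] by (metis add.l_cancel_one add_cancel_right_left p_closed)

lemma p_rzero [simp]: "p r \<zero> = \<zero>"
  using p_radd[of \<zero> \<zero> r] by (metis add.l_cancel_one l_zero p_closed zero_closed)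

lemma diff_eq_zero: "v \<in> carrier M \<Longrightarrow> w \<in> carrier M \<Longrightarrow> v \<ominus> w = \<zero> \<longleftrightarrow> v = w"
  by (metis a_minus_def a_inv_closed minus_equality minus_minus r_neg)

lemma p_minus: "v \<in> carrier M \<Longrightarrow> p (- r) v = \<ominus> p r v"
  using p_add[of v "- r" r] by (metis add.left_inverse minus_equality p_closed p_zero)

lemma p_rminus: "v \<in> carrier M \<Longrightarrow> p r (\<ominus> v) = \<ominus> p r v"
  using p_radd[of "\<ominus> v" v r] by (metis a_inv_closed l_neg minus_equality p_closed p_rzero)

lemma p_commute: "v \<in> carrier M \<Longrightarrow> p r (p s v) = p s (p r v)"
  by (metis p_mult mult.commute)

lemma p_finsum:
  assumes "f \<in> A \<rightarrow> carrier M"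
  shows "p r (finsum M f A) = finsum M (\<lambda>i. p r (f i)) A"
  using assms by (induction A rule: infinite_finite_induct) (auto simp: p_radd Pi_def)

end

text \<open>A module over A(t) by generators and relations. \<open>X\<close> is constrained at
  \<open>Gen_Xp\<close> and \<open>Gen_Xm\<close> only; z acts through \<open>p\<close>.\<close>

locale gwa_act = poly_act +
  fixes t :: "complex poly" and X :: "gwa_gen \<Rightarrow> 'a \<Rightarrow> 'a"
  assumes X_closed [simp, intro]: "v \<in> carrier M \<Longrightarrow> x \<noteq> Gen_z \<Longrightarrow> X x v \<in> carrier M"
    and X_add: "v \<in> carrier M \<Longrightarrow> w \<in> carrier M \<Longrightarrow> x \<noteq> Gen_z \<Longrightarrow> X x (v \<oplus> w) = X x v \<oplus> X x w"
    and Xp_p: "v \<in> carrier M \<Longrightarrow> X Gen_Xp (p r v) = p (shift 1 r) (X Gen_Xp v)"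
    and Xm_p: "v \<in> carrier M \<Longrightarrow> X Gen_Xm (p r v) = p (shift (- 1) r) (X Gen_Xm v)"
    and XpXm: "v \<in> carrier M \<Longrightarrow> X Gen_Xp (X Gen_Xm v) = p (shift (1 / 2) t) v"
    and XmXp: "v \<in> carrier M \<Longrightarrow> X Gen_Xm (X Gen_Xp v) = p (shift (- 1 / 2) t) v"
begin

lemma X_zero: "x \<noteq> Gen_z \<Longrightarrow> X x \<zero> = \<zero>"
  using X_add[of \<zero> \<zero> x] by (metis X_closed add.l_cancel_one l_zero zero_closed)

definition gen :: "gwa_gen \<Rightarrow> 'a \<Rightarrow> 'a" where
  "gen x v = (if x = Gen_z then p [:0, 1:] v else X x v)"

lemma gen_closed [simp]: "v \<in> carrier M \<Longrightarrow> gen x v \<in> carrier M"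
  by (auto simp: gen_def)

lemma gen_add: "v \<in> carrier M \<Longrightarrow> w \<in> carrier M \<Longrightarrow> gen x (v \<oplus> w) = gen x v \<oplus> gen x w"
  by (auto simp: gen_def X_add p_radd)

text \<open>Shifts fix constant polynomials, so X+ and X- are linear over the complex numbers
  although only semilinear over C[z]. Coefficients can therefore be moved through words.\<close>

lemma gen_const: "v \<in> carrier M \<Longrightarrow> gen x (p [:c:] v) = p [:c:] (gen x v)"
  using p_commute[of v "[:0,1:]" "[:c:]"]
  by (cases x) (auto simp: gen_def Xp_p Xm_p shift_def)

definition word :: "gwa_gen list \<Rightarrow> 'a \<Rightarrow> 'a" where
  "word u v = foldr gen u v"

lemma word_simps [simp]: "word [] v = v" "word (x # u) v = gen x (word u v)"
    "word (u @ w) v = word u (word w v)"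
  by (auto simp: word_def)

lemma word_closed [simp]: "v \<in> carrier M \<Longrightarrow> word u v \<in> carrier M"
  by (induction u) auto

lemma word_add: "v \<in> carrier M \<Longrightarrow> w \<in> carrier M \<Longrightarrow> word u (v \<oplus> w) = word u v \<oplus> word u w"
  by (induction u) (auto simp: gen_add)

lemma word_const: "v \<in> carrier M \<Longrightarrow> word u (p [:c:] v) = p [:c:] (word u v)"
  by (induction u) (auto simp: gen_const)

definition act :: "gwa_free \<Rightarrow> 'a \<Rightarrow> 'a" where
  "act f v = (\<Oplus>u\<in>Poly_Mapping.keys f. p [:Poly_Mapping.lookup f u:] (word u v))"

lemma act_superset:
  assumes "finite A" "Poly_Mapping.keys f \<subseteq> A" "v \<in> carrier M"
  shows "act f v = (\<Oplus>u\<in>A. p [:Poly_Mapping.lookup f u:] (word u v))"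
  unfolding act_def using assms
  by (intro add.finprod_mono_neutral_cong_left) (auto simp: in_keys_iff)

lemma act_closed [simp]: "v \<in> carrier M \<Longrightarrow> act f v \<in> carrier M"
  unfolding act_def by (intro finsum_closed) auto

lemma act_single [simp]: "v \<in> carrier M \<Longrightarrow> act (Poly_Mapping.single u c) v = p [:c:] (word u v)"
  by (subst act_superset[of "{u}"]) auto

lemma act_add: 
  assumes "v \<in> carrier M" shows "act (f + g) v = act f v \<oplus> act g v"
proof -
  let ?A = "Poly_Mapping.keys f \<union> Poly_Mapping.keys g"
  have "Poly_Mapping.keys (f + g) \<subseteq> ?A" by (rule keys_add)
  moreover have "p [:Poly_Mapping.lookup f u + Poly_Mapping.lookup g u:] (word u v) =
     p [:Poly_Mapping.lookup f u:] (word u v) \<oplus> p [:Poly_Mapping.lookup g u:] (word u v)" for u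
    using p_add[of "word u v" "[:Poly_Mapping.lookup f u:]" "[:Poly_Mapping.lookup g u:]"] assms by simp
  ultimately show ?thesis using assms
    by (simp add: act_superset[of ?A] lookup_add finsum_addf)
qed

lemma act_radd: "v \<in> carrier M \<Longrightarrow> w \<in> carrier M \<Longrightarrow> act f (v \<oplus> w) = act f v \<oplus> act f w"
  by (induction f rule: poly_mapping_additive_induct)
    (auto simp: act_add word_add p_radd a_ac)

lemma act_mult: "v \<in> carrier M \<Longrightarrow> act (free_mult f g) v = act f (act g v)"
proof (induction f rule: poly_mapping_additive_induct)
  case (1 u a)
  then show ?case
  proof (induction g rule: poly_mapping_additive_induct)
    case (1 w b)
    then show ?case using p_mult[of "word u (word w v)" "[:a:]" "[:b:]"]
      by (simp add: word_const mult.commute)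
  qed (auto simp: act_add free_mult_add_right act_radd)
qed (auto simp: act_add free_mult_add_left)

lemma act_poly: "v \<in> carrier M \<Longrightarrow> act (free_poly r) v = p r v"
proof (induction r)
  case 0
  then show ?case by (simp add: act_def)
next
  case (pCons a r)
  have "pCons a r = [:a:] + [:0,1:] * r" by simp
  then have "p (pCons a r) v = p [:a:] v \<oplus> p [:0,1:] (p r v)"
    using pCons.prems by (metis p_add p_mult)
  moreover have "p 1 (gen Gen_z (p r v)) = p [:0,1:] (p r v)"
    using pCons.prems by (simp add: p_one gen_def)
  ultimately show ?case using pCons
    by (simp add: free_poly_pCons act_add act_mult free_gen_def flip: one_pCons)
qed

lemma act_gen: "v \<in> carrier M \<Longrightarrow> act (free_gen x) v = gen x v"
  by (simp add: free_gen_def p_one flip: one_pCons)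

lemma act_minus: "v \<in> carrier M \<Longrightarrow> act (f - g) v = act f v \<ominus> act g v"
  using act_add[of v "f - g" g] by (simp add: a_minus_def a_assoc r_neg)

lemma act_rels: "f \<in> gwa_rels t \<Longrightarrow> v \<in> carrier M \<Longrightarrow> act f v = \<zero>"
  by (auto simp: gwa_rels_def act_minus act_mult act_poly act_gen gen_def Xp_p Xm_p XpXm XmXp a_minus_def r_neg)

text \<open>The elements that act as zero on the whole module form a two-sided ideal, and this ideal
  contains the relations.\<close>

lemma act_ideal:
  assumes "f \<in> Idl\<^bsub>free_algebra\<^esub> (gwa_rels t)" "v \<in> carrier M"
  shows "act f v = \<zero>"
proof -
  let ?K = "{f. \<forall>v\<in>carrier M. act f v = \<zero>}"
  have 0: "act 0 v = \<zero>" for v by (simp add: act_def)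
  have m: "\<ominus>\<^bsub>free_algebra\<^esub> x = - x" for x
    by (rule F.minus_equality) auto
  have neg: "act (- f) v = \<zero>" if "act f v = \<zero>" "v \<in> carrier M" for f v
    using act_minus[of v 0 f] that by (simp add: 0 a_minus_def)
  have r0: "act f \<zero> = \<zero>" for f
    using act_radd[of \<zero> \<zero> f] by (metis act_closed add.l_cancel_one l_zero zero_closed)
  have "ideal ?K free_algebra"
  proof (rule idealI[OF ring_free_algebra])
    show "subgroup ?K (add_monoid free_algebra)"
    proof (rule subgroup.intro)
      fix x assume "x \<in> ?K"
      then show "inv\<^bsub>add_monoid free_algebra\<^esub> x \<in> ?K"
        using neg unfolding a_inv_def[symmetric] m by auto
    qed (auto simp: act_add 0)
  qed (auto simp: act_mult r0)
  then have "Idl\<^bsub>free_algebra\<^esub> (gwa_rels t) \<subseteq> ?K"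
    by (rule F.genideal_minimal) (auto simp: act_rels)
  with assms show ?thesis by auto
qed

end

text \<open>A coset acts through a chosen representative; two representatives differ by an element
  of the ideal, which acts as zero. Only the field \<open>smult\<close> is replaced, so the result
  applies to records whose additive structure is already fixed, such as tensor products and sequence
  spaces.\<close>

lemma gwa_act_imp_left_module:
  fixes M :: "(gwa_free set, 'a) module" (structure)
  assumes "gwa_act M p t X"
  shows "\<exists>s. left_module (gwa t) (M\<lparr>smult := s\<rparr>)
     \<and> (\<forall>v\<in>carrier M. (\<forall>r. act_poly t (M\<lparr>smult := s\<rparr>) r v = p r v)
          \<and> (\<forall>x\<in>{Gen_Xp, Gen_Xm}. act_gen t (M\<lparr>smult := s\<rparr>) x v = X x v))"
proof -
  interpret gwa_act M p t X by fact
  interpret R: ring "gwa t" by (rule ring_gwa)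
  define s where "s S = act (SOME f. gwa_elt t f = S)" for S
  have s: "s (gwa_elt t f) v = act f v" if "v \<in> carrier M" for f v
  proof -
    have "gwa_elt t (SOME g. gwa_elt t g = gwa_elt t f) = gwa_elt t f"
      by (rule someI) simp
    from act_ideal[OF this[unfolded gwa_elt_eq_iff] that]
    have "act (SOME g. gwa_elt t g = gwa_elt t f) v \<ominus> act f v = \<zero>"
      using that by (simp only: act_minus gwa_elt_eq_iff)
    then show ?thesis
      using that diff_eq_zero by (simp add: s_def)
  qed
  have "left_module (gwa t) (M\<lparr>smult := s\<rparr>)"
  proof (intro left_module.intro left_module_axioms.intro)
    show "abelian_group (M\<lparr>smult := s\<rparr>)"
      by (rule abelian_groupI) (auto simp: a_ac intro: add.l_inv_ex)
  qed (auto simp: carrier_gwa s act_radd act_add act_mult ring_gwa p_one simp flip: gwa_elt_simps one_pCons)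
  then show ?thesis
    by (intro exI[of _ s]) (auto simp: act_poly_def act_gen_def s act_poly act_gen gen_def)
qed

section \<open>From modules over A(t) back to the operators of the generators\<close>

context left_module
begin

lemma smult_zero_right: "a \<in> carrier R \<Longrightarrow> a \<odot>\<^bsub>M\<^esub> \<zero>\<^bsub>M\<^esub> = \<zero>\<^bsub>M\<^esub>"
  using smult_r_distr[of a "\<zero>\<^bsub>M\<^esub>" "\<zero>\<^bsub>M\<^esub>"]
  by (metis M.add.l_cancel_one M.l_zero M.zero_closed smult_closed)

end

lemma left_module_imp_gwa_act:
  assumes "left_module (gwa t) M"
  shows "gwa_act M (act_poly t M) t (act_gen t M)"
proof -
  interpret left_module "gwa t" M by fact
  have rel: "f - g \<in> gwa_rels t \<Longrightarrow> gwa_elt t f \<odot>\<^bsub>M\<^esub> v = gwa_elt t g \<odot>\<^bsub>M\<^esub> v" for f g v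
    using gwa_elt_rel by metis
  have m: "gwa_elt t f \<odot>\<^bsub>M\<^esub> (gwa_elt t g \<odot>\<^bsub>M\<^esub> v) = gwa_elt t (free_mult f g) \<odot>\<^bsub>M\<^esub> v"
    if "v \<in> carrier M" for f g v
    using that by (simp add: gwa_elt_simps smult_assoc1)
  show ?thesis
  proof (unfold_locales, goal_cases)
    case 9 then show ?case by (auto simp: act_gen_def act_poly_def m intro!: rel simp: gwa_rels_def)
  next
    case 10 then show ?case by (auto simp: act_gen_def act_poly_def m intro!: rel simp: gwa_rels_def)
  next
    case 8 then show ?case by (auto simp: act_gen_def act_poly_def m intro!: rel simp: gwa_rels_def)
  next
    case 11 then show ?case by (auto simp: act_gen_def act_poly_def m intro!: rel simp: gwa_rels_def)
  qed (auto simp: act_poly_def act_gen_def smult_closed gwa_elt_simps free_poly_add free_poly_mult free_poly_1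
      smult_l_distr smult_r_distr smult_assoc1 smult_one)
qed

text \<open>The elements of A(t) that commute with \<open>h\<close> are closed under sums and
  products, and the hypotheses put a generating set among them.\<close>

lemma gwa_homI:
  assumes "left_module (gwa t) M" "left_module (gwa t) N"
    and h: "h \<in> carrier M \<rightarrow> carrier N"
    and add: "\<And>x y. x \<in> carrier M \<Longrightarrow> y \<in> carrier M \<Longrightarrow> h (x \<oplus>\<^bsub>M\<^esub> y) = h x \<oplus>\<^bsub>N\<^esub> h y"
    and p: "\<And>r v. v \<in> carrier M \<Longrightarrow> h (act_poly t M r v) = act_poly t N r (h v)"
    and X: "\<And>x v. v \<in> carrier M \<Longrightarrow> x \<in> {Gen_Xp, Gen_Xm} \<Longrightarrow> h (act_gen t M x v) = act_gen t N x (h v)"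
  shows "h \<in> gwa_hom t M N"
proof -
  interpret M: left_module "gwa t" M by fact
  interpret N: left_module "gwa t" N by fact
  have "\<forall>v\<in>carrier M. h (gwa_elt t f \<odot>\<^bsub>M\<^esub> v) = gwa_elt t f \<odot>\<^bsub>N\<^esub> h v" for f
  proof (induction f rule: free_algebra_induct)
    case (1 r)
    then show ?case using p by (auto simp: act_poly_def)
  next
    case (2 x)
    then show ?case using X by (cases x) (auto simp: act_gen_def)
  next
    case (3 f g)
    then show ?case using h
      by (auto simp: gwa_elt_simps M.smult_l_distr N.smult_l_distr add M.smult_closed Pi_iff)
  next
    case (4 f g)
    then show ?case using h
      by (auto simp: gwa_elt_simps M.smult_assoc1 N.smult_assoc1 M.smult_closed Pi_iff)
  qed
  with h add show ?thesis by (auto simp: gwa_hom_def carrier_gwa)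
qed

lemma gwa_homD:
  assumes "h \<in> gwa_hom t M N"
  shows "v \<in> carrier M \<Longrightarrow> h v \<in> carrier N"
    and "v \<in> carrier M \<Longrightarrow> w \<in> carrier M \<Longrightarrow> h (v \<oplus>\<^bsub>M\<^esub> w) = h v \<oplus>\<^bsub>N\<^esub> h w"
    and "v \<in> carrier M \<Longrightarrow> h (act_poly t M r v) = act_poly t N r (h v)"
    and "v \<in> carrier M \<Longrightarrow> h (act_gen t M x v) = act_gen t N x (h v)"
  using assms by (auto simp: gwa_hom_def act_poly_def act_gen_def carrier_gwa)

section \<open>Weight spaces\<close>

text \<open>The ideal at n is generated by z - n, so annihilation by this single polynomial
  describes the weight space. Only integer weights are indexed.\<close>

definition wt_space :: "('a, 'm) ring_scheme \<Rightarrow> (complex poly \<Rightarrow> 'a \<Rightarrow> 'a) \<Rightarrow> int \<Rightarrow> 'a set" where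
  "wt_space M p n = {v \<in> carrier M. p [:- of_int n, 1:] v = \<zero>\<^bsub>M\<^esub>}"

text \<open>An inductive closure instead of a set of finite sums, so that claims about all vectors
  of a weight module go by induction over weight vectors and sums of two vectors.\<close>

inductive_set wt_span :: "('a, 'm) ring_scheme \<Rightarrow> (complex poly \<Rightarrow> 'a \<Rightarrow> 'a) \<Rightarrow> 'a set"
  for M p where
  wt: "v \<in> wt_space M p n \<Longrightarrow> v \<in> wt_span M p"
| add: "v \<in> wt_span M p \<Longrightarrow> w \<in> wt_span M p \<Longrightarrow> v \<oplus>\<^bsub>M\<^esub> w \<in> wt_span M p"

definition lin_comb :: "('a, 'm) ring_scheme \<Rightarrow> (complex poly \<Rightarrow> 'a \<Rightarrow> 'a) \<Rightarrow> 'a set \<Rightarrow> ('a \<Rightarrow> complex) \<Rightarrow> 'a" where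
  "lin_comb M p B c = (\<Oplus>\<^bsub>M\<^esub>b\<in>B. p [:c b:] b)"

definition additive :: "('a, 'm) ring_scheme \<Rightarrow> ('b, 'n) ring_scheme \<Rightarrow> ('a \<Rightarrow> 'b) \<Rightarrow> bool" where
  "additive M N h \<longleftrightarrow> h \<in> carrier M \<rightarrow> carrier N
     \<and> (\<forall>v\<in>carrier M. \<forall>w\<in>carrier M. h (v \<oplus>\<^bsub>M\<^esub> w) = h v \<oplus>\<^bsub>N\<^esub> h w)"

lemma additiveI:
  assumes "\<And>v. v \<in> carrier M \<Longrightarrow> h v \<in> carrier N"
    and "\<And>v w. v \<in> carrier M \<Longrightarrow> w \<in> carrier M \<Longrightarrow> h (v \<oplus>\<^bsub>M\<^esub> w) = h v \<oplus>\<^bsub>N\<^esub> h w"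
  shows "additive M N h"
  using assms by (auto simp: additive_def)

lemma additive_closed: "additive M N h \<Longrightarrow> v \<in> carrier M \<Longrightarrow> h v \<in> carrier N"
  and additive_add: "additive M N h \<Longrightarrow> v \<in> carrier M \<Longrightarrow> w \<in> carrier M \<Longrightarrow> h (v \<oplus>\<^bsub>M\<^esub> w) = h v \<oplus>\<^bsub>N\<^esub> h w"
  by (auto simp: additive_def)

lemma additive_zero:
  assumes "additive M N h" "abelian_group M" "abelian_group N"
  shows "h \<zero>\<^bsub>M\<^esub> = \<zero>\<^bsub>N\<^esub>"
proof -
  interpret M: abelian_group M by fact
  interpret N: abelian_group N by fact
  show ?thesis
    using assms(1) additive_add[OF assms(1), of "\<zero>\<^bsub>M\<^esub>" "\<zero>\<^bsub>M\<^esub>"]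
    by (metis M.l_zero M.zero_closed N.add.l_cancel_one additive_closed)
qed

lemma additive_minus:
  assumes "additive M N h" "abelian_group M" "abelian_group N" "v \<in> carrier M"
  shows "h (\<ominus>\<^bsub>M\<^esub> v) = \<ominus>\<^bsub>N\<^esub> h v"
proof -
  interpret M: abelian_group M by fact
  interpret N: abelian_group N by fact
  have "h (\<ominus>\<^bsub>M\<^esub> v) \<oplus>\<^bsub>N\<^esub> h v = \<zero>\<^bsub>N\<^esub>"
    using assms by (metis M.a_inv_closed M.l_neg additive_add additive_zero)
  then show ?thesis
    using assms by (metis M.a_inv_closed N.minus_equality additive_closed)
qed

lemma additive_finsum:
  assumes "additive M N h" "abelian_group M" "abelian_group N" "f \<in> A \<rightarrow> carrier M"
  shows "h (finsum M f A) = finsum N (\<lambda>i. h (f i)) A"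
proof -
  interpret M: abelian_group M by fact
  interpret N: abelian_group N by fact
  show ?thesis
    using assms(4)
  proof (induction A rule: infinite_finite_induct)
    case (insert x F)
    have 1: "h (finsum M f F) = (\<Oplus>\<^bsub>N\<^esub>i\<in>F. h (f i))"
      using insert by auto
    have 2: "f \<in> F \<rightarrow> carrier M" "f x \<in> carrier M" 
        "(\<lambda>i. h (f i)) \<in> F \<rightarrow> carrier N" "h (f x) \<in> carrier N"
      using insert.prems additive_closed[OF assms(1)] by auto
    have "h (finsum M f (insert x F)) = h (f x \<oplus>\<^bsub>M\<^esub> finsum M f F)"
      using insert.hyps 2 by simp
    also have "\<dots> = h (f x) \<oplus>\<^bsub>N\<^esub> (\<Oplus>\<^bsub>N\<^esub>i\<in>F. h (f i))"
      using 2 1 by (simp add: additive_add[OF assms(1)])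
    finally show ?case using insert.hyps 2 by simp
  qed (use additive_zero[OF assms(1-3)] in auto)
qed

definition p_linear where
  "p_linear M p N q h \<longleftrightarrow> additive M N h \<and> (\<forall>r. \<forall>v\<in>carrier M. h (p r v) = q r (h v))"

context poly_act
begin

lemma p_const_mult: "v \<in> carrier M \<Longrightarrow> p [:a:] (p [:b:] v) = p [:a * b:] v"
  using p_mult[of v "[:a:]" "[:b:]"] by (simp add: mult.commute)

lemma p_const_one: "v \<in> carrier M \<Longrightarrow> p [:1:] v = v"
  using p_one by (simp add: one_pCons)

lemma p_const_add: "v \<in> carrier M \<Longrightarrow> p [:a + b:] v = p [:a:] v \<oplus> p [:b:] v"
  using p_add[of v "[:a:]" "[:b:]"] by simp

lemma p_const_cancel: "v \<in> carrier M \<Longrightarrow> p [:c:] v = \<zero> \<Longrightarrow> c \<noteq> 0 \<Longrightarrow> v = \<zero>"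
  using p_const_mult[of v "1 / c" c] by (simp add: p_const_one)

lemma p_const_minus_one: "v \<in> carrier M \<Longrightarrow> p [:- 1:] v = \<ominus> v"
  using p_minus[of v "[:1:]"] by (simp add: p_const_one)

lemma p_diff: "v \<in> carrier M \<Longrightarrow> p (r - s) v = p r v \<ominus> p s v"
  using p_add[of v r "- s"] by (simp add: p_minus a_minus_def)

lemma p_rdiff: "v \<in> carrier M \<Longrightarrow> w \<in> carrier M \<Longrightarrow> p r (v \<ominus> w) = p r v \<ominus> p r w"
  by (simp add: a_minus_def p_radd p_rminus)

lemma wt_spaceD [dest]: "v \<in> wt_space M p n \<Longrightarrow> v \<in> carrier M"
  by (auto simp: wt_space_def)

lemma wt_zero [simp, intro]: "\<zero> \<in> wt_space M p n"
  by (auto simp: wt_space_def)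

lemma wt_add [intro]: "v \<in> wt_space M p n \<Longrightarrow> w \<in> wt_space M p n \<Longrightarrow> v \<oplus> w \<in> wt_space M p n"
  by (auto simp: wt_space_def p_radd)

lemma wt_minus [intro]: "v \<in> wt_space M p n \<Longrightarrow> \<ominus> v \<in> wt_space M p n"
  by (auto simp: wt_space_def p_rminus)

lemma wt_p [intro]: "v \<in> wt_space M p n \<Longrightarrow> p r v \<in> wt_space M p n"
  by (auto simp: wt_space_def p_commute[of _ "[:- of_int n, 1:]"])

lemma wt_finsum: "f \<in> A \<rightarrow> wt_space M p n \<Longrightarrow> finsum M f A \<in> wt_space M p n"
proof (induction A rule: infinite_finite_induct)
  case (insert x F)
  then have "f \<in> F \<rightarrow> carrier M" "f x \<in> carrier M" by auto
  with insert show ?case by auto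
qed auto

text \<open>Division by z - n leaves the constant remainder r(n), and the multiple of z - n acts as
  zero.\<close>

lemma p_wt: 
  assumes "v \<in> wt_space M p n"
  shows "p r v = p [:poly r (of_int n):] v"
proof -
  have "poly (r - [:poly r (of_int n):]) (of_int n) = 0" by simp
  then obtain q where "r - [:poly r (of_int n):] = [:- of_int n, 1:] * q"
    unfolding poly_eq_0_iff_dvd by (rule dvdE)
  then have r: "r = q * [:- of_int n, 1:] + [:poly r (of_int n):]"
    by (simp add: algebra_simps)
  have "p r v = p q (p [:- of_int n, 1:] v) \<oplus> p [:poly r (of_int n):] v"
    using assms by (subst r) (auto simp: p_add p_mult simp del: mult_pCons_right)
  then show ?thesis using assms by (auto simp: wt_space_def)
qed

lemma wt_span_carrier: "v \<in> wt_span M p \<Longrightarrow> v \<in> carrier M"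
  by (induction rule: wt_span.induct) auto

lemma lin_comb_closed [simp]: "B \<subseteq> carrier M \<Longrightarrow> lin_comb M p B c \<in> carrier M"
  unfolding lin_comb_def by (intro finsum_closed) auto

lemma lin_comb_add:
  "B \<subseteq> carrier M \<Longrightarrow> lin_comb M p B (\<lambda>b. c b + d b) = lin_comb M p B c \<oplus> lin_comb M p B d"
  unfolding lin_comb_def
  by (subst finsum_addf[symmetric]) (auto simp: p_const_add intro!: add.finprod_cong')

lemma lin_comb_scale:
  "B \<subseteq> carrier M \<Longrightarrow> lin_comb M p B (\<lambda>b. k * c b) = p [:k:] (lin_comb M p B c)"
  unfolding lin_comb_def
  by (subst p_finsum) (auto simp: p_const_mult intro!: add.finprod_cong')

text \<open>A spanning set of minimal cardinality is a basis.\<close>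

lemma basis_exists:
  assumes "finite B0" "B0 \<subseteq> W" "\<And>w. w \<in> W \<Longrightarrow> \<exists>c. w = lin_comb M p B0 c"
    and W: "W \<subseteq> carrier M" "\<And>v w. v \<in> W \<Longrightarrow> w \<in> W \<Longrightarrow> v \<oplus> w \<in> W"
      "\<And>c v. v \<in> W \<Longrightarrow> p [:c:] v \<in> W"
  shows "\<exists>B k. finite B \<and> B \<subseteq> W \<and> (\<forall>w\<in>W. w = lin_comb M p B (k w))
     \<and> (\<forall>v\<in>W. \<forall>w\<in>W. \<forall>b\<in>B. k (v \<oplus> w) b = k v b + k w b)
     \<and> (\<forall>v\<in>W. \<forall>c. \<forall>b\<in>B. k (p [:c:] v) b = c * k v b)"
proof -
  let ?S = "\<lambda>B. finite B \<and> B \<subseteq> W \<and> (\<forall>w\<in>W. \<exists>c. w = lin_comb M p B c)"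
  have "?S B0" using assms by auto
  then obtain B where B: "?S B" and min: "\<And>B'. ?S B' \<Longrightarrow> card B \<le> card B'"
    using ex_has_least_nat[of ?S B0 card] by blast
  have BM: "B \<subseteq> carrier M" using B W by auto
  have indep: "e b = 0" if e: "lin_comb M p B e = \<zero>" and b: "b \<in> B" for e b
  proof (rule ccontr)
    assume nz: "e b \<noteq> 0"
    have "?S (B - {b})"
    proof (intro conjI ballI)
      fix w assume "w \<in> W"
      then obtain c where c: "w = lin_comb M p B c" using B by blast
      let ?d = "\<lambda>x. c x + (- c b / e b) * e x"
      have "w = lin_comb M p B ?d"
        unfolding lin_comb_add[OF BM] lin_comb_scale[OF BM] e using c BM by simp
      also have "\<dots> = lin_comb M p (B - {b}) ?d"
        unfolding lin_comb_def using B BM nz b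
        by (intro add.finprod_mono_neutral_cong_right) auto
      finally show "\<exists>c. w = lin_comb M p (B - {b}) c" by blast
    qed (use B in auto)
    moreover have "card (B - {b}) < card B" using B b by (intro card_Diff1_less) auto
    ultimately show False using min leD by metis
  qed
  have uniq: "c b = d b" if "lin_comb M p B c = lin_comb M p B d" "b \<in> B" for c d b
  proof -
    have "lin_comb M p B (\<lambda>b. c b + (-1) * d b) = \<zero>"
      unfolding lin_comb_add[OF BM] lin_comb_scale[OF BM] that(1)
      using BM by (simp add: p_const_minus_one r_neg)
    from indep[OF this that(2)] show ?thesis by simp
  qed
  define k where "k w = (SOME c. w = lin_comb M p B c)" for w
  have k: "w = lin_comb M p B (k w)" if "w \<in> W" for w
    using someI_ex[of "\<lambda>c. w = lin_comb M p B c"] B that unfolding k_def by blast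
  have "k (v \<oplus> w) b = k v b + k w b" if "v \<in> W" "w \<in> W" "b \<in> B" for v w b
    by (rule uniq[OF _ that(3)]) (simp only: k[OF that(1), symmetric] k[OF that(2), symmetric] k[OF W(2)[OF that(1,2)], symmetric] lin_comb_add[OF BM])
  moreover have "k (p [:c:] v) b = c * k v b" if "v \<in> W" "b \<in> B" for v c b
    by (rule uniq[OF _ that(2)]) (simp only: k[OF that(1), symmetric] k[OF W(3)[OF that(1)], symmetric] lin_comb_scale[OF BM])
  ultimately have k2: "\<forall>v\<in>W. \<forall>w\<in>W. \<forall>b\<in>B. k (v \<oplus> w) b = k v b + k w b"
    "\<forall>v\<in>W. \<forall>c. \<forall>b\<in>B. k (p [:c:] v) b = c * k v b" by auto
  have k1: "\<forall>w\<in>W. w = lin_comb M p B (k w)" by (rule ballI) (rule k)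
  have "finite B" "B \<subseteq> W" using B by simp_all
  from this k1 k2 show ?thesis
    by (intro exI[of _ B] exI[of _ k] conjI)
qed

lemma p_linear_wt:
  assumes "p_linear M p N q h" "poly_act N q" "v \<in> wt_space M p n"
  shows "h v \<in> wt_space N q n"
proof -
  interpret N: poly_act N q by fact
  have add: "additive M N h" using assms by (auto simp: p_linear_def)
  have "q [:- of_int n, 1:] (h v) = h (p [:- of_int n, 1:] v)"
    using assms by (auto simp: p_linear_def)
  then show ?thesis
    using assms add additive_closed[OF add] additive_zero[OF add abelian_group_axioms N.abelian_group_axioms]
    by (auto simp: wt_space_def)
qed

end

section \<open>Components of a vector in the weight spaces\<close>

locale wt_act = poly_act +
  assumes spans: "v \<in> carrier M \<Longrightarrow> v \<in> wt_span M p"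
begin

text \<open>Characterizes the component without choosing a decomposition: the remainder
  \<open>v \<ominus> w\<close> is killed by a polynomial that does not vanish at n, as is the case
  when it involves only other weights.\<close>

definition is_comp :: "int \<Rightarrow> 'a \<Rightarrow> 'a \<Rightarrow> bool" where
  "is_comp n v w \<longleftrightarrow> w \<in> wt_space M p n \<and> (\<exists>q. poly q (of_int n) \<noteq> 0 \<and> p q (v \<ominus> w) = \<zero>)"

text \<open>The difference of two candidates has weight n, so the product of the two annihilating
  polynomials acts on it by its value at n, which is nonzero; yet that product kills the
  difference.\<close>

lemma is_comp_unique:
  assumes "is_comp n v w" "is_comp n v w'" "v \<in> carrier M"
  shows "w = w'"
proof -
  obtain q q' where q: "poly q (of_int n) \<noteq> 0" "p q (v \<ominus> w) = \<zero>"
    "poly q' (of_int n) \<noteq> 0" "p q' (v \<ominus> w') = \<zero>" and w: "w \<in> wt_space M p n" "w' \<in> wt_space M p n"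
    using assms by (auto simp: is_comp_def)
  have wM: "w \<in> carrier M" "w' \<in> carrier M" using w by auto
  have d: "w' \<ominus> w \<in> wt_space M p n" using w by (auto simp: a_minus_def)
  have e: "w' \<ominus> w = (v \<ominus> w) \<oplus> \<ominus> (v \<ominus> w')"
    using wM assms(3) by (simp add: a_minus_def minus_add a_ac r_neg2)
  have 1: "p (q * q') (v \<ominus> w) = \<zero>" using q wM assms(3) by (metis minus_closed mult.commute p_mult p_rzero)
  have 2: "p (q * q') (v \<ominus> w') = \<zero>" using q wM assms(3) by (metis minus_closed p_mult p_rzero)
  have "p (q * q') (w' \<ominus> w) = \<zero>"
    unfolding e using 1 2 wM assms(3) by (simp add: p_radd p_rminus)
  then have "p [:poly (q * q') (of_int n):] (w' \<ominus> w) = \<zero>"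
    using p_wt[OF d, of "q * q'"] by simp
  then have "w' \<ominus> w = \<zero>" using q d p_const_cancel by auto
  then show ?thesis using wM diff_eq_zero by metis
qed

lemma is_comp_self: "w \<in> wt_space M p n \<Longrightarrow> is_comp n w w"
  unfolding is_comp_def by (auto intro!: exI[of _ 1] simp: a_minus_def r_neg)

text \<open>The polynomial z - m kills a vector of weight m and takes the nonzero value n - m at
  n.\<close>

lemma is_comp_other: "w \<in> wt_space M p m \<Longrightarrow> m \<noteq> n \<Longrightarrow> is_comp n w \<zero>"
  unfolding is_comp_def
  by (auto intro!: exI[of _ "[:- of_int m, 1:]"] simp: p_rdiff[OF wt_spaceD]) (auto simp: wt_space_def a_minus_def r_neg)

lemma is_comp_add:
  assumes "is_comp n v w" "is_comp n v' w'" "v \<in> carrier M" "v' \<in> carrier M"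
  shows "is_comp n (v \<oplus> v') (w \<oplus> w')"
proof -
  obtain q q' where q: "poly q (of_int n) \<noteq> 0" "p q (v \<ominus> w) = \<zero>"
    "poly q' (of_int n) \<noteq> 0" "p q' (v' \<ominus> w') = \<zero>" and w: "w \<in> wt_space M p n" "w' \<in> wt_space M p n"
    using assms by (auto simp: is_comp_def)
  have wM: "w \<in> carrier M" "w' \<in> carrier M" using w by auto
  have 1: "p (q * q') (v \<ominus> w) = \<zero>" using q wM assms(3) by (metis minus_closed mult.commute p_mult p_rzero)
  have 2: "p (q * q') (v' \<ominus> w') = \<zero>" using q wM assms(4) by (metis minus_closed p_mult p_rzero)
  have e: "v \<oplus> v' \<ominus> (w \<oplus> w') = (v \<ominus> w) \<oplus> (v' \<ominus> w')"
    using wM assms by (simp add: a_minus_def minus_add a_ac)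
  have "p (q * q') (v \<oplus> v' \<ominus> (w \<oplus> w')) = \<zero>"
    unfolding e using 1 2 wM assms(3,4) by (simp add: p_radd)
  then show ?thesis unfolding is_comp_def using w q
    by (auto intro!: exI[of _ "q * q'"])
qed

lemma is_comp_ex: "v \<in> carrier M \<Longrightarrow> \<exists>w. is_comp n v w"
proof -
  assume "v \<in> carrier M"
  from spans[OF this] show ?thesis
  proof induction
    case (wt v m)
    then show ?case using is_comp_self is_comp_other by metis
  next
    case (add v w)
    then show ?case using is_comp_add wt_span_carrier by metis
  qed
qed

definition comp :: "int \<Rightarrow> 'a \<Rightarrow> 'a" where
  "comp n v = (THE w. is_comp n v w)"

lemma comp_eqI: "v \<in> carrier M \<Longrightarrow> is_comp n v w \<Longrightarrow> comp n v = w"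
  unfolding comp_def by (rule the_equality) (auto dest: is_comp_unique)

lemma is_comp_comp: "v \<in> carrier M \<Longrightarrow> is_comp n v (comp n v)"
  using is_comp_ex comp_eqI by metis

lemma comp_wt: "v \<in> carrier M \<Longrightarrow> comp n v \<in> wt_space M p n"
  using is_comp_comp by (auto simp: is_comp_def)

lemma comp_closed [simp]: "v \<in> carrier M \<Longrightarrow> comp n v \<in> carrier M"
  using comp_wt by auto

lemma comp_add: "v \<in> carrier M \<Longrightarrow> w \<in> carrier M \<Longrightarrow> comp n (v \<oplus> w) = comp n v \<oplus> comp n w"
  by (intro comp_eqI is_comp_add is_comp_comp) auto

lemma comp_self: "w \<in> wt_space M p n \<Longrightarrow> comp n w = w"
  by (intro comp_eqI is_comp_self) auto

lemma comp_other: "w \<in> wt_space M p m \<Longrightarrow> m \<noteq> n \<Longrightarrow> comp n w = \<zero>"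
  by (intro comp_eqI is_comp_other) auto

lemma comp_zero [simp]: "comp n \<zero> = \<zero>"
  by (rule comp_self) auto

lemma comp_additive: "additive M M (comp n)"
  by (rule additiveI) (auto simp: comp_add)

lemma comp_p: "v \<in> carrier M \<Longrightarrow> comp n (p r v) = p r (comp n v)"
proof (rule comp_eqI)
  assume v: "v \<in> carrier M"
  from is_comp_comp[OF v, of n] obtain q where
    q: "poly q (of_int n) \<noteq> 0" "p q (v \<ominus> comp n v) = \<zero>" and w: "comp n v \<in> wt_space M p n"
    by (auto simp: is_comp_def)
  have "p q (p r v \<ominus> p r (comp n v)) = p r (p q (v \<ominus> comp n v))"
    using v by (simp add: p_commute flip: p_rdiff)
  then show "is_comp n (p r v) (p r (comp n v))"
    unfolding is_comp_def using w q by auto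
qed auto

text \<open>The equation is claimed for all sufficiently large finite sets of weights. In this form
  it passes to a sum of two vectors by taking the union of the two thresholds.\<close>

lemma ex_sum_comp:
  assumes "v \<in> carrier M"
  shows "\<exists>S0. finite S0 \<and> (\<forall>S. finite S \<longrightarrow> S0 \<subseteq> S \<longrightarrow> v = (\<Oplus>n\<in>S. comp n v))"
  using spans[OF assms]
proof induction
  case (wt v m)
  have "v = (\<Oplus>n\<in>S. comp n v)" if "finite S" "m \<in> S" for S
  proof -
    have "(\<Oplus>n\<in>S. comp n v) = (\<Oplus>n\<in>{m}. comp n v)"
      using that wt by (intro add.finprod_mono_neutral_cong_right) (auto intro: comp_other)
    then show ?thesis using wt wt_spaceD[OF wt] by (simp add: comp_self)
  qed
  then have "\<forall>S. finite S \<longrightarrow> {m} \<subseteq> S \<longrightarrow> v = (\<Oplus>n\<in>S. comp n v)" by (intro allI impI) blast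
  then show ?case by (intro exI[of _ "{m}"] conjI) simp
next
  case (add v w)
  then obtain S T where S: "finite S" "\<And>S'. finite S' \<Longrightarrow> S \<subseteq> S' \<Longrightarrow> v = (\<Oplus>n\<in>S'. comp n v)"
    and T: "finite T" "\<And>S'. finite S' \<Longrightarrow> T \<subseteq> S' \<Longrightarrow> w = (\<Oplus>n\<in>S'. comp n w)" by metis
  have vw: "v \<in> carrier M" "w \<in> carrier M" using add by (auto dest: wt_span_carrier)
  have "v \<oplus> w = (\<Oplus>n\<in>S'. comp n (v \<oplus> w))" if "finite S'" "S \<union> T \<subseteq> S'" for S'
  proof -
    have 1: "v = (\<Oplus>n\<in>S'. comp n v)" by (rule S(2)) (use that in auto)
    have 2: "w = (\<Oplus>n\<in>S'. comp n w)" by (rule T(2)) (use that in auto)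
    have "v \<oplus> w = (\<Oplus>n\<in>S'. comp n v) \<oplus> (\<Oplus>n\<in>S'. comp n w)"
      by (rule arg_cong2[where f = "(\<oplus>)", OF 1 2])
    also have "\<dots> = (\<Oplus>n\<in>S'. comp n v \<oplus> comp n w)"
      using vw by (intro finsum_addf[symmetric]) auto
    also have "\<dots> = (\<Oplus>n\<in>S'. comp n (v \<oplus> w))"
      using vw by (intro add.finprod_cong') (auto simp: comp_add)
    finally show ?thesis .
  qed
  moreover have "finite (S \<union> T)" using S(1) T(1) by simp
  ultimately show ?case by meson
qed

definition supp :: "'a \<Rightarrow> int set" where
  "supp v = {n. comp n v \<noteq> \<zero>}"

lemma finite_supp: 
  assumes v: "v \<in> carrier M" shows "finite (supp v)"
proof -
  obtain S where S: "finite S" "\<And>S'. finite S' \<Longrightarrow> S \<subseteq> S' \<Longrightarrow> v = (\<Oplus>n\<in>S'. comp n v)"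
    using ex_sum_comp[OF v] by blast
  have "comp n v = \<zero>" if "n \<notin> S" for n
  proof -
    \<comment> \<open>Comparing the sums over \<open>S\<close> and over \<open>insert n S\<close>
      isolates the component at n.\<close>
    have "v = (\<Oplus>m\<in>insert n S. comp m v)" by (rule S(2)) (use S in auto)
    also have "\<dots> = comp n v \<oplus> (\<Oplus>m\<in>S. comp m v)"
      using S(1) that v by (intro finsum_insert) auto
    also have "(\<Oplus>m\<in>S. comp m v) = v" by (rule S(2)[symmetric]) (use S in auto)
    finally show ?thesis using v add.l_cancel_one[of v "comp n v"] by simp
  qed
  then have "supp v \<subseteq> S" by (auto simp: supp_def)
  with S show ?thesis by (auto intro: finite_subset)
qed

lemma sum_comp:
  assumes v: "v \<in> carrier M" and S: "finite S" "supp v \<subseteq> S"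
  shows "(\<Oplus>n\<in>S. comp n v) = v"
proof -
  obtain T where T: "finite T" "\<And>S'. finite S' \<Longrightarrow> T \<subseteq> S' \<Longrightarrow> v = (\<Oplus>n\<in>S'. comp n v)"
    using ex_sum_comp[OF v] by blast
  have "(\<Oplus>n\<in>S. comp n v) = (\<Oplus>n\<in>S \<union> T. comp n v)"
    using S T v by (intro add.finprod_mono_neutral_cong_left) (auto simp: supp_def)
  also have "\<dots> = v" by (rule T(2)[symmetric]) (use S T(1) in auto)
  finally show ?thesis .
qed

lemma comp_ext:
  assumes "v \<in> carrier M" "w \<in> carrier M" "\<And>n. comp n v = comp n w"
  shows "v = w"
proof -
  have "supp v = supp w" using assms by (auto simp: supp_def)
  then have "(\<Oplus>n\<in>supp v. comp n v) = (\<Oplus>n\<in>supp w. comp n w)" using assms(3) by simp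
  then show ?thesis
    unfolding sum_comp[OF assms(1) finite_supp[OF assms(1)] subset_refl]
      sum_comp[OF assms(2) finite_supp[OF assms(2)] subset_refl] .
qed

text \<open>As an abelian group the module is the direct sum of its weight spaces, so additive maps
  out of it may be prescribed on each weight space independently. The map sums the prescribed values
  over the finite support.\<close>

lemma universal:
  assumes K: "abelian_group K"
    and s: "\<And>n v. v \<in> wt_space M p n \<Longrightarrow> s n v \<in> carrier K"
    and add: "\<And>n v w. v \<in> wt_space M p n \<Longrightarrow> w \<in> wt_space M p n \<Longrightarrow> s n (v \<oplus> w) = s n v \<oplus>\<^bsub>K\<^esub> s n w"
  shows "\<exists>h. additive M K h \<and> (\<forall>n. \<forall>v\<in>wt_space M p n. h v = s n v)"
proof -
  interpret K: abelian_group K by fact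
  have s0: "s n \<zero> = \<zero>\<^bsub>K\<^esub>" for n
    using add[of \<zero> n \<zero>] s[of \<zero> n] by (metis K.add.l_cancel_one l_zero wt_zero zero_closed)
  define h where "h v = (\<Oplus>\<^bsub>K\<^esub>n\<in>supp v. s n (comp n v))" for v
  have h: "h v = (\<Oplus>\<^bsub>K\<^esub>n\<in>S. s n (comp n v))" if "v \<in> carrier M" "finite S" "supp v \<subseteq> S" for v S
    unfolding h_def using that
    by (intro K.add.finprod_mono_neutral_cong_left) (auto simp: supp_def s0 intro!: s comp_wt)
  have "additive M K h"
  proof (rule additiveI)
    fix v assume v: "v \<in> carrier M"
    then show "h v \<in> carrier K" unfolding h_def by (intro K.finsum_closed) (auto intro!: s comp_wt)
  next
    fix v w assume v: "v \<in> carrier M" and w: "w \<in> carrier M"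
    let ?S = "supp v \<union> supp w"
    have "supp (v \<oplus> w) \<subseteq> ?S" using v w by (auto simp: supp_def comp_add)
    then have "h (v \<oplus> w) = (\<Oplus>\<^bsub>K\<^esub>n\<in>?S. s n (comp n v) \<oplus>\<^bsub>K\<^esub> s n (comp n w))"
      using v w by (subst h[of _ ?S]) (auto simp: finite_supp comp_add add comp_wt intro!: K.add.finprod_cong' s)
    also have "\<dots> = h v \<oplus>\<^bsub>K\<^esub> h w"
      using v w by (subst K.finsum_addf) (auto simp: h[of _ ?S] finite_supp intro!: s comp_wt)
    finally show "h (v \<oplus> w) = h v \<oplus>\<^bsub>K\<^esub> h w" .
  qed
  moreover have "h v = s n v" if "v \<in> wt_space M p n" for n v
  proof -
    have "supp v \<subseteq> {n}" using that comp_other[of v n] by (force simp: supp_def)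
    then have "h v = (\<Oplus>\<^bsub>K\<^esub>n\<in>{n}. s n (comp n v))" using that by (intro h) auto
    then show ?thesis using that s[OF that] by (simp add: comp_self)
  qed
  ultimately show ?thesis by blast
qed

lemma additive_eq:
  assumes "additive M K h" "additive M K h'" "abelian_group K"
    and "\<And>n v. v \<in> wt_space M p n \<Longrightarrow> h v = h' v" "v \<in> carrier M"
  shows "h v = h' v"
  using spans[OF assms(5)]
proof induction
  case (wt v n)
  then show ?case using assms by auto
next
  case (add v w)
  then show ?case using additive_add[OF assms(1)] additive_add[OF assms(2)] wt_span_carrier by simp
qed

text \<open>On weight n every polynomial acts by a scalar, so a map that preserves weights and
  complex scalars commutes with all polynomials.\<close>

lemma p_linearI:
  assumes "additive M N h" "poly_act N q"
    and "\<And>n v. v \<in> wt_space M p n \<Longrightarrow> h v \<in> wt_space N q n"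
    and "\<And>n v c. v \<in> wt_space M p n \<Longrightarrow> h (p [:c:] v) = q [:c:] (h v)"
  shows "p_linear M p N q h"
proof -
  interpret N: poly_act N q by fact
  have "h (p r v) = q r (h v)" if "v \<in> carrier M" for r v
    using spans[OF that]
  proof induction
    case (wt v n)
    then show ?case using assms(4)[OF wt] by (subst p_wt[OF wt], subst N.p_wt[OF assms(3)[OF wt]]) auto
  next
    case (add v w)
    then show ?case using additive_add[OF assms(1)] additive_closed[OF assms(1)] wt_span_carrier
      by (simp add: p_radd N.p_radd)
  qed
  with assms(1) show ?thesis by (auto simp: p_linear_def)
qed

lemma comp_p_linear:
  assumes "p_linear M p N q h" "wt_act N q" "v \<in> carrier M"
  shows "wt_act.comp N q n (h v) = h (comp n v)"
proof -
  interpret N: wt_act N q by fact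
  have add: "additive M N h" using assms by (auto simp: p_linear_def)
  note Z = additive_zero[OF add abelian_group_axioms N.abelian_group_axioms]
  note W = p_linear_wt[OF assms(1) N.poly_act_axioms]
  show ?thesis
    using spans[OF assms(3)]
  proof induction
    case (wt v m)
    show ?case
    proof (cases "m = n")
      case True
      then show ?thesis using comp_self[of v n] N.comp_self[OF W[of v n]] wt by auto
    next
      case False
      then show ?thesis using comp_other[of v m n] N.comp_other[OF W[of v m]] wt Z by auto
    qed
  next
    case (add v w)
    then show ?case using additive_add[OF \<open>additive M N h\<close>] additive_closed[OF \<open>additive M N h\<close>] wt_span_carrier
      by (simp add: comp_add N.comp_add)
  qed
qed

end

definition fin_dim :: "('a, 'm) ring_scheme \<Rightarrow> (complex poly \<Rightarrow> 'a \<Rightarrow> 'a) \<Rightarrow> 'a set \<Rightarrow> bool" where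
  "fin_dim M p W \<longleftrightarrow> (\<exists>B. finite B \<and> B \<subseteq> W \<and> (\<forall>w\<in>W. \<exists>c. w = lin_comb M p B c))"

text \<open>Weight modules are semisimple over the polynomials in \<open>z\<close>.\<close>

lemma p_linear_section:
  assumes M: "wt_act M p" and N: "wt_act N q" and g: "p_linear M p N q g"
    and surj: "g ` carrier M = carrier N" and fd: "\<And>n. fin_dim N q (wt_space N q n)"
  shows "\<exists>s. p_linear N q M p s \<and> (\<forall>v\<in>carrier N. g (s v) = v)"
proof -
  interpret M: wt_act M p by fact
  interpret N: wt_act N q by fact
  have gadd: "additive M N g" using g by (auto simp: p_linear_def)
  have "\<exists>l. l \<in> wt_space M p n \<and> g l = b" if "b \<in> wt_space N q n" for n b
  proof -
    have "b \<in> g ` carrier M" using that surj by auto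
    then obtain v where v: "v \<in> carrier M" "g v = b" by blast
    \<comment> \<open>A map linear over C[z] commutes with taking components, so the component of
      weight n of any preimage is again a preimage.\<close>
    have "g (M.comp n v) = b"
      using M.comp_p_linear[OF g N v(1), of n] N.comp_self[OF that] v(2) by simp
    then show ?thesis using M.comp_wt[OF v(1), of n] by blast
  qed
  note lift = this
  define l where "l n b = (SOME l. l \<in> wt_space M p n \<and> g l = b)" for n b
  have l: "l n b \<in> wt_space M p n" "g (l n b) = b" if "b \<in> wt_space N q n" for n b
    using someI_ex[OF lift[OF that]] unfolding l_def by auto
  define basis where "basis n B k \<longleftrightarrow> finite B \<and> B \<subseteq> wt_space N q n
     \<and> (\<forall>w\<in>wt_space N q n. w = lin_comb N q B (k w))
     \<and> (\<forall>v\<in>wt_space N q n. \<forall>w\<in>wt_space N q n. \<forall>b\<in>B. k (v \<oplus>\<^bsub>N\<^esub> w) b = k v b + k w b)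
     \<and> (\<forall>v\<in>wt_space N q n. \<forall>c. \<forall>b\<in>B. k (q [:c:] v) b = c * k v b)" for n B k
  have "\<exists>B k. basis n B k" for n
  proof -
    obtain B where "finite B" "B \<subseteq> wt_space N q n" "\<forall>w\<in>wt_space N q n. \<exists>c. w = lin_comb N q B c"
      using fd[of n] by (auto simp: fin_dim_def)
    then show ?thesis unfolding basis_def
      by (intro N.basis_exists[of B]) (blast intro: N.wt_add N.wt_p dest: N.wt_spaceD)+
  qed
  then obtain B k where "\<And>n. basis n (B n) (k n)" by metis
  then have B: "\<And>n. finite (B n)" "\<And>n. B n \<subseteq> wt_space N q n"
    and k: "\<And>n w. w \<in> wt_space N q n \<Longrightarrow> w = lin_comb N q (B n) (k n w)"
     "\<And>n v w b. v \<in> wt_space N q n \<Longrightarrow> w \<in> wt_space N q n \<Longrightarrow> b \<in> B n \<Longrightarrow> k n (v \<oplus>\<^bsub>N\<^esub> w) b = k n v b + k n w b"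
     "\<And>n v c b. v \<in> wt_space N q n \<Longrightarrow> b \<in> B n \<Longrightarrow> k n (q [:c:] v) b = c * k n v b"
    unfolding basis_def by blast+
  \<comment> \<open>The lifts \<open>l n b\<close> are chosen one by one and need not depend
    linearly on \<open>b\<close>. Only the lifts of a basis are used, and \<open>s\<close> extends
    them linearly through the coordinates \<open>k\<close>.\<close>
  define s where "s n v = (\<Oplus>\<^bsub>M\<^esub>b\<in>B n. p [:k n v b:] (l n b))" for n v
  have lB: "l n b \<in> wt_space M p n" "l n b \<in> carrier M" "b \<in> carrier N" if "b \<in> B n" for n b
    using l(1) B(2) that by blast+
  have lg: "g (l n b) = b" if "b \<in> B n" for n b
    using l(2) B(2) that by blast
  have s_wt: "s n v \<in> wt_space M p n" for n v
    unfolding s_def by (intro M.wt_finsum) (auto dest: lB)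
  have s_add: "s n (v \<oplus>\<^bsub>N\<^esub> w) = s n v \<oplus>\<^bsub>M\<^esub> s n w" if "v \<in> wt_space N q n" "w \<in> wt_space N q n" for n v w
  proof -
    have "s n (v \<oplus>\<^bsub>N\<^esub> w) = (\<Oplus>\<^bsub>M\<^esub>b\<in>B n. p [:k n v b:] (l n b) \<oplus>\<^bsub>M\<^esub> p [:k n w b:] (l n b))"
      unfolding s_def by (intro M.add.finprod_cong') (auto simp: k(2)[OF that] M.p_const_add lB)
    then show ?thesis unfolding s_def by (subst (asm) M.finsum_addf) (auto simp: lB)
  qed
  have s_scale: "s n (q [:c:] v) = p [:c:] (s n v)" if "v \<in> wt_space N q n" for n v c
    unfolding s_def
    by (subst M.p_finsum) (auto simp: k(3)[OF that] M.p_const_mult lB intro!: M.add.finprod_cong')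
  obtain h where h: "additive N M h" "\<And>n v. v \<in> wt_space N q n \<Longrightarrow> h v = s n v"
    using N.universal[OF M.abelian_group_axioms, of s] s_wt s_add by blast
  have "p_linear N q M p h"
  proof (rule N.p_linearI[OF h(1) M.poly_act_axioms])
    fix n v c assume v: "v \<in> wt_space N q n"
    show "h v \<in> wt_space M p n" using h(2)[OF v] s_wt by simp
    show "h (q [:c:] v) = p [:c:] (h v)"
      using h(2)[OF v] h(2)[OF N.wt_p[OF v]] s_scale[OF v] by simp
  qed
  moreover have "g (h v) = v" if "v \<in> carrier N" for v
  proof (rule N.additive_eq[where h = "\<lambda>v. g (h v)" and h' = "\<lambda>v. v", OF _ _ N.abelian_group_axioms _ that])
    show "additive N N (\<lambda>v. g (h v))"
      using h(1) gadd by (auto simp: additive_def Pi_iff)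
    fix n v assume v: "v \<in> wt_space N q n"
    have "g (h v) = (\<Oplus>\<^bsub>N\<^esub>b\<in>B n. g (p [:k n v b:] (l n b)))"
      unfolding h(2)[OF v] s_def
      by (rule additive_finsum[OF gadd M.abelian_group_axioms N.abelian_group_axioms]) (auto simp: lB)
    also have "\<dots> = lin_comb N q (B n) (k n v)"
      unfolding lin_comb_def using g lg lB
      by (intro N.add.finprod_cong') (auto simp: p_linear_def)
    also have "\<dots> = v" by (rule k(1)[OF v, symmetric])
    finally show "g (h v) = v" .
  qed (auto simp: additive_def)
  ultimately show ?thesis by blast
qed

section \<open>Maximal ideals of C[z] and the comparison with the original notion of weight
  module\<close>

lemma poly_ring_simps [simp]:
  "carrier poly_ring = UNIV" "monoid.mult poly_ring = (*)" "one poly_ring = 1"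
  "ring.zero poly_ring = 0" "add poly_ring = (+)"
  by (auto simp: poly_ring_def)

lemma cring_poly_ring: "cring poly_ring"
  by (rule cringI; (rule abelian_groupI | rule comm_monoidI)?)
    (auto simp: algebra_simps intro: exI[of _ "- _"] add.left_inverse)

lemma ideal_at_eq: "ideal_at w = {r. poly r w = 0}"
  by (auto simp: ideal_at_def cgenideal_def poly_eq_0_iff_dvd dvd_def mult.commute[of _ "[:- w, 1:]"]
      simp del: mult_pCons_left mult_pCons_right)

lemma inj_ideal_at: "inj ideal_at"
proof (rule injI)
  fix v w assume "ideal_at v = ideal_at w"
  moreover have "[:- v, 1:] \<in> ideal_at v" by (simp add: ideal_at_eq)
  ultimately show "v = w" by (auto simp: ideal_at_eq)
qed

lemma ideal_UNIV_if_const: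
  assumes "ideal J poly_ring" "[:c:] \<in> J" "c \<noteq> 0"
  shows "J = UNIV"
proof -
  have "r \<in> J" for r
    using ideal.I_l_closed[OF assms(1,2), of "Polynomial.smult (1 / c) r"] assms(3) by simp
  then show ?thesis by auto
qed

text \<open>A strictly larger ideal contains some r with r(w) nonzero. Since r(w) - r vanishes at w,
  the ideal then contains the invertible constant r(w).\<close>

lemma ideal_at_maximal: "ideal_at w \<in> max_ideals"
proof -
  interpret R: cring poly_ring by (rule cring_poly_ring)
  have "maximalideal (ideal_at w) poly_ring"
  proof (rule maximalidealI)
    show "ideal (ideal_at w) poly_ring"
      unfolding ideal_at_def by (rule R.cgenideal_ideal) simp
    show "carrier poly_ring \<noteq> ideal_at w"
    proof
      assume "carrier poly_ring = ideal_at w"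
      then have "1 \<in> ideal_at w" by auto
      then show False by (simp add: ideal_at_eq)
    qed
    fix J assume J: "ideal J poly_ring" "ideal_at w \<subseteq> J" "J \<subseteq> carrier poly_ring"
    show "J = ideal_at w \<or> J = carrier poly_ring"
    proof (cases "J \<subseteq> ideal_at w")
      case False
      then obtain r where r: "r \<in> J" "poly r w \<noteq> 0" by (auto simp: ideal_at_eq)
      have "[:poly r w:] - r \<in> ideal_at w" by (simp add: ideal_at_eq)
      then have "[:poly r w:] - r \<in> J" using J by auto
      from additive_subgroup.a_closed[OF ideal.axioms(1)[OF J(1)] this r(1)]
      have "[:poly r w:] \<in> J" by simp
      from ideal_UNIV_if_const[OF J(1) this r(2)] show ?thesis by auto
    qed (use J in auto)
  qed
  then show ?thesis by (simp add: max_ideals_def)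
qed

lemma max_ideal_le_ideal_at:
  assumes "I \<in> max_ideals" "I \<subseteq> ideal_at w" shows "I = ideal_at w"
proof -
  have m: "maximalideal I poly_ring" "maximalideal (ideal_at w) poly_ring"
    using assms ideal_at_maximal[of w] by (auto simp: max_ideals_def)
  from maximalideal.I_maximal[OF m(1) maximalideal.axioms(1)[OF m(2)]] maximalideal.I_notcarr[OF m(2)]
  show ?thesis using assms by auto
qed

lemma weight_space_eq:
  assumes "left_module (gwa t) M"
  shows "weight_space t M (ideal_at (of_int n)) = wt_space M (act_poly t M) n"
proof -
  interpret gwa_act M "act_poly t M" t "act_gen t M" by (rule left_module_imp_gwa_act[OF assms])
  have "act_poly t M r v = \<zero>\<^bsub>M\<^esub>" if "v \<in> wt_space M (act_poly t M) n" "poly r (of_int n) = 0" for r v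
    using p_wt[OF that(1), of r] that by auto
  then show ?thesis
    by (auto simp: weight_space_def wt_space_def ideal_at_eq)
qed

lemma finite_dim_iff: "finite_dim t M W \<longleftrightarrow> fin_dim M (act_poly t M) W"
  by (simp add: finite_dim_def fin_dim_def lin_comb_def)

definition graded :: "complex poly \<Rightarrow> 'a gwa_module \<Rightarrow> bool" where
  "graded t M \<longleftrightarrow> left_module (gwa t) M \<and> wt_act M (act_poly t M)
     \<and> (\<forall>n. fin_dim M (act_poly t M) (wt_space M (act_poly t M) n))"

text \<open>Trades a unique decomposition indexed by maximal ideals for spanning by integer weight
  vectors. The uniqueness is recovered from the components, which are determined by the vector
  alone.\<close>

lemma wmod_iff: "wmod integer_orbit t M \<longleftrightarrow> graded t M"
proof
  assume w: "wmod integer_orbit t M"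
  then have L: "left_module (gwa t) M" by (auto simp: wmod_def weight_module_def)
  interpret gwa_act M "act_poly t M" t "act_gen t M" by (rule left_module_imp_gwa_act[OF L])
  have "v \<in> wt_span M (act_poly t M)" if v: "v \<in> carrier M" for v
  proof -
    obtain f where f: "\<forall>I\<in>max_ideals. f I \<in> weight_space t M I"
      "\<forall>I. I \<notin> max_ideals \<longrightarrow> f I = \<zero>\<^bsub>M\<^esub>" "finite {I. f I \<noteq> \<zero>\<^bsub>M\<^esub>}"
      "v = (\<Oplus>\<^bsub>M\<^esub>I\<in>{I. f I \<noteq> \<zero>\<^bsub>M\<^esub>}. f I)"
      using w v unfolding wmod_def weight_module_def by meson
    have fI: "f I \<in> wt_span M (act_poly t M)" for I
    proof (cases "f I = \<zero>\<^bsub>M\<^esub>")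
      case True
      then show ?thesis by (metis wt_zero wt_span.wt)
    next
      case False
      then have I: "I \<in> max_ideals" "f I \<in> weight_space t M I" using f by auto
      then have "I \<in> integer_orbit" using w False by (auto simp: wmod_def)
      then obtain n where "I = ideal_at (of_int n)" by (auto simp: integer_orbit_def)
      then show ?thesis using I weight_space_eq[OF L] by (auto intro: wt_span.wt)
    qed
    have "(\<Oplus>\<^bsub>M\<^esub>I\<in>A. f I) \<in> wt_span M (act_poly t M)" if "finite A" for A
      using that
    proof induction
      case empty
      then show ?case by (simp add: wt_span.wt[OF wt_zero])
    next
      case (insert I A)
      have "f \<in> A \<rightarrow> carrier M" "f I \<in> carrier M" using fI wt_span_carrier by auto
      then show ?case using insert fI by (auto intro: wt_span.add)
    qed
    then show ?thesis using f by simp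
  qed
  then have "wt_act M (act_poly t M)" by unfold_locales
  moreover have "finite_dim t M (wt_space M (act_poly t M) n)" for n
    using w ideal_at_maximal[of "of_int n"] unfolding weight_space_eq[OF L, symmetric] by (auto simp: wmod_def)
  ultimately show "graded t M" using L by (auto simp: graded_def finite_dim_iff)
next
  assume g: "graded t M"
  then have L: "left_module (gwa t) M" and W: "wt_act M (act_poly t M)"
    and fd: "\<And>n. finite_dim t M (wt_space M (act_poly t M) n)" by (auto simp: graded_def finite_dim_iff)
  interpret gwa_act M "act_poly t M" t "act_gen t M" by (rule left_module_imp_gwa_act[OF L])
  interpret wt_act M "act_poly t M" by (rule W)
  let ?id = "\<lambda>n::int. ideal_at (of_int n)"
  have inj: "inj ?id" by (auto intro!: injI dest: injD[OF inj_ideal_at])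
  \<comment> \<open>A nonzero vector killed by \<open>I\<close> has a nonzero component of some
    weight n. Every r in \<open>I\<close> acts on that component by r(n), so r(n) = 0; hence
    \<open>I\<close> lies in the ideal at n and equals it by maximality.\<close>
  have int: "\<exists>n. I = ?id n" if I: "I \<in> max_ideals" "v \<in> weight_space t M I" "v \<noteq> \<zero>\<^bsub>M\<^esub>" for I v
  proof -
    have v: "v \<in> carrier M" using I by (auto simp: weight_space_def)
    then obtain n where n: "comp n v \<noteq> \<zero>\<^bsub>M\<^esub>" using I(3) comp_ext[of v "\<zero>\<^bsub>M\<^esub>"] by auto
    have "I \<subseteq> ?id n"
    proof
      fix r assume "r \<in> I"
      then have "act_poly t M r v = \<zero>\<^bsub>M\<^esub>" using I by (auto simp: weight_space_def)
      then have "act_poly t M r (comp n v) = \<zero>\<^bsub>M\<^esub>" using comp_p[OF v, of n r] by simp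
      then have "act_poly t M [:poly r (of_int n):] (comp n v) = \<zero>\<^bsub>M\<^esub>"
        using p_wt[OF comp_wt[OF v, of n], of r] by simp
      then show "r \<in> ?id n" using p_const_cancel[OF comp_closed[OF v], of _ n] n by (auto simp: ideal_at_eq)
    qed
    then show ?thesis using max_ideal_le_ideal_at I by blast
  qed
  have "weight_module t M"
    unfolding weight_module_def
  proof (intro conjI ballI L)
    fix v assume v: "v \<in> carrier M"
    define f where "f I = (if \<exists>n. I = ?id n then comp (THE n. I = ?id n) v else \<zero>\<^bsub>M\<^esub>)" for I
    have f: "f (?id n) = comp n v" for n
    proof -
      have "(THE m. ?id n = ?id m) = n" by (rule the_equality) (use inj in \<open>auto dest: injD\<close>)
      then show ?thesis by (auto simp: f_def)
    qed
    have f0: "f I = \<zero>\<^bsub>M\<^esub>" if "I \<notin> range ?id" for I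
      using that by (auto simp: f_def)
    have supp: "{I. f I \<noteq> \<zero>\<^bsub>M\<^esub>} = ?id ` supp v"
      unfolding supp_def using f f0 by (auto simp: image_iff) (metis f f0 rangeE)
    show "\<exists>!f. (\<forall>I\<in>max_ideals. f I \<in> weight_space t M I) \<and>
      (\<forall>I. I \<notin> max_ideals \<longrightarrow> f I = \<zero>\<^bsub>M\<^esub>) \<and> finite {I. f I \<noteq> \<zero>\<^bsub>M\<^esub>} \<and>
      v = (\<Oplus>\<^bsub>M\<^esub>I\<in>{I. f I \<noteq> \<zero>\<^bsub>M\<^esub>}. f I)"
    proof (rule ex1I[of _ f], intro conjI ballI allI impI)
      fix I assume I: "I \<in> max_ideals"
      show "f I \<in> weight_space t M I"
      proof (cases "I \<in> range ?id")
        case True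
        then obtain n where n: "I = ?id n" by auto
        show ?thesis unfolding n f weight_space_eq[OF L] by (rule comp_wt[OF v])
      next
        case False
        then show ?thesis using f0 by (auto simp: weight_space_def)
      qed
    next
      fix I assume "I \<notin> max_ideals"
      then show "f I = \<zero>\<^bsub>M\<^esub>" by (intro f0) (use ideal_at_maximal in auto)
    next
      show "finite {I. f I \<noteq> \<zero>\<^bsub>M\<^esub>}" unfolding supp using finite_supp[OF v] by auto
      have "(\<Oplus>\<^bsub>M\<^esub>I\<in>{I. f I \<noteq> \<zero>\<^bsub>M\<^esub>}. f I) = (\<Oplus>\<^bsub>M\<^esub>n\<in>supp v. f (?id n))"
        unfolding supp using v f
        by (intro add.finprod_reindex) (auto intro: inj_on_subset[OF inj])
      then show "v = (\<Oplus>\<^bsub>M\<^esub>I\<in>{I. f I \<noteq> \<zero>\<^bsub>M\<^esub>}. f I)"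
        using sum_comp[OF v finite_supp[OF v]] f by simp
    next
      fix g assume g: "(\<forall>I\<in>max_ideals. g I \<in> weight_space t M I) \<and>
      (\<forall>I. I \<notin> max_ideals \<longrightarrow> g I = \<zero>\<^bsub>M\<^esub>) \<and> finite {I. g I \<noteq> \<zero>\<^bsub>M\<^esub>} \<and>
      v = (\<Oplus>\<^bsub>M\<^esub>I\<in>{I. g I \<noteq> \<zero>\<^bsub>M\<^esub>}. g I)"
      have g0: "g I = \<zero>\<^bsub>M\<^esub>" if "I \<notin> range ?id" for I
        using g int[of I "g I"] that by blast
      have gwt: "g (?id n) \<in> wt_space M (act_poly t M) n" for n
        using g ideal_at_maximal weight_space_eq[OF L] by blast
      have gM: "g I \<in> carrier M" for I
        using g0[of I] gwt by (cases "I \<in> range ?id") auto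
      \<comment> \<open>Uniqueness: taking the component of weight n of the given decomposition
        leaves only its term at n.\<close>
      have "g (?id n) = comp n v" for n
      proof -
        have "comp n v = comp n (\<Oplus>\<^bsub>M\<^esub>I\<in>{I. g I \<noteq> \<zero>\<^bsub>M\<^esub>}. g I)"
          using g by (intro arg_cong[where f = "comp n"]) blast
        also have "\<dots> = (\<Oplus>\<^bsub>M\<^esub>I\<in>{I. g I \<noteq> \<zero>\<^bsub>M\<^esub>}. comp n (g I))"
          using gM by (intro additive_finsum[OF comp_additive abelian_group_axioms abelian_group_axioms]) auto
        also have "\<dots> = (\<Oplus>\<^bsub>M\<^esub>I\<in>{?id n}. comp n (g I))"
        proof (rule add.finprod_mono_neutral_cong)
          fix I assume "I \<in> {?id n} - {I. g I \<noteq> \<zero>\<^bsub>M\<^esub>}"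
          then show "comp n (g I) = \<zero>\<^bsub>M\<^esub>" by auto
        next
          fix I assume I: "I \<in> {I. g I \<noteq> \<zero>\<^bsub>M\<^esub>} - {?id n}"
          then obtain m where m: "I = ?id m" using g0 by blast
          then show "comp n (g I) = \<zero>\<^bsub>M\<^esub>" using comp_other[OF gwt[of m], of n] I by auto
        qed (use g gM in auto)
        also have "\<dots> = g (?id n)" using comp_self[OF gwt[of n]] gM by simp
        finally show ?thesis by simp
      qed
      note gn = this
      show "g = f"
      proof
        fix I show "g I = f I"
        proof (cases "I \<in> range ?id")
          case True
          then obtain n where "I = ?id n" by auto
          then show ?thesis using gn f by simp
        next
          case False
          then show ?thesis using f0 g0 by simp
        qed
      qed
    qed
  qed
  moreover have "finite_dim t M (weight_space t M I)" if "I \<in> max_ideals" for I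
  proof (cases "\<exists>n. I = ?id n")
    case True
    then show ?thesis using fd weight_space_eq[OF L] by auto
  next
    case False
    then have "weight_space t M I \<subseteq> {\<zero>\<^bsub>M\<^esub>}" using int[OF that] by blast
    then show ?thesis by (auto simp: finite_dim_def intro!: exI[of _ "{}"])
  qed
  moreover have "I \<in> integer_orbit" if "I \<in> max_ideals" "weight_space t M I \<noteq> {\<zero>\<^bsub>M\<^esub>}" for I
  proof -
    have "\<zero>\<^bsub>M\<^esub> \<in> weight_space t M I" by (auto simp: weight_space_def)
    then have "\<not> weight_space t M I \<subseteq> {\<zero>\<^bsub>M\<^esub>}" using that(2) by (auto dest: subset_singletonD)
    then obtain v where v: "v \<in> weight_space t M I" "v \<noteq> \<zero>\<^bsub>M\<^esub>" by (auto simp: subset_iff)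
    from int[OF that(1) v] show ?thesis by (auto simp: integer_orbit_def)
  qed
  ultimately show "wmod integer_orbit t M" by (auto simp: wmod_def)
qed

lemma objs_iff: "M \<in> objs t \<longleftrightarrow> graded t M"
  by (simp add: objs_def wmod_iff)

section \<open>Isomorphisms and exact sequences\<close>

lemma gwa_hom_p_linear:
  "h \<in> gwa_hom t M N \<Longrightarrow> p_linear M (act_poly t M) N (act_poly t N) h"
  by (auto simp: p_linear_def additive_def gwa_homD intro: gwa_homD)

lemma gwa_hom_comp:
  assumes "f \<in> gwa_hom t M N" "g \<in> gwa_hom t N K"
  shows "(\<lambda>x. g (f x)) \<in> gwa_hom t M K"
  using assms by (auto simp: gwa_hom_def Pi_iff)

lemma gwa_hom_id: "(\<lambda>x. x) \<in> gwa_hom t M M"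
  by (auto simp: gwa_hom_def)

lemma gwa_hom_inverse:
  assumes f: "f \<in> gwa_hom t M N" and b: "bij_betw f (carrier M) (carrier N)"
    and M: "left_module (gwa t) M"
  shows "inv_into (carrier M) f \<in> gwa_hom t N M"
proof -
  interpret left_module "gwa t" M by fact
  let ?g = "inv_into (carrier M) f"
  have g: "?g y \<in> carrier M" "f (?g y) = y" if "y \<in> carrier N" for y
    using that b by (auto simp: bij_betw_def inv_into_into f_inv_into_f)
  have gf: "?g (f x) = x" if "x \<in> carrier M" for x
    using that b by (auto simp: bij_betw_def)
  have eq: "?g y = x" if "f x = y" "x \<in> carrier M" for x y
    using gf that by auto
  show ?thesis
    unfolding gwa_hom_def
  proof (intro CollectI conjI ballI)
    show "?g (x \<oplus>\<^bsub>N\<^esub> y) = ?g x \<oplus>\<^bsub>M\<^esub> ?g y" if "x \<in> carrier N" "y \<in> carrier N" for x y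
      using g that f by (intro eq) (auto simp: gwa_hom_def)
    show "?g (a \<odot>\<^bsub>N\<^esub> y) = a \<odot>\<^bsub>M\<^esub> ?g y" if "a \<in> carrier (gwa t)" "y \<in> carrier N" for a y
      using g that f by (intro eq) (auto simp: gwa_hom_def smult_closed)
  qed (use g in auto)
qed

lemma gwa_iso_refl: "gwa_iso t M M"
  unfolding gwa_iso_def using gwa_hom_id bij_betw_id[unfolded id_def] by blast

lemma gwa_iso_sym: "gwa_iso t M N \<Longrightarrow> left_module (gwa t) M \<Longrightarrow> gwa_iso t N M"
  unfolding gwa_iso_def using gwa_hom_inverse bij_betw_inv_into by blast

lemma gwa_iso_trans: "gwa_iso t M N \<Longrightarrow> gwa_iso t N K \<Longrightarrow> gwa_iso t M K"
  unfolding gwa_iso_def using gwa_hom_comp bij_betw_trans[unfolded o_def] by blast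

lemma gwa_isoI:
  assumes "f \<in> gwa_hom t M N" "g \<in> gwa_hom t N M"
    and "\<And>x. x \<in> carrier M \<Longrightarrow> g (f x) = x" "\<And>y. y \<in> carrier N \<Longrightarrow> f (g y) = y"
  shows "gwa_iso t M N"
  unfolding gwa_iso_def
  by (rule bexI[OF _ assms(1)], rule bij_betw_byWitness[where f' = g])
    (use assms gwa_homD(1) in \<open>auto intro: gwa_homD\<close>)

lemma graded_iso:
  assumes M: "graded t M" and N: "left_module (gwa t) N" and iso: "gwa_iso t M N"
  shows "graded t N"
proof -
  obtain f where f: "f \<in> gwa_hom t M N" and b: "bij_betw f (carrier M) (carrier N)"
    using iso by (auto simp: gwa_iso_def)
  let ?p = "act_poly t M" and ?q = "act_poly t N"
  have LM: "left_module (gwa t) M" using M by (auto simp: graded_def)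
  interpret M: wt_act M ?p using M by (auto simp: graded_def)
  interpret N: gwa_act N ?q t "act_gen t N" by (rule left_module_imp_gwa_act[OF N])
  have pl: "p_linear M ?p N ?q f" by (rule gwa_hom_p_linear[OF f])
  have add: "additive M N f" using pl by (auto simp: p_linear_def)
  let ?g = "inv_into (carrier M) f"
  have pl': "p_linear N ?q M ?p ?g" by (rule gwa_hom_p_linear[OF gwa_hom_inverse[OF f b LM]])
  have fw: "f v \<in> wt_space N ?q n" if "v \<in> wt_space M ?p n" for v n
    using M.p_linear_wt[OF pl N.poly_act_axioms that] .
  have gw: "?g v \<in> wt_space M ?p n" if "v \<in> wt_space N ?q n" for v n
    using N.p_linear_wt[OF pl' M.poly_act_axioms that] .
  have gf: "?g (f x) = x" if "x \<in> carrier M" for x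
    using that b by (auto simp: bij_betw_def)
  have fg: "f (?g x) = x" "?g x \<in> carrier M" if "x \<in> carrier N" for x
    using that b by (auto simp: bij_betw_def inv_into_into f_inv_into_f)
  have sp: "f v \<in> wt_span N ?q" if "v \<in> wt_span M ?p" for v
    using that
  proof induction
    case (wt v n)
    then show ?case using fw by (auto intro: wt_span.wt)
  next
    case (add v w)
    then show ?case using additive_add[OF \<open>additive M N f\<close>] M.wt_span_carrier
      by (auto intro: wt_span.add)
  qed
  have "wt_act N ?q"
  proof unfold_locales
    fix v assume "v \<in> carrier N"
    then show "v \<in> wt_span N ?q" using sp[OF M.spans[of "?g v"]] fg by auto
  qed
  moreover have "fin_dim N ?q (wt_space N ?q n)" for n
  proof -
    obtain B where B: "finite B" "B \<subseteq> wt_space M ?p n" "\<forall>w\<in>wt_space M ?p n. \<exists>c. w = lin_comb M ?p B c"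
      using M unfolding graded_def fin_dim_def by blast
    have BM: "B \<subseteq> carrier M" using B by auto
    have "\<exists>c. w = lin_comb N ?q (f ` B) c" if w: "w \<in> wt_space N ?q n" for w
    proof -
      obtain c where c: "?g w = lin_comb M ?p B c" using B gw[OF w] by blast
      have "w = f (lin_comb M ?p B c)" using fg w c by (metis N.wt_spaceD)
      also have "\<dots> = (\<Oplus>\<^bsub>N\<^esub>b\<in>B. f (?p [:c b:] b))"
        unfolding lin_comb_def using BM
        by (intro additive_finsum[OF add M.abelian_group_axioms N.abelian_group_axioms]) auto
      also have "\<dots> = (\<Oplus>\<^bsub>N\<^esub>b\<in>B. ?q [:c (?g (f b)):] (f b))"
        using BM pl additive_closed[OF add] by (intro N.add.finprod_cong') (auto simp: p_linear_def gf subset_iff)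
      also have "\<dots> = (\<Oplus>\<^bsub>N\<^esub>b\<in>f ` B. ?q [:c (?g b):] b)"
        using BM b additive_closed[OF add]
        by (intro N.add.finprod_reindex[symmetric]) (auto simp: bij_betw_def intro: inj_on_subset)
      finally show ?thesis unfolding lin_comb_def by (intro exI[of _ "\<lambda>b. c (?g b)"])
    qed
    then show ?thesis using B fw unfolding fin_dim_def by (intro exI[of _ "f ` B"]) auto
  qed
  ultimately show ?thesis using N by (auto simp: graded_def)
qed

text \<open>The equations present M'' as a biproduct of M and M'. Exactness is replaced by equations
  because these survive tensoring; which of the four maps commute with X+ and X- is recorded
  separately in each use.\<close>

definition splitting where
  "splitting M M'' M' f g s r \<longleftrightarrow>
     (\<forall>x\<in>carrier M. r (f x) = x) \<and> (\<forall>y\<in>carrier M'. g (s y) = y)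
   \<and> (\<forall>z\<in>carrier M''. f (r z) \<oplus>\<^bsub>M''\<^esub> s (g z) = z)"

lemma short_exact_splitting:
  assumes se: "short_exact t M M'' M'" and gr: "graded t M" "graded t M''" "graded t M'"
  shows "\<exists>f g s r. f \<in> gwa_hom t M M'' \<and> g \<in> gwa_hom t M'' M'
     \<and> p_linear M' (act_poly t M') M'' (act_poly t M'') s
     \<and> p_linear M'' (act_poly t M'') M (act_poly t M) r \<and> splitting M M'' M' f g s r"
proof -
  let ?p = "act_poly t M" and ?p' = "act_poly t M'" and ?p'' = "act_poly t M''"
  interpret M: wt_act M ?p using gr by (auto simp: graded_def)
  interpret M': wt_act M' ?p' using gr by (auto simp: graded_def)
  interpret M'': wt_act M'' ?p'' using gr by (auto simp: graded_def)
  obtain f g where f: "f \<in> gwa_hom t M M''" and g: "g \<in> gwa_hom t M'' M'"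
    and ex: "inj_on f (carrier M)" "g ` carrier M'' = carrier M'"
      "f ` carrier M = {x \<in> carrier M''. g x = \<zero>\<^bsub>M'\<^esub>}"
    using se by (auto simp: short_exact_def)
  have fpl: "p_linear M ?p M'' ?p'' f" and gpl: "p_linear M'' ?p'' M' ?p' g"
    using f g gwa_hom_p_linear by auto
  obtain s where s: "p_linear M' ?p' M'' ?p'' s" "\<And>v. v \<in> carrier M' \<Longrightarrow> g (s v) = v"
    using p_linear_section[OF M''.wt_act_axioms M'.wt_act_axioms gpl ex(2)] gr by (auto simp: graded_def)
  have gadd: "additive M'' M' g" and sadd: "additive M' M'' s" and fadd: "additive M M'' f"
    using s gpl fpl by (auto simp: p_linear_def)
  note cl = additive_closed[OF gadd] additive_closed[OF sadd] additive_closed[OF fadd]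
  have d: "z \<ominus>\<^bsub>M''\<^esub> s (g z) \<in> f ` carrier M" if z: "z \<in> carrier M''" for z
  proof -
    have "g (z \<ominus>\<^bsub>M''\<^esub> s (g z)) = \<zero>\<^bsub>M'\<^esub>"
      using z cl s(2) additive_add[OF gadd]
        additive_minus[OF gadd M''.abelian_group_axioms M'.abelian_group_axioms]
      by (simp add: a_minus_def M'.r_neg)
    then show ?thesis using ex z cl by auto
  qed
  \<comment> \<open>The vector \<open>z \<ominus> s (g z)\<close> lies in the kernel of
    \<open>g\<close>, hence in the image of the injective map \<open>f\<close>.\<close>
  define r where "r z = inv_into (carrier M) f (z \<ominus>\<^bsub>M''\<^esub> s (g z))" for z
  have r: "r z \<in> carrier M" "f (r z) = z \<ominus>\<^bsub>M''\<^esub> s (g z)" if "z \<in> carrier M''" for z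
    using d[OF that] by (auto simp: r_def inv_into_into f_inv_into_f)
  have req: "r z = x" if "z \<in> carrier M''" "x \<in> carrier M" "f x = z \<ominus>\<^bsub>M''\<^esub> s (g z)" for x z
    by (rule inj_onD[OF ex(1)]) (use r[OF that(1)] that in auto)
  have "additive M'' M r"
  proof (rule additiveI)
    fix v w assume vw: "v \<in> carrier M''" "w \<in> carrier M''"
    then show "r (v \<oplus>\<^bsub>M''\<^esub> w) = r v \<oplus>\<^bsub>M\<^esub> r w"
      using r cl by (intro req) (auto simp: additive_add[OF fadd] additive_add[OF gadd] additive_add[OF sadd]
          a_minus_def M''.minus_add M''.a_ac)
  qed (use r in auto)
  then have "p_linear M'' ?p'' M ?p r"
    unfolding p_linear_def
  proof (intro conjI allI ballI)
    fix q v assume v: "v \<in> carrier M''"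
    then show "r (?p'' q v) = ?p q (r v)"
      using r cl s(1) fpl gpl by (intro req) (auto simp: p_linear_def M''.p_rdiff)
  qed
  moreover have "splitting M M'' M' f g s r"
    unfolding splitting_def
  proof (intro conjI ballI)
    fix x assume x: "x \<in> carrier M"
    then have "g (f x) = \<zero>\<^bsub>M'\<^esub>" using ex by blast
    then show "r (f x) = x" using x cl additive_zero[OF sadd M'.abelian_group_axioms M''.abelian_group_axioms]
      by (intro req) (auto simp: a_minus_def)
  next
    fix z assume z: "z \<in> carrier M''"
    then show "f (r z) \<oplus>\<^bsub>M''\<^esub> s (g z) = z" using r cl
      by (simp add: a_minus_def M''.a_assoc M''.l_neg)
  qed (use s in auto)
  ultimately show ?thesis using f g s by blast
qed

text \<open>Inserting f x into f r + s g = id leaves s (g (f x)) = 0, and g s = id then gives g f =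
  0. The identity r s = 0 is obtained in the same way from s y. Exactness in the middle is the case
  g z = 0 of the third equation.\<close>

lemma splitting_short_exact:
  assumes f: "f \<in> gwa_hom t M M''" and g: "g \<in> gwa_hom t M'' M'"
    and s: "additive M' M'' s" and r: "additive M'' M r"
    and sp: "splitting M M'' M' f g s r"
    and ab: "abelian_group M" "abelian_group M''" "abelian_group M'"
  shows "short_exact t M M'' M'" 
    and "\<And>x. x \<in> carrier M \<Longrightarrow> g (f x) = \<zero>\<^bsub>M'\<^esub>"
    and "\<And>y. y \<in> carrier M' \<Longrightarrow> r (s y) = \<zero>\<^bsub>M\<^esub>"
proof -
  interpret M: abelian_group M by fact
  interpret M': abelian_group M' by fact
  interpret M'': abelian_group M'' by fact
  have gadd: "additive M'' M' g" and fadd: "additive M M'' f"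
    using f g gwa_hom_p_linear by (auto simp: p_linear_def)
  note cl = additive_closed[OF gadd] additive_closed[OF s] additive_closed[OF fadd] additive_closed[OF r]
  have s1: "\<And>x. x \<in> carrier M \<Longrightarrow> r (f x) = x" "\<And>y. y \<in> carrier M' \<Longrightarrow> g (s y) = y"
     "\<And>z. z \<in> carrier M'' \<Longrightarrow> f (r z) \<oplus>\<^bsub>M''\<^esub> s (g z) = z"
    using sp by (auto simp: splitting_def)
  show gf: "g (f x) = \<zero>\<^bsub>M'\<^esub>" if x: "x \<in> carrier M" for x
  proof -
    have c: "f x \<in> carrier M''" "g (f x) \<in> carrier M'" "s (g (f x)) \<in> carrier M''" using x cl by blast+
    have "f x \<oplus>\<^bsub>M''\<^esub> s (g (f x)) = f x" using s1(3)[OF c(1)] unfolding s1(1)[OF x] .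
    then have "s (g (f x)) = \<zero>\<^bsub>M''\<^esub>" using M''.add.l_cancel_one[OF c(1,3)] by simp
    then have "g (s (g (f x))) = \<zero>\<^bsub>M'\<^esub>" using additive_zero[OF gadd ab(2,3)] by simp
    then show ?thesis unfolding s1(2)[OF c(2)] .
  qed
  show rs: "r (s y) = \<zero>\<^bsub>M\<^esub>" if y: "y \<in> carrier M'" for y
  proof -
    have c: "s y \<in> carrier M''" "r (s y) \<in> carrier M" "f (r (s y)) \<in> carrier M''" using y cl by blast+
    have "f (r (s y)) \<oplus>\<^bsub>M''\<^esub> s y = s y" using s1(3)[OF c(1)] unfolding s1(2)[OF y] .
    then have "f (r (s y)) = \<zero>\<^bsub>M''\<^esub>" using M''.add.r_cancel_one[OF c(1,3)] by simp
    then have "r (f (r (s y))) = \<zero>\<^bsub>M\<^esub>" using additive_zero[OF r ab(2,1)] by simp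
    then show ?thesis unfolding s1(1)[OF c(2)] .
  qed
  have "inj_on f (carrier M)" using s1(1) by (metis inj_onI)
  moreover have "g ` carrier M'' = carrier M'"
  proof (intro equalityI subsetI)
    fix y assume "y \<in> carrier M'"
    then show "y \<in> g ` carrier M''" using s1(2) cl(2) by (intro image_eqI[of _ g "s y"]) auto
  qed (use cl in auto)
  moreover have "f ` carrier M = {x \<in> carrier M''. g x = \<zero>\<^bsub>M'\<^esub>}"
  proof (intro equalityI subsetI)
    fix z assume z: "z \<in> {x \<in> carrier M''. g x = \<zero>\<^bsub>M'\<^esub>}"
    then have c: "z \<in> carrier M''" "g z = \<zero>\<^bsub>M'\<^esub>" "r z \<in> carrier M" using cl by auto
    have "f (r z) = z"
      using s1(3)[OF c(1)] additive_zero[OF s ab(3,2)] c(2) cl(3)[OF c(3)] by simp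
    then show "z \<in> f ` carrier M" using c(3) by (intro image_eqI[of _ f "r z"]) auto
  qed (use gf cl in auto)
  ultimately show "short_exact t M M'' M'"
    unfolding short_exact_def using f g by blast
qed

section \<open>Direct sums of modules\<close>

lemma direct_sum_simps [simp]:
  "carrier (direct_sum M N) = carrier M \<times> carrier N"
  "\<zero>\<^bsub>direct_sum M N\<^esub> = (\<zero>\<^bsub>M\<^esub>, \<zero>\<^bsub>N\<^esub>)"
  "(x, y) \<oplus>\<^bsub>direct_sum M N\<^esub> (x', y') = (x \<oplus>\<^bsub>M\<^esub> x', y \<oplus>\<^bsub>N\<^esub> y')"
  "a \<odot>\<^bsub>direct_sum M N\<^esub> (x, y) = (a \<odot>\<^bsub>M\<^esub> x, a \<odot>\<^bsub>N\<^esub> y)"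
  by (auto simp: direct_sum_def)

lemma left_module_direct_sum:
  assumes "left_module (gwa t) M" "left_module (gwa t) N"
  shows "left_module (gwa t) (direct_sum M N)"
proof -
  interpret M: left_module "gwa t" M by fact
  interpret N: left_module "gwa t" N by fact
  show ?thesis
  proof (intro left_module.intro left_module_axioms.intro ring_gwa)
    show "abelian_group (direct_sum M N)"
    proof (rule abelian_groupI)
      show "\<exists>y\<in>carrier (direct_sum M N). y \<oplus>\<^bsub>direct_sum M N\<^esub> x = \<zero>\<^bsub>direct_sum M N\<^esub>"
        if "x \<in> carrier (direct_sum M N)" for x
        using that by (intro bexI[of _ "(\<ominus>\<^bsub>M\<^esub> fst x, \<ominus>\<^bsub>N\<^esub> snd x)"]) (auto simp: M.l_neg N.l_neg)
    qed (auto intro: M.a_assoc N.a_assoc M.a_comm N.a_comm)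
  qed (auto simp: M.smult_closed N.smult_closed M.smult_l_distr N.smult_l_distr M.smult_r_distr N.smult_r_distr
      M.smult_assoc1 N.smult_assoc1 M.smult_one N.smult_one)
qed

lemma direct_sum_splitting:
  assumes "left_module (gwa t) M" "left_module (gwa t) N"
  shows "(\<lambda>x. (x, \<zero>\<^bsub>N\<^esub>)) \<in> gwa_hom t M (direct_sum M N)" "snd \<in> gwa_hom t (direct_sum M N) N"
    "(\<lambda>y. (\<zero>\<^bsub>M\<^esub>, y)) \<in> gwa_hom t N (direct_sum M N)" "fst \<in> gwa_hom t (direct_sum M N) M"
    "splitting M (direct_sum M N) N (\<lambda>x. (x, \<zero>\<^bsub>N\<^esub>)) snd (\<lambda>y. (\<zero>\<^bsub>M\<^esub>, y)) fst"
proof -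
  interpret M: left_module "gwa t" M by fact
  interpret N: left_module "gwa t" N by fact
  show "(\<lambda>x. (x, \<zero>\<^bsub>N\<^esub>)) \<in> gwa_hom t M (direct_sum M N)" "snd \<in> gwa_hom t (direct_sum M N) N"
    "(\<lambda>y. (\<zero>\<^bsub>M\<^esub>, y)) \<in> gwa_hom t N (direct_sum M N)" "fst \<in> gwa_hom t (direct_sum M N) M"
    by (auto simp: gwa_hom_def M.smult_zero_right N.smult_zero_right)
  show "splitting M (direct_sum M N) N (\<lambda>x. (x, \<zero>\<^bsub>N\<^esub>)) snd (\<lambda>y. (\<zero>\<^bsub>M\<^esub>, y)) fst"
    by (auto simp: splitting_def)
qed

text \<open>When all four maps are linear over A(t), pairing \<open>r\<close> with \<open>g\<close>
  is an isomorphism whose inverse is the sum of \<open>f\<close> and \<open>s\<close>.\<close>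

lemma splitting_iso_direct_sum:
  assumes f: "f \<in> gwa_hom t M M''" and g: "g \<in> gwa_hom t M'' M'"
    and s: "s \<in> gwa_hom t M' M''" and r: "r \<in> gwa_hom t M'' M"
    and sp: "splitting M M'' M' f g s r"
    and L: "left_module (gwa t) M" "left_module (gwa t) M''" "left_module (gwa t) M'"
  shows "gwa_iso t M'' (direct_sum M M')"
proof (rule gwa_isoI)
  interpret M: left_module "gwa t" M by fact
  interpret M': left_module "gwa t" M' by fact
  interpret M'': left_module "gwa t" M'' by fact
  have sadd: "additive M' M'' s" and radd: "additive M'' M r"
    using s r gwa_hom_p_linear by (auto simp: p_linear_def)
  note z = splitting_short_exact(2,3)[OF f g sadd radd sp M.abelian_group_axioms M''.abelian_group_axioms M'.abelian_group_axioms]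
  note homs = gwa_homD[OF f] gwa_homD[OF g] gwa_homD[OF s] gwa_homD[OF r]
  show "(\<lambda>x. (r x, g x)) \<in> gwa_hom t M'' (direct_sum M M')"
    using r g by (auto simp: gwa_hom_def)
  show "(\<lambda>(x, y). f x \<oplus>\<^bsub>M''\<^esub> s y) \<in> gwa_hom t (direct_sum M M') M''"
    using f s by (auto simp: gwa_hom_def Pi_iff M''.smult_r_distr M''.a_ac M.smult_closed M'.smult_closed)
  show "(\<lambda>x. (r x, g x)) ((\<lambda>(x, y). f x \<oplus>\<^bsub>M''\<^esub> s y) y) = y" if "y \<in> carrier (direct_sum M M')" for y
    using that sp z by (auto simp: homs splitting_def)
  show "(\<lambda>(x, y). f x \<oplus>\<^bsub>M''\<^esub> s y) ((\<lambda>x. (r x, g x)) x) = x" if "x \<in> carrier M''" for x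
    using that sp by (auto simp: splitting_def)
qed

section \<open>Quotients of free abelian groups and tensor products\<close>

lemma hom_compose_fun: "h \<in> hom G H \<Longrightarrow> g \<in> hom H K \<Longrightarrow> (\<lambda>x. g (h x)) \<in> hom G K"
  by (auto simp: hom_def Pi_iff)

lemma hom_free_diff:
  assumes "h \<in> hom (free_Abelian_group S) K" "comm_group K"
    "Poly_Mapping.keys f \<subseteq> S" "Poly_Mapping.keys g \<subseteq> S"
  shows "h (f - g) = h f \<otimes>\<^bsub>K\<^esub> inv\<^bsub>K\<^esub> h g"
proof -
  interpret K: comm_group K by fact
  have d: "Poly_Mapping.keys (f - g) \<subseteq> S" using assms keys_diff[of f g] by auto
  have "h (f - g) \<otimes>\<^bsub>K\<^esub> h g = h f"
    using hom_mult[OF assms(1), of "f - g" g] assms d by simp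
  moreover have "h (f - g) \<in> carrier K" "h f \<in> carrier K" "h g \<in> carrier K"
    using assms d hom_in_carrier[OF assms(1)] by auto
  ultimately show ?thesis by (metis K.inv_solve_right)
qed

text \<open>Grothendieck groups and tensor products are both of this form, so coset arithmetic,
  induction and the universal property are proved once for both.\<close>

locale free_quotient =
  fixes S :: "'x set" and R :: "('x \<Rightarrow>\<^sub>0 int) set"
  assumes rels: "R \<subseteq> carrier (free_Abelian_group S)"
begin

abbreviation "F \<equiv> free_Abelian_group S"
abbreviation "N \<equiv> generate F R"
abbreviation "Q \<equiv> F Mod N"
abbreviation "cls f \<equiv> N #>\<^bsub>F\<^esub> f"

lemma F_comm: "comm_group F" by (rule abelian_free_Abelian_group)

lemma N_subgroup: "subgroup N F"
  by (rule group.generate_is_subgroup[OF group_free_Abelian_group rels])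

lemma N_normal: "N \<lhd> F"
  by (rule comm_group.subgroup_imp_normal[OF F_comm N_subgroup])

lemma Q_comm: "comm_group Q"
  by (rule comm_group.abelian_FactGroup[OF F_comm N_subgroup])

lemma cls_closed [simp]: "Poly_Mapping.keys f \<subseteq> S \<Longrightarrow> cls f \<in> carrier Q"
  by (auto simp: carrier_FactGroup)

lemma cls_hom: "cls \<in> hom F Q"
  by (rule normal.r_coset_hom_Mod[OF N_normal])

lemma cls_add: "Poly_Mapping.keys f \<subseteq> S \<Longrightarrow> Poly_Mapping.keys g \<subseteq> S \<Longrightarrow> cls (f + g) = cls f \<otimes>\<^bsub>Q\<^esub> cls g"
  using hom_mult[OF cls_hom, of f g] by simp

lemma cls_zero: "cls 0 = \<one>\<^bsub>Q\<^esub>"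
  using comm_group.axioms(2)[OF Q_comm] comm_group.axioms(2)[OF F_comm] hom_one[OF cls_hom] by simp

lemma cls_N: "f \<in> N \<Longrightarrow> cls f = \<one>\<^bsub>Q\<^esub>"
  using subgroup.subset[OF N_subgroup]
  by (auto intro!: group.coset_join2[OF group_free_Abelian_group _ N_subgroup])

lemma cls_rel: "f \<in> R \<Longrightarrow> cls f = \<one>\<^bsub>Q\<^esub>"
  by (rule cls_N) (rule generate.incl)

lemma cls_diff: "Poly_Mapping.keys f \<subseteq> S \<Longrightarrow> Poly_Mapping.keys g \<subseteq> S \<Longrightarrow> cls (f - g) = cls f \<otimes>\<^bsub>Q\<^esub> inv\<^bsub>Q\<^esub> cls g"
  by (rule hom_free_diff[OF cls_hom Q_comm])

lemma Q_cases:
  assumes "z \<in> carrier Q" obtains f where "Poly_Mapping.keys f \<subseteq> S" "z = cls f"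
  using assms by (auto simp: carrier_FactGroup)

lemma Q_induct [consumes 1]:
  assumes z: "z \<in> carrier Q"
    and one: "P \<one>\<^bsub>Q\<^esub>"
    and gen: "\<And>s. s \<in> S \<Longrightarrow> P (cls (frag_of s))" "\<And>s. s \<in> S \<Longrightarrow> P (inv\<^bsub>Q\<^esub> cls (frag_of s))"
    and mult: "\<And>u v. u \<in> carrier Q \<Longrightarrow> v \<in> carrier Q \<Longrightarrow> P u \<Longrightarrow> P v \<Longrightarrow> P (u \<otimes>\<^bsub>Q\<^esub> v)"
  shows "P z"
proof -
  obtain f where f: "Poly_Mapping.keys f \<subseteq> S" "z = cls f" using z by (rule Q_cases)
  interpret Q: comm_group Q by (rule Q_comm)
  \<comment> \<open>The induction rule for free abelian groups proceeds through differences, so the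
    claim has to carry the inverse class along.\<close>
  have "P (cls f) \<and> P (inv\<^bsub>Q\<^esub> cls f)"
  proof (rule free_Abelian_group_induct[OF f(1)])
    show "P (cls 0) \<and> P (inv\<^bsub>Q\<^esub> cls 0)"
      using one by (simp add: cls_zero del: one_FactGroup)
  next
    fix x y
    assume xy: "Poly_Mapping.keys x \<subseteq> S" "Poly_Mapping.keys y \<subseteq> S"
      "P (cls x) \<and> P (inv\<^bsub>Q\<^esub> cls x)" "P (cls y) \<and> P (inv\<^bsub>Q\<^esub> cls y)"
    then have "inv\<^bsub>Q\<^esub> (cls x \<otimes>\<^bsub>Q\<^esub> inv\<^bsub>Q\<^esub> cls y) = inv\<^bsub>Q\<^esub> cls x \<otimes>\<^bsub>Q\<^esub> cls y"
      using cls_closed Q.inv_mult Q.inv_closed Q.inv_inv by metis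
    then show "P (cls (x - y)) \<and> P (inv\<^bsub>Q\<^esub> cls (x - y))"
      using xy mult[of "cls x" "inv\<^bsub>Q\<^esub> cls y"] mult[of "inv\<^bsub>Q\<^esub> cls x" "cls y"]
      by (simp add: cls_diff del: mult_FactGroup)
  qed (auto intro: gen)
  then show ?thesis using f by simp
qed

lemma universal:
  assumes K: "comm_group K" and h: "h \<in> hom F K" and R: "\<And>r. r \<in> R \<Longrightarrow> h r = \<one>\<^bsub>K\<^esub>"
  obtains g where "g \<in> hom Q K" "\<And>f. Poly_Mapping.keys f \<subseteq> S \<Longrightarrow> g (cls f) = h f"
proof -
  interpret h: group_hom F K h
    using h comm_group.axioms(2)[OF K] by (simp add: group_hom_def group_hom_axioms_def)
  have "subgroup (kernel F K h) F" by (rule h.subgroup_kernel)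
  moreover have "R \<subseteq> kernel F K h" using R subsetD[OF rels] by (auto simp: kernel_def)
  ultimately have "N \<subseteq> kernel F K h"
    by (intro group.generate_subgroup_incl[OF group_free_Abelian_group])
  from h.FactGroup_universal_kernel[OF N_normal this] that show thesis by (auto simp: Ball_def)
qed

end

section \<open>Biadditive maps and tensor products\<close>

definition bihom where
  "bihom G H K \<beta> \<longleftrightarrow> (\<forall>x\<in>carrier G. \<forall>y\<in>carrier H. \<beta> x y \<in> carrier K)
    \<and> (\<forall>x\<in>carrier G. \<forall>x'\<in>carrier G. \<forall>y\<in>carrier H. \<beta> (x \<otimes>\<^bsub>G\<^esub> x') y = \<beta> x y \<otimes>\<^bsub>K\<^esub> \<beta> x' y)
    \<and> (\<forall>x\<in>carrier G. \<forall>y\<in>carrier H. \<forall>y'\<in>carrier H. \<beta> x (y \<otimes>\<^bsub>H\<^esub> y') = \<beta> x y \<otimes>\<^bsub>K\<^esub> \<beta> x y')"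

lemma bihomD:
  assumes "bihom G H K \<beta>"
  shows "x \<in> carrier G \<Longrightarrow> y \<in> carrier H \<Longrightarrow> \<beta> x y \<in> carrier K"
    "x \<in> carrier G \<Longrightarrow> x' \<in> carrier G \<Longrightarrow> y \<in> carrier H \<Longrightarrow> \<beta> (x \<otimes>\<^bsub>G\<^esub> x') y = \<beta> x y \<otimes>\<^bsub>K\<^esub> \<beta> x' y"
    "x \<in> carrier G \<Longrightarrow> y \<in> carrier H \<Longrightarrow> y' \<in> carrier H \<Longrightarrow> \<beta> x (y \<otimes>\<^bsub>H\<^esub> y') = \<beta> x y \<otimes>\<^bsub>K\<^esub> \<beta> x y'"
    "y \<in> carrier H \<Longrightarrow> (\<lambda>x. \<beta> x y) \<in> hom G K" "x \<in> carrier G \<Longrightarrow> \<beta> x \<in> hom H K"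
  using assms by (auto simp: bihom_def hom_def)

locale tensor_product = G: comm_group G + H: comm_group H
  for a :: "'r \<Rightarrow> 'a \<Rightarrow> 'a" and G :: "'a monoid" (structure) and b :: "'r \<Rightarrow> 'b \<Rightarrow> 'b" and H :: "'b monoid" (structure) +
  assumes a_closed [simp]: "x \<in> carrier G \<Longrightarrow> a r x \<in> carrier G"
    and b_closed [simp]: "y \<in> carrier H \<Longrightarrow> b r y \<in> carrier H"
begin

abbreviation "T \<equiv> tensor_group a G b H"
abbreviation "pure \<equiv> tensor_pure a G b H"

sublocale quot: free_quotient "carrier G \<times> carrier H" "tensor_rels a G b H"
  rewrites "free_Abelian_group (carrier G \<times> carrier H) Mod
      generate (free_Abelian_group (carrier G \<times> carrier H)) (tensor_rels a G b H) = tensor_group a G b H"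
proof -
  show "free_quotient (carrier G \<times> carrier H) (tensor_rels a G b H)"
  proof
    let ?S = "carrier G \<times> carrier H"
    have d: "f - g \<in> carrier (free_Abelian_group ?S)"
      if "f \<in> carrier (free_Abelian_group ?S)" "g \<in> carrier (free_Abelian_group ?S)" for f g
      using that keys_diff[of f g] by auto
    show "tensor_rels a G b H \<subseteq> carrier (free_Abelian_group ?S)"
    proof
      fix f assume "f \<in> tensor_rels a G b H"
      then show "f \<in> carrier (free_Abelian_group ?S)"
        unfolding tensor_rels_def
        by (elim UnE CollectE exE conjE; hypsubst; intro d frag_of_in_free_Abelian_group[THEN iffD2]; simp)
    qed
  qed
qed (simp add: tensor_group_def tensor_null_def)

lemma pure_eq: "pure x y = quot.cls (frag_of (x, y))"
  by (simp add: tensor_pure_def tensor_null_def)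

lemma T_comm: "comm_group T"
  by (rule quot.Q_comm)

lemma pure_closed [simp]: "x \<in> carrier G \<Longrightarrow> y \<in> carrier H \<Longrightarrow> pure x y \<in> carrier T"
  unfolding pure_eq by (rule quot.cls_closed) simp

lemma rel_eq:
  assumes "f - g \<in> tensor_rels a G b H"
    "Poly_Mapping.keys f \<subseteq> carrier G \<times> carrier H" "Poly_Mapping.keys g \<subseteq> carrier G \<times> carrier H"
  shows "quot.cls f = quot.cls g"
proof -
  interpret T: comm_group T by (rule T_comm)
  have "quot.cls f \<otimes>\<^bsub>T\<^esub> inv\<^bsub>T\<^esub> quot.cls g = \<one>\<^bsub>T\<^esub>"
    using quot.cls_rel[OF assms(1)] quot.cls_diff[OF assms(2,3)] by simp
  then show ?thesis using quot.cls_closed assms(2,3)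
    by (metis T.inv_closed T.inv_equality T.inv_inv)
qed

lemma pure_add_left:
  assumes "x \<in> carrier G" "x' \<in> carrier G" "y \<in> carrier H"
  shows "pure (x \<otimes>\<^bsub>G\<^esub> x') y = pure x y \<otimes>\<^bsub>T\<^esub> pure x' y"
proof -
  have "quot.cls (frag_of (x \<otimes>\<^bsub>G\<^esub> x', y)) = quot.cls (frag_of (x, y) + frag_of (x', y))"
  proof (rule rel_eq)
    show "Poly_Mapping.keys (frag_of (x, y) + frag_of (x', y)) \<subseteq> carrier G \<times> carrier H"
      using assms keys_add[of "frag_of (x, y)" "frag_of (x', y)"] by auto
    show "frag_of (x \<otimes>\<^bsub>G\<^esub> x', y) - (frag_of (x, y) + frag_of (x', y)) \<in> tensor_rels a G b H"
      unfolding tensor_rels_def using assms by (auto simp: diff_diff_add)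
  qed (use assms in auto)
  also have "\<dots> = quot.cls (frag_of (x, y)) \<otimes>\<^bsub>T\<^esub> quot.cls (frag_of (x', y))"
    using assms by (intro quot.cls_add) auto
  finally show ?thesis by (simp add: pure_eq)
qed

lemma pure_add_right:
  assumes "x \<in> carrier G" "y \<in> carrier H" "y' \<in> carrier H"
  shows "pure x (y \<otimes>\<^bsub>H\<^esub> y') = pure x y \<otimes>\<^bsub>T\<^esub> pure x y'"
proof -
  have "quot.cls (frag_of (x, y \<otimes>\<^bsub>H\<^esub> y')) = quot.cls (frag_of (x, y) + frag_of (x, y'))"
  proof (rule rel_eq)
    show "Poly_Mapping.keys (frag_of (x, y) + frag_of (x, y')) \<subseteq> carrier G \<times> carrier H"
      using assms keys_add[of "frag_of (x, y)" "frag_of (x, y')"] by auto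
    show "frag_of (x, y \<otimes>\<^bsub>H\<^esub> y') - (frag_of (x, y) + frag_of (x, y')) \<in> tensor_rels a G b H"
      unfolding tensor_rels_def using assms by (auto simp: diff_diff_add)
  qed (use assms in auto)
  also have "\<dots> = quot.cls (frag_of (x, y)) \<otimes>\<^bsub>T\<^esub> quot.cls (frag_of (x, y'))"
    using assms by (intro quot.cls_add) auto
  finally show ?thesis by (simp add: pure_eq)
qed

lemma pure_balanced:
  assumes "x \<in> carrier G" "y \<in> carrier H"
  shows "pure (a r x) y = pure x (b r y)"
proof -
  have "quot.cls (frag_of (a r x, y)) = quot.cls (frag_of (x, b r y))"
    by (rule rel_eq) (use assms in \<open>auto simp: tensor_rels_def\<close>)
  then show ?thesis by (simp add: pure_eq)
qed

lemma pure_bihom: "bihom G H T pure"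
  by (auto simp: bihom_def pure_add_left pure_add_right)

lemma pure_one_left: "y \<in> carrier H \<Longrightarrow> pure \<one>\<^bsub>G\<^esub> y = \<one>\<^bsub>T\<^esub>"
  using hom_one[OF bihomD(4)[OF pure_bihom] G.is_group comm_group.axioms(2)[OF T_comm]] by simp

lemma pure_one_right: "x \<in> carrier G \<Longrightarrow> pure x \<one>\<^bsub>H\<^esub> = \<one>\<^bsub>T\<^esub>"
  using hom_one[OF bihomD(5)[OF pure_bihom] H.is_group comm_group.axioms(2)[OF T_comm]] by simp

lemma pure_inv_left: "x \<in> carrier G \<Longrightarrow> y \<in> carrier H \<Longrightarrow> pure (inv\<^bsub>G\<^esub> x) y = inv\<^bsub>T\<^esub> pure x y"
  using group_hom.hom_inv[of G T "\<lambda>x. pure x y" x] bihomD(4)[OF pure_bihom]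
    G.is_group comm_group.axioms(2)[OF T_comm] by (simp add: group_hom_def group_hom_axioms_def)

text \<open>The inverse of a pure tensor is pure, with the inverse moved into the first factor, and
  the neutral element is pure as well. So the cases for inverses and for the neutral element
  disappear.\<close>

lemma T_induct [consumes 1, case_names pure mult]:
  assumes "z \<in> carrier T"
    and pure: "\<And>x y. x \<in> carrier G \<Longrightarrow> y \<in> carrier H \<Longrightarrow> P (pure x y)"
    and mult: "\<And>u v. u \<in> carrier T \<Longrightarrow> v \<in> carrier T \<Longrightarrow> P u \<Longrightarrow> P v \<Longrightarrow> P (u \<otimes>\<^bsub>T\<^esub> v)"
  shows "P z"
  using assms(1)
proof (induction z rule: quot.Q_induct)
  case 1
  show ?case using pure[of "\<one>\<^bsub>G\<^esub>" "\<one>\<^bsub>H\<^esub>"] by (simp add: pure_one_left)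
next
  case (2 s)
  then show ?case using pure by (auto simp flip: pure_eq)
next
  case (3 s)
  then obtain x y where s: "s = (x, y)" "x \<in> carrier G" "y \<in> carrier H" by auto
  have "inv\<^bsub>T\<^esub> quot.cls (frag_of s) = pure (inv\<^bsub>G\<^esub> x) y"
    unfolding s(1) using pure_inv_left[OF s(2,3)] by (simp add: pure_eq)
  then show ?case using pure s by simp
qed (use mult in auto)

text \<open>The extension of \<beta> to the free group sends the first two kinds of relation to the
  neutral element by biadditivity and the third by \<open>bal\<close>.\<close>

lemma T_universal:
  assumes K: "comm_group K" and \<beta>: "bihom G H K \<beta>"
    and bal: "\<And>r x y. x \<in> carrier G \<Longrightarrow> y \<in> carrier H \<Longrightarrow> \<beta> (a r x) y = \<beta> x (b r y)"
  obtains h where "h \<in> hom T K" "\<And>x y. x \<in> carrier G \<Longrightarrow> y \<in> carrier H \<Longrightarrow> h (pure x y) = \<beta> x y"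
proof -
  interpret K: comm_group K by fact
  let ?S = "carrier G \<times> carrier H"
  have "(\<lambda>(x, y). \<beta> x y) ` ?S \<subseteq> carrier K" using bihomD(1)[OF \<beta>] by auto
  from K.free_Abelian_group_universal[OF this] obtain h0 where
    h0: "h0 \<in> hom (free_Abelian_group ?S) K" "\<And>s. s \<in> ?S \<Longrightarrow> h0 (frag_of s) = (\<lambda>(x, y). \<beta> x y) s" by metis
  have d3: "h0 (frag_of s - frag_of s' - frag_of s'') = h0 (frag_of s) \<otimes>\<^bsub>K\<^esub> inv\<^bsub>K\<^esub> h0 (frag_of s') \<otimes>\<^bsub>K\<^esub> inv\<^bsub>K\<^esub> h0 (frag_of s'')"
    if "s \<in> ?S" "s' \<in> ?S" "s'' \<in> ?S" for s s' s''
  proof -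
    have "Poly_Mapping.keys (frag_of s - frag_of s') \<subseteq> ?S"
      using that keys_diff[of "frag_of s" "frag_of s'"] by auto
    then show ?thesis using that hom_free_diff[OF h0(1) K] by simp
  qed
  have d2: "h0 (frag_of s - frag_of s') = h0 (frag_of s) \<otimes>\<^bsub>K\<^esub> inv\<^bsub>K\<^esub> h0 (frag_of s')"
    if "s \<in> ?S" "s' \<in> ?S" for s s'
    using that hom_free_diff[OF h0(1) K] by simp
  have c: "x \<otimes>\<^bsub>K\<^esub> y \<otimes>\<^bsub>K\<^esub> inv\<^bsub>K\<^esub> x \<otimes>\<^bsub>K\<^esub> inv\<^bsub>K\<^esub> y = \<one>\<^bsub>K\<^esub>" if "x \<in> carrier K" "y \<in> carrier K" for x y
    using that by (simp add: K.m_assoc K.m_comm[of x "y \<otimes>\<^bsub>K\<^esub> _"] K.inv_mult[symmetric])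
  have "h0 r = \<one>\<^bsub>K\<^esub>" if "r \<in> tensor_rels a G b H" for r
    using that unfolding tensor_rels_def
    by (auto simp: d2 d3 h0(2) bihomD[OF \<beta>] bal c)
  from quot.universal[OF K h0(1) this] obtain g where
    g: "g \<in> hom T K" "\<And>f. Poly_Mapping.keys f \<subseteq> ?S \<Longrightarrow> g (quot.cls f) = h0 f" by metis
  show thesis
    by (rule that[OF g(1)]) (use g(2) h0(2) in \<open>simp add: pure_eq\<close>)
qed

end

section \<open>Representing modules on the universe\<close>

lemma transport_module:
  fixes M :: "'a gwa_module" and j :: "'a \<Rightarrow> 'b"
  assumes M: "left_module (gwa t) M" and j: "inj_on j (carrier M)"
  shows "\<exists>N :: 'b gwa_module. left_module (gwa t) N \<and> gwa_iso t N M"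
proof -
  interpret left_module "gwa t" M by fact
  let ?i = "inv_into (carrier M) j"
  define N :: "'b gwa_module" where "N = \<lparr>carrier = j ` carrier M, monoid.mult = undefined, one = undefined,
    ring.zero = j \<zero>\<^bsub>M\<^esub>, add = (\<lambda>x y. j (?i x \<oplus>\<^bsub>M\<^esub> ?i y)), smult = (\<lambda>a x. j (a \<odot>\<^bsub>M\<^esub> ?i x))\<rparr>"
  have N [simp]: "carrier N = j ` carrier M" "\<zero>\<^bsub>N\<^esub> = j \<zero>\<^bsub>M\<^esub>"
    "x \<oplus>\<^bsub>N\<^esub> y = j (?i x \<oplus>\<^bsub>M\<^esub> ?i y)" "a \<odot>\<^bsub>N\<^esub> x = j (a \<odot>\<^bsub>M\<^esub> ?i x)" for x y a
    by (auto simp: N_def)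
  have ij [simp]: "?i (j x) = x" if "x \<in> carrier M" for x
    using that j by simp
  have L: "left_module (gwa t) N"
  proof (intro left_module.intro left_module_axioms.intro ring_gwa)
    show "abelian_group N"
    proof (rule abelian_groupI)
      show "\<exists>y\<in>carrier N. y \<oplus>\<^bsub>N\<^esub> x = \<zero>\<^bsub>N\<^esub>" if "x \<in> carrier N" for x
        using that by (auto intro!: bexI[of _ "\<ominus>\<^bsub>M\<^esub> ?i x"] simp: M.l_neg)
    qed (auto simp: M.a_ac)
  qed (auto simp: smult_closed smult_l_distr smult_r_distr smult_assoc1 smult_one)
  have "j \<in> gwa_hom t M N" by (auto simp: gwa_hom_def)
  then have "gwa_iso t M N" using j by (auto simp: gwa_iso_def bij_betw_def)
  from gwa_iso_sym[OF this M] L show ?thesis by blast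
qed

lemma infinite_universe: "infinite (UNIV :: universe set)"
proof -
  have "inj (\<lambda>n::nat. Poly_Mapping.single (0, n) (1::complex) :: universe)"
  proof (rule injI)
    fix m n :: nat
    assume "Poly_Mapping.single (0::int, m) (1::complex) = Poly_Mapping.single (0, n) 1"
    then have "Poly_Mapping.keys (Poly_Mapping.single (0::int, m) (1::complex)) = Poly_Mapping.keys (Poly_Mapping.single (0::int, n) (1::complex))"
      by simp
    then show "m = n" by simp
  qed
  then show ?thesis
    using finite_subset[OF subset_UNIV] range_inj_infinite by blast
qed

lemma inj_pairs_universe: "\<exists>j :: universe \<times> universe \<Rightarrow> universe. inj j"
proof -
  have "|UNIV \<times> UNIV :: (universe \<times> universe) set| =o |UNIV :: universe set|"
    by (rule card_of_Times_same_infinite[OF infinite_universe])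
  then have "|UNIV :: (universe \<times> universe) set| \<le>o |UNIV :: universe set|"
    by (simp add: ordIso_iff_ordLeq)
  then show ?thesis by (auto simp flip: card_of_ordLeq)
qed

text \<open>A free abelian group on an infinite set has the cardinality of that set. The carrier of
  a tensor product of two objects consists of cosets in such a group and is embedded through
  representatives.\<close>

lemma inj_frags_universe: "\<exists>j :: (universe \<times> universe \<Rightarrow>\<^sub>0 int) \<Rightarrow> universe. inj j"
proof -
  have inf: "infinite (UNIV :: (universe \<times> universe) set)"
    using infinite_universe by (simp add: finite_prod)
  have "carrier (free_Abelian_group (UNIV :: (universe \<times> universe) set)) = UNIV" by auto
  then obtain k :: "(universe \<times> universe \<Rightarrow>\<^sub>0 int) \<Rightarrow> universe \<times> universe" where "inj k"
    using eqpoll_free_Abelian_group_infinite[OF inf] by (auto simp: eqpoll_def bij_betw_def)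
  moreover obtain j :: "universe \<times> universe \<Rightarrow> universe" where "inj j" using inj_pairs_universe by blast
  ultimately show ?thesis by (metis inj_compose)
qed

lemma iso_class_cong:
  assumes "gwa_iso t M N" "left_module (gwa t) M"
  shows "iso_class t M = iso_class t N"
  unfolding iso_class_def
  by (auto intro: gwa_iso_trans[OF _ assms(1)] gwa_iso_trans[OF _ gwa_iso_sym[OF assms]])

text \<open>\<open>iso_class\<close> accepts a module on any type but consists of modules on the
  universe. This supplies an actual object with the same class for a module that lives
  elsewhere.\<close>

lemma ex_obj:
  assumes M: "graded t (M :: 'a gwa_module)" and j: "inj_on (j :: 'a \<Rightarrow> universe) (carrier M)"
  shows "\<exists>N\<in>objs t. gwa_iso t N M \<and> iso_class t N = iso_class t M"
proof -
  have L: "left_module (gwa t) M" using M by (auto simp: graded_def)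
  from transport_module[OF L j] obtain N :: "universe gwa_module" where
    N: "left_module (gwa t) N" "gwa_iso t N M" by blast
  have "graded t N" using graded_iso[OF M N(1) gwa_iso_sym[OF N(2,1)]] .
  then show ?thesis using N iso_class_cong objs_iff by blast
qed

lemma left_module_obj: "M \<in> objs t \<Longrightarrow> left_module (gwa t) M"
  by (simp add: objs_iff graded_def)

section \<open>Tensor products of weight modules\<close>

lemma shift_mult: "shift a (r * s) = shift a r * shift a s"
  by (simp add: shift_def pcompose_mult)

lemma comm_group_add_group: "abelian_group M \<Longrightarrow> comm_group (add_group M)"
proof -
  assume "abelian_group M"
  then interpret abelian_group M .
  show ?thesis
    by (rule comm_groupI) (auto simp: add_group_def a_ac intro: add.l_inv_ex)
qed

lemma add_group_simps [simp]:
  "carrier (add_group M) = carrier M" "monoid.mult (add_group M) = add M" "one (add_group M) = \<zero>\<^bsub>M\<^esub>"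
  by (auto simp: add_group_def)

lemma tensor_product_modules:
  assumes "left_module (gwa t) M" "left_module (gwa t') M'"
  shows "tensor_product (act_poly t M) (add_group M) (act_poly t' M') (add_group M')"
proof -
  interpret M: gwa_act M "act_poly t M" t "act_gen t M" by (rule left_module_imp_gwa_act[OF assms(1)])
  interpret M': gwa_act M' "act_poly t' M'" t' "act_gen t' M'" by (rule left_module_imp_gwa_act[OF assms(2)])
  show ?thesis
    by (intro tensor_product.intro tensor_product_axioms.intro comm_group_add_group
        M.abelian_group_axioms M'.abelian_group_axioms) auto
qed

definition tpure where
  "tpure t M t' M' = tensor_pure (act_poly t M) (add_group M) (act_poly t' M') (add_group M')"

text \<open>The record that is built inside \<open>tensor_module\<close>, with the action left as a
  parameter.\<close>

definition module_on :: "'a monoid \<Rightarrow> ('r \<Rightarrow> 'a \<Rightarrow> 'a) \<Rightarrow> ('r, 'a) module" where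
  "module_on T s = \<lparr>carrier = carrier T, monoid.mult = undefined, one = undefined,
     ring.zero = \<one>\<^bsub>T\<^esub>, add = monoid.mult T, smult = s\<rparr>"

lemma module_on_simps [simp]:
  "carrier (module_on T s) = carrier T" "ring.zero (module_on T s) = \<one>\<^bsub>T\<^esub>"
  "add (module_on T s) = monoid.mult T" "(module_on T s)\<lparr>smult := s'\<rparr> = module_on T s'"
  by (auto simp: module_on_def)

lemma abelian_group_module_on:
  assumes "comm_group T" shows "abelian_group (module_on T s)"
proof -
  interpret T: comm_group T by fact
  show ?thesis
    by (rule abelian_groupI) (auto simp: T.m_ac intro!: bexI[of _ "inv\<^bsub>T\<^esub> _"])
qed

locale tensor_modules =
  fixes t :: "complex poly" and M :: "'a gwa_module" and t' :: "complex poly" and M' :: "'b gwa_module"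
  assumes M: "left_module (gwa t) M" and M': "left_module (gwa t') M'"
begin

sublocale M: gwa_act M "act_poly t M" t "act_gen t M" by (rule left_module_imp_gwa_act[OF M])
sublocale M': gwa_act M' "act_poly t' M'" t' "act_gen t' M'" by (rule left_module_imp_gwa_act[OF M'])
sublocale tp: tensor_product "act_poly t M" "add_group M" "act_poly t' M'" "add_group M'"
  by (rule tensor_product_modules[OF M M'])

abbreviation "pur \<equiv> tp.pure"

text \<open>The balancing condition is weaker than linearity of \<open>u\<close> and
  \<open>w\<close>. It also admits pairs of semilinear operators that twist polynomials by the same
  shift, and this is how X+ and X- come to act on a tensor product.\<close>

lemma ex_op:
  assumes "additive M M u" "additive M' M' w"
    and "\<And>r x y. x \<in> carrier M \<Longrightarrow> y \<in> carrier M' \<Longrightarrow>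
      pur (u (act_poly t M r x)) (w y) = pur (u x) (w (act_poly t' M' r y))"
  shows "\<exists>h\<in>hom tp.T tp.T. \<forall>x\<in>carrier M. \<forall>y\<in>carrier M'. h (pur x y) = pur (u x) (w y)"
proof -
  have "bihom (add_group M) (add_group M') tp.T (\<lambda>x y. pur (u x) (w y))"
    using bihomD[OF tp.pure_bihom] additive_closed[OF assms(1)] additive_closed[OF assms(2)]
      additive_add[OF assms(1)] additive_add[OF assms(2)]
    by (auto simp: bihom_def)
  then show ?thesis
  proof (rule tp.T_universal[OF tp.T_comm])
    show "pur (u (act_poly t M r x)) (w y) = pur (u x) (w (act_poly t' M' r y))"
      if "x \<in> carrier (add_group M)" "y \<in> carrier (add_group M')" for r x y
      using assms(3) that by simp
  next
    fix h assume "h \<in> hom tp.T tp.T"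
      "\<And>x y. x \<in> carrier (add_group M) \<Longrightarrow> y \<in> carrier (add_group M') \<Longrightarrow> h (pur x y) = pur (u x) (w y)"
    then show ?thesis by (intro bexI[of _ h] ballI) simp_all
  qed
qed

lemma ex_tensor_action:
  "\<exists>s. left_module (gwa (t * t')) (module_on tp.T s)
     \<and> (\<forall>v\<in>carrier M. \<forall>v'\<in>carrier M'.
          (\<forall>r. act_poly (t * t') (module_on tp.T s) r (pur v v') = pur (act_poly t M r v) v')
        \<and> (\<forall>x\<in>{Gen_Xp, Gen_Xm}.
             act_gen (t * t') (module_on tp.T s) x (pur v v') = pur (act_gen t M x v) (act_gen t' M' x v')))"
proof -
  interpret T: comm_group tp.T by (rule tp.T_comm)
  have "\<exists>h\<in>hom tp.T tp.T. \<forall>x\<in>carrier M. \<forall>y\<in>carrier M'. h (pur x y) = pur (act_poly t M r x) y" for r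
    by (rule ex_op[where w = "\<lambda>y. y"])
      (auto simp: additive_def M.p_radd M.p_commute tp.pure_balanced[symmetric] simp flip: add_group_simps(1))
  then obtain P where P: "\<And>r. P r \<in> hom tp.T tp.T"
    "\<And>r x y. x \<in> carrier M \<Longrightarrow> y \<in> carrier M' \<Longrightarrow> P r (pur x y) = pur (act_poly t M r x) y"
    by metis
  have "\<exists>h\<in>hom tp.T tp.T. \<forall>x\<in>carrier M. \<forall>y\<in>carrier M'. h (pur x y) = pur (act_gen t M g x) (act_gen t' M' g y)"
    if "g \<noteq> Gen_z" for g
  proof (rule ex_op)
    show "pur (act_gen t M g (act_poly t M r x)) (act_gen t' M' g y) =
          pur (act_gen t M g x) (act_gen t' M' g (act_poly t' M' r y))"
      if "x \<in> carrier M" "y \<in> carrier M'" for r x y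
      using \<open>g \<noteq> Gen_z\<close> that by (cases g) (auto simp: M.Xp_p M'.Xp_p M.Xm_p M'.Xm_p tp.pure_balanced)
  qed (use that in \<open>auto simp: additive_def M.X_add M'.X_add\<close>)
  then obtain X where X: "\<And>g. g \<noteq> Gen_z \<Longrightarrow> X g \<in> hom tp.T tp.T"
    "\<And>g x y. g \<noteq> Gen_z \<Longrightarrow> x \<in> carrier M \<Longrightarrow> y \<in> carrier M' \<Longrightarrow>
      X g (pur x y) = pur (act_gen t M g x) (act_gen t' M' g y)"
    by metis
  have PT: "P r z \<in> carrier tp.T" if "z \<in> carrier tp.T" for r z
    using hom_in_carrier[OF P(1) that] .
  have XT: "X g z \<in> carrier tp.T" if "z \<in> carrier tp.T" "g \<noteq> Gen_z" for g z
    using hom_in_carrier[OF X(1) that(1)] that(2) .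
  have Pm: "P r (u \<otimes>\<^bsub>tp.T\<^esub> v) = P r u \<otimes>\<^bsub>tp.T\<^esub> P r v" if "u \<in> carrier tp.T" "v \<in> carrier tp.T" for r u v
    using hom_mult[OF P(1) that] .
  have Xm: "X g (u \<otimes>\<^bsub>tp.T\<^esub> v) = X g u \<otimes>\<^bsub>tp.T\<^esub> X g v" if "u \<in> carrier tp.T" "v \<in> carrier tp.T" "g \<noteq> Gen_z" for g u v
    using hom_mult[OF X(1)[OF that(3)] that(1,2)] .
  \<comment> \<open>Balancing moves the factor that comes from t' across the tensor sign, where it
    multiplies the one that comes from t. This yields the relations between X+ and X- in
    A(tt').\<close>
  have rel: "pur (act_poly t M (shift c t) x) (act_poly t' M' (shift c t') y)
      = pur (act_poly t M (shift c (t * t')) x) y" if "x \<in> carrier M" "y \<in> carrier M'" for c x y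
    using tp.pure_balanced[of "act_poly t M (shift c t) x" y "shift c t'"] that
    by (simp add: shift_mult M.p_mult M.p_commute)
  let ?V = "module_on tp.T undefined"
  have "gwa_act ?V P (t * t') X"
  proof (intro gwa_act.intro gwa_act_axioms.intro poly_act.intro poly_act_axioms.intro)
    show "abelian_group ?V" by (rule abelian_group_module_on[OF tp.T_comm])
  next
    fix z assume "z \<in> carrier ?V"
    then have z: "z \<in> carrier tp.T" by simp
    show "P r z \<in> carrier ?V" for r using PT[OF z] by simp
    show "X g z \<in> carrier ?V" if "g \<noteq> Gen_z" for g using XT[OF z that] by simp
    show "P (r + s) z = P r z \<oplus>\<^bsub>?V\<^esub> P s z" for r s
      using z by (induction z rule: tp.T_induct)
        (simp_all add: P(2) M.p_add tp.pure_add_left[simplified] Pm PT T.m_ac)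
    show "P (r * s) z = P r (P s z)" for r s
      using z by (induction z rule: tp.T_induct) (simp_all add: P(2) M.p_mult Pm PT)
    show "P 1 z = z"
      using z by (induction z rule: tp.T_induct) (simp_all add: P(2) M.p_one Pm)
    show "X Gen_Xp (P r z) = P (shift 1 r) (X Gen_Xp z)" for r
      using z by (induction z rule: tp.T_induct) (simp_all add: P(2) X(2) M.Xp_p Pm Xm PT XT)
    show "X Gen_Xm (P r z) = P (shift (- 1) r) (X Gen_Xm z)" for r
      using z by (induction z rule: tp.T_induct) (simp_all add: P(2) X(2) M.Xm_p Pm Xm PT XT)
    show "X Gen_Xp (X Gen_Xm z) = P (shift (1 / 2) (t * t')) z"
      using z by (induction z rule: tp.T_induct)
        (simp_all add: P(2) X(2) M.XpXm M'.XpXm Pm Xm PT XT rel)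
    show "X Gen_Xm (X Gen_Xp z) = P (shift (- 1 / 2) (t * t')) z"
      using z by (induction z rule: tp.T_induct)
        (simp_all add: P(2) X(2) M.XmXp M'.XmXp Pm Xm PT XT rel)
    fix w assume "w \<in> carrier ?V"
    then have w: "w \<in> carrier tp.T" by simp
    show "P r (z \<oplus>\<^bsub>?V\<^esub> w) = P r z \<oplus>\<^bsub>?V\<^esub> P r w" for r using Pm z w by simp
    show "X g (z \<oplus>\<^bsub>?V\<^esub> w) = X g z \<oplus>\<^bsub>?V\<^esub> X g w" if "g \<noteq> Gen_z" for g using Xm z w that by simp
  qed
  from gwa_act_imp_left_module[OF this] obtain s where
    s: "left_module (gwa (t * t')) (module_on tp.T s)"
    "\<forall>v\<in>carrier tp.T. (\<forall>r. act_poly (t * t') (module_on tp.T s) r v = P r v)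
      \<and> (\<forall>x\<in>{Gen_Xp, Gen_Xm}. act_gen (t * t') (module_on tp.T s) x v = X x v)"
    unfolding module_on_simps by blast
  show ?thesis
    by (rule exI[of _ s]) (use s P X in auto)
qed

definition "TM = tensor_module t M t' M'"

text \<open>The action in \<open>tensor_module\<close> is a choice; since a suitable action exists,
  the chosen one obeys the formulas on pure tensors, and all later arguments rely on these
  alone.\<close>

lemma tensor_module_spec:
  "\<exists>s. TM = module_on tp.T s"
  "left_module (gwa (t * t')) TM"
  "v \<in> carrier M \<Longrightarrow> v' \<in> carrier M' \<Longrightarrow> act_poly (t * t') TM r (pur v v') = pur (act_poly t M r v) v'"
  "v \<in> carrier M \<Longrightarrow> v' \<in> carrier M' \<Longrightarrow> x \<noteq> Gen_z \<Longrightarrow>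
    act_gen (t * t') TM x (pur v v') = pur (act_gen t M x v) (act_gen t' M' x v')"
proof -
  let ?P = "\<lambda>s. left_module (gwa (t * t')) (module_on tp.T s)
     \<and> (\<forall>v\<in>carrier M. \<forall>v'\<in>carrier M'.
          (\<forall>r. act_poly (t * t') (module_on tp.T s) r (pur v v') = pur (act_poly t M r v) v')
        \<and> (\<forall>x\<in>{Gen_Xp, Gen_Xm}.
             act_gen (t * t') (module_on tp.T s) x (pur v v') = pur (act_gen t M x v) (act_gen t' M' x v')))"
  have TM: "TM = module_on tp.T (SOME s. ?P s)"
    unfolding TM_def tensor_module_def Let_def module_on_def ..
  then show "\<exists>s. TM = module_on tp.T s" by blast
  have P: "?P (SOME s. ?P s)" by (rule someI_ex[OF ex_tensor_action])
  show "left_module (gwa (t * t')) TM"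
    "v \<in> carrier M \<Longrightarrow> v' \<in> carrier M' \<Longrightarrow> act_poly (t * t') TM r (pur v v') = pur (act_poly t M r v) v'"
    unfolding TM using P by blast+
  show "v \<in> carrier M \<Longrightarrow> v' \<in> carrier M' \<Longrightarrow> x \<noteq> Gen_z \<Longrightarrow>
    act_gen (t * t') TM x (pur v v') = pur (act_gen t M x v) (act_gen t' M' x v')"
    unfolding TM using P by (cases x) blast+
qed

lemma TM_simps:
  "carrier TM = carrier tp.T" "\<zero>\<^bsub>TM\<^esub> = \<one>\<^bsub>tp.T\<^esub>" "add TM = monoid.mult tp.T"
  using tensor_module_spec(1) by auto

sublocale TM: gwa_act TM "act_poly (t * t') TM" "t * t'" "act_gen (t * t') TM"
  by (rule left_module_imp_gwa_act[OF tensor_module_spec(2)])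

lemma TM_induct [consumes 1, case_names pure add]:
  assumes "z \<in> carrier TM"
    and "\<And>x y. x \<in> carrier M \<Longrightarrow> y \<in> carrier M' \<Longrightarrow> P (pur x y)"
    and "\<And>u v. u \<in> carrier TM \<Longrightarrow> v \<in> carrier TM \<Longrightarrow> P u \<Longrightarrow> P v \<Longrightarrow> P (u \<oplus>\<^bsub>TM\<^esub> v)"
  shows "P z"
proof -
  have "z \<in> carrier tp.T" using assms(1) by (simp add: TM_simps)
  then show ?thesis
    by (induction z rule: tp.T_induct) (use assms(2,3) in \<open>auto simp: TM_simps\<close>)
qed

lemma pur_closed [simp]: "x \<in> carrier M \<Longrightarrow> y \<in> carrier M' \<Longrightarrow> pur x y \<in> carrier TM"
  by (simp add: TM_simps)

lemma pur_additive: 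
  "y \<in> carrier M' \<Longrightarrow> additive M TM (\<lambda>x. pur x y)" "x \<in> carrier M \<Longrightarrow> additive M' TM (pur x)"
  using bihomD[OF tp.pure_bihom] by (auto simp: additive_def TM_simps)

lemma pur_p_right:
  "x \<in> carrier M \<Longrightarrow> y \<in> carrier M' \<Longrightarrow> pur x (act_poly t' M' r y) = act_poly (t * t') TM r (pur x y)"
  using tp.pure_balanced[of x y r] by (simp add: tensor_module_spec(3))

end

section \<open>Spans and the weight spaces of a tensor product\<close>

lemma (in poly_act) lin_comb_single:
  assumes "b \<in> B" "B \<subseteq> carrier M" "finite B"
  shows "lin_comb M p B (\<lambda>x. if x = b then 1 else 0) = b"
proof -
  have "lin_comb M p B (\<lambda>x. if x = b then 1 else 0) = (\<Oplus>x\<in>{b}. p [:1:] x)"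
    unfolding lin_comb_def using assms
    by (intro add.finprod_mono_neutral_cong_right) auto
  then show ?thesis using assms by (auto simp: p_const_one)
qed

definition lin_span where
  "lin_span M p B = {lin_comb M p B c | c. True}"

lemma (in poly_act) lin_span_facts:
  assumes B: "B \<subseteq> carrier M" "finite B"
  shows "v \<in> lin_span M p B \<Longrightarrow> w \<in> lin_span M p B \<Longrightarrow> v \<oplus> w \<in> lin_span M p B"
    "v \<in> lin_span M p B \<Longrightarrow> p [:k:] v \<in> lin_span M p B"
    "b \<in> B \<Longrightarrow> b \<in> lin_span M p B" "\<zero> \<in> lin_span M p B"
    "finite A \<Longrightarrow> f \<in> A \<rightarrow> lin_span M p B \<Longrightarrow> finsum M f A \<in> lin_span M p B"
proof -
  have I: "lin_comb M p B c \<in> lin_span M p B" for c by (auto simp: lin_span_def)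
  show add: "v \<oplus> w \<in> lin_span M p B" if vw: "v \<in> lin_span M p B" "w \<in> lin_span M p B" for v w
  proof -
    obtain c d where "v = lin_comb M p B c" "w = lin_comb M p B d" using vw by (auto simp: lin_span_def)
    then have "v \<oplus> w = lin_comb M p B (\<lambda>b. c b + d b)" using lin_comb_add[OF B(1)] by simp
    then show ?thesis by (simp add: I)
  qed
  show "v \<in> lin_span M p B \<Longrightarrow> p [:k:] v \<in> lin_span M p B"
  proof -
    assume "v \<in> lin_span M p B"
    then obtain c where "v = lin_comb M p B c" by (auto simp: lin_span_def)
    then have "p [:k:] v = lin_comb M p B (\<lambda>b. k * c b)" using lin_comb_scale[OF B(1)] by simp
    then show ?thesis by (simp add: I)
  qed
  show "b \<in> B \<Longrightarrow> b \<in> lin_span M p B"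
    using lin_comb_single[OF _ B] I by metis
  have "lin_comb M p B (\<lambda>_. 0) = \<zero>"
    unfolding lin_comb_def using B(1) by (intro add.finprod_one_eqI) auto
  then show z: "\<zero> \<in> lin_span M p B" using I by metis
  have sub: "lin_span M p B \<subseteq> carrier M" using lin_comb_closed[OF B(1)] by (auto simp: lin_span_def)
  show "finite A \<Longrightarrow> f \<in> A \<rightarrow> lin_span M p B \<Longrightarrow> finsum M f A \<in> lin_span M p B"
  proof (induction A rule: finite_induct)
    case (insert x F)
    then have "f \<in> F \<rightarrow> carrier M" "f x \<in> carrier M" using sub by auto
    with insert show ?case by (auto intro: add)
  qed (use z in auto)
qed

lemma fin_dim_iff: "fin_dim M p W \<longleftrightarrow> (\<exists>B. finite B \<and> B \<subseteq> W \<and> W \<subseteq> lin_span M p B)"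
  by (auto simp: fin_dim_def lin_span_def)

context tensor_modules
begin

text \<open>On the pure tensor z acts as n through the first factor and as m through the second, so
  the scalar n - m annihilates it.\<close>

lemma pur_wt:
  assumes v: "v \<in> wt_space M (act_poly t M) n" and w: "w \<in> wt_space M' (act_poly t' M') m"
  shows "n = m \<Longrightarrow> pur v w \<in> wt_space TM (act_poly (t * t') TM) n"
    and "n \<noteq> m \<Longrightarrow> pur v w = \<zero>\<^bsub>TM\<^esub>"
proof -
  have vM: "v \<in> carrier M" "w \<in> carrier M'" using v w by auto
  have 0: "pur \<zero>\<^bsub>M\<^esub> w = \<zero>\<^bsub>TM\<^esub>" using tp.pure_one_left[of w] vM by (simp add: TM_simps)
  have z: "act_poly (t * t') TM [:- of_int n, 1:] (pur v w) = \<zero>\<^bsub>TM\<^esub>"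
    using v vM 0 by (simp add: tensor_module_spec(3) wt_space_def)
  then show "n = m \<Longrightarrow> pur v w \<in> wt_space TM (act_poly (t * t') TM) n"
    using vM by (auto simp: wt_space_def)
  assume ne: "n \<noteq> m"
  have "act_poly (t * t') TM [:- of_int n, 1:] (pur v w) = pur v (act_poly t' M' [:- of_int n, 1:] w)"
    using pur_p_right vM by simp
  also have "act_poly t' M' [:- of_int n, 1:] w = act_poly t' M' [:poly [:- of_int n, 1:] (of_int m):] w"
    by (rule M'.p_wt[OF w])
  also have "pur v \<dots> = act_poly (t * t') TM [:poly [:- of_int n, 1:] (of_int m):] (pur v w)"
    using pur_p_right vM by simp
  finally have "act_poly (t * t') TM [:poly [:- of_int n, 1:] (of_int m):] (pur v w) = \<zero>\<^bsub>TM\<^esub>"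
    using z by simp
  from TM.p_const_cancel[OF pur_closed[OF vM] this] ne show "pur v w = \<zero>\<^bsub>TM\<^esub>" by simp
qed

text \<open>Pure tensors of weight vectors span, and those of two different weights vanish. So
  weight n of the tensor product is spanned by the tensors of two finite spanning sets, taken from
  the weight n spaces of the factors.\<close>

lemma graded_tensor:
  assumes gM: "graded t M" and gM': "graded t' M'"
  shows "graded (t * t') TM"
proof -
  let ?p = "act_poly t M" and ?p' = "act_poly t' M'" and ?q = "act_poly (t * t') TM"
  interpret wM: wt_act M ?p using gM by (auto simp: graded_def)
  interpret wM': wt_act M' ?p' using gM' by (auto simp: graded_def)
  note add = additive_add[OF pur_additive(1)] additive_add[OF pur_additive(2)]
  have span1: "pur v w \<in> wt_span TM ?q" if "v \<in> wt_span M ?p" "w \<in> wt_space M' ?p' m" for v w m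
    using that(1)
  proof induction
    case (wt v n)
    show ?case
    proof (cases "n = m")
      case True
      from wt_span.wt[OF pur_wt(1)[OF wt that(2) True]] show ?thesis .
    next
      case False
      from wt_span.wt[OF TM.wt_zero] show ?thesis unfolding pur_wt(2)[OF wt that(2) False] .
    qed
  next
    case (add v1 v2)
    have "pur (v1 \<oplus>\<^bsub>M\<^esub> v2) w = pur v1 w \<oplus>\<^bsub>TM\<^esub> pur v2 w"
      using add(1,2) that(2) by (intro additive_add[OF pur_additive(1)]) (auto dest: M.wt_span_carrier)
    then show ?case using add by (auto intro: wt_span.add)
  qed
  have span2: "pur v w \<in> wt_span TM ?q" if "v \<in> carrier M" "w \<in> wt_span M' ?p'" for v w
    using that(2)
  proof induction
    case (wt w m)
    then show ?case using span1[OF wM.spans[OF that(1)] wt] by simp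
  next
    case (add w1 w2)
    have "pur v (w1 \<oplus>\<^bsub>M'\<^esub> w2) = pur v w1 \<oplus>\<^bsub>TM\<^esub> pur v w2"
      using add(1,2) that(1) by (intro additive_add[OF pur_additive(2)]) (auto dest: M'.wt_span_carrier)
    then show ?case using add by (auto intro: wt_span.add)
  qed
  have W: "wt_act TM ?q"
  proof unfold_locales
    fix z assume "z \<in> carrier TM"
    then show "z \<in> wt_span TM ?q"
      by (induction z rule: TM_induct) (auto intro: span2 wM'.spans wt_span.add)
  qed
  interpret W: wt_act TM ?q by (rule W)
  have "fin_dim TM ?q (wt_space TM ?q n)" for n
  proof -
    obtain B where B: "finite B" "B \<subseteq> wt_space M ?p n" "wt_space M ?p n \<subseteq> lin_span M ?p B"
      using gM unfolding graded_def fin_dim_iff by blast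
    obtain C where C: "finite C" "C \<subseteq> wt_space M' ?p' n" "wt_space M' ?p' n \<subseteq> lin_span M' ?p' C"
      using gM' unfolding graded_def fin_dim_iff by blast
    let ?D = "(\<lambda>(b, c). pur b c) ` (B \<times> C)"
    have D: "?D \<subseteq> wt_space TM ?q n"
    proof clarify
      fix b c assume "b \<in> B" "c \<in> C"
      then show "pur b c \<in> wt_space TM ?q n"
        using pur_wt(1)[OF subsetD[OF B(2)] subsetD[OF C(2)] refl] by blast
    qed
    have Dc: "?D \<subseteq> carrier TM" by (rule subset_trans[OF D]) (auto simp: wt_space_def)
    have Df: "finite ?D" using B(1) C(1) by simp
    note S = TM.lin_span_facts[OF Dc Df]
    have BM: "\<And>b. b \<in> B \<Longrightarrow> b \<in> carrier M" "\<And>c. c \<in> C \<Longrightarrow> c \<in> carrier M'" using subsetD[OF B(2)] subsetD[OF C(2)] by blast+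
    have 1: "pur b w \<in> lin_span TM ?q ?D" if b: "b \<in> B" and w: "w \<in> wt_space M' ?p' n" for b w
    proof -
      obtain c where c: "w = lin_comb M' ?p' C c" using C(3) w by (auto simp: lin_span_def)
      have "pur b w = (\<Oplus>\<^bsub>TM\<^esub>x\<in>C. pur b (?p' [:c x:] x))"
        unfolding c lin_comb_def using BM b
        by (intro additive_finsum[OF pur_additive(2) M'.abelian_group_axioms TM.abelian_group_axioms]) auto
      moreover have "pur b (?p' [:c x:] x) \<in> lin_span TM ?q ?D" if "x \<in> C" for x
      proof -
        have "pur b x \<in> lin_span TM ?q ?D" by (rule S(3)) (use b that in auto)
        from S(2)[OF this] show ?thesis using pur_p_right BM b that by simp
      qed
      ultimately show ?thesis using S(5)[OF C(1), of "\<lambda>x. pur b (?p' [:c x:] x)"] by auto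
    qed
    have 2: "pur v w \<in> lin_span TM ?q ?D" if v: "v \<in> wt_space M ?p n" and w: "w \<in> wt_space M' ?p' n" for v w
    proof -
      obtain c where c: "v = lin_comb M ?p B c" using B(3) v by (auto simp: lin_span_def)
      have wM: "w \<in> carrier M'" using w by auto
      have "pur v w = (\<Oplus>\<^bsub>TM\<^esub>x\<in>B. pur (?p [:c x:] x) w)"
        unfolding c lin_comb_def using BM wM
        by (intro additive_finsum[OF pur_additive(1) M.abelian_group_axioms TM.abelian_group_axioms]) auto
      moreover have "pur (?p [:c x:] x) w \<in> lin_span TM ?q ?D" if "x \<in> B" for x
        using tensor_module_spec(3)[of x w "[:c x:]"] BM wM that 1[OF that w] by (metis S(2))
      ultimately show ?thesis using S(5)[OF B(1), of "\<lambda>x. pur (?p [:c x:] x) w"] by auto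
    qed
    have 3: "W.comp n (pur v w) \<in> lin_span TM ?q ?D" if v: "v \<in> wt_space M ?p k" and w: "w \<in> wt_space M' ?p' m" for v w k m
    proof (cases "k = m \<and> k = n")
      case True
      then have "v \<in> wt_space M ?p n" "w \<in> wt_space M' ?p' n" using v w by auto
      then show ?thesis using 2[of v w] W.comp_self[OF pur_wt(1)[of v n w n]] by simp
    next
      case False
      then have "W.comp n (pur v w) = \<zero>\<^bsub>TM\<^esub>"
        using pur_wt[OF v w] W.comp_other[of "pur v w" k n] W.comp_zero[of n] by (cases "k = m") auto
      then show ?thesis using S(4) by simp
    qed
    have 4: "W.comp n (pur v w) \<in> lin_span TM ?q ?D" if "v \<in> wt_span M ?p" and w: "w \<in> wt_space M' ?p' m" for v w m
      using that(1)
    proof induction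
      case (wt v k)
      then show ?case using 3 w by blast
    next
      case (add v1 v2)
      have vw: "v1 \<in> carrier M" "v2 \<in> carrier M" "w \<in> carrier M'" using add(1,2) w by (auto dest: M.wt_span_carrier)
      have "W.comp n (pur (v1 \<oplus>\<^bsub>M\<^esub> v2) w) = W.comp n (pur v1 w) \<oplus>\<^bsub>TM\<^esub> W.comp n (pur v2 w)"
        unfolding additive_add[OF pur_additive(1)[OF vw(3)] vw(1,2)] using vw by (intro W.comp_add pur_closed)
      then show ?case using S(1)[OF add(3,4)] by simp
    qed
    have 5: "W.comp n (pur v w) \<in> lin_span TM ?q ?D" if v: "v \<in> carrier M" and "w \<in> wt_span M' ?p'" for v w
      using that(2)
    proof induction
      case (wt w k)
      then show ?case using 4 wM.spans[OF v] by blast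
    next
      case (add w1 w2)
      have vw: "w1 \<in> carrier M'" "w2 \<in> carrier M'" using add(1,2) by (auto dest: M'.wt_span_carrier)
      have "W.comp n (pur v (w1 \<oplus>\<^bsub>M'\<^esub> w2)) = W.comp n (pur v w1) \<oplus>\<^bsub>TM\<^esub> W.comp n (pur v w2)"
        unfolding additive_add[OF pur_additive(2)[OF v] vw] using vw v by (intro W.comp_add pur_closed)
      then show ?case using S(1)[OF add(3,4)] by simp
    qed
    \<comment> \<open>The span is reached by every projection to weight n, built up from weight
      vectors to pure tensors to sums. A vector of weight n is its own projection.\<close>
    have 6: "W.comp n z \<in> lin_span TM ?q ?D" if "z \<in> carrier TM" for z
      using that
    proof (induction z rule: TM_induct)
      case (pure x y)
      then show ?case using 5 wM'.spans by blast
    next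
      case (add u v)
      then show ?case using S(1)[OF add(3,4)] W.comp_add[OF add(1,2)] by simp
    qed
    have "wt_space TM ?q n \<subseteq> lin_span TM ?q ?D"
    proof
      fix z assume z: "z \<in> wt_space TM ?q n"
      show "z \<in> lin_span TM ?q ?D" using 6[of z] W.comp_self[OF z] z by auto
    qed
    with D Df show ?thesis unfolding fin_dim_iff by blast
  qed
  with W tensor_module_spec(2) show ?thesis by (auto simp: graded_def)
qed

end

section \<open>Functoriality of the tensor product\<close>

abbreviation tens where "tens \<equiv> tensor_module"

text \<open>This is u tensored with the identity. The same h is linear over C[z], and linear over
  A(tt') if u is linear over A(t): the section and retraction of an exact sequence use the first
  property, the maps of the sequence the second.\<close>

lemma tensor_map:
  assumes L: "left_module (gwa t) M" "left_module (gwa t) M1" "left_module (gwa t') N"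
    and u: "p_linear M (act_poly t M) M1 (act_poly t M1) u"
  shows "\<exists>h. p_linear (tens t M t' N) (act_poly (t * t') (tens t M t' N))
       (tens t M1 t' N) (act_poly (t * t') (tens t M1 t' N)) h
    \<and> (\<forall>x\<in>carrier M. \<forall>y\<in>carrier N. h (tpure t M t' N x y) = tpure t M1 t' N (u x) y)
    \<and> (u \<in> gwa_hom t M M1 \<longrightarrow> h \<in> gwa_hom (t * t') (tens t M t' N) (tens t M1 t' N))"
proof -
  interpret A: tensor_modules t M t' N using L by (intro tensor_modules.intro)
  interpret B: tensor_modules t M1 t' N using L by (intro tensor_modules.intro)
  have uadd: "additive M M1 u" and up: "\<And>r v. v \<in> carrier M \<Longrightarrow> u (act_poly t M r v) = act_poly t M1 r (u v)"
    using u by (auto simp: p_linear_def)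
  note ucl = additive_closed[OF uadd]
  have bi: "bihom (add_group M) (add_group N) B.tp.T (\<lambda>x y. B.pur (u x) y)"
    using bihomD[OF B.tp.pure_bihom] ucl additive_add[OF uadd] by (auto simp: bihom_def)
  obtain h where h: "h \<in> hom A.tp.T B.tp.T"
    "\<And>x y. x \<in> carrier (add_group M) \<Longrightarrow> y \<in> carrier (add_group N) \<Longrightarrow> h (A.pur x y) = B.pur (u x) y"
    by (rule A.tp.T_universal[OF B.tp.T_comm bi]) (use up ucl B.tp.pure_balanced in auto)
  have h2: "h (A.pur x y) = B.pur (u x) y" if "x \<in> carrier M" "y \<in> carrier N" for x y
    using h(2) that by simp
  have hadd: "additive A.TM B.TM h"
    using h(1) by (auto simp: additive_def hom_def A.TM_simps B.TM_simps)
  note hcl = additive_closed[OF hadd]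
  have "h (act_poly (t * t') A.TM r z) = act_poly (t * t') B.TM r (h z)" if "z \<in> carrier A.TM" for r z
    using that
  proof (induction z rule: A.TM_induct)
    case (pure x y)
    then show ?case by (simp add: A.tensor_module_spec(3) B.tensor_module_spec(3) h2 up ucl)
  next
    case (add v w)
    then show ?case by (simp add: A.TM.p_radd B.TM.p_radd additive_add[OF hadd] hcl)
  qed
  then have 1: "p_linear A.TM (act_poly (t * t') A.TM) B.TM (act_poly (t * t') B.TM) h"
    using hadd by (simp add: p_linear_def)
  have 2: "h \<in> gwa_hom (t * t') A.TM B.TM" if uh: "u \<in> gwa_hom t M M1"
  proof (rule gwa_homI[OF A.tensor_module_spec(2) B.tensor_module_spec(2)])
    fix z x assume z: "z \<in> carrier A.TM" and x: "x \<in> {Gen_Xp, Gen_Xm}"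
    then have xz: "x \<noteq> Gen_z" by auto
    show "h (act_gen (t * t') A.TM x z) = act_gen (t * t') B.TM x (h z)"
      using z
    proof (induction z rule: A.TM_induct)
      case (pure v w)
      then show ?case using xz
        by (simp add: A.tensor_module_spec(4) B.tensor_module_spec(4) h2 ucl gwa_homD(4)[OF uh])
    next
      case (add v w)
      then show ?case using xz
        by (simp add: A.TM.X_add B.TM.X_add additive_add[OF hadd] hcl)
    qed
  qed (use 1 in \<open>auto simp: p_linear_def additive_def\<close>)
  show ?thesis
    using 1 2 h2 unfolding A.TM_def B.TM_def tpure_def by blast
qed

text \<open>The splitting equations hold on pure tensors and are additive. Linearity over A(tt') is
  a separate implication for each map, since an exact sequence supplies it for two of the maps and a
  direct sum for all four.\<close>

lemma tensor_splitting:
  assumes L: "left_module (gwa t) M" "left_module (gwa t) M''" "left_module (gwa t) M'" "left_module (gwa t') N"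
    and f: "p_linear M (act_poly t M) M'' (act_poly t M'') f"
    and g: "p_linear M'' (act_poly t M'') M' (act_poly t M') g"
    and s: "p_linear M' (act_poly t M') M'' (act_poly t M'') s"
    and r: "p_linear M'' (act_poly t M'') M (act_poly t M) r"
    and sp: "splitting M M'' M' f g s r"
  shows "\<exists>F G S R. splitting (tens t M t' N) (tens t M'' t' N) (tens t M' t' N) F G S R
    \<and> additive (tens t M' t' N) (tens t M'' t' N) S \<and> additive (tens t M'' t' N) (tens t M t' N) R
    \<and> (f \<in> gwa_hom t M M'' \<longrightarrow> F \<in> gwa_hom (t * t') (tens t M t' N) (tens t M'' t' N))
    \<and> (g \<in> gwa_hom t M'' M' \<longrightarrow> G \<in> gwa_hom (t * t') (tens t M'' t' N) (tens t M' t' N))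
    \<and> (s \<in> gwa_hom t M' M'' \<longrightarrow> S \<in> gwa_hom (t * t') (tens t M' t' N) (tens t M'' t' N))
    \<and> (r \<in> gwa_hom t M'' M \<longrightarrow> R \<in> gwa_hom (t * t') (tens t M'' t' N) (tens t M t' N))"
proof -
  interpret A: tensor_modules t M t' N using L by (intro tensor_modules.intro)
  interpret B: tensor_modules t M'' t' N using L by (intro tensor_modules.intro)
  interpret C: tensor_modules t M' t' N using L by (intro tensor_modules.intro)
  obtain F where F: "p_linear A.TM (act_poly (t * t') A.TM) B.TM (act_poly (t * t') B.TM) F"
    "\<And>x y. x \<in> carrier M \<Longrightarrow> y \<in> carrier N \<Longrightarrow> F (A.pur x y) = B.pur (f x) y"
    "f \<in> gwa_hom t M M'' \<Longrightarrow> F \<in> gwa_hom (t * t') A.TM B.TM"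
    using tensor_map[OF L(1,2,4) f] unfolding A.TM_def B.TM_def tpure_def by blast
  obtain G where G: "p_linear B.TM (act_poly (t * t') B.TM) C.TM (act_poly (t * t') C.TM) G"
    "\<And>x y. x \<in> carrier M'' \<Longrightarrow> y \<in> carrier N \<Longrightarrow> G (B.pur x y) = C.pur (g x) y"
    "g \<in> gwa_hom t M'' M' \<Longrightarrow> G \<in> gwa_hom (t * t') B.TM C.TM"
    using tensor_map[OF L(2,3,4) g] unfolding C.TM_def B.TM_def tpure_def by blast
  obtain S where S: "p_linear C.TM (act_poly (t * t') C.TM) B.TM (act_poly (t * t') B.TM) S"
    "\<And>x y. x \<in> carrier M' \<Longrightarrow> y \<in> carrier N \<Longrightarrow> S (C.pur x y) = B.pur (s x) y"
    "s \<in> gwa_hom t M' M'' \<Longrightarrow> S \<in> gwa_hom (t * t') C.TM B.TM"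
    using tensor_map[OF L(3,2,4) s] unfolding C.TM_def B.TM_def tpure_def by blast
  obtain R where R: "p_linear B.TM (act_poly (t * t') B.TM) A.TM (act_poly (t * t') A.TM) R"
    "\<And>x y. x \<in> carrier M'' \<Longrightarrow> y \<in> carrier N \<Longrightarrow> R (B.pur x y) = A.pur (r x) y"
    "r \<in> gwa_hom t M'' M \<Longrightarrow> R \<in> gwa_hom (t * t') B.TM A.TM"
    using tensor_map[OF L(2,1,4) r] unfolding A.TM_def B.TM_def tpure_def by blast
  have add: "additive A.TM B.TM F" "additive B.TM C.TM G" "additive C.TM B.TM S" "additive B.TM A.TM R"
    using F G S R by (auto simp: p_linear_def)
  note addS = additive_add[OF add(1)] additive_add[OF add(2)] additive_add[OF add(3)] additive_add[OF add(4)]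
    additive_closed[OF add(1)] additive_closed[OF add(2)] additive_closed[OF add(3)] additive_closed[OF add(4)]
  have cl: "\<And>x. x \<in> carrier M \<Longrightarrow> f x \<in> carrier M''" "\<And>x. x \<in> carrier M'' \<Longrightarrow> g x \<in> carrier M'"
     "\<And>x. x \<in> carrier M' \<Longrightarrow> s x \<in> carrier M''" "\<And>x. x \<in> carrier M'' \<Longrightarrow> r x \<in> carrier M"
    using f g s r by (auto simp: p_linear_def additive_def)
  have "splitting A.TM B.TM C.TM F G S R"
    unfolding splitting_def
  proof (intro conjI ballI)
    fix z assume "z \<in> carrier A.TM"
    then show "R (F z) = z"
    proof (induction z rule: A.TM_induct)
      case (pure x y)
      then show ?case using sp cl by (simp add: F(2) R(2) splitting_def)
    next
      case (add u v)
      then show ?case by (simp only: addS)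
    qed
  next
    fix z assume "z \<in> carrier C.TM"
    then show "G (S z) = z"
    proof (induction z rule: C.TM_induct)
      case (pure x y)
      then show ?case using sp cl by (simp add: G(2) S(2) splitting_def)
    next
      case (add u v)
      then show ?case by (simp only: addS)
    qed
  next
    fix z assume "z \<in> carrier B.TM"
    then show "F (R z) \<oplus>\<^bsub>B.TM\<^esub> S (G z) = z"
    proof (induction z rule: B.TM_induct)
      case (pure x y)
      then have "F (R (B.pur x y)) \<oplus>\<^bsub>B.TM\<^esub> S (G (B.pur x y)) = B.pur (f (r x)) y \<oplus>\<^bsub>B.TM\<^esub> B.pur (s (g x)) y"
        using cl by (simp add: F(2) R(2) G(2) S(2))
      also have "\<dots> = B.pur (f (r x) \<oplus>\<^bsub>M''\<^esub> s (g x)) y"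
        using pure cl by (intro additive_add[OF B.pur_additive(1), symmetric]) auto
      finally show ?case using sp pure by (simp add: splitting_def)
    next
      case (add u v)
      have "F (R (u \<oplus>\<^bsub>B.TM\<^esub> v)) \<oplus>\<^bsub>B.TM\<^esub> S (G (u \<oplus>\<^bsub>B.TM\<^esub> v))
        = (F (R u) \<oplus>\<^bsub>B.TM\<^esub> S (G u)) \<oplus>\<^bsub>B.TM\<^esub> (F (R v) \<oplus>\<^bsub>B.TM\<^esub> S (G v))"
        using add(1,2) addS by (simp add: B.TM.a_ac)
      then show ?case using add(3,4) by (simp only:)
    qed
  qed
  then show ?thesis
    using F(3) G(3) S(3) R(3) add(3,4) unfolding A.TM_def B.TM_def C.TM_def by blast
qed

lemma left_module_tens:
  "left_module (gwa t) M \<Longrightarrow> left_module (gwa t') N \<Longrightarrow> left_module (gwa (t * t')) (tens t M t' N)"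
  using tensor_modules.tensor_module_spec(2)[unfolded tensor_modules.TM_def]
  by (metis tensor_modules.TM_def tensor_modules.intro)

lemma tensor_exact:
  assumes "short_exact t M M'' M'" "graded t M" "graded t M''" "graded t M'" "graded t' N"
  shows "short_exact (t * t') (tens t M t' N) (tens t M'' t' N) (tens t M' t' N)"
proof -
  have L: "left_module (gwa t) M" "left_module (gwa t) M''" "left_module (gwa t) M'" "left_module (gwa t') N"
    using assms by (auto simp: graded_def)
  have ab: "abelian_group (tens t X t' N)" if "left_module (gwa t) X" for X :: "'z gwa_module"
    using left_module_tens[OF that L(4)] by (simp add: left_module_def)
  obtain f g s r where 1: "f \<in> gwa_hom t M M''" "g \<in> gwa_hom t M'' M'"
     "p_linear M' (act_poly t M') M'' (act_poly t M'') s"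
     "p_linear M'' (act_poly t M'') M (act_poly t M) r" "splitting M M'' M' f g s r"
    using short_exact_splitting[OF assms(1-4)] by blast
  show ?thesis
    using tensor_splitting[OF L gwa_hom_p_linear[OF 1(1)] gwa_hom_p_linear[OF 1(2)] 1(3-5)] 1(1,2)
      splitting_short_exact(1)[OF _ _ _ _ _ ab[OF L(1)]] 
    by (metis L(1-4) left_module_def left_module_tens splitting_short_exact(1))
qed

text \<open>The isomorphism is rewritten as a splitting by four maps linear over A(t), to which the
  tensor functor is applied.\<close>

lemma tensor_direct_sum:
  assumes iso: "gwa_iso t M'' (direct_sum M M')"
    and L: "left_module (gwa t) M" "left_module (gwa t) M''" "left_module (gwa t) M'" "left_module (gwa t') N"
  shows "gwa_iso (t * t') (tens t M'' t' N) (direct_sum (tens t M t' N) (tens t M' t' N))"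
proof -
  obtain h where h: "h \<in> gwa_hom t M'' (direct_sum M M')" "bij_betw h (carrier M'') (carrier (direct_sum M M'))"
    using iso by (auto simp: gwa_iso_def)
  let ?k = "inv_into (carrier M'') h"
  have k: "?k \<in> gwa_hom t (direct_sum M M') M''" by (rule gwa_hom_inverse[OF h L(2)])
  have hk: "h (?k z) = z" if "z \<in> carrier (direct_sum M M')" for z
    using h(2) that by (simp add: bij_betw_def f_inv_into_f del: direct_sum_simps)
  have kh: "?k (h z) = z" if "z \<in> carrier M''" for z
    using h(2) that by (simp add: bij_betw_def)
  note ds = direct_sum_splitting[OF L(1,3)]
  let ?f = "\<lambda>x. ?k (x, \<zero>\<^bsub>M'\<^esub>)" and ?g = "\<lambda>z. snd (h z)" and ?s = "\<lambda>y. ?k (\<zero>\<^bsub>M\<^esub>, y)" and ?r = "\<lambda>z. fst (h z)"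
  have f: "?f \<in> gwa_hom t M M''" and g: "?g \<in> gwa_hom t M'' M'"
    and s: "?s \<in> gwa_hom t M' M''" and r: "?r \<in> gwa_hom t M'' M"
    using gwa_hom_comp[OF ds(1) k] gwa_hom_comp[OF h(1) ds(2)] gwa_hom_comp[OF ds(3) k] gwa_hom_comp[OF h(1) ds(4)] by auto
  interpret M: left_module "gwa t" M by fact
  interpret M': left_module "gwa t" M' by fact
  have sp: "splitting M M'' M' ?f ?g ?s ?r"
    unfolding splitting_def
  proof (intro conjI ballI)
    fix z assume z: "z \<in> carrier M''"
    have hz: "h z \<in> carrier (direct_sum M M')" by (rule gwa_homD(1)[OF h(1) z])
    then have hz': "fst (h z) \<in> carrier M" "snd (h z) \<in> carrier M'" by (auto simp: mem_Times_iff)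
    have "?f (?r z) \<oplus>\<^bsub>M''\<^esub> ?s (?g z) = ?k ((fst (h z), \<zero>\<^bsub>M'\<^esub>) \<oplus>\<^bsub>direct_sum M M'\<^esub> (\<zero>\<^bsub>M\<^esub>, snd (h z)))"
      using hz' by (intro gwa_homD(2)[OF k, symmetric]) auto
    also have "\<dots> = ?k (h z)" using hz' by simp
    finally show "?f (?r z) \<oplus>\<^bsub>M''\<^esub> ?s (?g z) = z" using kh[OF z] by simp
  qed (use hk in auto)
  obtain F G S R where 2: "splitting (tens t M t' N) (tens t M'' t' N) (tens t M' t' N) F G S R"
    "F \<in> gwa_hom (t * t') (tens t M t' N) (tens t M'' t' N)"
    "G \<in> gwa_hom (t * t') (tens t M'' t' N) (tens t M' t' N)"
    "S \<in> gwa_hom (t * t') (tens t M' t' N) (tens t M'' t' N)"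
    "R \<in> gwa_hom (t * t') (tens t M'' t' N) (tens t M t' N)"
    using tensor_splitting[OF L gwa_hom_p_linear[OF f] gwa_hom_p_linear[OF g] gwa_hom_p_linear[OF s]
        gwa_hom_p_linear[OF r] sp] f g s r by blast
  show ?thesis
    by (rule splitting_iso_direct_sum[OF 2(2-5) 2(1)]) (intro left_module_tens L)+
qed

lemma tensor_iso:
  assumes iso: "gwa_iso t M M1" and L: "left_module (gwa t) M" "left_module (gwa t) M1" "left_module (gwa t') N"
  shows "gwa_iso (t * t') (tens t M t' N) (tens t M1 t' N)"
proof -
  interpret A: tensor_modules t M t' N using L by (intro tensor_modules.intro)
  interpret B: tensor_modules t M1 t' N using L by (intro tensor_modules.intro)
  obtain h where h: "h \<in> gwa_hom t M M1" "bij_betw h (carrier M) (carrier M1)"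
    using iso by (auto simp: gwa_iso_def)
  let ?k = "inv_into (carrier M) h"
  have k: "?k \<in> gwa_hom t M1 M" by (rule gwa_hom_inverse[OF h L(1)])
  have hk: "h (?k z) = z" if "z \<in> carrier M1" for z
    using h(2) that by (simp add: bij_betw_def f_inv_into_f)
  have kh: "?k (h z) = z" if "z \<in> carrier M" for z
    using h(2) that by (simp add: bij_betw_def)
  obtain F where F: "F \<in> gwa_hom (t * t') A.TM B.TM"
    "\<And>x y. x \<in> carrier M \<Longrightarrow> y \<in> carrier N \<Longrightarrow> F (A.pur x y) = B.pur (h x) y"
    using tensor_map[OF L gwa_hom_p_linear[OF h(1)]] h(1) unfolding A.TM_def B.TM_def tpure_def by blast
  obtain G where G: "G \<in> gwa_hom (t * t') B.TM A.TM"
    "\<And>x y. x \<in> carrier M1 \<Longrightarrow> y \<in> carrier N \<Longrightarrow> G (B.pur x y) = A.pur (?k x) y"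
    using tensor_map[OF L(2,1,3) gwa_hom_p_linear[OF k]] k unfolding A.TM_def B.TM_def tpure_def by blast
  note c = gwa_homD(1)[OF F(1)] gwa_homD(1)[OF G(1)] gwa_homD(2)[OF F(1)] gwa_homD(2)[OF G(1)]
    gwa_homD(1)[OF h(1)] gwa_homD(1)[OF k]
  have "gwa_iso (t * t') A.TM B.TM"
  proof (rule gwa_isoI[OF F(1) G(1)])
    show "G (F z) = z" if "z \<in> carrier A.TM" for z
      using that
    proof (induction z rule: A.TM_induct)
      case (pure x y)
      then show ?case using F(2) G(2) c(5) kh by simp
    next
      case (add u v)
      then show ?case by (simp only: c)
    qed
    show "F (G z) = z" if "z \<in> carrier B.TM" for z
      using that
    proof (induction z rule: B.TM_induct)
      case (pure x y)
      then show ?case using F(2) G(2) c(6) hk by simp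
    next
      case (add u v)
      then show ?case by (simp only: c)
    qed
  qed
  then show ?thesis unfolding A.TM_def B.TM_def .
qed

text \<open>Reduces statements about the second factor to the first. The swapped product is a module
  over A(t't), which is A(tt') because polynomials commute.\<close>

lemma tensor_swap:
  assumes L: "left_module (gwa t) M" "left_module (gwa t') N"
  shows "gwa_iso (t * t') (tens t M t' N) (tens t' N t M)"
proof -
  have ex: "\<exists>h. h \<in> gwa_hom (t * t') (tens t M t' N) (tens t' N t M)
    \<and> (\<forall>x\<in>carrier M. \<forall>y\<in>carrier N. h (tpure t M t' N x y) = tpure t' N t M y x)"
    if L: "left_module (gwa t) M" "left_module (gwa t') N" for t t' and M :: "'x gwa_module" and N :: "'y gwa_module"
  proof -
    interpret A: tensor_modules t M t' N using L by (intro tensor_modules.intro)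
    interpret B: tensor_modules t' N t M using L by (intro tensor_modules.intro)
    note spB = B.tensor_module_spec[unfolded mult.commute[of t' t]]
    interpret BT: gwa_act B.TM "act_poly (t * t') B.TM" "t * t'" "act_gen (t * t') B.TM"
      by (rule left_module_imp_gwa_act[OF spB(2)])
    have bi: "bihom (add_group M) (add_group N) B.tp.T (\<lambda>x y. B.pur y x)"
      using bihomD[OF B.tp.pure_bihom] by (auto simp: bihom_def)
    obtain h where h: "h \<in> hom A.tp.T B.tp.T"
      "\<And>x y. x \<in> carrier (add_group M) \<Longrightarrow> y \<in> carrier (add_group N) \<Longrightarrow> h (A.pur x y) = B.pur y x"
      by (rule A.tp.T_universal[OF B.tp.T_comm bi]) (use B.tp.pure_balanced[symmetric] in auto)
    have h2: "h (A.pur x y) = B.pur y x" if "x \<in> carrier M" "y \<in> carrier N" for x y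
      using h(2) that by simp
    have hadd: "additive A.TM B.TM h"
      using h(1) by (auto simp: additive_def hom_def A.TM_simps B.TM_simps)
    note hcl = additive_closed[OF hadd]
    have "h \<in> gwa_hom (t * t') A.TM B.TM"
    proof (rule gwa_homI[OF A.tensor_module_spec(2) spB(2)])
      fix z r assume z: "z \<in> carrier A.TM"
      show "h (act_poly (t * t') A.TM r z) = act_poly (t * t') B.TM r (h z)"
        using z
      proof (induction z rule: A.TM_induct)
        case (pure x y)
        then show ?case using B.tp.pure_balanced[of y x r]
          by (simp add: A.tensor_module_spec(3) spB(3) h2)
      next
        case (add v w)
        then show ?case by (simp add: A.TM.p_radd BT.p_radd additive_add[OF hadd] hcl)
      qed
    next
      fix z x assume z: "z \<in> carrier A.TM" and x: "x \<in> {Gen_Xp, Gen_Xm}"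
      then have xz: "x \<noteq> Gen_z" by auto
      show "h (act_gen (t * t') A.TM x z) = act_gen (t * t') B.TM x (h z)"
        using z
      proof (induction z rule: A.TM_induct)
        case (pure v w)
        then show ?case using xz by (simp add: A.tensor_module_spec(4) spB(4) h2)
      next
        case (add v w)
        then show ?case using xz
          by (simp add: A.TM.X_add BT.X_add additive_add[OF hadd] hcl)
      qed
    qed (use hadd in \<open>auto simp: additive_def\<close>)
    then show ?thesis using h2 unfolding A.TM_def B.TM_def tpure_def by blast
  qed
  interpret A: tensor_modules t M t' N using L by (intro tensor_modules.intro)
  interpret B: tensor_modules t' N t M using L by (intro tensor_modules.intro)
  obtain F where F: "F \<in> gwa_hom (t * t') A.TM B.TM"
    "\<And>x y. x \<in> carrier M \<Longrightarrow> y \<in> carrier N \<Longrightarrow> F (A.pur x y) = B.pur y x"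
    using ex[OF L] unfolding A.TM_def B.TM_def tpure_def by blast
  obtain G where G: "G \<in> gwa_hom (t * t') B.TM A.TM"
    "\<And>x y. x \<in> carrier M \<Longrightarrow> y \<in> carrier N \<Longrightarrow> G (B.pur y x) = A.pur x y"
    using ex[OF L(2,1)] unfolding A.TM_def B.TM_def tpure_def mult.commute[of t' t] by blast
  note c = gwa_homD(1)[OF F(1)] gwa_homD(1)[OF G(1)] gwa_homD(2)[OF F(1)] gwa_homD(2)[OF G(1)]
  have "gwa_iso (t * t') A.TM B.TM"
  proof (rule gwa_isoI[OF F(1) G(1)])
    show "G (F z) = z" if "z \<in> carrier A.TM" for z
      using that
    proof (induction z rule: A.TM_induct)
      case (pure x y)
      then show ?case using F(2) G(2) by simp
    next
      case (add u v)
      then show ?case by (simp only: c)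
    qed
    show "F (G z) = z" if "z \<in> carrier B.TM" for z
      using that
    proof (induction z rule: B.TM_induct)
      case (pure x y)
      then show ?case using F(2) G(2) by simp
    next
      case (add u v)
      then show ?case by (simp only: c)
    qed
  qed
  then show ?thesis unfolding A.TM_def B.TM_def .
qed

section \<open>Transport along isomorphisms and return to the fixed universe\<close>

lemma (in poly_act) p_linear_lin_span:
  assumes f: "p_linear M p N q f" and N: "poly_act N q" and B: "B \<subseteq> carrier M" "finite B"
    and D: "f ` B \<subseteq> D" "D \<subseteq> carrier N" "finite D" and v: "v \<in> lin_span M p B"
  shows "f v \<in> lin_span N q D"
proof -
  interpret N: poly_act N q by fact
  have add: "additive M N f" and fp: "\<And>r v. v \<in> carrier M \<Longrightarrow> f (p r v) = q r (f v)"
    using f by (auto simp: p_linear_def)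
  obtain c where c: "v = lin_comb M p B c" using v by (auto simp: lin_span_def)
  have "f v = (\<Oplus>\<^bsub>N\<^esub>b\<in>B. f (p [:c b:] b))"
    unfolding c lin_comb_def using B
    by (intro additive_finsum[OF add abelian_group_axioms N.abelian_group_axioms]) auto
  moreover have "f (p [:c b:] b) \<in> lin_span N q D" if "b \<in> B" for b
  proof -
    have "f b \<in> lin_span N q D" by (rule N.lin_span_facts(3)[OF D(2,3)]) (use that D in auto)
    from N.lin_span_facts(2)[OF D(2,3) this] show ?thesis using fp B that by auto
  qed
  ultimately show ?thesis
    using N.lin_span_facts(5)[OF D(2,3) B(2), of "\<lambda>b. f (p [:c b:] b)"] by auto
qed

lemma (in poly_act) p_linear_wt_span:
  assumes f: "p_linear M p N q f" and N: "poly_act N q" and v: "v \<in> wt_span M p"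
  shows "f v \<in> wt_span N q"
  using v
proof induction
  case (wt v n)
  show ?case by (rule wt_span.wt[OF p_linear_wt[OF f N wt]])
next
  case (add v w)
  have "additive M N f" using f by (simp add: p_linear_def)
  from additive_add[OF this wt_span_carrier[OF add(1)] wt_span_carrier[OF add(2)]]
  show ?case using wt_span.add[OF add(3,4)] by simp
qed

lemma graded_direct_sum:
  assumes gM: "graded t M" and gN: "graded t N"
  shows "graded t (direct_sum M N)"
proof -
  have L: "left_module (gwa t) M" "left_module (gwa t) N" using gM gN by (auto simp: graded_def)
  let ?D = "direct_sum M N"
  have LD: "left_module (gwa t) ?D" by (rule left_module_direct_sum[OF L])
  let ?p = "act_poly t M" and ?q = "act_poly t N" and ?d = "act_poly t ?D"
  interpret M: wt_act M ?p using gM by (auto simp: graded_def)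
  interpret N: wt_act N ?q using gN by (auto simp: graded_def)
  interpret D: gwa_act ?D ?d t "act_gen t ?D" by (rule left_module_imp_gwa_act[OF LD])
  let ?f = "\<lambda>x. (x, \<zero>\<^bsub>N\<^esub>)" and ?s = "\<lambda>y. (\<zero>\<^bsub>M\<^esub>, y)"
  note ds = direct_sum_splitting[OF L]
  note pl = gwa_hom_p_linear[OF ds(1)] gwa_hom_p_linear[OF ds(2)] gwa_hom_p_linear[OF ds(3)] gwa_hom_p_linear[OF ds(4)]
  have W: "wt_act ?D ?d"
  proof unfold_locales
    fix z assume z: "z \<in> carrier ?D"
    have "?f (fst z) \<oplus>\<^bsub>?D\<^esub> ?s (snd z) \<in> wt_span ?D ?d"
      using z M.p_linear_wt_span[OF pl(1) D.poly_act_axioms M.spans]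
        N.p_linear_wt_span[OF pl(3) D.poly_act_axioms N.spans]
      by (intro wt_span.add) auto
    then show "z \<in> wt_span ?D ?d" using z by (auto simp: mem_Times_iff)
  qed
  have "fin_dim ?D ?d (wt_space ?D ?d n)" for n
  proof -
    obtain B where B: "finite B" "B \<subseteq> wt_space M ?p n" "wt_space M ?p n \<subseteq> lin_span M ?p B"
      using gM unfolding graded_def fin_dim_iff by blast
    obtain C where C: "finite C" "C \<subseteq> wt_space N ?q n" "wt_space N ?q n \<subseteq> lin_span N ?q C"
      using gN unfolding graded_def fin_dim_iff by blast
    let ?E = "?f ` B \<union> ?s ` C"
    have BM: "B \<subseteq> carrier M" "C \<subseteq> carrier N" using B C M.wt_spaceD N.wt_spaceD by blast+
    have E: "?E \<subseteq> wt_space ?D ?d n" 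
    proof -
      have "?f b \<in> wt_space ?D ?d n" if "b \<in> B" for b
        by (rule M.p_linear_wt[OF pl(1) D.poly_act_axioms]) (use B that in auto)
      moreover have "?s b \<in> wt_space ?D ?d n" if "b \<in> C" for b
        by (rule N.p_linear_wt[OF pl(3) D.poly_act_axioms]) (use C that in auto)
      ultimately show ?thesis by blast
    qed
    have Ef: "finite ?E" using B C by simp
    have Ec: "?E \<subseteq> carrier ?D" using BM by auto
    have "z \<in> lin_span ?D ?d ?E" if z: "z \<in> wt_space ?D ?d n" for z
    proof -
      have zc: "fst z \<in> carrier M" "snd z \<in> carrier N" using D.wt_spaceD[OF z] by (auto simp: mem_Times_iff)
      have 1: "fst z \<in> lin_span M ?p B"
        using D.p_linear_wt[OF pl(4) M.poly_act_axioms z] B(3) by blast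
      have 2: "snd z \<in> lin_span N ?q C"
        using D.p_linear_wt[OF pl(2) N.poly_act_axioms z] C(3) by blast
      have 3: "?f (fst z) \<in> lin_span ?D ?d ?E"
        by (rule M.p_linear_lin_span[OF pl(1) D.poly_act_axioms BM(1) B(1) _ Ec Ef 1]) auto
      have 4: "?s (snd z) \<in> lin_span ?D ?d ?E"
        by (rule N.p_linear_lin_span[OF pl(3) D.poly_act_axioms BM(2) C(1) _ Ec Ef 2]) auto
      from D.lin_span_facts(1)[OF Ec Ef 3 4] zc show ?thesis by simp
    qed
    then show ?thesis unfolding fin_dim_iff using E Ef by blast
  qed
  with W LD show ?thesis by (auto simp: graded_def)
qed

lemma direct_sum_iso:
  assumes "gwa_iso t M M1" "gwa_iso t N N1"
  shows "gwa_iso t (direct_sum M N) (direct_sum M1 N1)"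
proof -
  obtain f g where f: "f \<in> gwa_hom t M M1" "bij_betw f (carrier M) (carrier M1)"
    and g: "g \<in> gwa_hom t N N1" "bij_betw g (carrier N) (carrier N1)"
    using assms by (auto simp: gwa_iso_def)
  have "map_prod f g \<in> gwa_hom t (direct_sum M N) (direct_sum M1 N1)"
    using f(1) g(1) by (auto simp: gwa_hom_def)
  moreover have "bij_betw (map_prod f g) (carrier (direct_sum M N)) (carrier (direct_sum M1 N1))"
    using f(2) g(2) by (auto intro: bij_betw_map_prod)
  ultimately show ?thesis by (auto simp: gwa_iso_def)
qed

text \<open>The two maps are conjugated by the isomorphisms. An exact sequence of tensor products or
  of explicit models can thus be traded for one of objects on the universe.\<close>

lemma short_exact_iso:
  assumes se: "short_exact t M M'' M'" and iso: "gwa_iso t K M" "gwa_iso t K'' M''" "gwa_iso t K' M'"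
    and L: "left_module (gwa t) K" "left_module (gwa t) K''" "left_module (gwa t) K'"
      "left_module (gwa t) M" "left_module (gwa t) M''" "left_module (gwa t) M'"
  shows "short_exact t K K'' K'"
proof -
  obtain f g where fg: "f \<in> gwa_hom t M M''" "g \<in> gwa_hom t M'' M'"
    "inj_on f (carrier M)" "g ` carrier M'' = carrier M'" "f ` carrier M = {x \<in> carrier M''. g x = \<zero>\<^bsub>M'\<^esub>}"
    using se by (auto simp: short_exact_def)
  obtain a where a: "a \<in> gwa_hom t K M" "bij_betw a (carrier K) (carrier M)" using iso by (auto simp: gwa_iso_def)
  obtain b where b: "b \<in> gwa_hom t K'' M''" "bij_betw b (carrier K'') (carrier M'')" using iso by (auto simp: gwa_iso_def)
  obtain c where c: "c \<in> gwa_hom t K' M'" "bij_betw c (carrier K') (carrier M')" using iso by (auto simp: gwa_iso_def)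
  let ?b = "inv_into (carrier K'') b" and ?c = "inv_into (carrier K') c"
  have b': "?b \<in> gwa_hom t M'' K''" by (rule gwa_hom_inverse[OF b L(2)])
  have c': "?c \<in> gwa_hom t M' K'" by (rule gwa_hom_inverse[OF c L(3)])
  have bb: "bij_betw ?b (carrier M'') (carrier K'')" "bij_betw ?c (carrier M') (carrier K')"
    using b c by (auto intro: bij_betw_inv_into)
  have inv: "\<And>x. x \<in> carrier K'' \<Longrightarrow> ?b (b x) = x" "\<And>x. x \<in> carrier M'' \<Longrightarrow> b (?b x) = x"
    "\<And>x. x \<in> carrier K' \<Longrightarrow> ?c (c x) = x" "\<And>x. x \<in> carrier M' \<Longrightarrow> c (?c x) = x"
    using b c by (auto simp: bij_betw_def f_inv_into_f)
  let ?f = "\<lambda>x. ?b (f (a x))" and ?g = "\<lambda>x. ?c (g (b x))"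
  have ab: "abelian_group M'" "abelian_group K'" using L by (auto simp: left_module_def)
  have c0: "c \<zero>\<^bsub>K'\<^esub> = \<zero>\<^bsub>M'\<^esub>" 
    using gwa_hom_p_linear[OF c(1)] additive_zero[OF _ ab(2,1)] by (auto simp: p_linear_def)
  have c0': "?c \<zero>\<^bsub>M'\<^esub> = \<zero>\<^bsub>K'\<^esub>" 
    using gwa_hom_p_linear[OF c'] additive_zero[OF _ ab(1,2)] by (auto simp: p_linear_def)
  have homs: "?f \<in> gwa_hom t K K''" "?g \<in> gwa_hom t K'' K'"
    using gwa_hom_comp[OF gwa_hom_comp[OF a(1) fg(1)] b'] gwa_hom_comp[OF gwa_hom_comp[OF b(1) fg(2)] c'] by auto
  have im: "a ` carrier K = carrier M" "b ` carrier K'' = carrier M''" "?b ` carrier M'' = carrier K''" "?c ` carrier M' = carrier K'"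
    using a b bb by (auto simp: bij_betw_def)
  have "inj_on ?f (carrier K)"
  proof (rule inj_onI)
    fix x y assume xy: "x \<in> carrier K" "y \<in> carrier K" "?f x = ?f y"
    have "f (a x) = f (a y)"
      using xy(3) inv(2)[of "f (a x)"] inv(2)[of "f (a y)"] gwa_homD(1)[OF fg(1)] gwa_homD(1)[OF a(1)] xy(1,2) by metis
    then show "x = y" using fg(3) a xy gwa_homD(1)[OF a(1)] by (auto simp: bij_betw_def dest: inj_onD)
  qed
  moreover have "?g ` carrier K'' = carrier K'"
    using im fg(4) by (metis (no_types) image_image)
  moreover have "?f ` carrier K = {x \<in> carrier K''. ?g x = \<zero>\<^bsub>K'\<^esub>}"
  proof -
    have "?f ` carrier K = ?b ` f ` carrier M" using im by (metis (no_types) image_image)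
    also have "\<dots> = {x \<in> carrier K''. ?g x = \<zero>\<^bsub>K'\<^esub>}"
    proof (intro equalityI subsetI)
      fix y assume "y \<in> ?b ` f ` carrier M"
      then obtain x where x: "x \<in> carrier M''" "g x = \<zero>\<^bsub>M'\<^esub>" "y = ?b x" using fg(5) by auto
      then show "y \<in> {x \<in> carrier K''. ?g x = \<zero>\<^bsub>K'\<^esub>}" using inv(2)[OF x(1)] c0' gwa_homD(1)[OF b'] by simp
    next
      fix y assume y: "y \<in> {x \<in> carrier K''. ?g x = \<zero>\<^bsub>K'\<^esub>}"
      then have gb: "g (b y) \<in> carrier M'" using gwa_homD(1)[OF fg(2)] gwa_homD(1)[OF b(1)] by auto
      have "g (b y) = \<zero>\<^bsub>M'\<^esub>" using inv(4)[OF gb] y c0 by simp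
      then have "b y \<in> f ` carrier M" using y fg(5) gwa_homD(1)[OF b(1)] by auto
      then show "y \<in> ?b ` f ` carrier M" using inv(1)[of y] y by force
    qed
    finally show ?thesis .
  qed
  ultimately show ?thesis unfolding short_exact_def using homs by blast
qed

lemma ex_obj_tensor:
  assumes "M \<in> objs t" "N \<in> objs t'"
  shows "\<exists>K\<in>objs (t * t'). gwa_iso (t * t') K (tens t M t' N)
    \<and> iso_class (t * t') K = iso_class (t * t') (tens t M t' N)"
proof -
  interpret tensor_modules t M t' N using assms by (intro tensor_modules.intro left_module_obj)
  obtain j :: "(universe \<times> universe \<Rightarrow>\<^sub>0 int) \<Rightarrow> universe" where j: "inj j" using inj_frags_universe by blast
  \<comment> \<open>A chosen representative determines its coset, so the quotient embeds wherever
    the free group does.\<close>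
  define rep where "rep z = (SOME f. tp.quot.cls f = z)" for z
  have rep: "tp.quot.cls (rep z) = z" if "z \<in> carrier tp.T" for z
  proof -
    from that obtain f where "z = tp.quot.cls f" by (rule tp.quot.Q_cases)
    then show ?thesis unfolding rep_def by (metis (mono_tags) someI)
  qed
  have "inj_on (\<lambda>z. j (rep z)) (carrier TM)"
    by (rule inj_onI) (metis TM_simps(1) injD[OF j] rep)
  then have "\<exists>K\<in>objs (t * t'). gwa_iso (t * t') K TM \<and> iso_class (t * t') K = iso_class (t * t') TM"
    by (rule ex_obj[rotated]) (use assms in \<open>simp add: graded_tensor objs_iff\<close>)
  then show ?thesis by (simp add: TM_def)
qed

lemma ex_obj_direct_sum:
  assumes "M \<in> objs t" "N \<in> objs t"
  shows "\<exists>K\<in>objs t. gwa_iso t K (direct_sum M N) \<and> iso_class t K = iso_class t (direct_sum M N)"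
proof -
  obtain j :: "universe \<times> universe \<Rightarrow> universe" where j: "inj j" using inj_pairs_universe by blast
  then have "inj_on j (carrier (direct_sum M N))" by (auto intro: inj_on_subset)
  then show ?thesis
    by (rule ex_obj[rotated]) (use assms in \<open>simp add: graded_direct_sum objs_iff\<close>)
qed

section \<open>Relation families compatible with tensor products\<close>

type_synonym ext_rel = "complex poly \<Rightarrow> universe gwa_module \<Rightarrow> universe gwa_module \<Rightarrow> universe gwa_module \<Rightarrow> bool"

text \<open>The common part of the exact and the split case: relations come from a ternary predicate
  that is stable under tensoring. Stability is phrased for objects isomorphic to the tensor
  products, as these do not live on the universe themselves.\<close>

locale rel_fam =
  fixes E :: rel_family and ext :: ext_rel
  assumes E_eq: "E t = {frag_of (iso_class t M'') - frag_of (iso_class t M) - frag_of (iso_class t M') | M M'' M'.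
        M \<in> objs t \<and> M'' \<in> objs t \<and> M' \<in> objs t \<and> ext t M M'' M'}"
    and ext_tensor: "\<lbrakk>M \<in> objs t; M'' \<in> objs t; M' \<in> objs t; N \<in> objs t'; ext t M M'' M';
      K \<in> objs (t * t'); K'' \<in> objs (t * t'); K' \<in> objs (t * t');
      gwa_iso (t * t') K (tens t M t' N); gwa_iso (t * t') K'' (tens t M'' t' N);
      gwa_iso (t * t') K' (tens t M' t' N)\<rbrakk> \<Longrightarrow> ext (t * t') K K'' K'"

lemma rel_fam_exact: "rel_fam exact_rels short_exact"
proof
  show "exact_rels t = {frag_of (iso_class t M'') - frag_of (iso_class t M) - frag_of (iso_class t M') | M M'' M'.
        M \<in> objs t \<and> M'' \<in> objs t \<and> M' \<in> objs t \<and> short_exact t M M'' M'}" for t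
    by (simp add: exact_rels_def)
next
  fix M M'' M' N K K'' K' t t'
  assume o: "M \<in> objs t" "M'' \<in> objs t" "M' \<in> objs t" "N \<in> objs t'"
    and ext: "short_exact t M M'' M'" and K: "K \<in> objs (t * t')" "K'' \<in> objs (t * t')" "K' \<in> objs (t * t')"
    and iso: "gwa_iso (t * t') K (tens t M t' N)" "gwa_iso (t * t') K'' (tens t M'' t' N)"
      "gwa_iso (t * t') K' (tens t M' t' N)"
  have "short_exact (t * t') (tens t M t' N) (tens t M'' t' N) (tens t M' t' N)"
    by (rule tensor_exact[OF ext]) (use o in \<open>auto simp: objs_iff\<close>)
  from short_exact_iso[OF this iso] show "short_exact (t * t') K K'' K'"
    using o K by (auto intro!: left_module_tens left_module_obj)
qed

text \<open>In \<open>split_rels\<close> the middle term is the direct sum itself, which is not on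
  the universe. It has the isomorphism class of any object isomorphic to it, and this brings the
  relations into the form required by \<open>rel_fam\<close>.\<close>

lemma rel_fam_split: "rel_fam split_rels (\<lambda>t M M'' M'. gwa_iso t M'' (direct_sum M M'))"
proof
  fix t
  show "split_rels t = {frag_of (iso_class t M'') - frag_of (iso_class t M) - frag_of (iso_class t M') | M M'' M'.
        M \<in> objs t \<and> M'' \<in> objs t \<and> M' \<in> objs t \<and> gwa_iso t M'' (direct_sum M M')}" (is "_ = ?R")
  proof (intro equalityI subsetI)
    fix e assume "e \<in> split_rels t"
    then obtain M M' where e: "M \<in> objs t" "M' \<in> objs t"
      "e = frag_of (iso_class t (direct_sum M M')) - frag_of (iso_class t M) - frag_of (iso_class t M')"
      by (auto simp: split_rels_def)
    obtain K where K: "K \<in> objs t" "gwa_iso t K (direct_sum M M')" "iso_class t K = iso_class t (direct_sum M M')"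
      using ex_obj_direct_sum[OF e(1,2)] by blast
    have "e = frag_of (iso_class t K) - frag_of (iso_class t M) - frag_of (iso_class t M')" using e(3) K(3) by simp
    then show "e \<in> ?R" using e(1,2) K(1,2) by blast
  next
    fix e assume "e \<in> ?R"
    then obtain M M'' M' where e: "M \<in> objs t" "M' \<in> objs t" "M'' \<in> objs t" "gwa_iso t M'' (direct_sum M M')"
      "e = frag_of (iso_class t M'') - frag_of (iso_class t M) - frag_of (iso_class t M')" by auto
    have "iso_class t M'' = iso_class t (direct_sum M M')"
      by (rule iso_class_cong[OF e(4) left_module_obj[OF e(3)]])
    then show "e \<in> split_rels t" using e by (auto simp: split_rels_def)
  qed
next
  fix M M'' M' N K K'' K' t t'
  assume o: "M \<in> objs t" "M'' \<in> objs t" "M' \<in> objs t" "N \<in> objs t'"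
    and ext: "gwa_iso t M'' (direct_sum M M')" and K: "K \<in> objs (t * t')" "K'' \<in> objs (t * t')" "K' \<in> objs (t * t')"
    and iso: "gwa_iso (t * t') K (tens t M t' N)" "gwa_iso (t * t') K'' (tens t M'' t' N)"
      "gwa_iso (t * t') K' (tens t M' t' N)"
  have 1: "gwa_iso (t * t') (tens t M'' t' N) (direct_sum (tens t M t' N) (tens t M' t' N))"
    by (rule tensor_direct_sum[OF ext]) (use o in \<open>auto intro: left_module_obj\<close>)
  have 2: "gwa_iso (t * t') (direct_sum (tens t M t' N) (tens t M' t' N)) (direct_sum K K')"
    using iso K by (intro direct_sum_iso gwa_iso_sym[OF _ left_module_obj])
  from gwa_iso_trans[OF iso(2) gwa_iso_trans[OF 1 2]]
  show "gwa_iso (t * t') K'' (direct_sum K K')" .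
qed

lemma split_subset_exact: "split_rels t \<subseteq> exact_rels t"
proof
  fix e assume "e \<in> split_rels t"
  then obtain M M'' M' where e: "M \<in> objs t" "M' \<in> objs t" "M'' \<in> objs t" "gwa_iso t M'' (direct_sum M M')"
    "e = frag_of (iso_class t M'') - frag_of (iso_class t M) - frag_of (iso_class t M')"
    unfolding rel_fam.E_eq[OF rel_fam_split] by auto
  have L: "left_module (gwa t) M" "left_module (gwa t) M'" "left_module (gwa t) M''"
    using e by (auto intro: left_module_obj)
  note ds = direct_sum_splitting[OF L(1,2)]
  have LD: "left_module (gwa t) (direct_sum M M')" by (rule left_module_direct_sum[OF L(1,2)])
  have "short_exact t M (direct_sum M M') M'"
    using ds gwa_hom_p_linear[OF ds(3)] gwa_hom_p_linear[OF ds(4)] L LD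
    by (intro splitting_short_exact(1)[OF ds(1,2) _ _ ds(5)]) (auto simp: p_linear_def left_module_def)
  from short_exact_iso[OF this gwa_iso_refl e(4) gwa_iso_refl] L LD
  have "short_exact t M M'' M'" by simp
  then show "e \<in> exact_rels t" using e by (auto simp: exact_rels_def)
qed

section \<open>Bilinear maps on quotients, complexifications and direct sums\<close>

lemma bihomI:
  assumes "\<And>x y. x \<in> carrier G \<Longrightarrow> y \<in> carrier H \<Longrightarrow> \<beta> x y \<in> carrier K"
    "\<And>x x' y. x \<in> carrier G \<Longrightarrow> x' \<in> carrier G \<Longrightarrow> y \<in> carrier H \<Longrightarrow> \<beta> (x \<otimes>\<^bsub>G\<^esub> x') y = \<beta> x y \<otimes>\<^bsub>K\<^esub> \<beta> x' y"
    "\<And>x y y'. x \<in> carrier G \<Longrightarrow> y \<in> carrier H \<Longrightarrow> y' \<in> carrier H \<Longrightarrow> \<beta> x (y \<otimes>\<^bsub>H\<^esub> y') = \<beta> x y \<otimes>\<^bsub>K\<^esub> \<beta> x y'"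
  shows "bihom G H K \<beta>"
  using assms by (auto simp: bihom_def)

text \<open>One variable descends at a time: for each fixed f the second variable passes to its
  quotient, and then the first variable does so for each fixed class of the second.\<close>

lemma bihom_quotient:
  assumes q: "free_quotient S R" "free_quotient S' R'" and K: "comm_group K"
    and m: "bihom (free_Abelian_group S) (free_Abelian_group S') K m"
    and k1: "\<And>r f'. r \<in> R \<Longrightarrow> Poly_Mapping.keys f' \<subseteq> S' \<Longrightarrow> m r f' = \<one>\<^bsub>K\<^esub>"
    and k2: "\<And>f r'. Poly_Mapping.keys f \<subseteq> S \<Longrightarrow> r' \<in> R' \<Longrightarrow> m f r' = \<one>\<^bsub>K\<^esub>"
  shows "\<exists>\<mu>. bihom (free_Abelian_group S Mod generate (free_Abelian_group S) R)
        (free_Abelian_group S' Mod generate (free_Abelian_group S') R') K \<mu>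
    \<and> (\<forall>f f'. Poly_Mapping.keys f \<subseteq> S \<longrightarrow> Poly_Mapping.keys f' \<subseteq> S' \<longrightarrow>
        \<mu> (generate (free_Abelian_group S) R #>\<^bsub>free_Abelian_group S\<^esub> f)
          (generate (free_Abelian_group S') R' #>\<^bsub>free_Abelian_group S'\<^esub> f') = m f f')"
proof -
  interpret A: free_quotient S R by fact
  interpret B: free_quotient S' R' by fact
  have "\<exists>g. g \<in> hom B.Q K \<and> (\<forall>f'. Poly_Mapping.keys f' \<subseteq> S' \<longrightarrow> g (B.cls f') = m f f')"
    if "Poly_Mapping.keys f \<subseteq> S" for f
  proof -
    have "m f \<in> hom B.F K" using bihomD(5)[OF m] that by simp
    from B.universal[OF K this k2[OF that]] show ?thesis by blast
  qed
  then obtain g where g: "\<And>f. Poly_Mapping.keys f \<subseteq> S \<Longrightarrow> g f \<in> hom B.Q K"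
    "\<And>f f'. Poly_Mapping.keys f \<subseteq> S \<Longrightarrow> Poly_Mapping.keys f' \<subseteq> S' \<Longrightarrow> g f (B.cls f') = m f f'"
    by metis
  have "\<exists>h. h \<in> hom A.Q K \<and> (\<forall>f. Poly_Mapping.keys f \<subseteq> S \<longrightarrow> h (A.cls f) = g f z)"
    if z: "z \<in> carrier B.Q" for z
  proof -
    obtain f0 where f0: "Poly_Mapping.keys f0 \<subseteq> S'" "z = B.cls f0" using z by (rule B.Q_cases)
    have 1: "(\<lambda>f. m f f0) \<in> hom A.F K" using bihomD(4)[OF m] f0 by simp
    show ?thesis
    proof (rule A.universal[OF K 1 k1[OF _ f0(1)]])
      fix h assume "h \<in> hom A.Q K" "\<And>f. Poly_Mapping.keys f \<subseteq> S \<Longrightarrow> h (A.cls f) = m f f0"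
      then show ?thesis using g(2) f0 by (intro exI[of _ h]) simp
    qed
  qed
  then obtain h where h: "\<And>z. z \<in> carrier B.Q \<Longrightarrow> h z \<in> hom A.Q K"
    "\<And>z f. z \<in> carrier B.Q \<Longrightarrow> Poly_Mapping.keys f \<subseteq> S \<Longrightarrow> h z (A.cls f) = g f z"
    by metis
  interpret BQ: comm_group B.Q by (rule B.Q_comm)
  have "bihom A.Q B.Q K (\<lambda>x z. h z x)"
  proof (rule bihomI)
    fix x y y' assume x: "x \<in> carrier A.Q" and y: "y \<in> carrier B.Q" "y' \<in> carrier B.Q"
    obtain f where f: "Poly_Mapping.keys f \<subseteq> S" "x = A.cls f" using x by (rule A.Q_cases)
    show "h (y \<otimes>\<^bsub>B.Q\<^esub> y') x = h y x \<otimes>\<^bsub>K\<^esub> h y' x"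
      using h(2)[OF BQ.m_closed[OF y] f(1)] h(2)[OF y(1) f(1)] h(2)[OF y(2) f(1)] hom_mult[OF g(1)[OF f(1)] y] f(2)
      by simp
  qed (auto intro: hom_in_carrier[OF h(1)] hom_mult[OF h(1)] simp del: mult_FactGroup)
  moreover have "h (B.cls f') (A.cls f) = m f f'" if "Poly_Mapping.keys f \<subseteq> S" "Poly_Mapping.keys f' \<subseteq> S'" for f f'
    using h(2)[OF B.cls_closed[OF that(2)] that(1)] g(2)[OF that] by simp
  ultimately show ?thesis by (intro exI[of _ "\<lambda>x z. h z x"]) blast
qed

subsection \<open>Complexification\<close>

lemma complex_ring_simps [simp]:
  "carrier complex_ring = UNIV" "ring.zero complex_ring = 0" "add complex_ring = (+)"
  by (auto simp: complex_ring_def)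

text \<open>\<open>cgroth\<close> with an arbitrary group in place of the Grothendieck group, so
  that complexification can be treated as a functor.\<close>

definition ctens :: "'h monoid \<Rightarrow> (complex \<times> 'h \<Rightarrow>\<^sub>0 int) set monoid" where
  "ctens H = tensor_group (\<lambda>(n::int) c. of_int n * c) (add_group complex_ring) (\<lambda>n g. g [^]\<^bsub>H\<^esub> n) H"

definition cpure :: "'h monoid \<Rightarrow> complex \<Rightarrow> 'h \<Rightarrow> (complex \<times> 'h \<Rightarrow>\<^sub>0 int) set" where
  "cpure H = tensor_pure (\<lambda>(n::int) c. of_int n * c) (add_group complex_ring) (\<lambda>n g. g [^]\<^bsub>H\<^esub> n) H"

locale complexified = H: comm_group H for H :: "'h monoid"
begin

sublocale tp: tensor_product "\<lambda>(n::int) c. of_int n * c" "add_group complex_ring" "\<lambda>n g. g [^]\<^bsub>H\<^esub> n" H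
proof (intro tensor_product.intro tensor_product_axioms.intro)
  have "abelian_group complex_ring"
    by (rule abelian_groupI) (auto simp: algebra_simps intro: exI[of _ "- _"] add.left_inverse)
  then show "comm_group (add_group complex_ring)" by (rule comm_group_add_group)
  show "comm_group H" by (rule H.comm_group_axioms)
qed auto

lemma T_eq: "tp.T = ctens H" and pure_eq: "tp.pure = cpure H"
  by (simp_all add: ctens_def cpure_def)

lemmas ctens_comm = tp.T_comm[unfolded T_eq]
lemmas ctens_induct [consumes 1, case_names pure mult] = tp.T_induct[unfolded T_eq pure_eq, simplified]
lemmas cpure_closed [simp] = tp.pure_closed[unfolded T_eq pure_eq, simplified]
lemmas cpure_add_left = tp.pure_add_left[unfolded T_eq pure_eq, simplified]
lemmas cpure_add_right = tp.pure_add_right[unfolded T_eq pure_eq, simplified]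
lemmas cpure_balanced = tp.pure_balanced[unfolded T_eq pure_eq, simplified]
lemmas cpure_one = tp.pure_one_right[unfolded T_eq pure_eq, simplified]

lemma cpure_inv: "g \<in> carrier H \<Longrightarrow> cpure H c (inv\<^bsub>H\<^esub> g) = cpure H (- c) g"
  using cpure_balanced[of g "-1" c] H.int_pow_neg[of g 1] by (simp add: H.int_pow_1)

lemma ctens_universal:
  assumes K: "comm_group K"
    and cl: "\<And>c g. g \<in> carrier H \<Longrightarrow> \<beta> c g \<in> carrier K"
    and a1: "\<And>c d g. g \<in> carrier H \<Longrightarrow> \<beta> (c + d) g = \<beta> c g \<otimes>\<^bsub>K\<^esub> \<beta> d g"
    and a2: "\<And>c g g'. g \<in> carrier H \<Longrightarrow> g' \<in> carrier H \<Longrightarrow> \<beta> c (g \<otimes>\<^bsub>H\<^esub> g') = \<beta> c g \<otimes>\<^bsub>K\<^esub> \<beta> c g'"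
    and bal: "\<And>n c g. g \<in> carrier H \<Longrightarrow> \<beta> (of_int n * c) g = \<beta> c (g [^]\<^bsub>H\<^esub> (n::int))"
  shows "\<exists>h. h \<in> hom (ctens H) K \<and> (\<forall>c. \<forall>g\<in>carrier H. h (cpure H c g) = \<beta> c g)"
proof -
  have "bihom (add_group complex_ring) H K \<beta>" by (rule bihomI) (use cl a1 a2 in auto)
  from tp.T_universal[OF K this] bal show ?thesis unfolding T_eq pure_eq by (metis UNIV_I add_group_simps(1) complex_ring_simps(1))
qed

end

lemma hom_pow_int:
  assumes "f \<in> hom G K" "comm_group G" "comm_group K" "g \<in> carrier G"
  shows "f (g [^]\<^bsub>G\<^esub> (n::int)) = f g [^]\<^bsub>K\<^esub> n"
  using assms by (intro hom_int_pow) (auto simp: comm_group_def)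

text \<open>The factor d covers three uses: d = 1 for the map induced by a homomorphism, k the
  identity for multiplication by a scalar, and both general for a bilinear map with its first
  argument fixed.\<close>

lemma ctens_map:
  assumes H: "comm_group H" "comm_group H'" and k: "k \<in> hom H H'"
  shows "\<exists>\<Phi>. \<Phi> \<in> hom (ctens H) (ctens H') \<and> (\<forall>c. \<forall>g\<in>carrier H. \<Phi> (cpure H c g) = cpure H' (d * c) (k g))"
proof -
  interpret A: complexified H using H by (simp add: complexified_def)
  interpret B: complexified H' using H by (simp add: complexified_def)
  show ?thesis
  proof (rule A.ctens_universal[OF B.ctens_comm])
    fix n :: int and c g assume g: "g \<in> carrier H"
    have "cpure H' (d * (of_int n * c)) (k g) = cpure H' (of_int n * (d * c)) (k g)"
      by (simp add: mult.left_commute)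
    also have "\<dots> = cpure H' (d * c) (k (g [^]\<^bsub>H\<^esub> n))"
      using g hom_in_carrier[OF k g] by (simp add: B.cpure_balanced hom_pow_int[OF k H])
    finally show "cpure H' (d * (of_int n * c)) (k g) = cpure H' (d * c) (k (g [^]\<^bsub>H\<^esub> n))" .
  qed (use hom_in_carrier[OF k] hom_mult[OF k] in \<open>auto simp: B.cpure_add_left B.cpure_add_right distrib_left\<close>)
qed

text \<open>Fixing the coefficient c and the element g of the first factor gives a homomorphism
  \<open>L c g\<close> in the second variable. It depends on c and g in a biadditive and balanced
  way, hence extends to the complexification of the first group.\<close>

lemma ctens_bimap:
  assumes H: "comm_group H1" "comm_group H2" "comm_group H3" and m: "bihom H1 H2 H3 m"
  shows "\<exists>\<nu>. bihom (ctens H1) (ctens H2) (ctens H3) \<nu>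
    \<and> (\<forall>c d. \<forall>g\<in>carrier H1. \<forall>h\<in>carrier H2. \<nu> (cpure H1 c g) (cpure H2 d h) = cpure H3 (c * d) (m g h))"
proof -
  interpret A: complexified H1 using H by (simp add: complexified_def)
  interpret B: complexified H2 using H by (simp add: complexified_def)
  interpret C: complexified H3 using H by (simp add: complexified_def)
  interpret CT: comm_group "ctens H3" by (rule C.ctens_comm)
  have "\<exists>L. L \<in> hom (ctens H2) (ctens H3) \<and> (\<forall>d. \<forall>h\<in>carrier H2. L (cpure H2 d h) = cpure H3 (c * d) (m g h))"
    if "g \<in> carrier H1" for c g
    by (rule ctens_map[OF H(2,3) bihomD(5)[OF m that]])
  note ex = this
  define L where "L c g = (SOME L. L \<in> hom (ctens H2) (ctens H3) \<and> (\<forall>d. \<forall>h\<in>carrier H2. L (cpure H2 d h) = cpure H3 (c * d) (m g h)))" for c g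
  have L: "L c g \<in> hom (ctens H2) (ctens H3)"
    "h \<in> carrier H2 \<Longrightarrow> L c g (cpure H2 d h) = cpure H3 (c * d) (m g h)" if "g \<in> carrier H1" for c g d h
    using someI_ex[OF ex[OF that, of c]] unfolding L_def by blast+
  have mc: "m g h \<in> carrier H3" if "g \<in> carrier H1" "h \<in> carrier H2" for g h
    using bihomD(1)[OF m that] .
  have L1: "L (c + d) g z = L c g z \<otimes>\<^bsub>ctens H3\<^esub> L d g z" if "z \<in> carrier (ctens H2)" "g \<in> carrier H1" for c d g z
    using that(1)
  proof (induction z rule: B.ctens_induct)
    case (pure x y)
    then show ?case using that(2) by (simp add: L(2) distrib_right C.cpure_add_left mc)
  next
    case (mult u v)
    then show ?case using that(2) hom_in_carrier[OF L(1)] by (simp add: hom_mult[OF L(1)] CT.m_ac)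
  qed
  have L2: "L c (g \<otimes>\<^bsub>H1\<^esub> g') z = L c g z \<otimes>\<^bsub>ctens H3\<^esub> L c g' z"
    if "z \<in> carrier (ctens H2)" "g \<in> carrier H1" "g' \<in> carrier H1" for c g g' z
    using that(1)
  proof (induction z rule: B.ctens_induct)
    case (pure x y)
    then show ?case using that(2,3) by (simp add: L(2) bihomD(2)[OF m] C.cpure_add_right mc)
  next
    case (mult u v)
    then show ?case using that(2,3) hom_in_carrier[OF L(1)] by (simp add: hom_mult[OF L(1)] CT.m_ac)
  qed
  have L3: "L (of_int n * c) g z = L c (g [^]\<^bsub>H1\<^esub> n) z" if "z \<in> carrier (ctens H2)" "g \<in> carrier H1" for n :: int and c g z
    using that(1)
  proof (induction z rule: B.ctens_induct)
    case (pure x y)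
    have "m (g [^]\<^bsub>H1\<^esub> n) y = m g y [^]\<^bsub>H3\<^esub> n"
      using hom_pow_int[OF bihomD(4)[OF m pure] H(1,3) that(2)] .
    then show ?case using that(2) pure C.cpure_balanced[of "m g y" n "c * x"] by (simp add: L(2) mc mult.assoc)
  next
    case (mult u v)
    then show ?case using that(2) by (simp add: hom_mult[OF L(1)])
  qed
  have "\<exists>h. h \<in> hom (ctens H1) (ctens H3) \<and> (\<forall>c. \<forall>g\<in>carrier H1. h (cpure H1 c g) = L c g z)"
    if "z \<in> carrier (ctens H2)" for z
    by (rule A.ctens_universal[OF C.ctens_comm]) (use that L1 L2 L3 hom_in_carrier[OF L(1)] in auto)
  then obtain h where h: "\<And>z. z \<in> carrier (ctens H2) \<Longrightarrow> h z \<in> hom (ctens H1) (ctens H3)"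
    "\<And>z c g. z \<in> carrier (ctens H2) \<Longrightarrow> g \<in> carrier H1 \<Longrightarrow> h z (cpure H1 c g) = L c g z" by metis
  interpret BT: comm_group "ctens H2" by (rule B.ctens_comm)
  have "bihom (ctens H1) (ctens H2) (ctens H3) (\<lambda>x z. h z x)"
  proof (rule bihomI)
    fix x y y' assume x: "x \<in> carrier (ctens H1)" and y: "y \<in> carrier (ctens H2)" "y' \<in> carrier (ctens H2)"
    show "h (y \<otimes>\<^bsub>ctens H2\<^esub> y') x = h y x \<otimes>\<^bsub>ctens H3\<^esub> h y' x"
      using x
    proof (induction x rule: A.ctens_induct)
      case (pure c g)
      then show ?case using y by (simp add: h(2) hom_mult[OF L(1)])
    next
      case (mult u v)
      then show ?case using y hom_in_carrier[OF h(1)] by (simp add: hom_mult[OF h(1)] CT.m_ac)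
    qed
  qed (simp_all add: hom_in_carrier[OF h(1)] hom_mult[OF h(1)])
  then show ?thesis using h(2) L(2) by (intro exI[of _ "\<lambda>x z. h z x"]) simp
qed

text \<open>Identifies scalar multiplication, defined on cosets as sets, with a homomorphism. The
  product of the null subgroup with the image of a coset is again a single coset, because the map on
  the free group preserves the null subgroup.\<close>

lemma ctens_smult_eq:
  assumes H: "comm_group H"
  shows "\<exists>\<theta>. \<theta> \<in> hom (ctens H) (ctens H) \<and> (\<forall>d. \<forall>g\<in>carrier H. \<theta> (cpure H d g) = cpure H (c * d) g)
    \<and> (\<forall>S\<in>carrier (ctens H). tensor_null (\<lambda>(n::int) c. of_int n * c) (add_group complex_ring) (\<lambda>n g. g [^]\<^bsub>H\<^esub> n) H
       <#>\<^bsub>free_Abelian_group (UNIV \<times> carrier H)\<^esub>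
     (frag_extend (\<lambda>(d, g). frag_of (c * d, g)) ` S) = \<theta> S)"
proof -
  interpret A: complexified H using H by (simp add: complexified_def)
  interpret AT: comm_group "ctens H" by (rule A.ctens_comm)
  obtain \<theta> where \<theta>: "\<theta> \<in> hom (ctens H) (ctens H)" "\<And>d g. g \<in> carrier H \<Longrightarrow> \<theta> (cpure H d g) = cpure H (c * d) g"
    using ctens_map[OF H H, of "\<lambda>x. x" c] by (auto simp: hom_def)
  let ?\<phi> = "frag_extend (\<lambda>(d, g). frag_of (c * d, g)) :: (complex \<times> 'a \<Rightarrow>\<^sub>0 int) \<Rightarrow> _"
  let ?S = "UNIV \<times> carrier H :: (complex \<times> 'a) set"
  have S: "carrier (add_group complex_ring) \<times> carrier H = ?S" by simp
  let ?F = "free_Abelian_group ?S"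
  let ?N = "tensor_null (\<lambda>(n::int) c. of_int n * c) (add_group complex_ring) (\<lambda>n g. g [^]\<^bsub>H\<^esub> n) H"
  have N: "?N = A.tp.quot.N" by (simp add: tensor_null_def)
  have \<phi>k: "Poly_Mapping.keys (?\<phi> f) \<subseteq> ?S" if "Poly_Mapping.keys f \<subseteq> ?S" for f
    using keys_frag_extend[of "\<lambda>(d, g). frag_of (c * d, g)" f] that by fastforce
  interpret \<theta>: group_hom "ctens H" "ctens H" \<theta>
    by unfold_locales (rule \<theta>(1))
  note [simp del] = mult_FactGroup one_FactGroup add_group_simps
  note clsT = A.tp.quot.cls_closed[unfolded A.T_eq S]
  note diff = A.tp.quot.cls_diff[unfolded A.T_eq S]
  let ?cls = "\<lambda>f. ?N #>\<^bsub>?F\<^esub> f"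
  have cls: "A.tp.quot.cls f = ?cls f" for f unfolding N S ..
  have cls0: "?cls 0 = \<one>\<^bsub>ctens H\<^esub>" using A.tp.quot.cls_zero unfolding A.T_eq cls .
  have comm: "\<theta> (?cls f) = ?cls (?\<phi> f)" if f: "Poly_Mapping.keys f \<subseteq> ?S" for f
  proof (rule free_Abelian_group_induct[OF f])
    show "\<theta> (?cls 0) = ?cls (?\<phi> 0)" by (simp add: cls0)
  next
    fix s assume "s \<in> ?S"
    then obtain d g where s: "s = (d, g)" "g \<in> carrier H" by (cases s) auto
    have p: "cpure H d g = ?cls (frag_of (d, g))" for d g
      using A.tp.pure_eq[of d g] unfolding A.pure_eq cls .
    show "\<theta> (?cls (frag_of s)) = ?cls (?\<phi> (frag_of s))"
      using \<theta>(2)[OF s(2), of d] unfolding s(1) p by simp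
  next
    fix x y assume xy: "Poly_Mapping.keys x \<subseteq> ?S" "Poly_Mapping.keys y \<subseteq> ?S"
      "\<theta> (?cls x) = ?cls (?\<phi> x)" "\<theta> (?cls y) = ?cls (?\<phi> y)"
    note dif = diff[unfolded cls[unfolded S]]
    have "\<theta> (?cls (x - y)) = \<theta> (?cls x \<otimes>\<^bsub>ctens H\<^esub> inv\<^bsub>ctens H\<^esub> ?cls y)"
      using diff[OF xy(1,2)] unfolding N S by simp
    also have "\<dots> = ?cls (?\<phi> x) \<otimes>\<^bsub>ctens H\<^esub> inv\<^bsub>ctens H\<^esub> ?cls (?\<phi> y)"
      using clsT[OF xy(1)] clsT[OF xy(2)] xy(3,4) unfolding N S by simp
    also have "\<dots> = ?cls (?\<phi> x - ?\<phi> y)"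
      using diff[OF \<phi>k[OF xy(1)] \<phi>k[OF xy(2)]] unfolding N S by simp
    finally show "\<theta> (?cls (x - y)) = ?cls (?\<phi> (x - y))" by (simp add: frag_extend_diff)
  qed
  have Nsub: "subgroup ?N ?F" using A.tp.quot.N_subgroup unfolding N S .
  \<comment> \<open>Follows from the compatibility with \<theta>: the class of
    \<open>?\<phi> n\<close> is the image under \<theta> of the neutral element. The relations
    themselves are not inspected.\<close>
  have \<phi>N: "?\<phi> n \<in> ?N" if n: "n \<in> ?N" for n
  proof -
    have nk: "Poly_Mapping.keys n \<subseteq> ?S" using subsetD[OF subgroup.subset[OF Nsub] n] by simp
    have "?cls n = \<one>\<^bsub>ctens H\<^esub>" using A.tp.quot.cls_N[of n] n unfolding A.T_eq cls N by simp
    then have "?cls (?\<phi> n) = \<one>\<^bsub>ctens H\<^esub>" using comm[OF nk] by simp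
    moreover have "\<one>\<^bsub>ctens H\<^esub> = ?N"
      unfolding ctens_def tensor_group_def by (rule one_FactGroup)
    moreover have "?\<phi> n \<in> ?cls (?\<phi> n)"
      using subgroup.one_closed[OF Nsub] by (force simp: r_coset_def)
    ultimately show ?thesis by simp
  qed
  have "?N <#>\<^bsub>?F\<^esub> (?\<phi> ` Z) = \<theta> Z" if Z: "Z \<in> carrier (ctens H)" for Z
  proof -
    obtain f where f: "Poly_Mapping.keys f \<subseteq> ?S" "Z = ?cls f"
      unfolding N S by (rule A.tp.quot.Q_cases[unfolded A.T_eq S, OF Z])
    have "?N <#>\<^bsub>?F\<^esub> (?\<phi> ` ?cls f) = ?cls (?\<phi> f)"
    proof (intro equalityI subsetI)
      fix u assume "u \<in> ?N <#>\<^bsub>?F\<^esub> (?\<phi> ` ?cls f)"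
      then obtain n n' where u: "n \<in> ?N" "n' \<in> ?N" "u = n + ?\<phi> (n' + f)"
        by (auto simp: set_mult_def r_coset_def)
      then have "u = (n + ?\<phi> n') + ?\<phi> f" by (simp add: frag_extend_add add.assoc)
      moreover have "n + ?\<phi> n' \<in> ?N" using subgroup.m_closed[OF Nsub u(1) \<phi>N[OF u(2)]] by simp
      ultimately show "u \<in> ?cls (?\<phi> f)" by (auto simp: r_coset_def)
    next
      fix u assume "u \<in> ?cls (?\<phi> f)"
      then obtain n where n: "n \<in> ?N" "u = n + ?\<phi> f" by (auto simp: r_coset_def)
      have "f \<in> ?cls f" using subgroup.one_closed[OF Nsub] by (force simp: r_coset_def)
      then show "u \<in> ?N <#>\<^bsub>?F\<^esub> (?\<phi> ` ?cls f)" using n by (auto simp: set_mult_def)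
    qed
    then show ?thesis using comm[OF f(1)] f(2) by simp
  qed
  then show ?thesis using \<theta> by blast
qed

subsection \<open>Direct sums\<close>

definition sum_incl :: "'i set \<Rightarrow> ('i \<Rightarrow> 'a monoid) \<Rightarrow> 'i \<Rightarrow> 'a \<Rightarrow> 'i \<Rightarrow> 'a" where
  "sum_incl I A i u = (\<lambda>s\<in>I. if s = i then u else \<one>\<^bsub>A s\<^esub>)"

locale comm_family =
  fixes I :: "'i set" and A :: "'i \<Rightarrow> 'a monoid"
  assumes comm: "i \<in> I \<Longrightarrow> comm_group (A i)"
begin

lemma grp: "i \<in> I \<Longrightarrow> group (A i)"
  using comm by (simp add: comm_group_def)

lemma carrier_sum:
  "carrier (sum_group I A) = {x \<in> \<Pi>\<^sub>E i\<in>I. carrier (A i). finite {i \<in> I. x i \<noteq> \<one>\<^bsub>A i\<^esub>}}"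
  by (rule carrier_sum_group) (rule grp)

lemma sum_comm_group: "comm_group (sum_group I A)"
proof (rule group.group_comm_groupI)
  show "group (sum_group I A)" by (rule sum_group) (rule grp)
  show "x \<otimes>\<^bsub>sum_group I A\<^esub> y = y \<otimes>\<^bsub>sum_group I A\<^esub> x"
    if "x \<in> carrier (sum_group I A)" "y \<in> carrier (sum_group I A)" for x y
  proof -
    have "x i \<otimes>\<^bsub>A i\<^esub> y i = y i \<otimes>\<^bsub>A i\<^esub> x i" if "i \<in> I" for i
      using \<open>x \<in> _\<close> \<open>y \<in> _\<close> that
      by (intro comm_monoid.m_comm[OF comm_group.axioms(1)[OF comm]]) (auto simp: carrier_sum)
    then show ?thesis by (auto intro!: restrict_ext)
  qed
qed

lemma incl_closed [simp]: "i \<in> I \<Longrightarrow> u \<in> carrier (A i) \<Longrightarrow> sum_incl I A i u \<in> carrier (sum_group I A)"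
  using grp by (auto simp: carrier_sum_group sum_incl_def group_def monoid.one_closed)

lemma incl_hom: "i \<in> I \<Longrightarrow> sum_incl I A i \<in> hom (A i) (sum_group I A)"
proof (rule homI)
  fix x y assume i: "i \<in> I"
  show "sum_incl I A i (x \<otimes>\<^bsub>A i\<^esub> y) = sum_incl I A i x \<otimes>\<^bsub>sum_group I A\<^esub> sum_incl I A i y"
    using grp by (auto simp: sum_incl_def group_def monoid.l_one monoid.one_closed intro!: restrict_ext)
qed simp

text \<open>Induction on the support: resetting one coordinate to the neutral element splits off a
  single summand.\<close>

lemma sum_induct [consumes 1, case_names one incl mult]:
  assumes x: "x \<in> carrier (sum_group I A)"
    and one: "P \<one>\<^bsub>sum_group I A\<^esub>"
    and incl: "\<And>i u. i \<in> I \<Longrightarrow> u \<in> carrier (A i) \<Longrightarrow> P (sum_incl I A i u)"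
    and mult: "\<And>x y. x \<in> carrier (sum_group I A) \<Longrightarrow> y \<in> carrier (sum_group I A) \<Longrightarrow> P x \<Longrightarrow> P y \<Longrightarrow> P (x \<otimes>\<^bsub>sum_group I A\<^esub> y)"
  shows "P x"
proof -
  have "P x" if "finite F" "x \<in> carrier (sum_group I A)" "{i \<in> I. x i \<noteq> \<one>\<^bsub>A i\<^esub>} \<subseteq> F" for F x
    using that
  proof (induction F arbitrary: x rule: finite_induct)
    case empty
    then have "x = \<one>\<^bsub>sum_group I A\<^esub>"
      by (auto simp: carrier_sum PiE_iff extensional_def)
    then show ?case using one by (simp only:)
  next
    case (insert i F)
    show ?case
    proof (cases "i \<in> I")
      case False
      then show ?thesis using insert by auto
    next
      case True
      let ?y = "x(i := \<one>\<^bsub>A i\<^esub>)"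
      have xi: "x i \<in> carrier (A i)" using insert.prems(1) True by (auto simp: carrier_sum)
      have y: "?y \<in> carrier (sum_group I A)"
      proof -
        have "finite {j \<in> I. ?y j \<noteq> \<one>\<^bsub>A j\<^esub>}"
          by (rule finite_subset[of _ "{j \<in> I. x j \<noteq> \<one>\<^bsub>A j\<^esub>}"])
            (use insert.prems(1) in \<open>auto simp: carrier_sum\<close>)
        moreover have "?y \<in> (\<Pi>\<^sub>E i\<in>I. carrier (A i))"
          using insert.prems(1) True monoid.one_closed[OF group.is_monoid[OF grp[OF True]]]
          by (auto simp: carrier_sum PiE_iff extensional_def)
        ultimately show ?thesis unfolding carrier_sum by blast
      qed
      have "P ?y" using insert.prems by (intro insert.IH y) auto
      moreover have "x = sum_incl I A i (x i) \<otimes>\<^bsub>sum_group I A\<^esub> ?y"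
      proof (rule ext)
        fix j
        show "x j = (sum_incl I A i (x i) \<otimes>\<^bsub>sum_group I A\<^esub> ?y) j"
        proof (cases "j \<in> I")
          case j: True
          interpret Aj: group "A j" by (rule grp[OF j])
          have "x j \<in> carrier (A j)" using insert.prems(1) j by (auto simp: carrier_sum)
          note xj = this
          have 1: "(sum_incl I A i (x i) \<otimes>\<^bsub>sum_group I A\<^esub> ?y) j = sum_incl I A i (x i) j \<otimes>\<^bsub>A j\<^esub> ?y j"
            using j by simp
          show ?thesis
          proof (cases "j = i")
            case True
            then have "sum_incl I A i (x i) j = x j" "?y j = \<one>\<^bsub>A j\<^esub>" using j by (simp_all add: sum_incl_def)
            then show ?thesis unfolding 1 using Aj.r_one[OF xj] by metis
          next
            case False
            then have "sum_incl I A i (x i) j = \<one>\<^bsub>A j\<^esub>" "?y j = x j" using j by (simp_all add: sum_incl_def)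
            then show ?thesis unfolding 1 using Aj.l_one[OF xj] by metis
          qed
        next
          case False
          then show ?thesis using insert.prems(1) by (auto simp: carrier_sum PiE_iff extensional_def)
        qed
      qed
      ultimately show ?thesis using mult[OF incl_closed[OF True xi] y incl[OF True xi]] by metis
    qed
  qed
  moreover have "finite {i \<in> I. x i \<noteq> \<one>\<^bsub>A i\<^esub>}" using x by (simp add: carrier_sum)
  ultimately show ?thesis using x by blast
qed

text \<open>The map multiplies the values f i (x i). \<open>gfinprod\<close> ignores neutral
  factors, so the product makes sense for infinite I and finitely supported x.\<close>

lemma sum_universal:
  assumes K: "comm_group K" and f: "\<And>i. i \<in> I \<Longrightarrow> f i \<in> hom (A i) K"
  shows "\<exists>h. h \<in> hom (sum_group I A) K \<and> (\<forall>i\<in>I. \<forall>u\<in>carrier (A i). h (sum_incl I A i u) = f i u)"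
proof -
  interpret K: comm_group K by fact
  let ?h = "\<lambda>x. gfinprod K (\<lambda>i. f i (x i)) I"
  have "?h (sum_incl I A i u) = f i u" if "i \<in> I" "u \<in> carrier (A i)" for i u
  proof -
    have v: "f j (sum_incl I A i u j) = (if j = i then f i u else \<one>\<^bsub>K\<^esub>)" if "j \<in> I" for j
      using that hom_one[OF f[OF that] grp[OF that] K.is_group] by (simp add: sum_incl_def)
    have fu: "f i u \<in> carrier K" using hom_in_carrier[OF f] that by blast
    have "?h (sum_incl I A i u) = gfinprod K (\<lambda>j. if j = i then f i u else \<one>\<^bsub>K\<^esub>) I"
      using fu by (intro K.gfinprod_cong) (auto simp: v simp_implies_def)
    also have "\<dots> = f i u"
    proof (cases "f i u = \<one>\<^bsub>K\<^esub>")
      case True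
      then show ?thesis by (simp add: gfinprod_def cong: conj_cong)
    next
      case False
      then have "{x \<in> I. (if x = i then f i u else \<one>\<^bsub>K\<^esub>) \<noteq> \<one>\<^bsub>K\<^esub>} = {i}" using \<open>i \<in> I\<close> by auto
      then show ?thesis using fu by (simp add: gfinprod_def)
    qed
    finally show ?thesis .
  qed
  moreover have "?h \<in> hom (sum_group I A) K" by (rule K.hom_group_sum[OF f grp])
  ultimately show ?thesis by blast
qed

end

text \<open>The same descent as for quotients, one variable at a time, now through the universal
  property of the direct sum.\<close>

lemma bihom_sum:
  assumes A: "comm_family I A" and B: "comm_family J B" and K: "comm_group K"
    and m: "\<And>i j. i \<in> I \<Longrightarrow> j \<in> J \<Longrightarrow> bihom (A i) (B j) K (m i j)"
  shows "\<exists>\<mu>. bihom (sum_group I A) (sum_group J B) K \<mu>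
    \<and> (\<forall>i\<in>I. \<forall>j\<in>J. \<forall>u\<in>carrier (A i). \<forall>v\<in>carrier (B j). \<mu> (sum_incl I A i u) (sum_incl J B j v) = m i j u v)"
proof -
  interpret A: comm_family I A by fact
  interpret B: comm_family J B by fact
  interpret K: comm_group K by fact
  interpret SA: comm_group "sum_group I A" by (rule A.sum_comm_group)
  interpret SB: comm_group "sum_group J B" by (rule B.sum_comm_group)
  note [simp del] = mult_sum_group one_sum_group
  have "\<exists>g. g \<in> hom (sum_group J B) K \<and> (\<forall>j\<in>J. \<forall>v\<in>carrier (B j). g (sum_incl J B j v) = m i j u v)"
    if "i \<in> I" "u \<in> carrier (A i)" for i u
    by (rule B.sum_universal[OF K]) (rule bihomD(5)[OF m[OF that(1)] that(2)])
  then obtain g where g: "\<And>i u. i \<in> I \<Longrightarrow> u \<in> carrier (A i) \<Longrightarrow> g i u \<in> hom (sum_group J B) K"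
    "\<And>i u j v. i \<in> I \<Longrightarrow> u \<in> carrier (A i) \<Longrightarrow> j \<in> J \<Longrightarrow> v \<in> carrier (B j) \<Longrightarrow> g i u (sum_incl J B j v) = m i j u v"
    by metis
  have g1: "(\<lambda>u. g i u y) \<in> hom (A i) K" if "i \<in> I" "y \<in> carrier (sum_group J B)" for i y
  proof (rule homI)
    fix u v assume uv: "u \<in> carrier (A i)" "v \<in> carrier (A i)"
    interpret Ai: comm_group "A i" by (rule A.comm[OF that(1)])
    note gi = g(1)[OF that(1) uv(1)] g(1)[OF that(1) uv(2)] g(1)[OF that(1) Ai.m_closed[OF uv]]
    show "g i (u \<otimes>\<^bsub>A i\<^esub> v) y = g i u y \<otimes>\<^bsub>K\<^esub> g i v y"
      using that(2)
    proof (induction y rule: B.sum_induct)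
      case one
      then show ?case using gi[THEN hom_one[OF _ SB.is_group K.is_group]] by simp
    next
      case (incl j w)
      then show ?case using g(2)[OF that(1)] uv bihomD(2)[OF m[OF that(1)]] by simp
    next
      case (mult x y)
      then show ?case using gi[THEN hom_in_carrier] by (simp add: gi[THEN hom_mult] K.m_ac)
    qed
  next
    fix u assume "u \<in> carrier (A i)"
    from hom_in_carrier[OF g(1)[OF that(1) this] that(2)] show "g i u y \<in> carrier K" .
  qed
  have "\<exists>h. h \<in> hom (sum_group I A) K \<and> (\<forall>i\<in>I. \<forall>u\<in>carrier (A i). h (sum_incl I A i u) = g i u y)"
    if "y \<in> carrier (sum_group J B)" for y
    by (rule A.sum_universal[OF K]) (rule g1[OF _ that])
  then obtain h where h: "\<And>y. y \<in> carrier (sum_group J B) \<Longrightarrow> h y \<in> hom (sum_group I A) K"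
    "\<And>y i u. y \<in> carrier (sum_group J B) \<Longrightarrow> i \<in> I \<Longrightarrow> u \<in> carrier (A i) \<Longrightarrow> h y (sum_incl I A i u) = g i u y" by metis
  have "bihom (sum_group I A) (sum_group J B) K (\<lambda>x y. h y x)"
  proof (rule bihomI)
    fix x y y' assume x: "x \<in> carrier (sum_group I A)" and y: "y \<in> carrier (sum_group J B)" "y' \<in> carrier (sum_group J B)"
    note hy = h(1)[OF y(1)] h(1)[OF y(2)] h(1)[OF SB.m_closed[OF y]]
    show "h (y \<otimes>\<^bsub>sum_group J B\<^esub> y') x = h y x \<otimes>\<^bsub>K\<^esub> h y' x"
      using x
    proof (induction x rule: A.sum_induct)
      case one
      then show ?case using hy[THEN hom_one[OF _ SA.is_group K.is_group]] by simp
    next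
      case (incl i u)
      then show ?case using h(2) y SB.m_closed[OF y] hom_mult[OF g(1)[OF incl] y] by simp
    next
      case (mult x y)
      then show ?case using hy[THEN hom_in_carrier] by (simp add: hy[THEN hom_mult] K.m_ac)
    qed
  qed (auto intro: hom_in_carrier[OF h(1)] hom_mult[OF h(1)])
  then show ?thesis using h(2) g(2) by (intro exI[of _ "\<lambda>x y. h y x"]) simp
qed

section \<open>The graded algebras\<close>

lemma tens_class_swap:
  assumes "left_module (gwa t) M" "left_module (gwa t') N"
  shows "iso_class (t * t') (tens t M t' N) = iso_class (t * t') (tens t' N t M)"
  by (rule iso_class_cong[OF tensor_swap[OF assms] left_module_tens[OF assms]])

lemma tens_class_cong_left:
  assumes "gwa_iso t M M1" "left_module (gwa t) M" "left_module (gwa t) M1" "left_module (gwa t') N"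
  shows "iso_class (t * t') (tens t M t' N) = iso_class (t * t') (tens t M1 t' N)"
  by (rule iso_class_cong[OF tensor_iso[OF assms] left_module_tens[OF assms(2,4)]])

lemma tens_class_cong:
  assumes "gwa_iso t M M1" "left_module (gwa t) M" "left_module (gwa t) M1"
    and "gwa_iso t' N N1" "left_module (gwa t') N" "left_module (gwa t') N1"
  shows "iso_class (t * t') (tens t M t' N) = iso_class (t * t') (tens t M1 t' N1)"
  using tens_class_cong_left[OF assms(1-3,5)] tens_class_swap[OF assms(3,5)]
    tens_class_cong_left[OF assms(4-6,3)] tens_class_swap[OF assms(3,6)]
  by (simp add: mult.commute)

lemma frag_extend_fun_add: "frag_extend (\<lambda>c. g c + h c) f = frag_extend g f + frag_extend h f"
  by (simp add: frag_extend_def frag_cmul_distrib2 sum.distrib)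

lemma keys_frag_extend_subset:
  "(\<And>x. x \<in> Poly_Mapping.keys f \<Longrightarrow> Poly_Mapping.keys (g x) \<subseteq> S) \<Longrightarrow> Poly_Mapping.keys (frag_extend g f) \<subseteq> S"
  by (rule subset_trans[OF keys_frag_extend]) (rule UN_least)

lemma alg_group_eq: 
  "alg_group E \<Gamma> = sum_group \<Gamma> (cgroth E)"
  by (simp add: alg_group_def)

lemma alg_incl_eq: "alg_incl E \<Gamma> t = sum_incl \<Gamma> (cgroth E) t"
  by (rule ext) (simp add: alg_incl_def sum_incl_def)

lemma cgroth_eq: "cgroth E t = ctens (groth E t)"
  by (simp add: cgroth_def ctens_def)

lemma cgroth_pure_eq: "cgroth_pure E t = cpure (groth E t)"
  by (simp add: cgroth_pure_def cpure_def)

context rel_fam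
begin

lemma fq: "free_quotient (iso_class t ` objs t) (E t)"
proof
  show "E t \<subseteq> carrier (free_Abelian_group (iso_class t ` objs t))"
  proof
    fix e assume "e \<in> E t"
    then obtain M M'' M' where e: "M \<in> objs t" "M'' \<in> objs t" "M' \<in> objs t"
      "e = frag_of (iso_class t M'') - frag_of (iso_class t M) - frag_of (iso_class t M')"
      unfolding E_eq by blast
    have d: "f - g \<in> carrier (free_Abelian_group S)"
      if "f \<in> carrier (free_Abelian_group S)" "g \<in> carrier (free_Abelian_group S)" for f g :: formal_sum and S
      using that keys_diff[of f g] by auto
    show "e \<in> carrier (free_Abelian_group (iso_class t ` objs t))"
      unfolding e(4) using e(1-3) by (intro d frag_of_in_free_Abelian_group[THEN iffD2]) auto
  qed
qed

sublocale Q: free_quotient "iso_class t ` objs t" "E t" for t by (rule fq)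

lemma groth_eq: "groth E t = Q.Q t"
  by (simp add: groth_def free_classes_def)

lemma groth_class_eq: "groth_class E t M = Q.cls t (frag_of (iso_class t M))"
  by (simp add: groth_class_def free_classes_def)

lemma groth_comm: "comm_group (groth E t)"
  unfolding groth_eq by (rule Q.Q_comm)

lemma groth_class_closed: "M \<in> objs t \<Longrightarrow> groth_class E t M \<in> carrier (groth E t)"
  unfolding groth_eq groth_class_eq by (rule Q.cls_closed) simp

lemma groth_ext:
  assumes "M \<in> objs t" "M'' \<in> objs t" "M' \<in> objs t" "ext t M M'' M'"
  shows "groth_class E t M'' = groth_class E t M \<otimes>\<^bsub>groth E t\<^esub> groth_class E t M'"
proof -
  interpret comm_group "groth E t" by (rule groth_comm)
  let ?f = "\<lambda>M. frag_of (iso_class t M)"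
  have k: "Poly_Mapping.keys (?f M) \<subseteq> iso_class t ` objs t" "Poly_Mapping.keys (?f M'') \<subseteq> iso_class t ` objs t"
    "Poly_Mapping.keys (?f M') \<subseteq> iso_class t ` objs t" "Poly_Mapping.keys (?f M + ?f M') \<subseteq> iso_class t ` objs t"
    using assms keys_add[of "?f M" "?f M'"] by auto
  have "?f M'' - (?f M + ?f M') \<in> E t" unfolding E_eq using assms by (auto simp: diff_diff_add)
  from Q.cls_rel[OF this] Q.cls_diff[OF k(2,4)] Q.cls_add[OF k(1,3)] Q.cls_closed[OF k(1)] Q.cls_closed[OF k(2)] Q.cls_closed[OF k(3)]
  show ?thesis
    unfolding groth_eq[symmetric] groth_class_eq
    by (metis inv_closed inv_equality inv_inv m_closed)
qed

definition rep :: "universe gwa_module set \<Rightarrow> universe gwa_module" where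
  "rep c = (SOME M. M \<in> c)"

text \<open>The tensor product on isomorphism classes. Passing through \<open>rep\<close> makes it a
  function of the classes, and isomorphism invariance of the tensor product makes the choice
  immaterial.\<close>

definition bil :: "complex poly \<Rightarrow> complex poly \<Rightarrow> universe gwa_module set \<Rightarrow> universe gwa_module set \<Rightarrow> formal_sum" where
  "bil t t' c c' = frag_of (iso_class (t * t') (tens t (rep c) t' (rep c')))"

lemma rep_class:
  assumes "M \<in> objs t"
  shows "rep (iso_class t M) \<in> objs t" "gwa_iso t (rep (iso_class t M)) M"
proof -
  have "M \<in> iso_class t M" using assms gwa_iso_refl by (auto simp: iso_class_def)
  then have "rep (iso_class t M) \<in> iso_class t M" unfolding rep_def by (rule someI)
  then show "rep (iso_class t M) \<in> objs t" "gwa_iso t (rep (iso_class t M)) M" by (auto simp: iso_class_def)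
qed

lemma bil_class:
  assumes "M \<in> objs t" "N \<in> objs t'"
  shows "bil t t' (iso_class t M) (iso_class t' N) = frag_of (iso_class (t * t') (tens t M t' N))"
  unfolding bil_def using rep_class[OF assms(1)] rep_class[OF assms(2)] assms
  by (intro arg_cong[where f = frag_of] tens_class_cong left_module_obj)

lemma tens_in_classes:
  assumes "M \<in> objs t" "N \<in> objs t'"
  shows "iso_class (t * t') (tens t M t' N) \<in> iso_class (t * t') ` objs (t * t')"
  using ex_obj_tensor[OF assms] by (metis imageI)

text \<open>The three tensor products are replaced by objects on the universe, to which the
  stability of \<open>ext\<close> applies.\<close>

lemma tens_rel:
  assumes "M \<in> objs t" "M'' \<in> objs t" "M' \<in> objs t" "ext t M M'' M'" "N \<in> objs t'"
  shows "frag_of (iso_class (t * t') (tens t M'' t' N)) - frag_of (iso_class (t * t') (tens t M t' N))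
    - frag_of (iso_class (t * t') (tens t M' t' N)) \<in> E (t * t')"
proof -
  obtain K where K: "K \<in> objs (t * t')" "gwa_iso (t * t') K (tens t M t' N)"
    "iso_class (t * t') K = iso_class (t * t') (tens t M t' N)" using ex_obj_tensor[OF assms(1,5)] by blast
  obtain K'' where K'': "K'' \<in> objs (t * t')" "gwa_iso (t * t') K'' (tens t M'' t' N)"
    "iso_class (t * t') K'' = iso_class (t * t') (tens t M'' t' N)" using ex_obj_tensor[OF assms(2,5)] by blast
  obtain K' where K': "K' \<in> objs (t * t')" "gwa_iso (t * t') K' (tens t M' t' N)"
    "iso_class (t * t') K' = iso_class (t * t') (tens t M' t' N)" using ex_obj_tensor[OF assms(3,5)] by blast
  have "ext (t * t') K K'' K'"
    by (rule ext_tensor[OF assms(1-3,5,4) K(1) K''(1) K'(1) K(2) K''(2) K'(2)])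
  then show ?thesis unfolding E_eq K(3)[symmetric] K''(3)[symmetric] K'(3)[symmetric] using K K' K'' by blast
qed

text \<open>The product of classes extends bilinearly to the free groups and then descends. A
  relation in the first argument times a class is a relation by stability under tensoring; for the
  second argument the factors are swapped.\<close>

lemma groth_bilinear:
  "\<exists>\<mu>. bihom (groth E t) (groth E t') (groth E (t * t')) \<mu>
    \<and> (\<forall>M\<in>objs t. \<forall>N\<in>objs t'. \<mu> (groth_class E t M) (groth_class E t' N) = groth_class E (t * t') (tens t M t' N))"
proof -
  let ?C = "\<lambda>t. iso_class t ` objs t"
  let ?m0 = "\<lambda>f f'. frag_extend (\<lambda>c. frag_extend (bil t t' c) f') f"
  let ?cls = "Q.cls (t * t')"
  let ?G = "groth E (t * t')"
  interpret G: comm_group ?G by (rule groth_comm)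
  have bk: "Poly_Mapping.keys (bil t t' c c') \<subseteq> ?C (t * t')" if "c \<in> ?C t" "c' \<in> ?C t'" for c c'
    using that bil_class tens_in_classes by auto
  have k1: "Poly_Mapping.keys (frag_extend (bil t t' c) f') \<subseteq> ?C (t * t')"
    if "c \<in> ?C t" "Poly_Mapping.keys f' \<subseteq> ?C t'" for c f'
    by (intro keys_frag_extend_subset bk that(1) subsetD[OF that(2)])
  have k: "Poly_Mapping.keys (?m0 f f') \<subseteq> ?C (t * t')"
    if "Poly_Mapping.keys f \<subseteq> ?C t" "Poly_Mapping.keys f' \<subseteq> ?C t'" for f f'
    by (intro keys_frag_extend_subset k1[OF _ that(2)] subsetD[OF that(1)])
  note clG = Q.cls_closed[of _ "t * t'", unfolded groth_eq[symmetric]]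
  note addG = Q.cls_add[of _ "t * t'", unfolded groth_eq[symmetric]]
  note difG = Q.cls_diff[of _ "t * t'", unfolded groth_eq[symmetric]]
  note zeroG = Q.cls_zero[of "t * t'", unfolded groth_eq[symmetric]]
  note relG = Q.cls_rel[of _ "t * t'", unfolded groth_eq[symmetric]]
  have bi: "bihom (free_Abelian_group (?C t)) (free_Abelian_group (?C t')) ?G (\<lambda>f f'. ?cls (?m0 f f'))"
  proof (rule bihomI; (unfold carrier_free_Abelian_group_iff mult_free_Abelian_group)?)
    fix f g f' :: formal_sum assume "Poly_Mapping.keys f \<subseteq> ?C t" "Poly_Mapping.keys g \<subseteq> ?C t" "Poly_Mapping.keys f' \<subseteq> ?C t'"
    then show "?cls (?m0 (f + g) f') = ?cls (?m0 f f') \<otimes>\<^bsub>?G\<^esub> ?cls (?m0 g f')"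
      unfolding frag_extend_add by (intro addG k)
  next
    fix f f' g' :: formal_sum assume "Poly_Mapping.keys f \<subseteq> ?C t" "Poly_Mapping.keys f' \<subseteq> ?C t'" "Poly_Mapping.keys g' \<subseteq> ?C t'"
    then show "?cls (?m0 f (f' + g')) = ?cls (?m0 f f') \<otimes>\<^bsub>?G\<^esub> ?cls (?m0 f g')"
      unfolding frag_extend_add frag_extend_fun_add by (intro addG k)
  qed (intro clG k)
  have r1: "?cls (?m0 r f') = \<one>\<^bsub>?G\<^esub>" if r: "r \<in> E t" and f': "Poly_Mapping.keys f' \<subseteq> ?C t'" for r f'
  proof -
    have rk: "Poly_Mapping.keys r \<subseteq> ?C t" using subsetD[OF Q.rels r] by simp
    show ?thesis
    proof (rule free_Abelian_group_induct[OF f'])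
      show "?cls (?m0 r 0) = \<one>\<^bsub>?G\<^esub>" using zeroG by (simp add: frag_extend_eq_0)
    next
      fix x y assume xy: "Poly_Mapping.keys x \<subseteq> ?C t'" "Poly_Mapping.keys y \<subseteq> ?C t'"
        "?cls (?m0 r x) = \<one>\<^bsub>?G\<^esub>" "?cls (?m0 r y) = \<one>\<^bsub>?G\<^esub>"
      \<comment> \<open>Additivity in the second argument sits under the outer
        \<open>frag_extend\<close>, so it is obtained from a pointwise sum of the inner
        maps.\<close>
      have "?m0 r (x - y) = ?m0 r x - ?m0 r y"
        using frag_extend_fun_add[of "\<lambda>c. frag_extend (bil t t' c) (x - y)" "\<lambda>c. frag_extend (bil t t' c) y" r]
        by (simp add: frag_extend_diff algebra_simps)
      then show "?cls (?m0 r (x - y)) = \<one>\<^bsub>?G\<^esub>" using difG[OF k[OF rk xy(1)] k[OF rk xy(2)]] xy(3,4) by simp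
    next
      fix a assume "a \<in> ?C t'"
      then obtain N where N: "N \<in> objs t'" "a = iso_class t' N" by auto
      obtain M M'' M' where e: "M \<in> objs t" "M'' \<in> objs t" "M' \<in> objs t" "ext t M M'' M'"
        "r = frag_of (iso_class t M'') - frag_of (iso_class t M) - frag_of (iso_class t M')"
        using r unfolding E_eq by blast
      show "?cls (?m0 r (frag_of a)) = \<one>\<^bsub>?G\<^esub>"
        using relG[OF tens_rel[OF e(1-4) N(1)]] e(1-3) N
        unfolding e(5) N(2) frag_extend_diff frag_extend_of by (simp only: bil_class)
    qed
  qed
  have r2: "?cls (?m0 f r) = \<one>\<^bsub>?G\<^esub>" if f: "Poly_Mapping.keys f \<subseteq> ?C t" and r: "r \<in> E t'" for r f
  proof -
    have rk: "Poly_Mapping.keys r \<subseteq> ?C t'" using subsetD[OF Q.rels r] by simp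
    show ?thesis
    proof (rule free_Abelian_group_induct[OF f])
      show "?cls (?m0 0 r) = \<one>\<^bsub>?G\<^esub>" using zeroG by simp
    next
      fix x y assume xy: "Poly_Mapping.keys x \<subseteq> ?C t" "Poly_Mapping.keys y \<subseteq> ?C t"
        "?cls (?m0 x r) = \<one>\<^bsub>?G\<^esub>" "?cls (?m0 y r) = \<one>\<^bsub>?G\<^esub>"
      then show "?cls (?m0 (x - y) r) = \<one>\<^bsub>?G\<^esub>"
        using difG[OF k[OF xy(1) rk] k[OF xy(2) rk]] xy(3,4) by (simp add: frag_extend_diff)
    next
      fix a assume "a \<in> ?C t"
      then obtain M where M: "M \<in> objs t" "a = iso_class t M" by auto
      obtain N N'' N' where e: "N \<in> objs t'" "N'' \<in> objs t'" "N' \<in> objs t'" "ext t' N N'' N'"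
        "r = frag_of (iso_class t' N'') - frag_of (iso_class t' N) - frag_of (iso_class t' N')"
        using r unfolding E_eq by blast
      have sw: "iso_class (t * t') (tens t M t' K) = iso_class (t' * t) (tens t' K t M)" if "K \<in> objs t'" for K
        using tens_class_swap[OF left_module_obj[OF M(1)] left_module_obj[OF that]] by (simp add: mult.commute)
      show "?cls (?m0 (frag_of a) r) = \<one>\<^bsub>?G\<^esub>"
        using relG[OF tens_rel[OF e(1-4) M(1), unfolded mult.commute[of t' t]]] e(1-3) M sw[unfolded mult.commute[of t' t]]
        unfolding e(5) M(2) frag_extend_diff frag_extend_of by (simp only: bil_class)
    qed
  qed
  obtain \<mu> where \<mu>: "bihom (Q.Q t) (Q.Q t') ?G \<mu>"
    "\<And>f f'. Poly_Mapping.keys f \<subseteq> ?C t \<Longrightarrow> Poly_Mapping.keys f' \<subseteq> ?C t' \<Longrightarrow> \<mu> (Q.cls t f) (Q.cls t' f') = ?cls (?m0 f f')"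
    using bihom_quotient[OF fq fq groth_comm bi r1 r2] by blast
  have "\<mu> (groth_class E t M) (groth_class E t' N) = groth_class E (t * t') (tens t M t' N)"
    if "M \<in> objs t" "N \<in> objs t'" for M N
    using \<mu>(2)[of "frag_of (iso_class t M)" "frag_of (iso_class t' N)"] that
    by (simp add: groth_class_eq bil_class)
  then show ?thesis using \<mu>(1) unfolding groth_eq[symmetric] by blast
qed

section \<open>Complex coefficients and generators of the graded algebras\<close>

lemma complexified_groth: "complexified (groth E t)"
  by (simp add: complexified_def groth_comm)

sublocale CG: complexified "groth E t" for t by (rule complexified_groth)

lemma comm_family_cgroth: "comm_family \<Gamma> (cgroth E)"
  by (intro comm_family.intro) (simp add: cgroth_eq CG.ctens_comm)

sublocale CF: comm_family \<Gamma> "cgroth E" for \<Gamma> by (rule comm_family_cgroth)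

lemma cgroth_smult_pure:
  "cgroth_smult E t c \<in> hom (cgroth E t) (cgroth E t)" (is ?hom)
  "g \<in> carrier (groth E t) \<Longrightarrow> cgroth_smult E t c (cgroth_pure E t d g) = cgroth_pure E t (c * d) g"
proof -
  obtain \<theta> where \<theta>: "\<theta> \<in> hom (cgroth E t) (cgroth E t)"
    "\<And>d g. g \<in> carrier (groth E t) \<Longrightarrow> \<theta> (cgroth_pure E t d g) = cgroth_pure E t (c * d) g"
    "\<And>S. S \<in> carrier (cgroth E t) \<Longrightarrow> cgroth_smult E t c S = \<theta> S"
    using ctens_smult_eq[OF groth_comm, of t c]
    unfolding cgroth_eq cgroth_pure_eq cgroth_smult_def cgroth_null_def by blast
  interpret comm_group "cgroth E t" unfolding cgroth_eq by (rule CG.ctens_comm)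
  show ?hom using \<theta>(1,3) by (auto simp: hom_def)
  show "cgroth_smult E t c (cgroth_pure E t d g) = cgroth_pure E t (c * d) g" if "g \<in> carrier (groth E t)"
    using \<theta>(2,3) that CG.cpure_closed unfolding cgroth_eq cgroth_pure_eq by simp
qed

abbreviation (input) "gen \<Gamma> t c M \<equiv> alg_incl E \<Gamma> t (cgroth_pure E t c (groth_class E t M))"

lemma alg_comm: "comm_group (alg_group E \<Gamma>)"
  unfolding alg_group_eq by (rule CF.sum_comm_group)

lemma pure_class_closed: "M \<in> objs t \<Longrightarrow> cgroth_pure E t c (groth_class E t M) \<in> carrier (cgroth E t)"
  unfolding cgroth_eq cgroth_pure_eq by (intro CG.cpure_closed groth_class_closed)

lemma gen_closed: "t \<in> \<Gamma> \<Longrightarrow> M \<in> objs t \<Longrightarrow> gen \<Gamma> t c M \<in> carrier (alg_group E \<Gamma>)"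
  unfolding alg_group_eq alg_incl_eq by (intro CF.incl_closed pure_class_closed)

lemma alg_incl_hom: "t \<in> \<Gamma> \<Longrightarrow> alg_incl E \<Gamma> t \<in> hom (cgroth E t) (alg_group E \<Gamma>)"
  unfolding alg_group_eq alg_incl_eq by (rule CF.incl_hom)

text \<open>Classes of objects with arbitrary complex coefficients generate additively: the inverse
  of a class is absorbed as the opposite coefficient. Identities between additive or biadditive maps
  then have to be checked on such elements only.\<close>

lemma alg_induct [consumes 1, case_names one gen mult]:
  assumes x: "x \<in> carrier (alg_group E \<Gamma>)"
    and one: "P \<one>\<^bsub>alg_group E \<Gamma>\<^esub>"
    and gen: "\<And>t c M. t \<in> \<Gamma> \<Longrightarrow> M \<in> objs t \<Longrightarrow> P (gen \<Gamma> t c M)"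
    and mult: "\<And>x y. x \<in> carrier (alg_group E \<Gamma>) \<Longrightarrow> y \<in> carrier (alg_group E \<Gamma>) \<Longrightarrow> P x \<Longrightarrow> P y \<Longrightarrow> P (x \<otimes>\<^bsub>alg_group E \<Gamma>\<^esub> y)"
  shows "P x"
proof -
  interpret B: comm_group "alg_group E \<Gamma>" by (rule alg_comm)
  have 1: "P (alg_incl E \<Gamma> t (cgroth_pure E t c g))" if t: "t \<in> \<Gamma>" and g: "g \<in> carrier (groth E t)" for t c g
  proof -
    interpret T: comm_group "cgroth E t" unfolding cgroth_eq by (rule CG.ctens_comm)
    note ih = alg_incl_hom[OF t]
    have ci: "alg_incl E \<Gamma> t (cgroth_pure E t c g) \<in> carrier (alg_group E \<Gamma>)" if "g \<in> carrier (groth E t)" for c g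
      by (rule hom_in_carrier[OF ih]) (use that in \<open>simp add: cgroth_eq cgroth_pure_eq\<close>)
    have "g \<in> carrier (Q.Q t)" using g unfolding groth_eq .
    then have "g \<in> carrier (groth E t) \<and> P (alg_incl E \<Gamma> t (cgroth_pure E t c g))"
    proof (induction g arbitrary: c rule: Q.Q_induct)
      case 1
      have "cgroth_pure E t c \<one>\<^bsub>groth E t\<^esub> = \<one>\<^bsub>cgroth E t\<^esub>"
        unfolding cgroth_eq cgroth_pure_eq by (rule CG.cpure_one)
      then have "P (alg_incl E \<Gamma> t (cgroth_pure E t c \<one>\<^bsub>groth E t\<^esub>))"
        using one hom_one[OF ih T.is_group B.is_group] by simp
      then show ?case using CG.H.one_closed unfolding groth_eq by blast
    next
      case (2 s)
      then show ?case using gen[OF t] groth_class_closed unfolding groth_class_eq by auto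
    next
      case (3 s)
      then obtain M where M: "M \<in> objs t" "s = iso_class t M" by auto
      have "cgroth_pure E t c (inv\<^bsub>groth E t\<^esub> groth_class E t M) = cgroth_pure E t (- c) (groth_class E t M)"
        unfolding cgroth_eq cgroth_pure_eq by (rule CG.cpure_inv[OF groth_class_closed[OF M(1)]])
      then have "P (alg_incl E \<Gamma> t (cgroth_pure E t c (inv\<^bsub>groth E t\<^esub> groth_class E t M)))"
        using gen[OF t M(1)] by simp
      then show ?case using CG.H.inv_closed[OF groth_class_closed[OF M(1)]]
        unfolding groth_eq groth_class_eq M(2) by blast
    next
      case (4 u v)
      then have uv: "u \<in> carrier (groth E t)" "v \<in> carrier (groth E t)" by blast+
      have "cgroth_pure E t c (u \<otimes>\<^bsub>groth E t\<^esub> v) = cgroth_pure E t c u \<otimes>\<^bsub>cgroth E t\<^esub> cgroth_pure E t c v"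
        unfolding cgroth_eq cgroth_pure_eq by (rule CG.cpure_add_right[OF uv])
      moreover have "cgroth_pure E t c u \<in> carrier (cgroth E t)" "cgroth_pure E t c v \<in> carrier (cgroth E t)"
        using uv by (simp_all add: cgroth_eq cgroth_pure_eq)
      ultimately have "P (alg_incl E \<Gamma> t (cgroth_pure E t c (u \<otimes>\<^bsub>groth E t\<^esub> v)))"
        using mult[OF ci[OF uv(1)] ci[OF uv(2)]] 4 hom_mult[OF ih] by metis
      then show ?case using CG.H.m_closed[OF uv] unfolding groth_eq by blast
    qed
    then show ?thesis by blast
  qed
  have 2: "P (alg_incl E \<Gamma> t u)" if t: "t \<in> \<Gamma>" and u: "u \<in> carrier (cgroth E t)" for t u
  proof -
    have "u \<in> carrier (ctens (groth E t))" using u by (simp add: cgroth_eq)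
    then show ?thesis
    proof (induction u rule: CG.ctens_induct)
      case (pure x y)
      then show ?case using 1[OF t] by (simp add: cgroth_pure_eq)
    next
      case (mult u v)
      then have "alg_incl E \<Gamma> t (u \<otimes>\<^bsub>cgroth E t\<^esub> v) = alg_incl E \<Gamma> t u \<otimes>\<^bsub>alg_group E \<Gamma>\<^esub> alg_incl E \<Gamma> t v"
        by (intro hom_mult[OF alg_incl_hom[OF t]]) (simp_all add: cgroth_eq)
      moreover have "alg_incl E \<Gamma> t u \<in> carrier (alg_group E \<Gamma>)" "alg_incl E \<Gamma> t v \<in> carrier (alg_group E \<Gamma>)"
        using mult(1,2) by (auto intro!: hom_in_carrier[OF alg_incl_hom[OF t]] simp: cgroth_eq)
      ultimately show ?case using assms(4) mult(3,4) by (metis cgroth_eq)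
    qed
  qed
  show ?thesis
    using x[unfolded alg_group_eq]
  proof (induction x rule: CF.sum_induct)
    case one
    show ?case using assms(2) unfolding alg_group_eq .
  next
    case (incl t u)
    then show ?case using 2[OF incl] by (simp add: alg_incl_eq)
  next
    case (mult x y)
    then show ?case using assms(4)[unfolded alg_group_eq] by blast
  qed
qed

lemma alg_hom_eqI:
  assumes K: "group K" and fg: "f \<in> hom (alg_group E \<Gamma>) K" "g \<in> hom (alg_group E \<Gamma>) K"
    and gen: "\<And>t c M. t \<in> \<Gamma> \<Longrightarrow> M \<in> objs t \<Longrightarrow> f (gen \<Gamma> t c M) = g (gen \<Gamma> t c M)"
    and x: "x \<in> carrier (alg_group E \<Gamma>)"
  shows "f x = g x"
  using x
proof (induction x rule: alg_induct)
  case one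
  show ?case using fg[THEN hom_one[OF _ comm_group.axioms(2)[OF alg_comm] K]] by simp
next
  case (mult x y)
  then show ?case using hom_mult[OF fg(1)] hom_mult[OF fg(2)] by simp
qed (rule gen)

lemma alg_bihom_eqI:
  assumes K: "group K" and fg: "bihom (alg_group E \<Gamma>) (alg_group E \<Gamma>) K f" "bihom (alg_group E \<Gamma>) (alg_group E \<Gamma>) K g"
    and gen: "\<And>t c M t' c' M'. t \<in> \<Gamma> \<Longrightarrow> M \<in> objs t \<Longrightarrow> t' \<in> \<Gamma> \<Longrightarrow> M' \<in> objs t' \<Longrightarrow>
      f (gen \<Gamma> t c M) (gen \<Gamma> t' c' M') = g (gen \<Gamma> t c M) (gen \<Gamma> t' c' M')"
    and x: "x \<in> carrier (alg_group E \<Gamma>)" and y: "y \<in> carrier (alg_group E \<Gamma>)"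
  shows "f x y = g x y"
proof (rule alg_hom_eqI[OF K bihomD(4)[OF fg(1) y] bihomD(4)[OF fg(2) y] _ x])
  fix t c M assume t: "t \<in> \<Gamma>" "M \<in> objs t"
  note c = gen_closed[OF t, of c]
  show "f (gen \<Gamma> t c M) y = g (gen \<Gamma> t c M) y"
    by (rule alg_hom_eqI[OF K bihomD(5)[OF fg(1) c] bihomD(5)[OF fg(2) c] _ y]) (rule gen[OF t])
qed

lemma alg_smult_hom: "alg_smult E \<Gamma> c \<in> hom (alg_group E \<Gamma>) (alg_group E \<Gamma>)"
proof (rule homI)
  fix x assume x: "x \<in> carrier (alg_group E \<Gamma>)"
  have g: "group (cgroth E t)" for t using CF.grp[of t UNIV] by simp
  have "{t \<in> \<Gamma>. alg_smult E \<Gamma> c x t \<noteq> \<one>\<^bsub>cgroth E t\<^esub>} \<subseteq> {t \<in> \<Gamma>. x t \<noteq> \<one>\<^bsub>cgroth E t\<^esub>}"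
    using hom_one[OF cgroth_smult_pure(1) g g] by (auto simp: alg_smult_def)
  moreover have "alg_smult E \<Gamma> c x \<in> (\<Pi>\<^sub>E t\<in>\<Gamma>. carrier (cgroth E t))"
    using x hom_in_carrier[OF cgroth_smult_pure(1)] unfolding alg_group_eq CF.carrier_sum
    by (auto simp: alg_smult_def PiE_iff)
  ultimately show "alg_smult E \<Gamma> c x \<in> carrier (alg_group E \<Gamma>)"
    using x unfolding alg_group_eq CF.carrier_sum by (auto intro: finite_subset)
next
  fix x y assume "x \<in> carrier (alg_group E \<Gamma>)" "y \<in> carrier (alg_group E \<Gamma>)"
  then show "alg_smult E \<Gamma> c (x \<otimes>\<^bsub>alg_group E \<Gamma>\<^esub> y) = alg_smult E \<Gamma> c x \<otimes>\<^bsub>alg_group E \<Gamma>\<^esub> alg_smult E \<Gamma> c y"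
    unfolding alg_group_eq CF.carrier_sum
    by (auto simp: alg_smult_def PiE_iff hom_mult[OF cgroth_smult_pure(1)] intro!: restrict_ext)
qed

lemma alg_smult_gen:
  assumes "t \<in> \<Gamma>" "g \<in> carrier (groth E t)"
  shows "alg_smult E \<Gamma> c (alg_incl E \<Gamma> t (cgroth_pure E t d g)) = alg_incl E \<Gamma> t (cgroth_pure E t (c * d) g)"
proof -
  have g: "group (cgroth E t)" for t using CF.grp[of t UNIV] by simp
  have "cgroth_smult E s c \<one>\<^bsub>cgroth E s\<^esub> = \<one>\<^bsub>cgroth E s\<^esub>" for s
    using hom_one[OF cgroth_smult_pure(1) g g] .
  then show ?thesis
    using cgroth_smult_pure(2)[OF assms(2)] by (auto simp: alg_smult_def alg_incl_def intro!: restrict_ext)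
qed

lemma groth_class_tens_closed:
  "M \<in> objs t \<Longrightarrow> N \<in> objs t' \<Longrightarrow> groth_class E (t * t') (tens t M t' N) \<in> carrier (groth E (t * t'))"
proof -
  assume "M \<in> objs t" "N \<in> objs t'"
  from ex_obj_tensor[OF this] obtain K where
    K: "K \<in> objs (t * t')" "iso_class (t * t') K = iso_class (t * t') (tens t M t' N)" by blast
  from groth_class_closed[OF K(1)] show ?thesis by (simp add: groth_class_def K(2))
qed

text \<open>\<open>alg_mult\<close> is a choice, so a product has to be exhibited. It is carried
  from the Grothendieck groups to complex coefficients, then into the summand at tt', then to the
  direct sum; compatibility with complex scalars is checked on generators.\<close>

lemma alg_product_exists:
  assumes \<Gamma>: "\<forall>t\<in>\<Gamma>. \<forall>t'\<in>\<Gamma>. t * t' \<in> \<Gamma>"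
  shows "\<exists>P. is_alg_product E \<Gamma> P"
proof -
  let ?B = "alg_group E \<Gamma>"
  interpret B: comm_group ?B by (rule alg_comm)
  have "\<exists>\<nu>. bihom (cgroth E t) (cgroth E t') (cgroth E (t * t')) \<nu>
     \<and> (\<forall>c d. \<forall>M\<in>objs t. \<forall>N\<in>objs t'. \<nu> (cgroth_pure E t c (groth_class E t M)) (cgroth_pure E t' d (groth_class E t' N))
        = cgroth_pure E (t * t') (c * d) (groth_class E (t * t') (tens t M t' N)))" for t t'
  proof -
    obtain \<mu> where \<mu>: "bihom (groth E t) (groth E t') (groth E (t * t')) \<mu>"
      "\<And>M N. M \<in> objs t \<Longrightarrow> N \<in> objs t' \<Longrightarrow> \<mu> (groth_class E t M) (groth_class E t' N) = groth_class E (t * t') (tens t M t' N)"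
      using groth_bilinear[of t t'] by blast
    obtain \<nu> where \<nu>: "bihom (ctens (groth E t)) (ctens (groth E t')) (ctens (groth E (t * t'))) \<nu>"
      "\<And>c d g h. g \<in> carrier (groth E t) \<Longrightarrow> h \<in> carrier (groth E t') \<Longrightarrow>
        \<nu> (cpure (groth E t) c g) (cpure (groth E t') d h) = cpure (groth E (t * t')) (c * d) (\<mu> g h)"
      using ctens_bimap[OF groth_comm groth_comm groth_comm \<mu>(1)] by blast
    show ?thesis
      unfolding cgroth_eq cgroth_pure_eq
      by (intro exI[of _ \<nu>] conjI \<nu>(1) allI ballI) (simp add: \<nu>(2) groth_class_closed \<mu>(2))
  qed
  then obtain \<nu> where \<nu>: "\<And>t t'. bihom (cgroth E t) (cgroth E t') (cgroth E (t * t')) (\<nu> t t')"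
     "\<And>t t' c d M N. M \<in> objs t \<Longrightarrow> N \<in> objs t' \<Longrightarrow>
        \<nu> t t' (cgroth_pure E t c (groth_class E t M)) (cgroth_pure E t' d (groth_class E t' N))
        = cgroth_pure E (t * t') (c * d) (groth_class E (t * t') (tens t M t' N))"
    by metis
  have "bihom (cgroth E t) (cgroth E t') ?B (\<lambda>u v. alg_incl E \<Gamma> (t * t') (\<nu> t t' u v))"
    if "t \<in> \<Gamma>" "t' \<in> \<Gamma>" for t t'
    using hom_in_carrier[OF alg_incl_hom[OF \<Gamma>[rule_format, OF that]]] hom_mult[OF alg_incl_hom[OF \<Gamma>[rule_format, OF that]]] bihomD(1-3)[OF \<nu>(1)]
    by (intro bihomI) simp_all
  from bihom_sum[OF comm_family_cgroth comm_family_cgroth alg_comm, of \<Gamma> \<Gamma>, OF this]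
  obtain P where P: "bihom ?B ?B ?B P" 
    "\<And>t t' u v. t \<in> \<Gamma> \<Longrightarrow> t' \<in> \<Gamma> \<Longrightarrow> u \<in> carrier (cgroth E t) \<Longrightarrow> v \<in> carrier (cgroth E t') \<Longrightarrow>
      P (alg_incl E \<Gamma> t u) (alg_incl E \<Gamma> t' v) = alg_incl E \<Gamma> (t * t') (\<nu> t t' u v)"
    unfolding alg_group_eq[symmetric] alg_incl_eq[symmetric] by blast
  have Pg: "P (gen \<Gamma> t c M) (gen \<Gamma> t' d N) = alg_incl E \<Gamma> (t * t') (cgroth_pure E (t * t') (c * d) (groth_class E (t * t') (tens t M t' N)))"
    if "t \<in> \<Gamma>" "t' \<in> \<Gamma>" "M \<in> objs t" "N \<in> objs t'" for t t' c d M N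
    using P(2)[OF that(1,2) pure_class_closed[OF that(3)] pure_class_closed[OF that(4)]] \<nu>(2)[OF that(3,4)] by simp
  note sh = alg_smult_hom[of \<Gamma>]
  note shc = hom_in_carrier[OF sh] and shm = hom_mult[OF sh]
  note Pc = bihomD(1)[OF P(1)] and Pl = bihomD(2)[OF P(1)] and Pr = bihomD(3)[OF P(1)]
  have b: "bihom ?B ?B ?B (\<lambda>x y. P (alg_smult E \<Gamma> c x) y)" "bihom ?B ?B ?B (\<lambda>x y. P x (alg_smult E \<Gamma> c y))"
    "bihom ?B ?B ?B (\<lambda>x y. alg_smult E \<Gamma> c (P x y))" for c
    by (intro bihomI; simp add: shc shm Pc Pl Pr)+
  have "is_alg_product E \<Gamma> P"
    unfolding is_alg_product_def Let_def
  proof (intro conjI ballI allI)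
    fix c x y assume xy: "x \<in> carrier ?B" "y \<in> carrier ?B"
    show "P (alg_smult E \<Gamma> c x) y = alg_smult E \<Gamma> c (P x y)"
      by (rule alg_bihom_eqI[OF B.is_group b(1) b(3) _ xy])
        (simp add: Pg alg_smult_gen groth_class_closed groth_class_tens_closed \<Gamma> mult.assoc)
    show "P x (alg_smult E \<Gamma> c y) = alg_smult E \<Gamma> c (P x y)"
      by (rule alg_bihom_eqI[OF B.is_group b(2) b(3) _ xy])
        (simp add: Pg alg_smult_gen groth_class_closed groth_class_tens_closed \<Gamma> mult.left_commute)
  next
    fix t t' M M' assume "t \<in> \<Gamma>" "t' \<in> \<Gamma>" "M \<in> objs t" "M' \<in> objs t'"
    then show "P (alg_class E \<Gamma> t M) (alg_class E \<Gamma> t' M') = alg_class E \<Gamma> (t * t') (tens t M t' M')"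
      unfolding alg_class_def by (simp add: Pg)
  qed (simp_all add: Pc Pl Pr)
  then show ?thesis by blast
qed

text \<open>The specification of the product prescribes classes with coefficient 1. The formula for
  general coefficients follows by writing each generator as a scalar multiple of such a
  class.\<close>

lemma alg_mult_product:
  assumes "\<forall>t\<in>\<Gamma>. \<forall>t'\<in>\<Gamma>. t * t' \<in> \<Gamma>"
  shows "bihom (alg_group E \<Gamma>) (alg_group E \<Gamma>) (alg_group E \<Gamma>) (alg_mult E \<Gamma>)"
    "\<lbrakk>t \<in> \<Gamma>; t' \<in> \<Gamma>; M \<in> objs t; N \<in> objs t'\<rbrakk> \<Longrightarrow> alg_mult E \<Gamma> (gen \<Gamma> t c M) (gen \<Gamma> t' d N)
       = alg_incl E \<Gamma> (t * t') (cgroth_pure E (t * t') (c * d) (groth_class E (t * t') (tens t M t' N)))"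
proof -
  have P: "is_alg_product E \<Gamma> (alg_mult E \<Gamma>)"
    unfolding alg_mult_def by (rule someI_ex[OF alg_product_exists[OF assms]])
  then show "bihom (alg_group E \<Gamma>) (alg_group E \<Gamma>) (alg_group E \<Gamma>) (alg_mult E \<Gamma>)"
    unfolding is_alg_product_def Let_def by (intro bihomI) blast+
  assume t: "t \<in> \<Gamma>" "t' \<in> \<Gamma>" and M: "M \<in> objs t" "N \<in> objs t'"
  have g: "gen \<Gamma> t c M = alg_smult E \<Gamma> c (alg_class E \<Gamma> t M)" if "t \<in> \<Gamma>" "M \<in> objs t" for t c M
    unfolding alg_class_def using alg_smult_gen[OF that(1) groth_class_closed[OF that(2)]] by simp
  have cl: "alg_class E \<Gamma> t M \<in> carrier (alg_group E \<Gamma>)" if "t \<in> \<Gamma>" "M \<in> objs t" for t M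
    unfolding alg_class_def using that by (rule gen_closed)
  have sc: "alg_smult E \<Gamma> c x \<in> carrier (alg_group E \<Gamma>)" if "x \<in> carrier (alg_group E \<Gamma>)" for c x
    using hom_in_carrier[OF alg_smult_hom that] .
  have "alg_mult E \<Gamma> (gen \<Gamma> t c M) (gen \<Gamma> t' d N) = alg_smult E \<Gamma> d (alg_smult E \<Gamma> c (alg_class E \<Gamma> (t * t') (tens t M t' N)))"
    using P t M cl sc unfolding g[OF t(1) M(1)] g[OF t(2) M(2)] is_alg_product_def Let_def by simp
  also have "\<dots> = alg_incl E \<Gamma> (t * t') (cgroth_pure E (t * t') (c * d) (groth_class E (t * t') (tens t M t' N)))"
    unfolding alg_class_def using assms[rule_format, OF t] groth_class_tens_closed[OF M] by (simp add: alg_smult_gen mult.commute)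
  finally show "alg_mult E \<Gamma> (gen \<Gamma> t c M) (gen \<Gamma> t' d N)
       = alg_incl E \<Gamma> (t * t') (cgroth_pure E (t * t') (c * d) (groth_class E (t * t') (tens t M t' N)))" .
qed

text \<open>The unit object enters as a parameter with its effect on tensor products. Symmetry of
  the tensor product on classes makes the left unit a two-sided one.\<close>

lemma alg_unit:
  assumes \<Gamma>: "\<forall>t\<in>\<Gamma>. \<forall>t'\<in>\<Gamma>. t * t' \<in> \<Gamma>" "1 \<in> \<Gamma>"
    and U: "U \<in> objs 1" "\<forall>t\<in>\<Gamma>. \<forall>M\<in>objs t. gwa_iso t (tens 1 U t M) M"
  shows "\<exists>e\<in>carrier (alg_group E \<Gamma>). \<forall>x\<in>carrier (alg_group E \<Gamma>). alg_mult E \<Gamma> e x = x \<and> alg_mult E \<Gamma> x e = x"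
proof -
  interpret B: comm_group "alg_group E \<Gamma>" by (rule alg_comm)
  note m = alg_mult_product[of \<Gamma>, OF \<Gamma>(1)]
  let ?e = "gen \<Gamma> 1 1 U"
  have e: "?e \<in> carrier (alg_group E \<Gamma>)" by (rule gen_closed[OF \<Gamma>(2) U(1)])
  have id: "(\<lambda>x. x) \<in> hom (alg_group E \<Gamma>) (alg_group E \<Gamma>)" by (auto simp: hom_def)
  have c: "groth_class E t (tens 1 U t M) = groth_class E t M" "groth_class E t (tens t M 1 U) = groth_class E t M"
    if "t \<in> \<Gamma>" "M \<in> objs t" for t M
  proof -
    have L: "left_module (gwa 1) U" "left_module (gwa t) M" using U(1) that by (auto intro: left_module_obj)
    have "iso_class t (tens 1 U t M) = iso_class t M"
      using iso_class_cong[OF bspec[OF bspec[OF U(2) that(1)] that(2)]] left_module_tens[OF L] by simp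
    then show "groth_class E t (tens 1 U t M) = groth_class E t M" "groth_class E t (tens t M 1 U) = groth_class E t M"
      using tens_class_swap[OF L] by (simp_all add: groth_class_def)
  qed
  have "alg_mult E \<Gamma> ?e x = x \<and> alg_mult E \<Gamma> x ?e = x" if x: "x \<in> carrier (alg_group E \<Gamma>)" for x
  proof
    show "alg_mult E \<Gamma> ?e x = x"
    proof (rule alg_hom_eqI[OF B.is_group bihomD(5)[OF m(1) e] id _ x])
      fix t c' M assume t: "t \<in> \<Gamma>" "M \<in> objs t"
      show "alg_mult E \<Gamma> ?e (gen \<Gamma> t c' M) = gen \<Gamma> t c' M"
        using m(2)[OF \<Gamma>(2) t(1) U(1) t(2), of 1 c'] c[OF t] by simp
    qed
    show "alg_mult E \<Gamma> x ?e = x"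
    proof (rule alg_hom_eqI[OF B.is_group bihomD(4)[OF m(1) e] id _ x])
      fix t c' M assume t: "t \<in> \<Gamma>" "M \<in> objs t"
      show "alg_mult E \<Gamma> (gen \<Gamma> t c' M) ?e = gen \<Gamma> t c' M"
        using m(2)[OF t(1) \<Gamma>(2) t(2) U(1), of c' 1] c[OF t] by simp
    qed
  qed
  then show ?thesis using e by blast
qed

end

section \<open>From the split to the exact algebra\<close>

interpretation Split: rel_fam split_rels "\<lambda>t M M'' M'. gwa_iso t M'' (direct_sum M M')"
  by (rule rel_fam_split)

interpretation Exact: rel_fam exact_rels short_exact
  by (rule rel_fam_exact)

lemma kappa_exists:
  "\<exists>\<kappa>. \<kappa> \<in> hom (groth split_rels t) (groth exact_rels t)
     \<and> (\<forall>M\<in>objs t. \<kappa> (groth_class split_rels t M) = groth_class exact_rels t M)"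
proof -
  have "Exact.Q.cls t r = \<one>\<^bsub>Exact.Q.Q t\<^esub>" if "r \<in> split_rels t" for r
    by (rule Exact.Q.cls_rel) (use that split_subset_exact in blast)
  then obtain g where
    g: "g \<in> hom (Split.Q.Q t) (Exact.Q.Q t)"
    "\<And>f. Poly_Mapping.keys f \<subseteq> iso_class t ` objs t \<Longrightarrow> g (Split.Q.cls t f) = Exact.Q.cls t f"
    using Split.Q.universal[OF Exact.Q.Q_comm[of t] Exact.Q.cls_hom[of t]] by blast
  show ?thesis
    using g unfolding Split.groth_eq[symmetric] Exact.groth_eq[symmetric]
    by (intro exI[of _ g]) (auto simp: Split.groth_class_eq Exact.groth_class_eq)
qed

lemma alg_simps:
  "carrier (alg E \<Gamma>) = carrier (alg_group E \<Gamma>)" "monoid.mult (alg E \<Gamma>) = alg_mult E \<Gamma>"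
  "add (alg E \<Gamma>) = monoid.mult (alg_group E \<Gamma>)" "module.smult (alg E \<Gamma>) = alg_smult E \<Gamma>"
  by (simp_all add: alg_def)

text \<open>Two-sided units coincide, so the definite description inside \<open>alg\<close> denotes
  any element known to act as one.\<close>

lemma alg_one:
  assumes "e \<in> carrier (alg_group E \<Gamma>)"
    "\<forall>x\<in>carrier (alg_group E \<Gamma>). alg_mult E \<Gamma> e x = x \<and> alg_mult E \<Gamma> x e = x"
  shows "\<one>\<^bsub>alg E \<Gamma>\<^esub> = e"
proof -
  have "(THE e. e \<in> carrier (alg_group E \<Gamma>)
      \<and> (\<forall>x\<in>carrier (alg_group E \<Gamma>). alg_mult E \<Gamma> e x = x \<and> alg_mult E \<Gamma> x e = x)) = e"
    by (rule the_equality) (use assms in \<open>blast, metis\<close>)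
  then show ?thesis by (simp add: alg_def)
qed

lemma canonical_map_exists:
  assumes \<Gamma>: "\<forall>t\<in>\<Gamma>. \<forall>t'\<in>\<Gamma>. t * t' \<in> \<Gamma>" "1 \<in> \<Gamma>"
    and U: "U \<in> objs 1" "\<forall>t\<in>\<Gamma>. \<forall>M\<in>objs t. gwa_iso t (tens 1 U t M) M"
  shows "\<exists>\<kappa> \<phi>.
      (\<forall>t\<in>\<Gamma>. \<kappa> t \<in> hom (groth split_rels t) (groth exact_rels t)
         \<and> (\<forall>M\<in>objs t. \<kappa> t (groth_class split_rels t M) = groth_class exact_rels t M))
    \<and> \<phi> \<in> algebra_hom (alg_split \<Gamma>) (alg_exact \<Gamma>)
    \<and> \<phi> ` carrier (alg_split \<Gamma>) = carrier (alg_exact \<Gamma>)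
    \<and> (\<forall>t\<in>\<Gamma>. \<forall>c. \<forall>g\<in>carrier (groth split_rels t).
         \<phi> (alg_incl split_rels \<Gamma> t (cgroth_pure split_rels t c g))
           = alg_incl exact_rels \<Gamma> t (cgroth_pure exact_rels t c (\<kappa> t g)))
    \<and> (\<forall>t\<in>\<Gamma>. \<forall>M\<in>objs t. \<phi> (alg_class split_rels \<Gamma> t M) = alg_class exact_rels \<Gamma> t M)"
proof -
  let ?A = "alg_group split_rels \<Gamma>" and ?B = "alg_group exact_rels \<Gamma>"
  interpret A: comm_group ?A by (rule Split.alg_comm)
  interpret B: comm_group ?B by (rule Exact.alg_comm)
  obtain \<kappa> where \<kappa>: "\<And>t. \<kappa> t \<in> hom (groth split_rels t) (groth exact_rels t)"
    "\<And>t M. M \<in> objs t \<Longrightarrow> \<kappa> t (groth_class split_rels t M) = groth_class exact_rels t M"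
    using kappa_exists by metis
  have "\<exists>\<Phi>. \<Phi> \<in> hom (cgroth split_rels t) (cgroth exact_rels t)
    \<and> (\<forall>c. \<forall>g\<in>carrier (groth split_rels t). \<Phi> (cgroth_pure split_rels t c g) = cgroth_pure exact_rels t c (\<kappa> t g))" for t
    using ctens_map[OF Split.groth_comm Exact.groth_comm \<kappa>(1), of t 1]
    unfolding cgroth_eq cgroth_pure_eq by simp
  then obtain \<Phi> where \<Phi>: "\<And>t. \<Phi> t \<in> hom (cgroth split_rels t) (cgroth exact_rels t)"
    "\<And>t c g. g \<in> carrier (groth split_rels t) \<Longrightarrow> \<Phi> t (cgroth_pure split_rels t c g) = cgroth_pure exact_rels t c (\<kappa> t g)"
    by metis
  have grp: "group (cgroth split_rels t)" "group (cgroth exact_rels t)" for t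
    using Split.CF.grp[of t UNIV] Exact.CF.grp[of t UNIV] by simp_all
  have \<Phi>1: "\<Phi> t \<one>\<^bsub>cgroth split_rels t\<^esub> = \<one>\<^bsub>cgroth exact_rels t\<^esub>" for t
    by (rule hom_one[OF \<Phi>(1) grp])
  define \<phi> where "\<phi> x = (\<lambda>t\<in>\<Gamma>. \<Phi> t (x t))" for x :: alg_elt
  have \<phi>: "\<phi> \<in> hom ?A ?B"
  proof (rule homI)
    fix x assume x: "x \<in> carrier ?A"
    have "{t \<in> \<Gamma>. \<phi> x t \<noteq> \<one>\<^bsub>cgroth exact_rels t\<^esub>} \<subseteq> {t \<in> \<Gamma>. x t \<noteq> \<one>\<^bsub>cgroth split_rels t\<^esub>}"
      using \<Phi>1 by (auto simp: \<phi>_def)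
    moreover have "\<phi> x \<in> (\<Pi>\<^sub>E t\<in>\<Gamma>. carrier (cgroth exact_rels t))"
      using x hom_in_carrier[OF \<Phi>(1)] unfolding alg_group_eq Split.CF.carrier_sum
      by (auto simp: \<phi>_def PiE_iff)
    ultimately show "\<phi> x \<in> carrier ?B"
      using x unfolding alg_group_eq Exact.CF.carrier_sum Split.CF.carrier_sum by (auto intro: finite_subset)
  next
    fix x y assume "x \<in> carrier ?A" "y \<in> carrier ?A"
    then show "\<phi> (x \<otimes>\<^bsub>?A\<^esub> y) = \<phi> x \<otimes>\<^bsub>?B\<^esub> \<phi> y"
      unfolding alg_group_eq Split.CF.carrier_sum
      by (auto simp: \<phi>_def PiE_iff hom_mult[OF \<Phi>(1)] intro!: restrict_ext)
  qed
  note \<phi>c = hom_in_carrier[OF \<phi>] and \<phi>m = hom_mult[OF \<phi>]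
  have \<phi>p: "\<phi> (alg_incl split_rels \<Gamma> t (cgroth_pure split_rels t c g)) = alg_incl exact_rels \<Gamma> t (cgroth_pure exact_rels t c (\<kappa> t g))"
    if "g \<in> carrier (groth split_rels t)" for t c g
    using \<Phi>(2)[OF that] \<Phi>1 by (auto simp: \<phi>_def alg_incl_def intro!: restrict_ext)
  have \<phi>g: "\<phi> (alg_incl split_rels \<Gamma> t (cgroth_pure split_rels t c (groth_class split_rels t M)))
    = alg_incl exact_rels \<Gamma> t (cgroth_pure exact_rels t c (groth_class exact_rels t M))"
    if "M \<in> objs t" for t c M
    using \<phi>p[OF Split.groth_class_closed[OF that]] \<kappa>(2)[OF that] by simp
  \<comment> \<open>A tensor product of two objects is not on the universe, so the formula for
    objects is applied to an isomorphic object with the same class.\<close>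
  have \<phi>t: "\<phi> (alg_incl split_rels \<Gamma> (t * t') (cgroth_pure split_rels (t * t') c (groth_class split_rels (t * t') (tens t M t' N))))
    = alg_incl exact_rels \<Gamma> (t * t') (cgroth_pure exact_rels (t * t') c (groth_class exact_rels (t * t') (tens t M t' N)))"
    if MN: "M \<in> objs t" "N \<in> objs t'" for t t' c M N
  proof -
    obtain K where K: "K \<in> objs (t * t')" "iso_class (t * t') K = iso_class (t * t') (tens t M t' N)"
      using ex_obj_tensor[OF MN] by blast
    show ?thesis using \<phi>g[OF K(1), of c] by (simp add: groth_class_def K(2))
  qed
  note mA = Split.alg_mult_product[OF \<Gamma>(1)] and mB = Exact.alg_mult_product[OF \<Gamma>(1)]
  have mult: "\<phi> (alg_mult split_rels \<Gamma> x y) = alg_mult exact_rels \<Gamma> (\<phi> x) (\<phi> y)"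
    if "x \<in> carrier ?A" "y \<in> carrier ?A" for x y
  proof (rule Split.alg_bihom_eqI[OF B.is_group _ _ _ that])
    show "bihom ?A ?A ?B (\<lambda>x y. \<phi> (alg_mult split_rels \<Gamma> x y))"
      using bihomD(1-3)[OF mA(1)] by (intro bihomI) (simp_all add: \<phi>c \<phi>m)
    show "bihom ?A ?A ?B (\<lambda>x y. alg_mult exact_rels \<Gamma> (\<phi> x) (\<phi> y))"
      using bihomD(1-3)[OF mB(1)] by (intro bihomI) (simp_all add: \<phi>c \<phi>m)
  qed (simp add: mA(2) mB(2) \<phi>g \<phi>t)
  have smult: "\<phi> (alg_smult split_rels \<Gamma> c x) = alg_smult exact_rels \<Gamma> c (\<phi> x)" if "x \<in> carrier ?A" for c x
  proof (rule Split.alg_hom_eqI[OF B.is_group _ _ _ that])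
    show "(\<lambda>x. \<phi> (alg_smult split_rels \<Gamma> c x)) \<in> hom ?A ?B"
      by (rule hom_compose_fun[OF Split.alg_smult_hom \<phi>])
    show "(\<lambda>x. alg_smult exact_rels \<Gamma> c (\<phi> x)) \<in> hom ?A ?B"
      by (rule hom_compose_fun[OF \<phi> Exact.alg_smult_hom])
  qed (simp add: Split.alg_smult_gen Exact.alg_smult_gen Split.groth_class_closed Exact.groth_class_closed \<phi>g)
  \<comment> \<open>Each generator of the exact algebra is the image of the split generator with the
    same module and the same coefficient.\<close>
  have "\<exists>x\<in>carrier ?A. \<phi> x = y" if "y \<in> carrier ?B" for y
    using that
  proof (induction y rule: Exact.alg_induct)
    case one
    then show ?case using hom_one[OF \<phi> A.is_group B.is_group] A.one_closed by blast
  next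
    case (gen t c M)
    then show ?case using \<phi>g[OF gen(2)] Split.gen_closed[OF gen] by blast
  next
    case (mult x y)
    then obtain x' y' where "x' \<in> carrier ?A" "\<phi> x' = x" "y' \<in> carrier ?A" "\<phi> y' = y" by blast
    then show ?case using \<phi>m[of x' y'] A.m_closed[of x' y'] by blast
  qed
  then have surj: "\<phi> ` carrier ?A = carrier ?B" using \<phi>c by blast
  obtain e where e: "e \<in> carrier ?A"
    "\<forall>x\<in>carrier ?A. alg_mult split_rels \<Gamma> e x = x \<and> alg_mult split_rels \<Gamma> x e = x"
    using Split.alg_unit[OF \<Gamma> U] by blast
  \<comment> \<open>The image of a unit under a surjective multiplicative map acts as a unit on the
    whole target, and the definite description identifies it.\<close>
  have "\<phi> \<one>\<^bsub>alg split_rels \<Gamma>\<^esub> = \<one>\<^bsub>alg exact_rels \<Gamma>\<^esub>"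
    unfolding alg_one[OF e]
  proof (rule alg_one[symmetric])
    show "\<phi> e \<in> carrier ?B" by (rule \<phi>c[OF e(1)])
  next
    show "\<forall>y\<in>carrier ?B. alg_mult exact_rels \<Gamma> (\<phi> e) y = y \<and> alg_mult exact_rels \<Gamma> y (\<phi> e) = y"
    proof
    fix y assume "y \<in> carrier ?B"
    then obtain x where x: "x \<in> carrier ?A" "y = \<phi> x" using surj by blast
    show "alg_mult exact_rels \<Gamma> (\<phi> e) y = y \<and> alg_mult exact_rels \<Gamma> y (\<phi> e) = y"
      using mult[OF e(1) x(1)] mult[OF x(1) e(1)] e(2)[rule_format, OF x(1)] x(2) by simp
    qed
  qed
  then have hom: "\<phi> \<in> algebra_hom (alg_split \<Gamma>) (alg_exact \<Gamma>)"
    unfolding algebra_hom_def ring_hom_def alg_split_def alg_exact_def alg_simps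
    using mult smult \<phi>m \<phi>c by auto
  have surj': "\<phi> ` carrier (alg_split \<Gamma>) = carrier (alg_exact \<Gamma>)"
    unfolding alg_split_def alg_exact_def alg_simps by (rule surj)
  show ?thesis
    unfolding alg_class_def
    by (intro exI[of _ \<kappa>] exI[of _ \<phi>] conjI ballI allI \<kappa> \<phi>p \<phi>g hom surj')
qed

section \<open>Modules with one-dimensional weight spaces\<close>

text \<open>Coordinates \<open>f n\<close> on a basis \<open>e\<^sub>n\<close> (\<open>n \<in> S\<close>) with
  \<open>X\<^sup>+ e\<^sub>n = a\<^sub>n e\<^sub>n\<^sub>+\<^sub>1\<close> and \<open>X\<^sup>- e\<^sub>n\<^sub>+\<^sub>1 = b\<^sub>n e\<^sub>n\<close>.\<close>

definition seq_group :: "int set \<Rightarrow> (int \<Rightarrow> complex) gwa_module" where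
  "seq_group S = \<lparr>carrier = {f. finite {n. f n \<noteq> 0} \<and> (\<forall>n. n \<notin> S \<longrightarrow> f n = 0)},
     monoid.mult = undefined, one = undefined, ring.zero = (\<lambda>_. 0), add = (\<lambda>f g n. f n + g n), smult = undefined\<rparr>"

definition seq_gen :: "(int \<Rightarrow> complex) \<Rightarrow> (int \<Rightarrow> complex) \<Rightarrow> gwa_gen \<Rightarrow> (int \<Rightarrow> complex) \<Rightarrow> int \<Rightarrow> complex" where
  "seq_gen a b x f = (\<lambda>n. if x = Gen_Xp then a (n - 1) * f (n - 1) else b n * f (n + 1))"

text \<open>The sequences fix the additive group and the operators of the generators; the action of
  all of A(t) is chosen so as to extend these operators.\<close>

definition seq_module where
  "seq_module t S a b = (seq_group S)\<lparr>smult := (SOME s. left_module (gwa t) ((seq_group S)\<lparr>smult := s\<rparr>)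
     \<and> (\<forall>v\<in>carrier (seq_group S). (\<forall>r. act_poly t ((seq_group S)\<lparr>smult := s\<rparr>) r v = (\<lambda>n. poly r (of_int n) * v n))
          \<and> (\<forall>x\<in>{Gen_Xp, Gen_Xm}. act_gen t ((seq_group S)\<lparr>smult := s\<rparr>) x v = seq_gen a b x v)))\<rparr>"

definition unit_seq :: "int \<Rightarrow> int \<Rightarrow> complex" where
  "unit_seq n = (\<lambda>m. if m = n then 1 else 0)"

lemma poly_shift: "poly (shift c r) x = poly r (x - c)"
  by (simp add: shift_def poly_pcompose algebra_simps)

text \<open>X- X+ acts on weight n as the value of t at n + 1/2, which fixes the product of the two
  structure constants between n and n + 1. Together with \<open>zero\<close> this forces t to vanish
  at n + 1/2 whenever exactly one of n and n + 1 lies in \<open>S\<close>.\<close>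

locale seq_data =
  fixes t :: "complex poly" and S :: "int set" and a b :: "int \<Rightarrow> complex"
  assumes ab: "n \<in> S \<or> n + 1 \<in> S \<Longrightarrow> a n * b n = poly t (of_int n + 1 / 2)"
    and zero: "n \<notin> S \<or> n + 1 \<notin> S \<Longrightarrow> a n = 0 \<and> b n = 0"
begin

abbreviation "D \<equiv> seq_module t S a b"

lemma seq_group_simps:
  "carrier (seq_group S) = {f. finite {n. f n \<noteq> 0} \<and> (\<forall>n. n \<notin> S \<longrightarrow> f n = 0)}"
  "\<zero>\<^bsub>seq_group S\<^esub> = (\<lambda>_. 0)" "f \<oplus>\<^bsub>seq_group S\<^esub> g = (\<lambda>n. f n + g n)"
  by (auto simp: seq_group_def)

lemma abelian_group_seq: "abelian_group (seq_group S)"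
proof (rule abelian_groupI)
  fix f g assume "f \<in> carrier (seq_group S)" "g \<in> carrier (seq_group S)"
  moreover have "{n. f n + g n \<noteq> 0} \<subseteq> {n. f n \<noteq> 0} \<union> {n. g n \<noteq> 0}" by auto
  ultimately show "f \<oplus>\<^bsub>seq_group S\<^esub> g \<in> carrier (seq_group S)"
    by (auto simp: seq_group_simps intro: finite_subset)
next
  fix f assume "f \<in> carrier (seq_group S)"
  then show "\<exists>g\<in>carrier (seq_group S). g \<oplus>\<^bsub>seq_group S\<^esub> f = \<zero>\<^bsub>seq_group S\<^esub>"
    by (intro bexI[of _ "\<lambda>n. - f n"]) (auto simp: seq_group_simps)
qed (auto simp: seq_group_simps algebra_simps)

lemma gen_closed:
  assumes f: "f \<in> carrier (seq_group S)"
  shows "seq_gen a b x f \<in> carrier (seq_group S)"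
proof (cases "x = Gen_Xp")
  case True
  have "{n. a (n - 1) * f (n - 1) \<noteq> 0} \<subseteq> (\<lambda>n. n + 1) ` {n. f n \<noteq> 0}"
    by (auto simp: image_iff) (metis diff_add_cancel)
  then have "finite {n. a (n - 1) * f (n - 1) \<noteq> 0}"
    using f by (auto simp: seq_group_simps intro: finite_subset)
  moreover have "a (n - 1) * f (n - 1) = 0" if "n \<notin> S" for n
    using zero[of "n - 1"] that by simp
  ultimately show ?thesis using True by (simp add: seq_gen_def seq_group_simps)
next
  case False
  have "{n. b n * f (n + 1) \<noteq> 0} \<subseteq> (\<lambda>n. n - 1) ` {n. f n \<noteq> 0}"
    by (auto simp: image_iff) (metis add_diff_cancel)
  then have "finite {n. b n * f (n + 1) \<noteq> 0}"
    using f by (auto simp: seq_group_simps intro: finite_subset)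
  moreover have "b n * f (n + 1) = 0" if "n \<notin> S" for n
    using zero[of n] that by simp
  ultimately show ?thesis using False by (simp add: seq_gen_def seq_group_simps)
qed

lemma gwa_act_seq: "gwa_act (seq_group S) (\<lambda>r v n. poly r (of_int n) * v n) t (seq_gen a b)"
proof (intro gwa_act.intro gwa_act_axioms.intro poly_act.intro poly_act_axioms.intro abelian_group_seq)
  fix v r assume v: "v \<in> carrier (seq_group S)"
  have "{n. poly r (of_int n) * v n \<noteq> 0} \<subseteq> {n. v n \<noteq> 0}" by auto
  then show "(\<lambda>n. poly r (of_int n) * v n) \<in> carrier (seq_group S)"
    using v by (auto simp: seq_group_simps intro: finite_subset)
next
  fix v assume v: "v \<in> carrier (seq_group S)"
  \<comment> \<open>X+ X- on weight n passes through weight n - 1, hence the structure constants at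
    n - 1 and the value of t at n - 1/2.\<close>
  show "seq_gen a b Gen_Xp (seq_gen a b Gen_Xm v) = (\<lambda>n. poly (shift (1 / 2) t) (of_int n) * v n)"
  proof
    fix n
    show "seq_gen a b Gen_Xp (seq_gen a b Gen_Xm v) n = poly (shift (1 / 2) t) (of_int n) * v n"
      using v ab[of "n - 1"] by (cases "n \<in> S") (auto simp: seq_gen_def poly_shift seq_group_simps field_simps)
  qed
  show "seq_gen a b Gen_Xm (seq_gen a b Gen_Xp v) = (\<lambda>n. poly (shift (- 1 / 2) t) (of_int n) * v n)"
  proof
    fix n
    show "seq_gen a b Gen_Xm (seq_gen a b Gen_Xp v) n = poly (shift (- 1 / 2) t) (of_int n) * v n"
      using v ab[of n] by (cases "n \<in> S") (auto simp: seq_gen_def poly_shift seq_group_simps mult.assoc mult.commute)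
  qed
qed (auto simp: gen_closed, auto simp: seq_gen_def seq_group_simps algebra_simps poly_shift fun_eq_iff)

lemma seq_module_spec:
  "left_module (gwa t) D" "carrier D = {f. finite {n. f n \<noteq> 0} \<and> (\<forall>n. n \<notin> S \<longrightarrow> f n = 0)}"
  "\<zero>\<^bsub>D\<^esub> = (\<lambda>_. 0)" "f \<oplus>\<^bsub>D\<^esub> g = (\<lambda>n. f n + g n)"
  "f \<in> carrier D \<Longrightarrow> act_poly t D r f = (\<lambda>n. poly r (of_int n) * f n)"
  "f \<in> carrier D \<Longrightarrow> act_gen t D Gen_Xp f = (\<lambda>n. a (n - 1) * f (n - 1))"
  "f \<in> carrier D \<Longrightarrow> act_gen t D Gen_Xm f = (\<lambda>n. b n * f (n + 1))"
proof -
  note P = someI_ex[OF gwa_act_imp_left_module[OF gwa_act_seq], folded seq_module_def]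
  then show "left_module (gwa t) D" by blast
  show c: "carrier D = {f. finite {n. f n \<noteq> 0} \<and> (\<forall>n. n \<notin> S \<longrightarrow> f n = 0)}"
    "\<zero>\<^bsub>D\<^esub> = (\<lambda>_. 0)" "f \<oplus>\<^bsub>D\<^esub> g = (\<lambda>n. f n + g n)"
    by (simp_all add: seq_module_def seq_group_def)
  assume "f \<in> carrier D"
  then have "f \<in> carrier (seq_group S)" by (simp add: c seq_group_simps)
  then show "act_poly t D r f = (\<lambda>n. poly r (of_int n) * f n)"
    "act_gen t D Gen_Xp f = (\<lambda>n. a (n - 1) * f (n - 1))"
    "act_gen t D Gen_Xm f = (\<lambda>n. b n * f (n + 1))"
    using P by (auto simp: seq_gen_def)
qed

sublocale D: gwa_act D "act_poly t D" t "act_gen t D"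
  by (rule left_module_imp_gwa_act[OF seq_module_spec(1)])

lemma single_closed: "n \<in> S \<or> c = 0 \<Longrightarrow> (\<lambda>m. if m = n then c else 0) \<in> carrier D"
  by (auto simp: seq_module_spec(2) intro: finite_subset[of _ "{n}"])

lemma wt_space_D: "f \<in> wt_space D (act_poly t D) n \<longleftrightarrow> f \<in> carrier D \<and> (\<forall>m. m \<noteq> n \<longrightarrow> f m = 0)"
proof -
  have "act_poly t D [:- of_int n, 1:] f = \<zero>\<^bsub>D\<^esub> \<longleftrightarrow> (\<forall>m. m \<noteq> n \<longrightarrow> f m = 0)" if "f \<in> carrier D"
    using that by (auto simp: seq_module_spec(3,5) fun_eq_iff)
  then show ?thesis by (auto simp: wt_space_def)
qed

lemma single_wt: "n \<in> S \<or> c = 0 \<Longrightarrow> (\<lambda>m. if m = n then c else 0) \<in> wt_space D (act_poly t D) n"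
  using single_closed by (simp add: wt_space_D)

lemma wt_single: "f \<in> wt_space D (act_poly t D) n \<Longrightarrow> (\<lambda>m. if m = n then f n else 0) = f \<and> (n \<in> S \<or> f n = 0)"
  by (auto simp: wt_space_D seq_module_spec(2) fun_eq_iff)

lemma wt_act_D: "wt_act D (act_poly t D)"
proof
  have "f \<in> wt_span D (act_poly t D)" if "finite F" "f \<in> carrier D" "{n. f n \<noteq> 0} \<subseteq> F" for F f
    using that
  proof (induction F arbitrary: f rule: finite_induct)
    case empty
    then have "f = \<zero>\<^bsub>D\<^esub>" by (auto simp: seq_module_spec(3))
    then show ?case using wt_span.wt[OF D.wt_zero] by simp
  next
    case (insert i F)
    let ?g = "\<lambda>m. if m = i then f i else 0" and ?h = "f(i := 0)"
    have "{n. ?h n \<noteq> 0} \<subseteq> {n. f n \<noteq> 0}" by auto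
    then have "?h \<in> carrier D" using insert.prems(1) by (auto simp: seq_module_spec(2) intro: finite_subset)
    moreover have "{n. ?h n \<noteq> 0} \<subseteq> F" using insert.prems(2) by auto
    ultimately have h: "?h \<in> wt_span D (act_poly t D)" by (rule insert.IH)
    have "?g \<in> wt_span D (act_poly t D)"
      by (rule wt_span.wt[OF single_wt]) (use insert.prems(1) in \<open>auto simp: seq_module_spec(2)\<close>)
    then have "?g \<oplus>\<^bsub>D\<^esub> ?h \<in> wt_span D (act_poly t D)" using h by (rule wt_span.add)
    moreover have "?g \<oplus>\<^bsub>D\<^esub> ?h = f" by (auto simp: seq_module_spec(4))
    ultimately show ?case by simp
  qed
  then show "f \<in> wt_span D (act_poly t D)" if "f \<in> carrier D" for f
    using that by (auto simp: seq_module_spec(2))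
qed

sublocale W: wt_act D "act_poly t D" by (rule wt_act_D)

lemma graded_D: "graded t D"
proof -
  have "fin_dim D (act_poly t D) (wt_space D (act_poly t D) n)" for n
  proof (cases "n \<in> S")
    case True
    have e: "unit_seq n \<in> wt_space D (act_poly t D) n" using single_wt[of n 1] True by (simp add: unit_seq_def)
    have "\<exists>c. f = lin_comb D (act_poly t D) {unit_seq n} c" if "f \<in> wt_space D (act_poly t D) n" for f
    proof (rule exI[of _ "\<lambda>_. f n"])
      have "lin_comb D (act_poly t D) {unit_seq n} (\<lambda>_. f n) = act_poly t D [:f n:] (unit_seq n)"
        using D.wt_spaceD[OF e] by (simp add: lin_comb_def)
      also have "\<dots> = f" using D.wt_spaceD[OF e] that
        by (auto simp: wt_space_D seq_module_spec(5) unit_seq_def fun_eq_iff)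
      finally show "f = lin_comb D (act_poly t D) {unit_seq n} (\<lambda>_. f n)" by (rule sym)
    qed
    then show ?thesis using e unfolding fin_dim_def by (intro exI[of _ "{unit_seq n}"]) auto
  next
    case False
    have "f = \<zero>\<^bsub>D\<^esub>" if "f \<in> wt_space D (act_poly t D) n" for f
      using that False by (auto simp: wt_space_D seq_module_spec(2,3) fun_eq_iff)
    then show ?thesis unfolding fin_dim_def by (intro exI[of _ "{}"]) (auto simp: lin_comb_def)
  qed
  then show ?thesis using seq_module_spec(1) wt_act_D by (auto simp: graded_def)
qed

lemma comp_D: "f \<in> carrier D \<Longrightarrow> W.comp n f = (\<lambda>m. if m = n then f n else 0)"
proof (rule W.additive_eq[where h = "W.comp n" and h' = "\<lambda>f m. if m = n then f n else 0"])
  show "additive D D (W.comp n)" by (rule W.comp_additive)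
  show "additive D D (\<lambda>f m. if m = n then f n else 0)"
  proof (rule additiveI)
    show "(\<lambda>m. if m = n then v n else 0) \<in> carrier D" if "v \<in> carrier D" for v
      by (rule single_closed) (use that in \<open>auto simp: seq_module_spec(2)\<close>)
  qed (auto simp: seq_module_spec(4))
  show "W.comp n v = (\<lambda>m. if m = n then v n else 0)" if v: "v \<in> wt_space D (act_poly t D) k" for k v
  proof (cases "k = n")
    case True
    then show ?thesis using W.comp_self[of v n] wt_single[of v n] v by simp
  next
    case False
    then show ?thesis using W.comp_other[OF v, of n] v by (auto simp: wt_space_D seq_module_spec(3))
  qed
qed (auto intro: D.abelian_group_axioms)

text \<open>Stated for every complex w because \<open>weights\<close> ranges over the complex
  numbers. For w outside the integers the right-hand side is the zero space.\<close>

lemma weight_space_D: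
  "weight_space t D (ideal_at w) = {f \<in> carrier D. \<forall>m. of_int m \<noteq> w \<longrightarrow> f m = 0}"
proof (intro equalityI subsetI)
  fix f assume f: "f \<in> weight_space t D (ideal_at w)"
  then have fc: "f \<in> carrier D" by (simp add: weight_space_def)
  have "[:- w, 1:] \<in> ideal_at w" by (simp add: ideal_at_eq)
  then have "act_poly t D [:- w, 1:] f = \<zero>\<^bsub>D\<^esub>" using f by (simp add: weight_space_def)
  then have "(of_int m - w) * f m = 0" for m
    using fc by (auto simp: seq_module_spec(3,5) fun_eq_iff)
  then show "f \<in> {f \<in> carrier D. \<forall>m. of_int m \<noteq> w \<longrightarrow> f m = 0}" using fc by auto
next
  fix f assume "f \<in> {f \<in> carrier D. \<forall>m. of_int m \<noteq> w \<longrightarrow> f m = 0}"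
  then show "f \<in> weight_space t D (ideal_at w)"
    by (auto simp: weight_space_def seq_module_spec(3,5) ideal_at_eq fun_eq_iff)
qed

lemma weights_D: "weights t D = of_int ` S"
proof (intro equalityI subsetI)
  fix w assume "w \<in> weights t D"
  then have ne: "weight_space t D (ideal_at w) \<noteq> {\<zero>\<^bsub>D\<^esub>}" by (simp add: weights_def)
  show "w \<in> of_int ` S"
  proof (rule ccontr)
    assume w: "w \<notin> of_int ` S"
    have z: "f = \<zero>\<^bsub>D\<^esub>" if "f \<in> weight_space t D (ideal_at w)" for f
      using that w unfolding weight_space_D by (auto simp: seq_module_spec(2,3) fun_eq_iff)
    have "\<zero>\<^bsub>D\<^esub> \<in> weight_space t D (ideal_at w)"
      unfolding weight_space_D by (simp add: seq_module_spec(2,3))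
    then have "{\<zero>\<^bsub>D\<^esub>} \<subseteq> weight_space t D (ideal_at w)" by simp
    moreover have "weight_space t D (ideal_at w) \<subseteq> {\<zero>\<^bsub>D\<^esub>}" by (rule subsetI) (simp add: z)
    ultimately have "weight_space t D (ideal_at w) = {\<zero>\<^bsub>D\<^esub>}" by (rule subset_antisym[rotated])
    with ne show False by (rule notE)
  qed
next
  fix w :: complex assume "w \<in> of_int ` S"
  then obtain n where n: "n \<in> S" "w = of_int n" by auto
  have "unit_seq n \<in> weight_space t D (ideal_at w)"
    using single_closed[of n 1] n unfolding weight_space_D unit_seq_def by auto
  moreover have "unit_seq n \<noteq> \<zero>\<^bsub>D\<^esub>" by (auto simp: seq_module_spec(3) unit_seq_def fun_eq_iff)
  ultimately show "w \<in> weights t D" by (auto simp: weights_def)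
qed

lemma one_dim_D: "one_dim_weight_spaces t D"
  unfolding one_dim_weight_spaces_def
proof
  fix w assume "w \<in> weights t D"
  then obtain n where n: "n \<in> S" "w = of_int n" by (auto simp: weights_D)
  have e: "unit_seq n \<in> carrier D" using single_closed[of n 1] n by (simp add: unit_seq_def)
  have "weight_space t D (ideal_at w) = {act_poly t D [:c:] (unit_seq n) | c. True}"
  proof (intro equalityI subsetI)
    fix f assume "f \<in> weight_space t D (ideal_at w)"
    then have "f = act_poly t D [:f n:] (unit_seq n)"
      using e n unfolding weight_space_D by (auto simp: seq_module_spec(5) unit_seq_def fun_eq_iff)
    then show "f \<in> {act_poly t D [:c:] (unit_seq n) | c. True}" by blast
  next
    fix f assume "f \<in> {act_poly t D [:c:] (unit_seq n) | c. True}"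
    then obtain c where "f = act_poly t D [:c:] (unit_seq n)" by blast
    then show "f \<in> weight_space t D (ideal_at w)"
      using D.p_closed[OF e, of "[:c:]"] e n unfolding weight_space_D
      by (auto simp: seq_module_spec(5) unit_seq_def)
  qed
  moreover have "unit_seq n \<noteq> \<zero>\<^bsub>D\<^esub>" by (auto simp: seq_module_spec(3) unit_seq_def fun_eq_iff)
  ultimately show "\<exists>v. v \<noteq> \<zero>\<^bsub>D\<^esub> \<and> weight_space t D (ideal_at w) = {act_poly t D [:c:] v |c. True} \<and> v \<in> carrier D"
    using e by blast
qed

text \<open>A nonzero submodule contains some basis vector, cut out of a nonzero element by a
  polynomial. By \<open>conv\<close> the set \<open>S\<close> is an interval, so X+ and X- carry
  this vector to all the others.\<close>

lemma simple_D:
  assumes ne: "S \<noteq> {}" and nz: "\<And>n. n \<in> S \<Longrightarrow> n + 1 \<in> S \<Longrightarrow> a n \<noteq> 0 \<and> b n \<noteq> 0"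
    and conv: "\<And>l m n. l \<in> S \<Longrightarrow> n \<in> S \<Longrightarrow> l \<le> m \<Longrightarrow> m \<le> n \<Longrightarrow> m \<in> S"
  shows "simple_module t D"
  unfolding simple_module_def
proof (intro conjI allI impI)
  obtain n where n: "n \<in> S" using ne by blast
  have "unit_seq n \<in> carrier D" using single_closed[of n 1] n by (simp add: unit_seq_def)
  moreover have "unit_seq n \<noteq> \<zero>\<^bsub>D\<^esub>" by (auto simp: seq_module_spec(3) unit_seq_def fun_eq_iff)
  ultimately show "carrier D \<noteq> {\<zero>\<^bsub>D\<^esub>}" by auto
next
  fix H assume H: "submodule H (gwa t) D"
  then have sub: "subgroup H (add_monoid D)" by (rule submodule.axioms)
  have Hc: "H \<subseteq> carrier D" using subgroup.subset[OF sub] by simp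
  have H0: "\<zero>\<^bsub>D\<^esub> \<in> H" using subgroup.one_closed[OF sub] by simp
  have Hadd: "v \<oplus>\<^bsub>D\<^esub> w \<in> H" if "v \<in> H" "w \<in> H" for v w using subgroup.m_closed[OF sub that] by simp
  have Hp: "act_poly t D r v \<in> H" "act_gen t D x v \<in> H" if "v \<in> H" for r x v
    using submodule.smult_closed[OF H _ that] by (auto simp: act_poly_def act_gen_def gwa_elt_simps)
  show "H = {\<zero>\<^bsub>D\<^esub>} \<or> H = carrier D"
  proof (cases "H \<subseteq> {\<zero>\<^bsub>D\<^esub>}")
    case True
    then show ?thesis using H0 by auto
  next
    case False
    then obtain f where f: "f \<in> H" "f \<noteq> \<zero>\<^bsub>D\<^esub>" by auto
    have fc: "f \<in> carrier D" using f Hc by auto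
    obtain m where m: "f m \<noteq> 0" using f(2) by (auto simp: seq_module_spec(3))
    have mS: "m \<in> S" using m fc by (auto simp: seq_module_spec(2))
    have scale: "unit_seq n \<in> H" if g: "g \<in> H" "\<And>k. k \<noteq> n \<Longrightarrow> g k = 0" "g n \<noteq> 0" for n g
    proof -
      have "act_poly t D [:1 / g n:] g = unit_seq n"
        using g Hc by (auto simp: seq_module_spec(5) unit_seq_def subset_iff fun_eq_iff)
      then show ?thesis using Hp(1)[OF g(1)] by metis
    qed
    \<comment> \<open>Vanishes at all other weights in the support of \<open>f\<close> but not at m,
      so it turns \<open>f\<close> into a nonzero multiple of the basis vector at m.\<close>
    let ?q = "\<Prod>k\<in>{k. f k \<noteq> 0} - {m}. [:- of_int k, 1:] :: complex poly"
    have fin: "finite {k. f k \<noteq> 0}" using fc by (simp add: seq_module_spec(2))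
    have "unit_seq m \<in> H"
    proof (rule scale[OF Hp(1)[OF f(1), of ?q]])
      fix k assume k: "k \<noteq> m"
      have "poly ?q (of_int k) = 0" if "f k \<noteq> 0"
        unfolding poly_prod using fin k that by (intro prod_zero) auto
      then show "act_poly t D ?q f k = 0" using fc by (auto simp: seq_module_spec(5))
    next
      have "poly ?q (of_int m) \<noteq> 0" unfolding poly_prod using fin by (auto simp: prod_zero_iff)
      then show "act_poly t D ?q f m \<noteq> 0" using fc m by (auto simp: seq_module_spec(5))
    qed
    note em = this
    have up: "unit_seq (n + 1) \<in> H" if "unit_seq n \<in> H" "n \<in> S" "n + 1 \<in> S" for n
    proof (rule scale[OF Hp(2)[OF that(1), of Gen_Xp]])
      have c: "unit_seq n \<in> carrier D" using that Hc by auto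
      show "act_gen t D Gen_Xp (unit_seq n) k = 0" if "k \<noteq> n + 1" for k
        using that seq_module_spec(6)[OF c] by (auto simp: unit_seq_def)
      show "act_gen t D Gen_Xp (unit_seq n) (n + 1) \<noteq> 0"
        using nz[OF that(2,3)] seq_module_spec(6)[OF c] by (auto simp: unit_seq_def)
    qed
    have down: "unit_seq n \<in> H" if "unit_seq (n + 1) \<in> H" "n \<in> S" "n + 1 \<in> S" for n
    proof (rule scale[OF Hp(2)[OF that(1), of Gen_Xm]])
      have c: "unit_seq (n + 1) \<in> carrier D" using that Hc by auto
      show "act_gen t D Gen_Xm (unit_seq (n + 1)) k = 0" if "k \<noteq> n" for k
        using that seq_module_spec(7)[OF c] by (auto simp: unit_seq_def)
      show "act_gen t D Gen_Xm (unit_seq (n + 1)) n \<noteq> 0"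
        using nz[OF that(2,3)] seq_module_spec(7)[OF c] by (auto simp: unit_seq_def)
    qed
    have "unit_seq n \<in> H" if "m \<le> n" "n \<in> S" for n
      using that
    proof (induction n rule: int_ge_induct)
      case (step n)
      have "n \<in> S" using conv[OF mS step(3)] step(1) by auto
      then show ?case using step up by blast
    qed (use em in simp)
    moreover have "unit_seq n \<in> H" if "n \<le> m" "n \<in> S" for n
      using that
    proof (induction n rule: int_le_induct)
      case (step n)
      have "n \<in> S" using conv[OF step(3) mS] step(1) by auto
      then show ?case using step down[of "n - 1"] by simp
    qed (use em in simp)
    ultimately have e: "unit_seq n \<in> H" if "n \<in> S" for n using that by (cases "m \<le> n") auto
    have wt: "v \<in> H" if "v \<in> wt_space D (act_poly t D) n" for v n
    proof (cases "n \<in> S")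
      case True
      have "act_poly t D [:v n:] (unit_seq n) = v"
        using that subsetD[OF Hc e[OF True]] by (auto simp: wt_space_D seq_module_spec(5) unit_seq_def fun_eq_iff)
      then show ?thesis using Hp(1)[OF e[OF True]] by metis
    next
      case False
      then have "v = \<zero>\<^bsub>D\<^esub>" using that by (auto simp: wt_space_D seq_module_spec(2,3) fun_eq_iff)
      then show ?thesis using H0 by simp
    qed
    have "v \<in> H" if "v \<in> wt_span D (act_poly t D)" for v
      using that by induction (auto intro: wt Hadd)
    then show ?thesis using W.spans Hc by blast
  qed
qed

text \<open>With one basis vector per weight, the coordinate at n can be stored at the index (n, 0)
  of the universe.\<close>

lemma ex_obj_D: "\<exists>K\<in>objs t. gwa_iso t K D \<and> iso_class t K = iso_class t D"
proof (rule ex_obj[OF graded_D])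
  let ?g = "\<lambda>f (i :: int \<times> nat). if snd i = 0 then f (fst i) else (0 :: complex)"
  have fin: "finite {i. ?g f i \<noteq> 0}" if "f \<in> carrier D" for f
    by (rule finite_subset[of _ "(\<lambda>n. (n, 0)) ` {n. f n \<noteq> 0}"])
      (use that in \<open>auto simp: seq_module_spec(2) image_iff split: if_splits\<close>)
  show "inj_on (\<lambda>f. Abs_poly_mapping (?g f) :: universe) (carrier D)"
  proof (rule inj_onI)
    fix f h assume fh: "f \<in> carrier D" "h \<in> carrier D" "Abs_poly_mapping (?g f) = (Abs_poly_mapping (?g h) :: universe)"
    have "?g f = ?g h" using arg_cong[OF fh(3), of Poly_Mapping.lookup] fin[OF fh(1)] fin[OF fh(2)] by simp
    then have "?g f (n, 0) = ?g h (n, 0)" for n by (rule fun_cong)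
    then show "f = h" by auto
  qed
qed

end

section \<open>Invariance under isomorphism and rigidity\<close>

lemma weight_space_iso:
  assumes h: "h \<in> gwa_hom t M N" "bij_betw h (carrier M) (carrier N)"
    and L: "left_module (gwa t) M" "left_module (gwa t) N"
  shows "h ` weight_space t M I = weight_space t N I"
proof -
  have ab: "abelian_group M" "abelian_group N" using L by (auto simp: left_module_def)
  have h0: "h \<zero>\<^bsub>M\<^esub> = \<zero>\<^bsub>N\<^esub>"
    using gwa_hom_p_linear[OF h(1)] additive_zero[OF _ ab] by (auto simp: p_linear_def)
  interpret M: gwa_act M "act_poly t M" t "act_gen t M" by (rule left_module_imp_gwa_act[OF L(1)])
  have iff: "h v \<in> weight_space t N I \<longleftrightarrow> v \<in> weight_space t M I" if v: "v \<in> carrier M" for v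
  proof -
    have "act_poly t N r (h v) = \<zero>\<^bsub>N\<^esub> \<longleftrightarrow> act_poly t M r v = \<zero>\<^bsub>M\<^esub>" for r
      using gwa_homD(3)[OF h(1) v, of r] h0 bij_betw_imp_inj_on[OF h(2)] v
      by (metis M.p_closed M.zero_closed inj_onD)
    then show ?thesis using v gwa_homD(1)[OF h(1) v] by (simp add: weight_space_def)
  qed
  show ?thesis
  proof (intro equalityI subsetI)
    fix y assume "y \<in> h ` weight_space t M I"
    then obtain v where v: "v \<in> weight_space t M I" "y = h v" by auto
    then have "v \<in> carrier M" by (simp add: weight_space_def)
    then show "y \<in> weight_space t N I" using iff v by simp
  next
    fix y assume y: "y \<in> weight_space t N I"
    then have "y \<in> h ` carrier M" using h(2) by (simp add: weight_space_def bij_betw_def)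
    then obtain v where v: "v \<in> carrier M" "y = h v" by auto
    then show "y \<in> h ` weight_space t M I" using iff y by auto
  qed
qed

text \<open>These are the properties by which the four modules over A(z - k) are described. They are
  transported from the explicit models to objects on the universe, which shows that the descriptions
  can be satisfied.\<close>

lemma iso_invariants:
  assumes iso: "gwa_iso t M N" and L: "left_module (gwa t) M" "left_module (gwa t) N"
  shows "weights t M = weights t N"
    and "one_dim_weight_spaces t M \<Longrightarrow> one_dim_weight_spaces t N"
    and "simple_module t M \<Longrightarrow> simple_module t N"
    and "(\<forall>v\<in>weight_space t M I. v \<noteq> \<zero>\<^bsub>M\<^esub> \<longrightarrow> act_gen t M x v \<noteq> \<zero>\<^bsub>M\<^esub>) \<Longrightarrow>
      (\<forall>v\<in>weight_space t N I. v \<noteq> \<zero>\<^bsub>N\<^esub> \<longrightarrow> act_gen t N x v \<noteq> \<zero>\<^bsub>N\<^esub>)"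
    and "(\<forall>v\<in>weight_space t M I. act_gen t M x v = \<zero>\<^bsub>M\<^esub>) \<Longrightarrow>
      (\<forall>v\<in>weight_space t N I. act_gen t N x v = \<zero>\<^bsub>N\<^esub>)"
proof -
  obtain h where h: "h \<in> gwa_hom t M N" "bij_betw h (carrier M) (carrier N)"
    using iso by (auto simp: gwa_iso_def)
  have ab: "abelian_group M" "abelian_group N" using L by (auto simp: left_module_def)
  interpret M: left_module "gwa t" M by fact
  have hadd: "additive M N h" using gwa_hom_p_linear[OF h(1)] by (simp add: p_linear_def)
  have h0: "h \<zero>\<^bsub>M\<^esub> = \<zero>\<^bsub>N\<^esub>" by (rule additive_zero[OF hadd ab])
  have inj: "h v = \<zero>\<^bsub>N\<^esub> \<longleftrightarrow> v = \<zero>\<^bsub>M\<^esub>" if "v \<in> carrier M" for v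
    using h0 inj_onD[OF bij_betw_imp_inj_on[OF h(2)], of v "\<zero>\<^bsub>M\<^esub>"] that M.zero_closed by auto
  have im: "h ` carrier M = carrier N" using h(2) by (simp add: bij_betw_def)
  note ws = weight_space_iso[OF h L]
  have wsc: "weight_space t M I \<subseteq> carrier M" for I by (auto simp: weight_space_def)
  have "weight_space t N I = {\<zero>\<^bsub>N\<^esub>} \<longleftrightarrow> weight_space t M I = {\<zero>\<^bsub>M\<^esub>}" for I
  proof -
    have "weight_space t M I = {\<zero>\<^bsub>M\<^esub>}" if "h ` weight_space t M I = {\<zero>\<^bsub>N\<^esub>}"
    proof -
      have "v = \<zero>\<^bsub>M\<^esub>" if "v \<in> weight_space t M I" for v
        using inj[of v] wsc[of I] that \<open>h ` weight_space t M I = {\<zero>\<^bsub>N\<^esub>}\<close> by blast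
      moreover have "weight_space t M I \<noteq> {}" using that by auto
      ultimately show ?thesis by blast
    qed
    then show ?thesis unfolding ws[symmetric] using h0 by auto
  qed
  then show w: "weights t M = weights t N" by (simp add: weights_def)
  show "one_dim_weight_spaces t M \<Longrightarrow> one_dim_weight_spaces t N"
    unfolding one_dim_weight_spaces_def
  proof
    fix x assume od: "\<forall>x\<in>weights t M. \<exists>v. v \<noteq> \<zero>\<^bsub>M\<^esub>
        \<and> weight_space t M (ideal_at x) = {act_poly t M [:c:] v | c. True} \<and> v \<in> carrier M"
      and x: "x \<in> weights t N"
    then obtain v where v: "v \<noteq> \<zero>\<^bsub>M\<^esub>" "weight_space t M (ideal_at x) = {act_poly t M [:c:] v | c. True}" "v \<in> carrier M"
      using w by blast
    have "weight_space t N (ideal_at x) = {h (act_poly t M [:c:] v) | c. True}"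
      unfolding ws[symmetric] v(2) by auto
    also have "\<dots> = {act_poly t N [:c:] (h v) | c. True}" using gwa_homD(3)[OF h(1) v(3)] by simp
    finally show "\<exists>v. v \<noteq> \<zero>\<^bsub>N\<^esub> \<and> weight_space t N (ideal_at x) = {act_poly t N [:c:] v | c. True} \<and> v \<in> carrier N"
      using inj[OF v(3)] v(1) gwa_homD(1)[OF h(1) v(3)] by blast
  qed
  show "simple_module t N" if s: "simple_module t M"
    unfolding simple_module_def
  proof (intro conjI allI impI)
    show "carrier N \<noteq> {\<zero>\<^bsub>N\<^esub>}"
    proof
      assume "carrier N = {\<zero>\<^bsub>N\<^esub>}"
      then have "v = \<zero>\<^bsub>M\<^esub>" if "v \<in> carrier M" for v using inj[OF that] im that by blast
      then have "carrier M = {\<zero>\<^bsub>M\<^esub>}" using M.zero_closed by auto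
      then show False using s by (simp add: simple_module_def)
    qed
    fix H assume H: "submodule H (gwa t) N"
    let ?H = "{v \<in> carrier M. h v \<in> H}"
    have sub: "subgroup H (add_monoid N)" using H by (rule submodule.axioms)
    have Hc: "H \<subseteq> carrier N" using subgroup.subset[OF sub] by simp
    have "submodule ?H (gwa t) M"
    proof (intro submodule.intro submodule_axioms.intro)
      show "subgroup ?H (add_monoid M)"
      proof (rule subgroup.intro)
        fix v assume v: "v \<in> ?H"
        have "h (\<ominus>\<^bsub>M\<^esub> v) = \<ominus>\<^bsub>N\<^esub> h v" using additive_minus[OF hadd ab] v by simp
        moreover have "\<ominus>\<^bsub>N\<^esub> h v \<in> H" using subgroup.m_inv_closed[OF sub] v by (simp add: a_inv_def)
        ultimately have "\<ominus>\<^bsub>M\<^esub> v \<in> ?H" using v by simp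
        then show "inv\<^bsub>add_monoid M\<^esub> v \<in> ?H" by (simp add: a_inv_def)
      qed (use subgroup.one_closed[OF sub] subgroup.m_closed[OF sub] h0 additive_add[OF hadd] in auto)
      show "a \<odot>\<^bsub>M\<^esub> v \<in> ?H" if "a \<in> carrier (gwa t)" "v \<in> ?H" for a v
        using that h(1) submodule.smult_closed[OF H that(1)] M.smult_closed by (auto simp: gwa_hom_def)
    qed
    then have alt: "?H = {\<zero>\<^bsub>M\<^esub>} \<or> ?H = carrier M" using s by (simp add: simple_module_def)
    have Him: "H = h ` ?H"
    proof (intro equalityI subsetI)
      fix y assume y: "y \<in> H"
      then have "y \<in> h ` carrier M" using Hc im by auto
      then show "y \<in> h ` ?H" using y by auto
    qed auto
    from alt show "H = {\<zero>\<^bsub>N\<^esub>} \<or> H = carrier N"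
    proof
      assume "?H = {\<zero>\<^bsub>M\<^esub>}"
      then have "h ` ?H = {\<zero>\<^bsub>N\<^esub>}" using h0 by simp
      then show ?thesis using Him by simp
    next
      assume "?H = carrier M"
      then have "h ` ?H = carrier N" using im by simp
      then show ?thesis using Him by simp
    qed
  qed
  show "\<forall>v\<in>weight_space t N I. v \<noteq> \<zero>\<^bsub>N\<^esub> \<longrightarrow> act_gen t N x v \<noteq> \<zero>\<^bsub>N\<^esub>"
    if nz: "\<forall>v\<in>weight_space t M I. v \<noteq> \<zero>\<^bsub>M\<^esub> \<longrightarrow> act_gen t M x v \<noteq> \<zero>\<^bsub>M\<^esub>"
    unfolding ws[symmetric]
  proof clarify
    fix v assume v: "v \<in> weight_space t M I" "h v \<noteq> \<zero>\<^bsub>N\<^esub>" "act_gen t N x (h v) = \<zero>\<^bsub>N\<^esub>"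
    have vc: "v \<in> carrier M" using v wsc by blast
    have ac: "act_gen t M x v \<in> carrier M" using M.smult_closed[OF gwa_elt_simps(4) vc] by (simp add: act_gen_def)
    have "h (act_gen t M x v) = \<zero>\<^bsub>N\<^esub>" using gwa_homD(4)[OF h(1) vc] v(3) by simp
    then have "act_gen t M x v = \<zero>\<^bsub>M\<^esub>" using inj[OF ac] by simp
    then have "v = \<zero>\<^bsub>M\<^esub>" using nz v(1) by blast
    then show False using v(2) h0 by simp
  qed
  show "\<forall>v\<in>weight_space t N I. act_gen t N x v = \<zero>\<^bsub>N\<^esub>"
    if z: "\<forall>v\<in>weight_space t M I. act_gen t M x v = \<zero>\<^bsub>M\<^esub>"
    unfolding ws[symmetric]
  proof clarify
    fix v assume v: "v \<in> weight_space t M I"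
    then have vc: "v \<in> carrier M" using wsc by blast
    show "act_gen t N x (h v) = \<zero>\<^bsub>N\<^esub>" using gwa_homD(4)[OF h(1) vc, of x] z v h0 by simp
  qed
qed

context gwa_act
begin

text \<open>The shift by 1 turns z - n into z - (n + 1), and the inverse shift turns it into z - (n
  - 1).\<close>

lemma X_wt:
  "v \<in> wt_space M p n \<Longrightarrow> X Gen_Xp v \<in> wt_space M p (n + 1)"
  "v \<in> wt_space M p n \<Longrightarrow> X Gen_Xm v \<in> wt_space M p (n - 1)"
proof -
  assume v: "v \<in> wt_space M p n"
  then have vc: "v \<in> carrier M" and z: "p [:- of_int n, 1:] v = \<zero>" by (auto simp: wt_space_def)
  have s: "shift 1 [:- of_int n, 1:] = [:- of_int (n + 1), 1:]" "shift (- 1) [:- of_int n, 1:] = [:- of_int (n - 1), 1:]"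
    by (simp_all add: shift_def pcompose_pCons)
  show "X Gen_Xp v \<in> wt_space M p (n + 1)"
    using Xp_p[OF vc, of "[:- of_int n, 1:]"] z X_zero[of Gen_Xp] X_closed[OF vc, of Gen_Xp]
    unfolding s by (simp add: wt_space_def)
  show "X Gen_Xm v \<in> wt_space M p (n - 1)"
    using Xm_p[OF vc, of "[:- of_int n, 1:]"] z X_zero[of Gen_Xm] X_closed[OF vc, of Gen_Xm]
    unfolding s by (simp add: wt_space_def)
qed

lemma X_const: "v \<in> carrier M \<Longrightarrow> x \<noteq> Gen_z \<Longrightarrow> X x (p [:c:] v) = p [:c:] (X x v)"
  using gen_const[of v x c] by (simp add: gen_def)

lemma XX_wt:
  assumes "v \<in> wt_space M p n"
  shows "X Gen_Xm (X Gen_Xp v) = p [:poly t (of_int n + 1 / 2):] v"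
    "X Gen_Xp (X Gen_Xm v) = p [:poly t (of_int n - 1 / 2):] v"
  using XmXp[of v] XpXm[of v] p_wt[OF assms, of "shift (- 1 / 2) t"] p_wt[OF assms, of "shift (1 / 2) t"] assms
  by (auto simp: poly_shift wt_space_def)

end

text \<open>A recursion over all integers, solved by products upwards from 0 and by inverse products
  downwards. It supplies the factors by which a weight basis is rescaled.\<close>

lemma int_ratio_sequence:
  fixes \<rho> :: "int \<Rightarrow> complex"
  assumes "\<And>n. \<rho> n \<noteq> 0"
  shows "\<exists>\<gamma>. (\<forall>n. \<gamma> n \<noteq> 0) \<and> (\<forall>n. \<gamma> (n + 1) = \<gamma> n * \<rho> n)"
proof -
  define \<gamma> where "\<gamma> n = (if n \<ge> 0 then \<Prod>i\<in>{0..<n}. \<rho> i else inverse (\<Prod>i\<in>{n..<0}. \<rho> i))" for n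
  have "\<gamma> n \<noteq> 0" for n using assms by (simp add: \<gamma>_def)
  moreover have "\<gamma> (n + 1) = \<gamma> n * \<rho> n" for n
  proof (cases "n \<ge> 0")
    case True
    then have "{0..<n + 1} = insert n {0..<n}" by auto
    then show ?thesis using True by (simp add: \<gamma>_def mult.commute)
  next
    case False
    then have "{n..<0} = insert n {n + 1..<0}" by auto
    then have "(\<Prod>i\<in>{n..<0}. \<rho> i) = \<rho> n * (\<Prod>i\<in>{n + 1..<0}. \<rho> i)" by simp
    then show ?thesis using False assms by (cases "n = - 1") (auto simp: \<gamma>_def)
  qed
  ultimately show ?thesis by blast
qed

text \<open>A module with one-dimensional weight spaces is rigid once one of \<open>X\<^sup>+\<close>, \<open>X\<^sup>-\<close> is known to be
  injective between any two consecutive weights: rescaling a weight basis normalises that operator,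
  and the value of \<open>X\<^sup>-X\<^sup>+\<close> then determines the other one.\<close>

lemma (in seq_data) iso_seq_module:
  assumes M: "graded t M" and od: "one_dim_weight_spaces t M" and wts: "weights t M = of_int ` S"
    and nz: "\<And>n. n \<in> S \<Longrightarrow> n + 1 \<in> S \<Longrightarrow>
      (a n \<noteq> 0 \<and> (\<forall>v\<in>wt_space M (act_poly t M) n. act_gen t M Gen_Xp v = \<zero>\<^bsub>M\<^esub> \<longrightarrow> v = \<zero>\<^bsub>M\<^esub>))
    \<or> (b n \<noteq> 0 \<and> (\<forall>v\<in>wt_space M (act_poly t M) (n + 1). act_gen t M Gen_Xm v = \<zero>\<^bsub>M\<^esub> \<longrightarrow> v = \<zero>\<^bsub>M\<^esub>))"
  shows "gwa_iso t D M"
proof -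
  let ?p = "act_poly t M" and ?X = "act_gen t M"
  have L: "left_module (gwa t) M" using M by (simp add: graded_def)
  interpret M: wt_act M ?p using M by (simp add: graded_def)
  interpret M: gwa_act M ?p t ?X by (rule left_module_imp_gwa_act[OF L])
  have "\<exists>u. u \<noteq> \<zero>\<^bsub>M\<^esub> \<and> u \<in> wt_space M ?p n \<and> (\<forall>w\<in>wt_space M ?p n. \<exists>c. w = ?p [:c:] u)" if "n \<in> S" for n
  proof -
    have "of_int n \<in> weights t M" using that wts by simp
    then obtain v where v: "v \<noteq> \<zero>\<^bsub>M\<^esub>" "wt_space M ?p n = {?p [:c:] v | c. True}" "v \<in> carrier M"
      using od unfolding one_dim_weight_spaces_def weight_space_eq[OF L, symmetric] by blast
    have "v \<in> wt_space M ?p n" unfolding v(2) using M.p_const_one[OF v(3)] by (intro CollectI exI[of _ 1]) simp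
    then show ?thesis using v(1,2) by blast
  qed
  then obtain u where u: "\<And>n. n \<in> S \<Longrightarrow> u n \<noteq> \<zero>\<^bsub>M\<^esub>" "\<And>n. n \<in> S \<Longrightarrow> u n \<in> wt_space M ?p n"
    "\<And>n w. n \<in> S \<Longrightarrow> w \<in> wt_space M ?p n \<Longrightarrow> \<exists>c. w = ?p [:c:] (u n)" by metis
  have uc: "u n \<in> carrier M" if "n \<in> S" for n using u(2)[OF that] by auto
  have const_eq: "c = d" if n: "n \<in> S" and eq: "?p [:c:] (u n) = ?p [:d:] (u n)" for c d n
  proof (rule ccontr)
    assume "c \<noteq> d"
    have "?p [:c - d:] (u n) = \<zero>\<^bsub>M\<^esub>"
      using M.p_diff[OF uc[OF n], of "[:c:]" "[:d:]"] eq uc[OF n] by (simp add: a_minus_def M.r_neg)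
    then show False using M.p_const_cancel[OF uc[OF n], of "c - d"] u(1)[OF n] \<open>c \<noteq> d\<close> by auto
  qed
  have W0: "wt_space M ?p n = {\<zero>\<^bsub>M\<^esub>}" if "n \<notin> S" for n
  proof -
    have "of_int n \<notin> weights t M" using that wts by auto
    then show ?thesis unfolding weights_def weight_space_eq[OF L, symmetric] by simp
  qed
  \<comment> \<open>The structure constants of the chosen basis \<open>u\<close> before rescaling.
    Their product is forced by t, as X- X+ acts on weight n by a scalar that depends only on t and
    n.\<close>
  have "\<exists>\<alpha> \<beta>. ?X Gen_Xp (u n) = ?p [:\<alpha>:] (u (n + 1)) \<and> ?X Gen_Xm (u (n + 1)) = ?p [:\<beta>:] (u n)
    \<and> \<alpha> * \<beta> = a n * b n" if n: "n \<in> S" "n + 1 \<in> S" for n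
  proof -
    obtain \<alpha> where \<alpha>: "?X Gen_Xp (u n) = ?p [:\<alpha>:] (u (n + 1))"
      using u(3)[OF n(2) M.X_wt(1)[OF u(2)[OF n(1)]]] by blast
    obtain \<beta> where \<beta>: "?X Gen_Xm (u (n + 1)) = ?p [:\<beta>:] (u n)"
      using u(3)[OF n(1), of "?X Gen_Xm (u (n + 1))"] M.X_wt(2)[OF u(2)[OF n(2)]] by auto
    have "?p [:poly t (of_int n + 1 / 2):] (u n) = ?X Gen_Xm (?X Gen_Xp (u n))"
      by (rule M.XX_wt(1)[OF u(2)[OF n(1)], symmetric])
    also have "\<dots> = ?p [:\<alpha> * \<beta>:] (u n)"
      unfolding \<alpha> using uc n \<beta> by (simp add: M.X_const M.p_const_mult)
    finally have "\<alpha> * \<beta> = a n * b n" using const_eq[OF n(1)] ab[of n] n by metis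
    then show ?thesis using \<alpha> \<beta> by blast
  qed
  then obtain \<alpha> \<beta> where \<alpha>\<beta>: "\<And>n. n \<in> S \<Longrightarrow> n + 1 \<in> S \<Longrightarrow> ?X Gen_Xp (u n) = ?p [:\<alpha> n:] (u (n + 1))"
    "\<And>n. n \<in> S \<Longrightarrow> n + 1 \<in> S \<Longrightarrow> ?X Gen_Xm (u (n + 1)) = ?p [:\<beta> n:] (u n)"
    "\<And>n. n \<in> S \<Longrightarrow> n + 1 \<in> S \<Longrightarrow> \<alpha> n * \<beta> n = a n * b n" by metis
  \<comment> \<open>The ratio of consecutive scaling factors: \<alpha> n / a n if X+ is the
    injective operator, b n / \<beta> n if X- is. The equality of the products makes the same ratio
    correct for the other operator. Where n or n + 1 is outside \<open>S\<close> the value 1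
    serves.\<close>
  have "\<exists>\<rho>. \<rho> \<noteq> 0 \<and> (n \<in> S \<longrightarrow> n + 1 \<in> S \<longrightarrow> \<alpha> n = \<rho> * a n \<and> \<rho> * \<beta> n = b n)" for n
  proof (cases "n \<in> S \<and> n + 1 \<in> S")
    case True
    then have n: "n \<in> S" "n + 1 \<in> S" by auto
    from nz[OF n] show ?thesis
    proof
      assume A: "a n \<noteq> 0 \<and> (\<forall>v\<in>wt_space M ?p n. ?X Gen_Xp v = \<zero>\<^bsub>M\<^esub> \<longrightarrow> v = \<zero>\<^bsub>M\<^esub>)"
      have "\<alpha> n \<noteq> 0"
      proof
        assume "\<alpha> n = 0"
        then have "?X Gen_Xp (u n) = \<zero>\<^bsub>M\<^esub>" using \<alpha>\<beta>(1)[OF n] uc[OF n(2)] by simp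
        then show False using A u(1,2)[OF n(1)] by blast
      qed
      then show ?thesis using A \<alpha>\<beta>(3)[OF n] by (intro exI[of _ "\<alpha> n / a n"]) (auto simp: field_simps)
    next
      assume B: "b n \<noteq> 0 \<and> (\<forall>v\<in>wt_space M ?p (n + 1). ?X Gen_Xm v = \<zero>\<^bsub>M\<^esub> \<longrightarrow> v = \<zero>\<^bsub>M\<^esub>)"
      have "\<beta> n \<noteq> 0"
      proof
        assume "\<beta> n = 0"
        then have "?X Gen_Xm (u (n + 1)) = \<zero>\<^bsub>M\<^esub>" using \<alpha>\<beta>(2)[OF n] uc[OF n(1)] by simp
        then show False using B u(1,2)[OF n(2)] by blast
      qed
      then show ?thesis using B \<alpha>\<beta>(3)[OF n] by (intro exI[of _ "b n / \<beta> n"]) (auto simp: field_simps)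
    qed
  qed (auto intro: exI[of _ 1])
  then obtain \<rho> where \<rho>: "\<And>n. \<rho> n \<noteq> 0" "\<And>n. n \<in> S \<Longrightarrow> n + 1 \<in> S \<Longrightarrow> \<alpha> n = \<rho> n * a n \<and> \<rho> n * \<beta> n = b n"
    by metis
  obtain \<gamma> where \<gamma>: "\<And>n. \<gamma> n \<noteq> 0" "\<And>n. \<gamma> (n + 1) = \<gamma> n * \<rho> n"
    using int_ratio_sequence[of \<rho>] \<rho>(1) by blast
  \<comment> \<open>The rescaled basis, extended by zero off \<open>S\<close> so that the formulas
    for X+ and X- hold at all integers.\<close>
  define v where "v n = (if n \<in> S then ?p [:\<gamma> n:] (u n) else \<zero>\<^bsub>M\<^esub>)" for n
  have vwt: "v n \<in> wt_space M ?p n" for n using u(2) by (auto simp: v_def M.wt_p)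
  have vc: "v n \<in> carrier M" for n using vwt[of n] by auto
  have Xp: "?X Gen_Xp (v n) = ?p [:a n:] (v (n + 1))" for n
  proof (cases "n \<in> S \<and> n + 1 \<in> S")
    case True
    then have n: "n \<in> S" "n + 1 \<in> S" by auto
    have "?X Gen_Xp (v n) = ?p [:\<gamma> n * \<alpha> n:] (u (n + 1))"
      using n uc \<alpha>\<beta>(1)[OF n] by (simp add: v_def M.X_const M.p_const_mult)
    also have "\<gamma> n * \<alpha> n = a n * \<gamma> (n + 1)" using \<rho>(2)[OF n] \<gamma>(2) by simp
    finally show ?thesis using n uc by (simp add: v_def M.p_const_mult)
  next
    case False
    then have "a n = 0" using zero[of n] by auto
    moreover have "?X Gen_Xp (v n) = \<zero>\<^bsub>M\<^esub>"
      using False M.X_wt(1)[OF vwt[of n]] W0[of "n + 1"] M.X_zero[of Gen_Xp] by (cases "n \<in> S") (auto simp: v_def)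
    ultimately show ?thesis using vc by simp
  qed
  have Xm: "?X Gen_Xm (v (n + 1)) = ?p [:b n:] (v n)" for n
  proof (cases "n \<in> S \<and> n + 1 \<in> S")
    case True
    then have n: "n \<in> S" "n + 1 \<in> S" by auto
    have "?X Gen_Xm (v (n + 1)) = ?p [:\<gamma> (n + 1) * \<beta> n:] (u n)"
      using n uc \<alpha>\<beta>(2)[OF n] by (simp add: v_def M.X_const M.p_const_mult)
    also have "\<gamma> (n + 1) * \<beta> n = b n * \<gamma> n" using \<rho>(2)[OF n] \<gamma>(2) by (simp add: mult.assoc)
    finally show ?thesis using n uc by (simp add: v_def M.p_const_mult)
  next
    case False
    then have "b n = 0" using zero[of n] by auto
    moreover have "?X Gen_Xm (v (n + 1)) = \<zero>\<^bsub>M\<^esub>"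
      using False M.X_wt(2)[OF vwt[of "n + 1"]] W0[of n] M.X_zero[of Gen_Xm] by (cases "n + 1 \<in> S") (auto simp: v_def)
    ultimately show ?thesis using vc by simp
  qed
  obtain h where h: "additive D M h" "\<And>n f. f \<in> wt_space D (act_poly t D) n \<Longrightarrow> h f = ?p [:f n:] (v n)"
    using W.universal[OF M.abelian_group_axioms, of "\<lambda>n f. ?p [:f n:] (v n)"] vc
    by (auto simp: seq_module_spec(4) M.p_const_add)
  have pl: "p_linear D (act_poly t D) M ?p h"
  proof (rule W.p_linearI[OF h(1) M.poly_act_axioms])
    fix n f c assume f: "f \<in> wt_space D (act_poly t D) n"
    show "h f \<in> wt_space M ?p n" unfolding h(2)[OF f] by (rule M.wt_p[OF vwt])
    show "h (act_poly t D [:c:] f) = ?p [:c:] (h f)"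
      unfolding h(2)[OF f] h(2)[OF D.wt_p[OF f]] using D.wt_spaceD[OF f] vc
      by (simp add: seq_module_spec(5) M.p_const_mult)
  qed
  have hom: "h \<in> gwa_hom t D M"
  proof (rule gwa_homI[OF seq_module_spec(1) L])
    fix f x assume f: "f \<in> carrier D" and x: "x \<in> {Gen_Xp, Gen_Xm}"
    then have xz: "x \<noteq> Gen_z" by auto
    show "h (act_gen t D x f) = ?X x (h f)"
    proof (rule W.additive_eq[where h = "\<lambda>f. h (act_gen t D x f)" and h' = "\<lambda>f. ?X x (h f)", OF _ _ M.abelian_group_axioms _ f])
      show "additive D M (\<lambda>f. h (act_gen t D x f))"
        using xz additive_closed[OF h(1)] additive_add[OF h(1)] by (intro additiveI) (auto simp: D.X_add)
      show "additive D M (\<lambda>f. ?X x (h f))"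
        using xz additive_closed[OF h(1)] additive_add[OF h(1)] by (intro additiveI) (auto simp: M.X_add)
      fix n f assume f: "f \<in> wt_space D (act_poly t D) n"
      have fc: "f \<in> carrier D" using f by auto
      show "h (act_gen t D x f) = ?X x (h f)"
      proof (cases "x = Gen_Xp")
        case True
        have "h (act_gen t D x f) = ?p [:a n * f n:] (v (n + 1))"
          using h(2)[OF D.X_wt(1)[OF f]] fc True by (simp add: seq_module_spec(6))
        also have "\<dots> = ?X x (h f)" unfolding h(2)[OF f] True
          using vc Xp[of n] by (simp add: M.X_const M.p_const_mult mult.commute)
        finally show ?thesis .
      next
        case False
        then have xm: "x = Gen_Xm" using x by simp
        have "h (act_gen t D x f) = ?p [:b (n - 1) * f n:] (v (n - 1))"
          using h(2)[OF D.X_wt(2)[OF f]] fc xm by (simp add: seq_module_spec(7))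
        also have "\<dots> = ?X x (h f)" unfolding h(2)[OF f] xm
          using vc Xm[of "n - 1"] by (simp add: M.X_const M.p_const_mult mult.commute)
        finally show ?thesis .
      qed
    qed
  qed (use pl additive_closed[OF h(1)] additive_add[OF h(1)] in \<open>auto simp: p_linear_def\<close>)
  have "inj_on h (carrier D)"
  proof (rule inj_onI)
    fix f g assume fg: "f \<in> carrier D" "g \<in> carrier D" "h f = h g"
    \<comment> \<open>The components of \<open>h f\<close> recover the coordinates of
      \<open>f\<close>, because \<open>v n\<close> is nonzero for n in \<open>S\<close>.\<close>
    have c: "M.comp n (h f) = ?p [:f n:] (v n)" if "f \<in> carrier D" for f n
    proof -
      have "n \<in> S \<or> f n = 0" using that by (auto simp: seq_module_spec(2))
      from h(2)[OF single_wt[OF this]] show ?thesis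
        using W.comp_p_linear[OF pl M.wt_act_axioms that, of n] comp_D[OF that, of n] by simp
    qed
    show "f = g"
    proof
      fix n
      show "f n = g n"
      proof (cases "n \<in> S")
        case True
        have "?p [:f n:] (v n) = ?p [:g n:] (v n)" using c[OF fg(1), of n] c[OF fg(2), of n] fg(3) by simp
        then have "?p [:f n * \<gamma> n:] (u n) = ?p [:g n * \<gamma> n:] (u n)"
          using True uc by (simp add: v_def M.p_const_mult)
        then show ?thesis using const_eq[OF True] \<gamma>(1)[of n] by (metis mult_right_cancel)
      next
        case False
        then show ?thesis using fg by (simp add: seq_module_spec(2))
      qed
    qed
  qed
  moreover have "h ` carrier D = carrier M"
  proof (intro equalityI subsetI)
    fix w assume "w \<in> carrier M"
    from M.spans[OF this] show "w \<in> h ` carrier D"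
    proof induction
      case (wt w n)
      show ?case
      proof (cases "n \<in> S")
        case True
        obtain c where c: "w = ?p [:c:] (u n)" using u(3)[OF True wt] by blast
        let ?f = "\<lambda>m. if m = n then c / \<gamma> n else 0"
        have f: "?f \<in> wt_space D (act_poly t D) n" by (rule single_wt) (use True in simp)
        have "h ?f = w" unfolding h(2)[OF f] c using True uc \<gamma>(1)[of n] by (simp add: v_def M.p_const_mult)
        then show ?thesis using D.wt_spaceD[OF f] by blast
      next
        case False
        then have "w = \<zero>\<^bsub>M\<^esub>" using W0 wt by auto
        then show ?thesis
          using additive_zero[OF h(1) D.abelian_group_axioms M.abelian_group_axioms] D.zero_closed by (metis imageI)
      qed
    next
      case (add w w')
      then obtain f f' where "f \<in> carrier D" "w = h f" "f' \<in> carrier D" "w' = h f'" by blast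
      then show ?case using additive_add[OF h(1), of f f'] D.add.m_closed[of f f'] by (metis imageI)
    qed
  qed (use additive_closed[OF h(1)] in auto)
  ultimately show ?thesis using hom unfolding gwa_iso_def bij_betw_def by blast
qed

text \<open>By \<open>sub\<close> neither operator leads from \<open>S1\<close> to
  \<open>S2\<close>, so the vectors supported on \<open>S1\<close> form a submodule, and restriction
  to \<open>S2\<close> is the quotient map.\<close>

lemma short_exact_seq:
  assumes D: "seq_data t S a b" and D1: "seq_data t S1 a1 b1" and D2: "seq_data t S2 a2 b2"
    and S: "S = S1 \<union> S2" "S1 \<inter> S2 = {}"
    and eq1: "\<And>n. n \<in> S1 \<Longrightarrow> a n = a1 n" "\<And>n. n + 1 \<in> S1 \<Longrightarrow> b n = b1 n"
    and eq2: "\<And>n. n + 1 \<in> S2 \<Longrightarrow> n \<in> S2 \<Longrightarrow> a n = a2 n" "\<And>n. n \<in> S2 \<Longrightarrow> n + 1 \<in> S2 \<Longrightarrow> b n = b2 n"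
    and sub: "\<And>n. n \<in> S1 \<Longrightarrow> n + 1 \<in> S2 \<Longrightarrow> a n = 0" "\<And>n. n + 1 \<in> S1 \<Longrightarrow> n \<in> S2 \<Longrightarrow> b n = 0"
  shows "short_exact t (seq_module t S1 a1 b1) (seq_module t S a b) (seq_module t S2 a2 b2)"
proof -
  interpret D: seq_data t S a b by fact
  interpret D1: seq_data t S1 a1 b1 by fact
  interpret D2: seq_data t S2 a2 b2 by fact
  let ?g = "\<lambda>f n. if n \<in> S2 then f n else 0"
  have Sm: "n \<in> S \<longleftrightarrow> n \<in> S1 \<or> n \<in> S2" "n \<in> S1 \<Longrightarrow> n \<notin> S2" for n using S by auto
  note spec = D.seq_module_spec and spec1 = D1.seq_module_spec and spec2 = D2.seq_module_spec
  have i: "f \<in> carrier D.D" if "f \<in> carrier D1.D" for f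
    using that by (auto simp: Sm(1) spec(2) spec1(2))
  have gc: "?g f \<in> carrier D2.D" if "f \<in> carrier D.D" for f
  proof -
    have "finite {n. ?g f n \<noteq> 0}"
      by (rule finite_subset[of _ "{n. f n \<noteq> 0}"]) (use that in \<open>auto simp: spec(2)\<close>)
    then show ?thesis by (simp add: spec2(2))
  qed
  have "(\<lambda>f. f) \<in> gwa_hom t D1.D D.D"
  proof (rule gwa_homI[OF spec1(1) spec(1)])
    fix f x assume f: "f \<in> carrier D1.D" and x: "x \<in> {Gen_Xp, Gen_Xm}"
    have fs: "f n = 0" if "n \<notin> S1" for n using f that by (simp add: spec1(2))
    show "act_gen t D1.D x f = act_gen t D.D x f"
      using x f i[OF f] eq1 fs by (auto simp: spec(6,7) spec1(6,7) fun_eq_iff) (metis mult_zero_right)+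
  qed (use i in \<open>auto simp: spec(4,5) spec1(4,5)\<close>)
  moreover have "?g \<in> gwa_hom t D.D D2.D"
  proof (rule gwa_homI[OF spec(1) spec2(1)])
    fix f x assume f: "f \<in> carrier D.D" and x: "x \<in> {Gen_Xp, Gen_Xm}"
    have fs: "f n = 0" if "n \<notin> S1" "n \<notin> S2" for n using f that by (simp add: spec(2) Sm(1))
    have 1: "(if n \<in> S2 then a (n - 1) * f (n - 1) else 0) = a2 (n - 1) * (if n - 1 \<in> S2 then f (n - 1) else 0)" for n
      using eq2(1)[of "n - 1"] sub(1)[of "n - 1"] fs[of "n - 1"] D2.zero[of "n - 1"] by auto
    have 2: "(if n \<in> S2 then b n * f (n + 1) else 0) = b2 n * (if n + 1 \<in> S2 then f (n + 1) else 0)" for n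
      using eq2(2)[of n] sub(2)[of n] fs[of "n + 1"] D2.zero[of n] by auto
    show "?g (act_gen t D.D x f) = act_gen t D2.D x (?g f)"
    proof (cases "x = Gen_Xp")
      case True
      show ?thesis unfolding True spec(6)[OF f] spec2(6)[OF gc[OF f]] by (rule ext) (rule 1)
    next
      case False
      then have xm: "x = Gen_Xm" using x by simp
      show ?thesis unfolding xm spec(7)[OF f] spec2(7)[OF gc[OF f]] by (rule ext) (rule 2)
    qed
  qed (use gc in \<open>auto simp: spec(4,5) spec2(4,5) fun_eq_iff\<close>)
  moreover have "inj_on (\<lambda>f. f) (carrier D1.D)" by simp
  moreover have "?g ` carrier D.D = carrier D2.D"
  proof (intro equalityI subsetI)
    fix f assume f: "f \<in> carrier D2.D"
    then have f: "f \<in> carrier D.D" "f = ?g f" by (auto simp: spec(2) spec2(2) fun_eq_iff Sm(1))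
    have "?g f \<in> ?g ` carrier D.D" by (rule imageI[OF f(1)])
    then show "f \<in> ?g ` carrier D.D" unfolding f(2)[symmetric] .
  qed (use gc in auto)
  moreover have "(\<lambda>f. f) ` carrier D1.D = {x \<in> carrier D.D. ?g x = \<zero>\<^bsub>D2.D\<^esub>}"
    using Sm(2) by (auto simp: spec(2) spec1(2) spec2(3) fun_eq_iff Sm(1))
  ultimately show ?thesis unfolding short_exact_def by blast
qed

section \<open>The unit object\<close>

lemma additive_plus:
  assumes "additive M N h" "additive M N h'" "abelian_group N"
  shows "additive M N (\<lambda>v. h v \<oplus>\<^bsub>N\<^esub> h' v)"
proof -
  interpret N: abelian_group N by fact
  show ?thesis
    by (rule additiveI) (use assms in \<open>simp_all add: additive_closed additive_add N.a_ac\<close>)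
qed

lemma additive_comp: "additive M N h \<Longrightarrow> additive N K h' \<Longrightarrow> additive M K (\<lambda>v. h' (h v))"
  by (simp add: additive_def Pi_iff)

text \<open>In A(1) the generators X+ and X- are inverse to each other. With all structure constants
  equal to 1, they act on a tensor product with this module as they do on the other factor.\<close>

abbreviation "unit_module \<equiv> seq_module 1 UNIV (\<lambda>_. 1) (\<lambda>_. 1)"

interpretation unit: seq_data 1 UNIV "\<lambda>_. 1" "\<lambda>_. 1"
  by unfold_locales auto

text \<open>The isomorphism sends \<open>f \<otimes> v\<close> to \<open>f\<^sub>n v\<close> for \<open>v\<close> of weight \<open>n\<close>.\<close>

lemma tens_unit:
  assumes M: "graded t M"
  shows "gwa_iso t (tens 1 unit_module t M) M"
proof -
  let ?U = unit_module and ?p = "act_poly t M"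
  have L: "left_module (gwa t) M" using M by (simp add: graded_def)
  interpret W: wt_act M ?p using M by (simp add: graded_def)
  interpret T: tensor_modules 1 ?U t M
    by (rule tensor_modules.intro[OF unit.seq_module_spec(1) L])
  note spec = T.tensor_module_spec[unfolded mult_1_left]
  note abM = W.abelian_group_axioms and abT = T.TM.abelian_group_axioms
  note Uspec = unit.seq_module_spec
  have p_add: "additive M M (?p r)" for r by (rule additiveI) (simp_all add: W.p_radd)
  have "\<exists>h. additive M M h \<and> (\<forall>n. \<forall>v\<in>wt_space M ?p n. h v = ?p [:f n:] v)" for f :: "int \<Rightarrow> complex"
    by (rule W.universal[OF abM]) (auto intro!: W.p_radd)
  then obtain \<beta> where \<beta>: "\<And>f. additive M M (\<beta> f)"
    "\<And>f n v. v \<in> wt_space M ?p n \<Longrightarrow> \<beta> f v = ?p [:f n:] v" by metis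
  note \<beta>c = additive_closed[OF \<beta>(1)]
  have \<beta>_add: "\<beta> (\<lambda>n. f n + g n) v = \<beta> f v \<oplus>\<^bsub>M\<^esub> \<beta> g v" if "v \<in> carrier M" for f g v
    by (rule W.additive_eq[OF \<beta>(1) additive_plus[OF \<beta>(1) \<beta>(1) abM] abM _ that])
      (auto simp: \<beta>(2) W.p_const_add)
  have \<beta>_p: "\<beta> (act_poly 1 ?U r f) v = ?p r (\<beta> f v)" if "f \<in> carrier ?U" "v \<in> carrier M" for r f v
  proof (rule W.additive_eq[OF \<beta>(1) additive_comp[OF \<beta>(1) p_add] abM _ that(2)])
    fix n w assume w: "w \<in> wt_space M ?p n"
    then have "?p [:f n:] w \<in> wt_space M ?p n" by (rule W.wt_p)
    from W.p_wt[OF this, of r] show "\<beta> (act_poly 1 ?U r f) w = ?p r (\<beta> f w)"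
      using w W.wt_spaceD[OF w] that(1) by (simp add: \<beta>(2)[OF w] Uspec(5) W.p_const_mult)
  qed
  have \<beta>_p2: "\<beta> f (?p r v) = ?p r (\<beta> f v)" if "v \<in> carrier M" for r f v
  proof (rule W.additive_eq[OF additive_comp[OF p_add \<beta>(1)] additive_comp[OF \<beta>(1) p_add] abM _ that])
    fix n w assume w: "w \<in> wt_space M ?p n"
    show "\<beta> f (?p r w) = ?p r (\<beta> f w)"
      using W.p_commute[OF W.wt_spaceD[OF w], of r] by (simp add: \<beta>(2)[OF w] \<beta>(2)[OF W.wt_p[OF w]])
  qed
  have X_add: "additive M M (act_gen t M x)" if "x \<noteq> Gen_z" for x
    by (rule additiveI) (simp_all add: that T.M'.X_add)
  \<comment> \<open>X+ and X- move the coordinates of \<open>f\<close> and the weight of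
    \<open>v\<close> by the same amount, so coordinate and weight still match.\<close>
  have \<beta>_X: "\<beta> (act_gen 1 ?U x f) (act_gen t M x v) = act_gen t M x (\<beta> f v)"
    if "f \<in> carrier ?U" "v \<in> carrier M" "x \<noteq> Gen_z" for x f v
  proof (rule W.additive_eq[OF additive_comp[OF X_add[OF that(3)] \<beta>(1)] additive_comp[OF \<beta>(1) X_add[OF that(3)]] abM _ that(2)])
    fix n w assume w: "w \<in> wt_space M ?p n"
    show "\<beta> (act_gen 1 ?U x f) (act_gen t M x w) = act_gen t M x (\<beta> f w)"
    proof (cases x)
      case Gen_Xp
      then show ?thesis using T.M'.X_const[OF W.wt_spaceD[OF w], of Gen_Xp] that(1)
        by (simp add: \<beta>(2)[OF w] \<beta>(2)[OF T.M'.X_wt(1)[OF w]] Uspec(6))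
    next
      case Gen_Xm
      then show ?thesis using T.M'.X_const[OF W.wt_spaceD[OF w], of Gen_Xm] that(1)
        by (simp add: \<beta>(2)[OF w] \<beta>(2)[OF T.M'.X_wt(2)[OF w]] Uspec(7))
    qed (use that in simp)
  qed
  have bi: "bihom (add_group ?U) (add_group M) (add_group M) \<beta>"
    using \<beta>c \<beta>_add additive_add[OF \<beta>(1)] by (simp add: bihom_def Uspec(4))
  obtain h where h: "h \<in> hom T.tp.T (add_group M)"
    "\<And>x y. x \<in> carrier (add_group ?U) \<Longrightarrow> y \<in> carrier (add_group M) \<Longrightarrow> h (T.pur x y) = \<beta> x y"
    by (rule T.tp.T_universal[OF comm_group_add_group[OF abM] bi]) (use \<beta>_p \<beta>_p2 in auto)
  have hp: "h (T.pur x y) = \<beta> x y" if "x \<in> carrier ?U" "y \<in> carrier M" for x y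
    using h(2) that by simp
  have hadd: "additive T.TM M h"
    using h(1) by (auto simp: additive_def hom_def T.TM_simps)
  note hcl = additive_closed[OF hadd]
  have hom: "h \<in> gwa_hom t T.TM M"
  proof (rule gwa_homI[OF spec(2) L])
    fix z r assume z: "z \<in> carrier T.TM"
    show "h (act_poly t T.TM r z) = ?p r (h z)"
      using z
    proof (induction z rule: T.TM_induct)
      case (pure f v)
      then show ?case by (simp add: spec(3) hp \<beta>_p)
    next
      case (add z w)
      then show ?case using T.TM.p_radd[of z w r] T.TM.p_closed[of z r] T.TM.p_closed[of w r]
        by (simp add: W.p_radd additive_add[OF hadd] hcl)
    qed
  next
    fix z x assume z: "z \<in> carrier T.TM" and x: "x \<in> {Gen_Xp, Gen_Xm}"
    then have xz: "x \<noteq> Gen_z" by auto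
    show "h (act_gen t T.TM x z) = act_gen t M x (h z)"
      using z
    proof (induction z rule: T.TM_induct)
      case (pure f v)
      then show ?case using xz unit.D.X_closed[of f x] T.M'.X_closed[of v x] by (simp add: spec(4) hp \<beta>_X)
    next
      case (add z w)
      then show ?case using xz T.TM.X_add[of z w x] T.TM.X_closed[of z x] T.TM.X_closed[of w x]
        by (simp add: T.M'.X_add additive_add[OF hadd] hcl)
    qed
  qed (use hcl additive_add[OF hadd] in auto)
  have e: "unit_seq n \<in> carrier ?U" for n using unit.single_closed[of n 1] by (simp add: unit_seq_def)
  \<comment> \<open>The inverse map pairs a vector of weight n with the basis vector of the same
    weight.\<close>
  have "\<exists>k. additive M T.TM k \<and> (\<forall>n. \<forall>v\<in>wt_space M ?p n. k v = T.pur (unit_seq n) v)"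
  proof (rule W.universal[OF abT])
    show "T.pur (unit_seq n) (v \<oplus>\<^bsub>M\<^esub> w) = T.pur (unit_seq n) v \<oplus>\<^bsub>T.TM\<^esub> T.pur (unit_seq n) w"
      if "v \<in> wt_space M ?p n" "w \<in> wt_space M ?p n" for n v w
      by (rule additive_add[OF T.pur_additive(2)[OF e]]) (use that in auto)
  qed (use e in auto)
  then obtain k where k: "additive M T.TM k" "\<And>n v. v \<in> wt_space M ?p n \<Longrightarrow> k v = T.pur (unit_seq n) v" by blast
  have hk: "h (k v) = v" if "v \<in> carrier M" for v
  proof (rule W.additive_eq[OF additive_comp[OF k(1) hadd] _ abM _ that, where h' = "\<lambda>v. v"])
    show "additive M M (\<lambda>v. v)" by (simp add: additive_def)
    fix n w assume w: "w \<in> wt_space M ?p n"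
    show "h (k w) = w"
      unfolding k(2)[OF w] hp[OF e W.wt_spaceD[OF w]] \<beta>(2)[OF w]
      using W.p_const_one[OF W.wt_spaceD[OF w]] by (simp add: unit_seq_def)
  qed
  \<comment> \<open>Against a vector of weight n only the n-th coordinate of \<open>f\<close>
    survives, as tensors of different weights vanish.\<close>
  have pc: "T.pur f v = T.pur (unit.W.comp n f) v" if f: "f \<in> carrier ?U" and v: "v \<in> wt_space M ?p n" for f v n
  proof (rule unit.W.additive_eq[OF T.pur_additive(1) additive_comp[OF unit.W.comp_additive T.pur_additive(1)] abT _ f])
    fix m g assume g: "g \<in> wt_space ?U (act_poly 1 ?U) m"
    show "T.pur g v = T.pur (unit.W.comp n g) v"
    proof (cases "m = n")
      case True
      then show ?thesis using unit.W.comp_self[of g n] g by simp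
    next
      case False
      show ?thesis
        using T.pur_wt(2)[OF g v False] unit.W.comp_other[OF g False]
          additive_zero[OF T.pur_additive(1)[OF W.wt_spaceD[OF v]] unit.D.abelian_group_axioms abT] by simp
    qed
  qed (use v in auto)
  have kb: "k (\<beta> f v) = T.pur f v" if f: "f \<in> carrier ?U" and v: "v \<in> carrier M" for f v
  proof (rule W.additive_eq[OF additive_comp[OF \<beta>(1) k(1)] T.pur_additive(2)[OF f] abT _ v])
    fix n w assume w: "w \<in> wt_space M ?p n"
    then have wc: "w \<in> carrier M" by auto
    have "k (\<beta> f w) = T.pur (unit_seq n) (?p [:f n:] w)"
      using k(2)[OF W.wt_p[OF w]] by (simp add: \<beta>(2)[OF w])
    also have "\<dots> = T.pur (act_poly 1 ?U [:f n:] (unit_seq n)) w"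
      using T.pur_p_right[OF e wc, of n "[:f n:]"] spec(3)[OF e wc, of "[:f n:]" n] by simp
    also have "act_poly 1 ?U [:f n:] (unit_seq n) = unit.W.comp n f"
      unfolding Uspec(5)[OF e] unit.comp_D[OF f] by (auto simp: unit_seq_def fun_eq_iff)
    finally show "k (\<beta> f w) = T.pur f w" using pc[OF f w] by simp
  qed
  have kh: "k (h z) = z" if "z \<in> carrier T.TM" for z
    using that
  proof (induction z rule: T.TM_induct)
    case (pure f v)
    then show ?case by (simp add: hp kb)
  next
    case (add z w)
    then show ?case by (simp add: additive_add[OF hadd] additive_add[OF k(1)] hcl)
  qed
  have "bij_betw h (carrier T.TM) (carrier M)"
    by (rule bij_betw_byWitness[where f' = k])
      (use kh hk hcl additive_closed[OF k(1)] in auto)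
  then show ?thesis using hom unfolding gwa_iso_def T.TM_def by blast
qed

section \<open>The generators over A(z - k)\<close>

lemma (in seq_data) X_weight_space_D:
  assumes f: "f \<in> weight_space t D (ideal_at (of_int n))"
  shows "act_gen t D Gen_Xp f = \<zero>\<^bsub>D\<^esub> \<longleftrightarrow> a n = 0 \<or> f = \<zero>\<^bsub>D\<^esub>"
    and "act_gen t D Gen_Xm f = \<zero>\<^bsub>D\<^esub> \<longleftrightarrow> b (n - 1) = 0 \<or> f = \<zero>\<^bsub>D\<^esub>"
proof -
  have fc: "f \<in> carrier D" and 0: "\<And>m. m \<noteq> n \<Longrightarrow> f m = 0" using f by (auto simp: weight_space_D)
  have f0: "f = \<zero>\<^bsub>D\<^esub> \<longleftrightarrow> f n = 0" using 0 unfolding seq_module_spec(3) fun_eq_iff by metis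
  have "(\<forall>m. a (m - 1) * f (m - 1) = 0) \<longleftrightarrow> a n * f n = 0"
    using 0 by (metis add_diff_cancel_right' mult_eq_0_iff)
  then show "act_gen t D Gen_Xp f = \<zero>\<^bsub>D\<^esub> \<longleftrightarrow> a n = 0 \<or> f = \<zero>\<^bsub>D\<^esub>"
    unfolding f0 using fc by (simp add: seq_module_spec(3,6) fun_eq_iff)
  have "(\<forall>m. b m * f (m + 1) = 0) \<longleftrightarrow> b (n - 1) * f n = 0"
    using 0 by (metis add_diff_cancel_right' diff_add_cancel mult_eq_0_iff)
  then show "act_gen t D Gen_Xm f = \<zero>\<^bsub>D\<^esub> \<longleftrightarrow> b (n - 1) = 0 \<or> f = \<zero>\<^bsub>D\<^esub>"
    unfolding f0 using fc by (simp add: seq_module_spec(3,7) fun_eq_iff)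
qed

section \<open>Explicit models over A(z - k)\<close>

definition restrict2 :: "int set \<Rightarrow> (int \<Rightarrow> complex) \<Rightarrow> int \<Rightarrow> complex" where
  "restrict2 S \<alpha> n = (if n \<in> S \<and> n + 1 \<in> S then \<alpha> n else 0)"

text \<open>At n + 1/2 the polynomial z - k takes the value n - m, which vanishes for n = m only. So
  \<open>S\<close> may be cut between m and m + 1 and nowhere else, and \<alpha>, \<beta> are any
  factorization of n - m.\<close>

locale lin_data =
  fixes m :: int and k :: real and S :: "int set" and \<alpha> \<beta> :: "int \<Rightarrow> complex"
  assumes k: "k = of_int m + 1 / 2"
    and S: "(n \<in> S) \<noteq> (n + 1 \<in> S) \<Longrightarrow> n = m"
    and \<alpha>\<beta>: "\<alpha> n * \<beta> n = of_int (n - m)"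
begin

lemma poly_lin: "poly (lin k) (of_int n + 1 / 2) = of_int (n - m)"
  by (simp add: lin_def k)

sublocale seq_data "lin k" S "restrict2 S \<alpha>" "restrict2 S \<beta>"
proof
  show "restrict2 S \<alpha> n * restrict2 S \<beta> n = poly (lin k) (of_int n + 1 / 2)" if "n \<in> S \<or> n + 1 \<in> S" for n
    using that S[of n] unfolding poly_lin by (auto simp: restrict2_def \<alpha>\<beta>)
qed (auto simp: restrict2_def)

text \<open>Away from m the operator X- X+ is multiplication by the nonzero number n - m, hence X+
  is injective there. The step between m and m + 1 is the one left to the hypothesis
  \<open>nz\<close>.\<close>

lemma iso_D:
  assumes M: "graded (lin k) M" and od: "one_dim_weight_spaces (lin k) M" and wts: "weights (lin k) M = of_int ` S"
    and nz: "m \<in> S \<Longrightarrow> m + 1 \<in> S \<Longrightarrow>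
      (\<alpha> m \<noteq> 0 \<and> (\<forall>v\<in>weight_space (lin k) M (ideal_at (of_int m)).
         v \<noteq> \<zero>\<^bsub>M\<^esub> \<longrightarrow> act_gen (lin k) M Gen_Xp v \<noteq> \<zero>\<^bsub>M\<^esub>))
    \<or> (\<beta> m \<noteq> 0 \<and> (\<forall>v\<in>weight_space (lin k) M (ideal_at (of_int (m + 1))).
         v \<noteq> \<zero>\<^bsub>M\<^esub> \<longrightarrow> act_gen (lin k) M Gen_Xm v \<noteq> \<zero>\<^bsub>M\<^esub>))"
  shows "gwa_iso (lin k) M D"
proof -
  have L: "left_module (gwa (lin k)) M" using M by (simp add: graded_def)
  interpret M: gwa_act M "act_poly (lin k) M" "lin k" "act_gen (lin k) M" by (rule left_module_imp_gwa_act[OF L])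
  have inj: "v = \<zero>\<^bsub>M\<^esub>"
    if n: "n \<noteq> m" and v: "v \<in> wt_space M (act_poly (lin k) M) n" "act_gen (lin k) M Gen_Xp v = \<zero>\<^bsub>M\<^esub>" for n v
    using M.XX_wt(1)[OF v(1)] M.p_const_cancel[OF M.wt_spaceD[OF v(1)], of "of_int (n - m)"] n
    unfolding v(2) poly_lin by (simp add: M.X_zero)
  have "gwa_iso (lin k) D M"
  proof (rule iso_seq_module[OF M od wts])
    fix n assume n: "n \<in> S" "n + 1 \<in> S"
    show "(restrict2 S \<alpha> n \<noteq> 0 \<and> (\<forall>v\<in>wt_space M (act_poly (lin k) M) n.
          act_gen (lin k) M Gen_Xp v = \<zero>\<^bsub>M\<^esub> \<longrightarrow> v = \<zero>\<^bsub>M\<^esub>))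
      \<or> (restrict2 S \<beta> n \<noteq> 0 \<and> (\<forall>v\<in>wt_space M (act_poly (lin k) M) (n + 1).
          act_gen (lin k) M Gen_Xm v = \<zero>\<^bsub>M\<^esub> \<longrightarrow> v = \<zero>\<^bsub>M\<^esub>))"
    proof (cases "n = m")
      case True
      then show ?thesis using nz n unfolding weight_space_eq[OF L] by (auto simp: restrict2_def)
    next
      case False
      then have "\<alpha> n \<noteq> 0" using \<alpha>\<beta>[of n] by auto
      then show ?thesis using inj[OF False] n by (auto simp: restrict2_def)
    qed
  qed
  then show ?thesis using seq_module_spec(1) by (rule gwa_iso_sym)
qed

lemma simple_half_line:
  assumes "S = {m<..} \<or> S = {..m}"
  shows "simple_module (lin k) D"
proof (rule simple_D)
  show "restrict2 S \<alpha> n \<noteq> 0 \<and> restrict2 S \<beta> n \<noteq> 0" if "n \<in> S" "n + 1 \<in> S" for n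
    using that assms \<alpha>\<beta>[of n] by (auto simp: restrict2_def)
  have "m + 1 \<in> {m<..}" "m \<in> {..m}" by simp_all
  then show "S \<noteq> {}" using assms by blast
qed (use assms in auto)

lemma ex_obj_invariants:
  "\<exists>K. K \<in> objs (lin k) \<and> one_dim_weight_spaces (lin k) K \<and> weights (lin k) K = of_int ` S
    \<and> gwa_iso (lin k) D K"
proof -
  obtain K where K: "K \<in> objs (lin k)" "gwa_iso (lin k) K D" using ex_obj_D by blast
  note L = left_module_obj[OF K(1)]
  note iso = gwa_iso_sym[OF K(2) L]
  show ?thesis
    using K(1) iso iso_invariants(1)[OF iso seq_module_spec(1) L] weights_D
      iso_invariants(2)[OF iso seq_module_spec(1) L one_dim_D] by metis
qed

end

lemma int_gt_half: "k = of_int m + 1 / 2 \<Longrightarrow> {of_int n |n::int. real_of_int n > k} = of_int ` {m<..}"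
  and int_lt_half: "k = of_int m + 1 / 2 \<Longrightarrow> {of_int n |n::int. real_of_int n < k} = of_int ` {..m}"
proof -
  assume k: "k = of_int m + 1 / 2"
  have "real_of_int n > k \<longleftrightarrow> n > m" "real_of_int n < k \<longleftrightarrow> n \<le> m" for n unfolding k by linarith+
  then show "{of_int n |n::int. real_of_int n > k} = of_int ` {m<..}"
    "{of_int n |n::int. real_of_int n < k} = of_int ` {..m}" by auto
qed

text \<open>The factorization of n - m is left free. Inside the half line n - m is nonzero, so every
  factorization describes the same simple module, and the two extensions call for different
  ones.\<close>

lemma mod_above:
  assumes k: "k = of_int m + 1 / 2" and \<alpha>\<beta>: "\<And>n. \<alpha> n * \<beta> n = of_int (n - m)"
  shows "mod_above k \<in> objs (lin k)"
    "gwa_iso (lin k) (mod_above k) (seq_module (lin k) {m<..} (restrict2 {m<..} \<alpha>) (restrict2 {m<..} \<beta>))"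
proof -
  interpret lin_data m k "{m<..}" \<alpha> \<beta> by unfold_locales (use k \<alpha>\<beta> in auto)
  obtain K where K: "K \<in> objs (lin k)" "one_dim_weight_spaces (lin k) K" "weights (lin k) K = of_int ` {m<..}"
    "gwa_iso (lin k) D K" using ex_obj_invariants by blast
  have "simple_module (lin k) K"
    using iso_invariants(3)[OF K(4) seq_module_spec(1) left_module_obj[OF K(1)]] simple_half_line by blast
  with K(1-3) have "\<exists>M. M \<in> objs (lin k) \<and> one_dim_weight_spaces (lin k) M \<and> simple_module (lin k) M
     \<and> weights (lin k) M = {of_int n | n::int. real_of_int n > k}" unfolding int_gt_half[OF k] by blast
  note P = someI_ex[OF this, folded mod_above_def, unfolded int_gt_half[OF k]]
  then show "mod_above k \<in> objs (lin k)" by blast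
  show "gwa_iso (lin k) (mod_above k) D"
    by (rule iso_D) (use P in \<open>auto simp: objs_iff\<close>)
qed

lemma mod_below:
  assumes k: "k = of_int m + 1 / 2" and \<alpha>\<beta>: "\<And>n. \<alpha> n * \<beta> n = of_int (n - m)"
  shows "mod_below k \<in> objs (lin k)"
    "gwa_iso (lin k) (mod_below k) (seq_module (lin k) {..m} (restrict2 {..m} \<alpha>) (restrict2 {..m} \<beta>))"
proof -
  interpret lin_data m k "{..m}" \<alpha> \<beta> by unfold_locales (use k \<alpha>\<beta> in auto)
  obtain K where K: "K \<in> objs (lin k)" "one_dim_weight_spaces (lin k) K" "weights (lin k) K = of_int ` {..m}"
    "gwa_iso (lin k) D K" using ex_obj_invariants by blast
  have "simple_module (lin k) K"
    using iso_invariants(3)[OF K(4) seq_module_spec(1) left_module_obj[OF K(1)]] simple_half_line by blast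
  with K(1-3) have "\<exists>M. M \<in> objs (lin k) \<and> one_dim_weight_spaces (lin k) M \<and> simple_module (lin k) M
     \<and> weights (lin k) M = {of_int n | n::int. real_of_int n < k}" unfolding int_lt_half[OF k] by blast
  note P = someI_ex[OF this, folded mod_below_def, unfolded int_lt_half[OF k]]
  then show "mod_below k \<in> objs (lin k)" by blast
  show "gwa_iso (lin k) (mod_below k) D"
    by (rule iso_D) (use P in \<open>auto simp: objs_iff\<close>)
qed

lemma half_weights:
  assumes "k = of_int m + 1 / 2"
  shows "complex_of_real (k - 1 / 2) = of_int m" "complex_of_real (k + 1 / 2) = of_int (m + 1)"
  unfolding assms by simp_all

text \<open>The condition on \<alpha> at m says that X+ survives between m and m + 1. As the product
  there is 0, \<beta> vanishes at m, which is the required vanishing of X-.\<close>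

lemma mod_plus:
  assumes k: "k = of_int m + 1 / 2" and \<alpha>\<beta>: "\<And>n. \<alpha> n * \<beta> n = of_int (n - m)" and \<alpha>m: "\<alpha> m \<noteq> 0"
  shows "mod_plus k \<in> objs (lin k)"
    "gwa_iso (lin k) (mod_plus k) (seq_module (lin k) UNIV (restrict2 UNIV \<alpha>) (restrict2 UNIV \<beta>))"
proof -
  interpret lin_data m k UNIV \<alpha> \<beta> by unfold_locales (use k \<alpha>\<beta> in auto)
  have \<beta>m: "\<beta> m = 0" using \<alpha>\<beta>[of m] \<alpha>m by simp
  obtain K where K: "K \<in> objs (lin k)" "one_dim_weight_spaces (lin k) K" "weights (lin k) K = range of_int"
    "gwa_iso (lin k) D K" using ex_obj_invariants by blast
  note iso = K(4) seq_module_spec(1) left_module_obj[OF K(1)]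
  have 1: "\<forall>v\<in>weight_space (lin k) K (ideal_at (of_int m)). v \<noteq> \<zero>\<^bsub>K\<^esub> \<longrightarrow> act_gen (lin k) K Gen_Xp v \<noteq> \<zero>\<^bsub>K\<^esub>"
    by (rule iso_invariants(4)[OF iso]) (use X_weight_space_D(1)[of _ m] \<alpha>m in \<open>auto simp: restrict2_def\<close>)
  have 2: "\<forall>v\<in>weight_space (lin k) K (ideal_at (of_int (m + 1))). act_gen (lin k) K Gen_Xm v = \<zero>\<^bsub>K\<^esub>"
    by (rule iso_invariants(5)[OF iso]) (use X_weight_space_D(2)[of _ "m + 1"] \<beta>m in \<open>auto simp: restrict2_def\<close>)
  have "\<exists>M. M \<in> objs (lin k) \<and> one_dim_weight_spaces (lin k) M
     \<and> weights (lin k) M = range of_int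
     \<and> (\<forall>v\<in>weight_space (lin k) M (ideal_at (of_real (k - 1 / 2))).
          v \<noteq> \<zero>\<^bsub>M\<^esub> \<longrightarrow> act_gen (lin k) M Gen_Xp v \<noteq> \<zero>\<^bsub>M\<^esub>)
     \<and> (\<forall>v\<in>weight_space (lin k) M (ideal_at (of_real (k + 1 / 2))).
          act_gen (lin k) M Gen_Xm v = \<zero>\<^bsub>M\<^esub>)"
    unfolding half_weights[OF k] using K(1-3) 1 2 by blast
  note P = someI_ex[OF this, folded mod_plus_def, unfolded half_weights[OF k]]
  then show "mod_plus k \<in> objs (lin k)" by blast
  show "gwa_iso (lin k) (mod_plus k) D"
    by (rule iso_D) (use P \<alpha>m in \<open>auto simp: objs_iff\<close>)
qed

lemma mod_minus:
  assumes k: "k = of_int m + 1 / 2" and \<alpha>\<beta>: "\<And>n. \<alpha> n * \<beta> n = of_int (n - m)" and \<beta>m: "\<beta> m \<noteq> 0"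
  shows "mod_minus k \<in> objs (lin k)"
    "gwa_iso (lin k) (mod_minus k) (seq_module (lin k) UNIV (restrict2 UNIV \<alpha>) (restrict2 UNIV \<beta>))"
proof -
  interpret lin_data m k UNIV \<alpha> \<beta> by unfold_locales (use k \<alpha>\<beta> in auto)
  have \<alpha>m: "\<alpha> m = 0" using \<alpha>\<beta>[of m] \<beta>m by simp
  obtain K where K: "K \<in> objs (lin k)" "one_dim_weight_spaces (lin k) K" "weights (lin k) K = range of_int"
    "gwa_iso (lin k) D K" using ex_obj_invariants by blast
  note iso = K(4) seq_module_spec(1) left_module_obj[OF K(1)]
  have 1: "\<forall>v\<in>weight_space (lin k) K (ideal_at (of_int m)). act_gen (lin k) K Gen_Xp v = \<zero>\<^bsub>K\<^esub>"
    by (rule iso_invariants(5)[OF iso]) (use X_weight_space_D(1)[of _ m] \<alpha>m in \<open>auto simp: restrict2_def\<close>)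
  have 2: "\<forall>v\<in>weight_space (lin k) K (ideal_at (of_int (m + 1))). v \<noteq> \<zero>\<^bsub>K\<^esub> \<longrightarrow> act_gen (lin k) K Gen_Xm v \<noteq> \<zero>\<^bsub>K\<^esub>"
    by (rule iso_invariants(4)[OF iso]) (use X_weight_space_D(2)[of _ "m + 1"] \<beta>m in \<open>auto simp: restrict2_def\<close>)
  have "\<exists>M. M \<in> objs (lin k) \<and> one_dim_weight_spaces (lin k) M
     \<and> weights (lin k) M = range of_int
     \<and> (\<forall>v\<in>weight_space (lin k) M (ideal_at (of_real (k - 1 / 2))).
          act_gen (lin k) M Gen_Xp v = \<zero>\<^bsub>M\<^esub>)
     \<and> (\<forall>v\<in>weight_space (lin k) M (ideal_at (of_real (k + 1 / 2))).
          v \<noteq> \<zero>\<^bsub>M\<^esub> \<longrightarrow> act_gen (lin k) M Gen_Xm v \<noteq> \<zero>\<^bsub>M\<^esub>)"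
    unfolding half_weights[OF k] using K(1-3) 1 2 by blast
  note P = someI_ex[OF this, folded mod_minus_def, unfolded half_weights[OF k]]
  then show "mod_minus k \<in> objs (lin k)" by blast
  show "gwa_iso (lin k) (mod_minus k) D"
    by (rule iso_D) (use P \<beta>m in \<open>auto simp: objs_iff\<close>)
qed

lemma exact_above_plus_below:
  assumes k: "k = of_int m + 1 / 2"
  shows "short_exact (lin k) (mod_above k) (mod_plus k) (mod_below k)"
proof -
  \<comment> \<open>With \<alpha> = 1 the operator X+ never vanishes on the full line, and \<beta> m
    = 0 cuts X- from m + 1 to m. So the half line above m is the submodule.\<close>
  let ?\<alpha> = "\<lambda>_. 1 :: complex" and ?\<beta> = "\<lambda>n. of_int (n - m) :: complex"
  have ab: "?\<alpha> n * ?\<beta> n = of_int (n - m)" for n by simp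
  interpret U: lin_data m k "{m<..}" ?\<alpha> ?\<beta> by unfold_locales (use k ab in auto)
  interpret V: lin_data m k UNIV ?\<alpha> ?\<beta> by unfold_locales (use k ab in auto)
  interpret W: lin_data m k "{..m}" ?\<alpha> ?\<beta> by unfold_locales (use k ab in auto)
  have "?\<alpha> m \<noteq> 0" by simp
  note obj = mod_above[OF k ab] mod_plus[OF k ab this] mod_below[OF k ab]
  have "short_exact (lin k) U.D V.D W.D"
    by (rule short_exact_seq[OF V.seq_data_axioms U.seq_data_axioms W.seq_data_axioms]) (auto simp: restrict2_def)
  then show ?thesis
    by (rule short_exact_iso[OF _ obj(2,4,6) obj(1,3,5)[THEN left_module_obj]
          U.seq_module_spec(1) V.seq_module_spec(1) W.seq_module_spec(1)])
qed

lemma exact_below_minus_above: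
  assumes k: "k = of_int m + 1 / 2"
  shows "short_exact (lin k) (mod_below k) (mod_minus k) (mod_above k)"
proof -
  \<comment> \<open>The mirror normalization: X- never vanishes on the full line, and \<alpha> m = 0
    cuts X+ from m to m + 1. So the half line up to m is the submodule.\<close>
  let ?\<alpha> = "\<lambda>n. of_int (n - m) :: complex" and ?\<beta> = "\<lambda>_. 1 :: complex"
  have ab: "?\<alpha> n * ?\<beta> n = of_int (n - m)" for n by simp
  interpret U: lin_data m k "{..m}" ?\<alpha> ?\<beta> by unfold_locales (use k ab in auto)
  interpret V: lin_data m k UNIV ?\<alpha> ?\<beta> by unfold_locales (use k ab in auto)
  interpret W: lin_data m k "{m<..}" ?\<alpha> ?\<beta> by unfold_locales (use k ab in auto)
  have "?\<beta> m \<noteq> 0" by simp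
  note obj = mod_below[OF k ab] mod_minus[OF k ab this] mod_above[OF k ab]
  have "short_exact (lin k) U.D V.D W.D"
    by (rule short_exact_seq[OF V.seq_data_axioms U.seq_data_axioms W.seq_data_axioms]) (auto simp: restrict2_def)
  then show ?thesis
    by (rule short_exact_iso[OF _ obj(2,4,6) obj(1,3,5)[THEN left_module_obj]
          U.seq_module_spec(1) V.seq_module_spec(1) W.seq_module_spec(1)])
qed

lemma alg_class_exact:
  assumes t: "t \<in> \<Gamma>" and M: "M \<in> objs t" "M'' \<in> objs t" "M' \<in> objs t" and se: "short_exact t M M'' M'"
  shows "alg_class exact_rels \<Gamma> t M''
    = alg_class exact_rels \<Gamma> t M \<oplus>\<^bsub>alg_exact \<Gamma>\<^esub> alg_class exact_rels \<Gamma> t M'"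
proof -
  note c = Exact.groth_class_closed[OF M(1)] Exact.groth_class_closed[OF M(3)]
  have "cgroth_pure exact_rels t 1 (groth_class exact_rels t M'')
    = cgroth_pure exact_rels t 1 (groth_class exact_rels t M)
      \<otimes>\<^bsub>cgroth exact_rels t\<^esub> cgroth_pure exact_rels t 1 (groth_class exact_rels t M')"
    unfolding Exact.groth_ext[OF M se] cgroth_eq cgroth_pure_eq by (rule Exact.CG.cpure_add_right[OF c])
  then show ?thesis
    unfolding alg_class_def alg_exact_def alg_simps
    using hom_mult[OF Exact.alg_incl_hom[OF t] Exact.pure_class_closed[OF M(1)] Exact.pure_class_closed[OF M(3)]]
    by simp
qed

lemma monic_with_zeros_in_closed:
  "1 \<in> monic_with_zeros_in Z"
  "t \<in> monic_with_zeros_in Z \<Longrightarrow> t' \<in> monic_with_zeros_in Z \<Longrightarrow> t * t' \<in> monic_with_zeros_in Z"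
  "k \<in> Z \<Longrightarrow> lin k \<in> monic_with_zeros_in Z"
  by (auto simp: monic_with_zeros_in_def lead_coeff_mult lin_def)

theorem theorem4p14:
  fixes Z :: "real set" and \<Gamma> :: "complex poly set"
  assumes "Z \<subseteq> {of_int n + 1 / 2 | n::int. True}"
    and "\<Gamma> = monic_with_zeros_in Z"
  shows "\<exists>\<kappa> \<phi>.
      (\<forall>t\<in>\<Gamma>. \<kappa> t \<in> hom (groth split_rels t) (groth exact_rels t)
         \<and> (\<forall>M\<in>objs t. \<kappa> t (groth_class split_rels t M) = groth_class exact_rels t M))
    \<and> \<phi> \<in> algebra_hom (alg_split \<Gamma>) (alg_exact \<Gamma>)
    \<and> \<phi> ` carrier (alg_split \<Gamma>) = carrier (alg_exact \<Gamma>)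
    \<and> (\<forall>t\<in>\<Gamma>. \<forall>c. \<forall>g\<in>carrier (groth split_rels t).
         \<phi> (alg_incl split_rels \<Gamma> t (cgroth_pure split_rels t c g))
           = alg_incl exact_rels \<Gamma> t (cgroth_pure exact_rels t c (\<kappa> t g)))
    \<and> (\<forall>k\<in>Z.
         \<phi> (x_plus split_rels \<Gamma> k) = x_plus exact_rels \<Gamma> k
       \<and> \<phi> (x_minus split_rels \<Gamma> k) = x_minus exact_rels \<Gamma> k
       \<and> \<phi> (y_plus \<Gamma> k) = x_plus exact_rels \<Gamma> k \<oplus>\<^bsub>alg_exact \<Gamma>\<^esub> x_minus exact_rels \<Gamma> k
       \<and> \<phi> (y_minus \<Gamma> k) = x_plus exact_rels \<Gamma> k \<oplus>\<^bsub>alg_exact \<Gamma>\<^esub> x_minus exact_rels \<Gamma> k)"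
proof -
  \<comment> \<open>\<open>unit_module\<close> lives on integer sequences, while the unit of the
    algebras has to be the class of an object on the universe.\<close>
  obtain U where U: "U \<in> objs 1" "gwa_iso 1 U unit_module" using unit.ex_obj_D by blast
  have iso: "gwa_iso t (tens 1 U t M) M" if "M \<in> objs t" for t and M :: "universe gwa_module"
  proof -
    have "gwa_iso (1 * t) (tens 1 U t M) (tens 1 unit_module t M)"
      by (rule tensor_iso[OF U(2) left_module_obj[OF U(1)] unit.seq_module_spec(1) left_module_obj[OF that]])
    moreover have "graded t M" using that by (simp add: objs_iff)
    ultimately show ?thesis using tens_unit[of t M] gwa_iso_trans[of t "tens 1 U t M"] by simp
  qed
  have \<Gamma>: "\<forall>t\<in>\<Gamma>. \<forall>t'\<in>\<Gamma>. t * t' \<in> \<Gamma>" "1 \<in> \<Gamma>"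
    using monic_with_zeros_in_closed(1,2) unfolding assms(2) by blast+
  have gens: "\<phi> (x_plus split_rels \<Gamma> k) = x_plus exact_rels \<Gamma> k
       \<and> \<phi> (x_minus split_rels \<Gamma> k) = x_minus exact_rels \<Gamma> k
       \<and> \<phi> (y_plus \<Gamma> k) = x_plus exact_rels \<Gamma> k \<oplus>\<^bsub>alg_exact \<Gamma>\<^esub> x_minus exact_rels \<Gamma> k
       \<and> \<phi> (y_minus \<Gamma> k) = x_plus exact_rels \<Gamma> k \<oplus>\<^bsub>alg_exact \<Gamma>\<^esub> x_minus exact_rels \<Gamma> k"
    if \<phi>: "\<forall>t\<in>\<Gamma>. \<forall>M\<in>objs t. \<phi> (alg_class split_rels \<Gamma> t M) = alg_class exact_rels \<Gamma> t M"
      and kZ: "k \<in> Z" for \<phi> k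
  proof -
    obtain m where k: "k = of_int m + 1 / 2" using kZ assms(1) by blast
    have t: "lin k \<in> \<Gamma>" using monic_with_zeros_in_closed(3)[OF kZ] assms(2) by simp
    have ab: "1 * of_int (n - m) = (of_int (n - m) :: complex)" "of_int (n - m) * 1 = (of_int (n - m) :: complex)" for n
      by simp_all
    have obj: "mod_above k \<in> objs (lin k)" "mod_below k \<in> objs (lin k)"
      "mod_plus k \<in> objs (lin k)" "mod_minus k \<in> objs (lin k)"
      by (rule mod_above(1)[OF k ab(1)], rule mod_below(1)[OF k ab(1)],
          rule mod_plus(1)[OF k ab(1) one_neq_zero], rule mod_minus(1)[OF k ab(2) one_neq_zero])
    interpret G: comm_group "alg_group exact_rels \<Gamma>" by (rule Exact.alg_comm)
    have "x_plus exact_rels \<Gamma> k \<in> carrier (alg_group exact_rels \<Gamma>)" "x_minus exact_rels \<Gamma> k \<in> carrier (alg_group exact_rels \<Gamma>)"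
      unfolding x_plus_def x_minus_def alg_class_def by (auto intro!: Exact.gen_closed t obj)
    \<comment> \<open>The sequence for \<open>y_minus\<close> has the lower simple module as its
      submodule, so it yields the two classes in the opposite order.\<close>
    then have comm: "x_minus exact_rels \<Gamma> k \<oplus>\<^bsub>alg_exact \<Gamma>\<^esub> x_plus exact_rels \<Gamma> k
        = x_plus exact_rels \<Gamma> k \<oplus>\<^bsub>alg_exact \<Gamma>\<^esub> x_minus exact_rels \<Gamma> k"
      unfolding alg_exact_def alg_simps by (simp add: G.m_comm)
    have "\<phi> (y_plus \<Gamma> k) = x_plus exact_rels \<Gamma> k \<oplus>\<^bsub>alg_exact \<Gamma>\<^esub> x_minus exact_rels \<Gamma> k"
      using \<phi> t obj alg_class_exact[OF t obj(1,3,2) exact_above_plus_below[OF k]]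
      by (simp add: y_plus_def x_plus_def x_minus_def)
    moreover have "\<phi> (y_minus \<Gamma> k) = x_minus exact_rels \<Gamma> k \<oplus>\<^bsub>alg_exact \<Gamma>\<^esub> x_plus exact_rels \<Gamma> k"
      using \<phi> t obj alg_class_exact[OF t obj(2,4,1) exact_below_minus_above[OF k]]
      by (simp add: y_minus_def x_plus_def x_minus_def)
    ultimately show ?thesis using \<phi> t obj comm by (simp add: x_plus_def x_minus_def)
  qed
  have unit: "\<forall>t\<in>\<Gamma>. \<forall>M\<in>objs t. gwa_iso t (tens 1 U t M) M" using iso by blast
  from canonical_map_exists[OF \<Gamma> U(1) unit] obtain \<kappa> \<phi> where
    \<kappa>: "\<forall>t\<in>\<Gamma>. \<kappa> t \<in> hom (groth split_rels t) (groth exact_rels t)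
         \<and> (\<forall>M\<in>objs t. \<kappa> t (groth_class split_rels t M) = groth_class exact_rels t M)"
    and \<phi>: "\<phi> \<in> algebra_hom (alg_split \<Gamma>) (alg_exact \<Gamma>)"
      "\<phi> ` carrier (alg_split \<Gamma>) = carrier (alg_exact \<Gamma>)"
      "\<forall>t\<in>\<Gamma>. \<forall>c. \<forall>g\<in>carrier (groth split_rels t).
         \<phi> (alg_incl split_rels \<Gamma> t (cgroth_pure split_rels t c g))
           = alg_incl exact_rels \<Gamma> t (cgroth_pure exact_rels t c (\<kappa> t g))"
    and cls: "\<forall>t\<in>\<Gamma>. \<forall>M\<in>objs t. \<phi> (alg_class split_rels \<Gamma> t M) = alg_class exact_rels \<Gamma> t M"
    by (elim exE conjE) blast+
  show ?thesis
    by (intro exI[of _ \<kappa>] exI[of _ \<phi>] conjI ballI) (use \<kappa> \<phi> gens[OF cls] in blast)+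
qed

end
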